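(* For every real number $E_0\ge 0$ there is a positive constant $d=d(E_0)$, depending on $E_0$ only, with the following property. Let the pair $v$ and $p$ be a suitable weak solution to the Navier-Stokes equations in $Q$ such that $$\sup_{0<r\leq 1}E(r)=E_0<+\infty .$$ Then $$A^{\frac 32}(r)+C(r)+D_0^2(r)\leq d\Big(r^{\frac 12}\big(A^{\frac 32}(1)+D_0^2(1)\big)+1\Big)$$ for all $0<r\leq 1/4$.
   Context: Notation. $B(r)$ is the ball of radius $r$ in $\mathbb R^3$ centered at $x=0$; $Q(r)=B(r)\times\,]-r^2,0[\,\subset\mathbb R^3\times\mathbb R$; $B=B(1)$, $Q=Q(1)$; $z=(x,t)$ denotes a point in space-time and $dz=dx\,dt$. $L_{2,\infty}(Q)=L_\infty(-1,0;L_2(B))$ and $W^{1,0}_2(Q)=L_2(-1,0;W^1_2(B))$, where $L_2(B)$, $W^1_2(B)$ are the usual Lebesgue and Sobolev spaces. The parabolic boundary of $Q$ is $(\overline B\times\{-1\})\cup(\partial B\times[-1,0])$. Suitable weak solution. A pair of a vector field $v:Q\to\mathbb R^3$ (velocity) and a scalar function $p:Q\to\mathbb R$ (pressure) is called a suitable weak solution to the Navier-Stokes equations in $Q$ if: (i) $v\in L_{2,\infty}(Q)\cap W^{1,0}_2(Q)$ and $p\in L_{\frac 32}(Q)$; (ii) the Navier-Stokes equations $\partial_t v+v\cdot\nabla v-\Delta v=-\nabla p$, $\mathrm{div}\,v=0$ hold in $Q$ in the sense of distributions; (iii) for a.a. $t\in\,]-1,0[$, the local energy inequality $$\int_B\varphi(x,t)|v(x,t)|^2dx+2\int_{-1}^t\int_B\varphi|\nabla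 v|^2dx\,dt'\leq\int_{-1}^t\int_B\Big\{|v|^2(\Delta\varphi+\partial_t\varphi)+v\cdot\nabla\varphi\,(|v|^2+2p)\Big\}dx\,dt'$$ holds for any non-negative test function $\varphi\in C_0^\infty(\mathbb R^3\times\mathbb R)$ vanishing in a neighborhood of the parabolic boundary of $Q$. Functionals. For $0<r\le 1$, $$A(r)=\operatorname*{ess\,sup}_{-r^2<t<0}\frac 1r\int_{B(r)}|v(x,t)|^2dx,\qquad C(r)=\frac 1{r^2}\int_{Q(r)}|v|^3dz,$$ $$E(r)=\frac 1r\int_{Q(r)}|\nabla v|^2dz,\qquad D_0(r)=\frac 1{r^2}\int_{Q(r)}|p-[p]_{B(r)}|^{\frac 32}dz,$$ where $[p]_{B(r)}(t)=\frac 1{|B(r)|}\int_{B(r)}p(x,t)dx$. Powers are written as $A^{\frac 32}(r)=(A(r))^{3/2}$, $D_0^2(r)=(D_0(r))^2$. *)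

theory Defs
  imports "HOL-Analysis.Analysis" "HOL-Probability.Essential_Supremum"
begin

subsection \<open>Test functions and distributional derivatives\<close>

definition dderiv :: "'a::euclidean_space \<Rightarrow> ('a \<Rightarrow> real) \<Rightarrow> 'a \<Rightarrow> real" where
  "dderiv e \<phi> x = frechet_derivative \<phi> (at x) e"

primrec Ck :: "nat \<Rightarrow> ('a::euclidean_space \<Rightarrow> real) \<Rightarrow> bool" where
  "Ck 0 \<phi> \<longleftrightarrow> continuous_on UNIV \<phi>"
| "Ck (Suc k) \<phi> \<longleftrightarrow> \<phi> differentiable_on UNIV \<and> (\<forall>e\<in>Basis. Ck k (dderiv e \<phi>))"

text \<open>The space \<open>C_0^\<infinity>(U)\<close> for an open set \<open>U\<close>; its elements are extended by zero
  to the whole space.\<close>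

definition test_functions :: "'a::euclidean_space set \<Rightarrow> ('a \<Rightarrow> real) set" where
  "test_functions U =
     {\<phi>. (\<forall>k. Ck k \<phi>) \<and> compact (closure {x. \<phi> x \<noteq> 0}) \<and> closure {x. \<phi> x \<noteq> 0} \<subseteq> U}"

text \<open>A distribution is treated as a functional of which only the values on
  \<^term>\<open>test_functions U\<close> matter.\<close>

type_synonym 'a distr = "('a \<Rightarrow> real) \<Rightarrow> real"

definition regular :: "'a::euclidean_space set \<Rightarrow> ('a \<Rightarrow> real) \<Rightarrow> 'a distr" where
  "regular U f \<phi> = (LINT x|lebesgue_on U. f x * \<phi> x)"

definition distr_deriv :: "'a::euclidean_space \<Rightarrow> 'a distr \<Rightarrow> 'a distr" where
  "distr_deriv e T \<phi> = - T (dderiv e \<phi>)"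

subsection \<open>Function spaces\<close>

text \<open>Elements of the spaces below are represented by Lebesgue measurable functions
  defined everywhere; their values outside the relevant set are irrelevant.\<close>

definition L_space :: "real \<Rightarrow> 'a::euclidean_space set \<Rightarrow> ('a \<Rightarrow> 'b::euclidean_space) set" where
  "L_space q S =
     {f. f \<in> borel_measurable (lebesgue_on S) \<and> integrable (lebesgue_on S) (\<lambda>x. norm (f x) powr q)}"

type_synonym spacetime = "(real^3) \<times> real"

definition Q :: "real \<Rightarrow> spacetime set" where
  "Q r = ball 0 r \<times> {- (r^2)<..<0}"

text \<open>\<open>g\<close> is the weak gradient on \<open>U\<close> of \<open>u\<close>, and \<open>u \<in> W^1_2(U)\<close>; here
  \<open>g x $ i $ j\<close> is \<open>\<partial>u_i/\<partial>x_j\<close>.\<close>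

definition W12_gradient ::
    "(real^3) set \<Rightarrow> (real^3 \<Rightarrow> real^3) \<Rightarrow> (real^3 \<Rightarrow> real^3^3) \<Rightarrow> bool" where
  "W12_gradient U u g \<longleftrightarrow>
     u \<in> L_space 2 U \<and> g \<in> L_space 2 U \<and>
     (\<forall>i j. \<forall>\<phi>\<in>test_functions U.
        distr_deriv (axis j 1) (regular U (\<lambda>x. u x $ i)) \<phi> = regular U (\<lambda>x. g x $ i $ j) \<phi>)"

text \<open>\<open>L_\<infinity>(-1,0;L_2(B))\<close>.\<close>

definition L2_inf :: "(spacetime \<Rightarrow> real^3) set" where
  "L2_inf =
     {v. v \<in> borel_measurable (lebesgue_on (Q 1)) \<and>
         (\<exists>M. AE t in lebesgue_on {-1<..<0}.
            (\<lambda>x. v (x, t)) \<in> L_space 2 (ball 0 1) \<and>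
            (LINT x|lebesgue_on (ball 0 1). (norm (v (x, t)))^2) \<le> M)}"

text \<open>\<open>v \<in> L_2(-1,0;W^1_2(B))\<close>, with spatial weak gradient \<open>G\<close>.\<close>

definition W12_0_gradient :: "(spacetime \<Rightarrow> real^3) \<Rightarrow> (spacetime \<Rightarrow> real^3^3) \<Rightarrow> bool" where
  "W12_0_gradient v G \<longleftrightarrow>
     v \<in> L_space 2 (Q 1) \<and> G \<in> L_space 2 (Q 1) \<and>
     (AE t in lebesgue_on {-1<..<0}. W12_gradient (ball 0 1) (\<lambda>x. v (x, t)) (\<lambda>x. G (x, t)))"

definition W12_0 :: "(spacetime \<Rightarrow> real^3) set" where
  "W12_0 = {v. \<exists>G. W12_0_gradient v G}"

text \<open>The gradient is unique up to null sets of \<^term>\<open>Q 1\<close>; a representative is chosen.\<close>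

definition grad :: "(spacetime \<Rightarrow> real^3) \<Rightarrow> spacetime \<Rightarrow> real^3^3" where
  "grad v = (SOME G. W12_0_gradient v G)"

subsection \<open>Suitable weak solutions\<close>

definition e_x :: "3 \<Rightarrow> spacetime" where "e_x i = (axis i 1, 0)"

definition e_t :: spacetime where "e_t = (0, 1)"

definition grad_x :: "(spacetime \<Rightarrow> real) \<Rightarrow> spacetime \<Rightarrow> real^3" where
  "grad_x \<phi> z = (\<chi> i. dderiv (e_x i) \<phi> z)"

definition laplace_x :: "(spacetime \<Rightarrow> real) \<Rightarrow> spacetime \<Rightarrow> real" where
  "laplace_x \<phi> z = (\<Sum>i\<in>UNIV. dderiv (e_x i) (dderiv (e_x i) \<phi>) z)"

text \<open>The matrix-vector product \<^term>\<open>grad v z *v v z\<close> is the convective term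
  \<open>v \<cdot> \<nabla> v\<close>, with \<open>i\<close>-th component \<open>\<Sum>j. v_j \<partial>v_i/\<partial>x_j\<close>.\<close>

definition navier_stokes :: "(spacetime \<Rightarrow> real^3) \<Rightarrow> (spacetime \<Rightarrow> real) \<Rightarrow> bool" where
  "navier_stokes v p \<longleftrightarrow>
     (\<forall>i. \<forall>\<phi>\<in>test_functions (Q 1).
        distr_deriv e_t (regular (Q 1) (\<lambda>z. v z $ i)) \<phi>
        + regular (Q 1) (\<lambda>z. (grad v z *v v z) $ i) \<phi>
        - (\<Sum>j\<in>UNIV. distr_deriv (e_x j) (distr_deriv (e_x j) (regular (Q 1) (\<lambda>z. v z $ i))) \<phi>)
        = - distr_deriv (e_x i) (regular (Q 1) p) \<phi>) \<and>
     (\<forall>\<phi>\<in>test_functions (Q 1).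
        (\<Sum>j\<in>UNIV. distr_deriv (e_x j) (regular (Q 1) (\<lambda>z. v z $ j)) \<phi>) = 0)"

definition parabolic_boundary :: "spacetime set" where
  "parabolic_boundary = cball 0 1 \<times> {-1} \<union> sphere 0 1 \<times> {-1..0}"

definition energy_test_functions :: "(spacetime \<Rightarrow> real) set" where
  "energy_test_functions =
     {\<phi>\<in>test_functions UNIV. (\<forall>z. 0 \<le> \<phi> z) \<and>
        (\<exists>N. open N \<and> parabolic_boundary \<subseteq> N \<and> (\<forall>z\<in>N. \<phi> z = 0))}"

text \<open>The norm on \<^typ>\<open>real^3^3\<close> is the Frobenius norm.\<close>

definition local_energy_inequality :: "(spacetime \<Rightarrow> real^3) \<Rightarrow> (spacetime \<Rightarrow> real) \<Rightarrow> bool" where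
  "local_energy_inequality v p \<longleftrightarrow>
     (AE t in lebesgue_on {-1<..<0}. \<forall>\<phi>\<in>energy_test_functions.
        (LINT x|lebesgue_on (ball 0 1). \<phi> (x, t) * (norm (v (x, t)))^2)
        + 2 * (LINT s|lebesgue_on {-1<..<t}. LINT x|lebesgue_on (ball 0 1).
                 \<phi> (x, s) * (norm (grad v (x, s)))^2)
        \<le> (LINT s|lebesgue_on {-1<..<t}. LINT x|lebesgue_on (ball 0 1).
              (norm (v (x, s)))^2 * (laplace_x \<phi> (x, s) + dderiv e_t \<phi> (x, s))
              + (v (x, s) \<bullet> grad_x \<phi> (x, s)) * ((norm (v (x, s)))^2 + 2 * p (x, s))))"

definition suitable_weak_solution :: "(spacetime \<Rightarrow> real^3) \<Rightarrow> (spacetime \<Rightarrow> real) \<Rightarrow> bool" where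
  "suitable_weak_solution v p \<longleftrightarrow>
     v \<in> L2_inf \<inter> W12_0 \<and> p \<in> L_space (3/2) (Q 1) \<and>
     navier_stokes v p \<and> local_energy_inequality v p"

subsection \<open>Scale-invariant functionals\<close>

text \<open>For a suitable weak solution and \<open>0 < r \<le> 1\<close> all of these are finite; for \<open>C\<close>
  because \<open>L_\<infinity>(-1,0;L_2(B)) \<inter> L_2(-1,0;W^1_2(B))\<close> embeds into \<open>L_3(Q)\<close>.  Hence the
  conventions for divergent integrals and for \<^const>\<open>real_of_ereal\<close> at infinity play no role.\<close>

definition A :: "(spacetime \<Rightarrow> real^3) \<Rightarrow> real \<Rightarrow> real" where
  "A v r = real_of_ereal (esssup (lebesgue_on {- (r^2)<..<0})
             (\<lambda>t. ereal (1 / r * (LINT x|lebesgue_on (ball 0 r). (norm (v (x, t)))^2))))"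

definition C :: "(spacetime \<Rightarrow> real^3) \<Rightarrow> real \<Rightarrow> real" where
  "C v r = 1 / r^2 * (LINT z|lebesgue_on (Q r). (norm (v z))^3)"

definition E :: "(spacetime \<Rightarrow> real^3) \<Rightarrow> real \<Rightarrow> real" where
  "E v r = 1 / r * (LINT z|lebesgue_on (Q r). (norm (grad v z))^2)"

definition mean :: "(spacetime \<Rightarrow> real) \<Rightarrow> real \<Rightarrow> real \<Rightarrow> real" where
  "mean p r t = 1 / measure lebesgue (ball (0::real^3) r) * (LINT x|lebesgue_on (ball 0 r). p (x, t))"

definition D0 :: "(spacetime \<Rightarrow> real) \<Rightarrow> real \<Rightarrow> real" where
  "D0 p r = 1 / r^2 * (LINT z|lebesgue_on (Q r). \<bar>p z - mean p r (snd z)\<bar> powr (3/2))"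

end

theory Submission
  imports Defs
begin

text \<open>
  With \<open>Y = A^{3/2} + D_0^2\<close> one shows that \<open>Y(\<theta>R) \<le> \<theta>^{1/2} Y(R) + K\<close> for a small \<open>\<theta>\<close> and a
  constant \<open>K\<close>, both depending on \<open>E_0\<close> only; iterating this from scale \<open>1\<close> bounds \<open>Y\<close>, and \<open>C\<close> is
  controlled by \<open>A\<close> and \<open>E\<close> at a comparable scale.

  On almost every time slice let \<open>c\<close> be a weighted mean of \<open>v\<close> over a ball.  A pointwise Poincare
  inequality bounds \<open>|v - c|\<close> by a Riesz potential of \<open>|\<nabla>v|\<close>, whence \<open>|v|^3\<close> is a small multiple of
  \<open>A^{3/2}\<close> (from \<open>c\<close>) plus a term of order \<open>A^{1/2} E\<close>.  Testing the pressure equation with the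
  difference of two regularised Newtonian potentials expresses \<open>p\<close>, up to a mollification at the fixed
  scale \<open>R/4\<close>, as a potential of \<open>v \<cdot> \<nabla>v\<close>.  By incompressibility \<open>v \<cdot> \<nabla>v\<close> may be replaced by
  \<open>(v - c) \<cdot> \<nabla>v\<close>, so this part has order \<open>A^{1/2} E\<close>, and the mollification is Lipschitz, which
  gives the decay of \<open>D_0\<close>.  The local energy inequality with a cut-off at scale \<open>\<theta>R\<close> then bounds \<open>A\<close>;
  in it \<open>|v|^2\<close> is replaced by \<open>|v|^2 - |c|^2\<close> in the convective term.  All terms that are not a small
  multiple of \<open>Y(R)\<close> grow more slowly than \<open>A^{3/2}\<close> and are absorbed into \<open>K\<close>.
\<close>

subsection \<open>Smooth functions and test functions\<close>

text \<open>Why \<open>A^{3/2}\<close> is paired with \<open>D_0^2\<close>: in the local energy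
  inequality the product of velocity and pressure is split by Young's inequality with a free
  parameter \<open>l\<close> into l x + d / sqrt l, where x bounds the cubic term and d the
  pressure. For a suitable \<open>l\<close> the power 3/2 of this is of order x + d^2. Measured in
  this way, the terms of order A^{1/2} E have degrees 3/4, 1/2 and 1 in A, below 3/2. The terms of
  full degree carry at least \<theta>^{3/4}, and the surplus \<theta>^{1/4} over the desired
  \<theta>^{1/2} outweighs any constant that depends on E_0 only. The integral estimates rest on
  Riesz potentials and the Cauchy-Schwarz inequality. The kernel |z|^{-2} is the product of
  |z|^{-5/8} and |z|^{-11/8}; the squares of both are integrable near the origin of R^3, and
  |z|^{-5/4} is even square integrable, so that it carries |\<nabla>v|^2 from L^1 to L^2. On a slice
  the bounds must be linear in the integral of |\<nabla>v|^2, since only its first power is known to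
  be integrable in time; higher powers are traded for the energy A.\<close>

lemma dderiv_eqI: "(f has_derivative f') (at x) \<Longrightarrow> dderiv e f x = f' e"
  by (metis dderiv_def frechet_derivative_at)

lemma has_derivative_dderiv:
  "f differentiable at x \<Longrightarrow> (f has_derivative (\<lambda>e. dderiv e f x)) (at x)"
  by (simp add: dderiv_def frechet_derivative_works)

lemma dderiv_basis_sum:
  assumes "f differentiable at x"
  shows "dderiv e f x = (\<Sum>b\<in>Basis. (e \<bullet> b) * dderiv b f x)"
proof -
  interpret linear "\<lambda>e. dderiv e f x"
    using has_derivative_dderiv[OF assms] by (rule has_derivative_linear)
  have "dderiv e f x = dderiv (\<Sum>b\<in>Basis. (e \<bullet> b) *\<^sub>R b) f x" by (simp add: euclidean_representation)
  also have "\<dots> = (\<Sum>b\<in>Basis. (e \<bullet> b) * dderiv b f x)" by (simp add: sum scale)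
  finally show ?thesis .
qed

lemma Ck_Suc_has_derivative: "Ck (Suc k) f \<Longrightarrow> (f has_derivative (\<lambda>e. dderiv e f x)) (at x)"
  by (rule has_derivative_dderiv) (auto simp: differentiable_on_def)

lemma Ck_SucD: "Ck (Suc k) f \<Longrightarrow> Ck k f"
  by (induction k arbitrary: f) (auto intro: differentiable_imp_continuous_on)

lemma Ck_SucI:
  assumes "\<And>x. (f has_derivative f' x) (at x)" "\<And>e. e \<in> Basis \<Longrightarrow> Ck k (\<lambda>x. f' x e)"
  shows "Ck (Suc k) f"
proof -
  have "dderiv e f = (\<lambda>x. f' x e)" for e
    using dderiv_eqI[OF assms(1)] by auto
  moreover have "f differentiable_on UNIV"
    using assms(1) by (auto simp: differentiable_on_def differentiable_def intro: has_derivative_at_withinI)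
  ultimately show ?thesis using assms(2) by simp
qed

lemma Ck_const: "Ck k (\<lambda>_. c)"
proof (induction k arbitrary: c)
  case (Suc k)
  show ?case by (rule Ck_SucI[where f'="\<lambda>_ _. 0"]) (auto intro!: derivative_eq_intros Suc)
qed simp

lemma Ck_add: "Ck k f \<Longrightarrow> Ck k g \<Longrightarrow> Ck k (\<lambda>x. f x + g x)"
proof (induction k arbitrary: f g)
  case (Suc k)
  show ?case
    by (rule Ck_SucI[where f'="\<lambda>x e. dderiv e f x + dderiv e g x"])
      (use Suc in \<open>auto intro!: has_derivative_add Ck_Suc_has_derivative[of k] simp del: Ck.simps\<close>, use Suc in auto)
qed (auto intro: continuous_intros)

lemma Ck_mult: "Ck k f \<Longrightarrow> Ck k g \<Longrightarrow> Ck k (\<lambda>x. f x * g x)"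
proof (induction k arbitrary: f g)
  case (Suc k)
  note d = Ck_Suc_has_derivative[OF Suc.prems(1)] Ck_Suc_has_derivative[OF Suc.prems(2)]
  show ?case
  proof (rule Ck_SucI)
    show "((\<lambda>x. f x * g x) has_derivative (\<lambda>e. f x * dderiv e g x + dderiv e f x * g x)) (at x)" for x
      by (rule has_derivative_mult[OF d])
    fix e :: 'a assume e: "e \<in> Basis"
    show "Ck k (\<lambda>x. f x * dderiv e g x + dderiv e f x * g x)"
      by (intro Ck_add Suc.IH) (use Suc.prems e Ck_SucD in auto)
  qed
qed (auto intro: continuous_intros)

lemma Ck_sum: "(\<And>i. i \<in> I \<Longrightarrow> Ck k (f i)) \<Longrightarrow> Ck k (\<lambda>x. \<Sum>i\<in>I. f i x)"
  by (induction I rule: infinite_finite_induct) (auto intro: Ck_add Ck_const)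

lemma Ck_dderiv: "Ck (Suc k) f \<Longrightarrow> Ck k (dderiv e f)"
proof -
  assume f: "Ck (Suc k) f"
  then have "dderiv e f = (\<lambda>x. \<Sum>b\<in>Basis. (e \<bullet> b) * dderiv b f x)"
    by (intro ext dderiv_basis_sum) (auto simp: differentiable_on_def)
  with f show ?thesis by (auto intro!: Ck_sum Ck_mult Ck_const)
qed

lemma Ck_compose_affine:
  fixes l :: "'a::euclidean_space \<Rightarrow> 'b::euclidean_space"
  assumes l: "bounded_linear l"
  shows "Ck k f \<Longrightarrow> Ck k (\<lambda>x. f (l x + b))"
proof (induction k arbitrary: f)
  case 0
  then show ?case
    using continuous_on_compose2[of UNIV f UNIV "\<lambda>x. l x + b"]
      continuous_on_add[OF linear_continuous_on[OF l] continuous_on_const] by auto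
next
  case (Suc k)
  show ?case
  proof (rule Ck_SucI)
    have "((\<lambda>x. l x + b) has_derivative l) (at x)" for x
      by (auto intro!: derivative_eq_intros bounded_linear.has_derivative[OF l])
    then show "((\<lambda>x. f (l x + b)) has_derivative (\<lambda>e. dderiv (l e) f (l x + b))) (at x)" for x
      by (rule has_derivative_compose) (rule Ck_Suc_has_derivative[OF Suc.prems])
    show "Ck k (\<lambda>x. dderiv (l e) f (l x + b))" for e
      by (intro Suc.IH Ck_dderiv Suc.prems)
  qed
qed

lemma Ck_compose_real:
  fixes g :: "real \<Rightarrow> real"
  shows "Ck k g \<Longrightarrow> Ck k f \<Longrightarrow> Ck k (\<lambda>x. g (f x))"
proof (induction k arbitrary: f g)
  case 0
  then show ?case by (auto intro: continuous_on_compose2)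
next
  case (Suc k)
  note d = Ck_Suc_has_derivative[OF Suc.prems(1)] Ck_Suc_has_derivative[OF Suc.prems(2)]
  show ?case
  proof (rule Ck_SucI)
    show "((\<lambda>x. g (f x)) has_derivative (\<lambda>e. dderiv 1 g (f x) * dderiv e f x)) (at x)" for x
    proof -
      have "((\<lambda>x. g (f x)) has_derivative (\<lambda>e. dderiv (dderiv e f x) g (f x))) (at x)"
        by (rule has_derivative_compose[OF d(2) d(1)])
      moreover have "dderiv (dderiv e f x) g (f x) = dderiv 1 g (f x) * dderiv e f x" for e
        using dderiv_basis_sum[OF differentiableI[OF d(1)], of "dderiv e f x" "f x"] by (simp add: mult.commute)
      ultimately show ?thesis by (simp only:)
    qed
    fix e :: 'a assume e: "e \<in> Basis"
    show "Ck k (\<lambda>x. dderiv 1 g (f x) * dderiv e f x)"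
      by (rule Ck_mult[OF Suc.IH[OF Ck_dderiv[OF Suc.prems(1)] Ck_SucD[OF Suc.prems(2)]]
            Ck_dderiv[OF Suc.prems(2)]])
  qed
qed

definition smooth :: "('a::euclidean_space \<Rightarrow> real) \<Rightarrow> bool" where "smooth f \<longleftrightarrow> (\<forall>k. Ck k f)"

named_theorems smooth_intros

lemma smooth_const [smooth_intros]: "smooth (\<lambda>_. c)"
  by (simp add: smooth_def Ck_const)

lemma smooth_add [smooth_intros]: "smooth f \<Longrightarrow> smooth g \<Longrightarrow> smooth (\<lambda>x. f x + g x)"
  by (simp add: smooth_def Ck_add)

lemma smooth_mult [smooth_intros]: "smooth f \<Longrightarrow> smooth g \<Longrightarrow> smooth (\<lambda>x. f x * g x)"
  by (simp add: smooth_def Ck_mult)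

lemma smooth_diff [smooth_intros]: "smooth f \<Longrightarrow> smooth g \<Longrightarrow> smooth (\<lambda>x. f x - g x)"
  using smooth_add[OF _ smooth_mult[OF smooth_const[of "-1"]], of f g] by simp

lemma smooth_sum [smooth_intros]: "(\<And>i. i \<in> I \<Longrightarrow> smooth (f i)) \<Longrightarrow> smooth (\<lambda>x. \<Sum>i\<in>I. f i x)"
  by (simp add: smooth_def Ck_sum)

lemma smooth_compose_real:
  fixes g :: "real \<Rightarrow> real"
  shows "smooth g \<Longrightarrow> smooth f \<Longrightarrow> smooth (\<lambda>x. g (f x))"
  by (simp add: smooth_def Ck_compose_real)

lemma smooth_compose_affine: "bounded_linear l \<Longrightarrow> smooth f \<Longrightarrow> smooth (\<lambda>x. f (l x + b))"
  by (simp add: smooth_def Ck_compose_affine)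

lemma smooth_dderiv [smooth_intros]: "smooth f \<Longrightarrow> smooth (dderiv e f)"
  by (metis smooth_def Ck_dderiv)

lemma smooth_has_derivative: "smooth f \<Longrightarrow> (f has_derivative (\<lambda>e. dderiv e f x)) (at x)"
  using Ck_Suc_has_derivative smooth_def by blast

lemma smooth_continuous_on: "smooth f \<Longrightarrow> continuous_on S f"
  by (metis Ck.simps(1) smooth_def continuous_on_subset top_greatest)

lemma smooth_borel [measurable_dest]: "smooth f \<Longrightarrow> f \<in> borel_measurable borel"
  by (simp add: smooth_continuous_on borel_measurable_continuous_onI)

lemma smoothI:
  assumes "\<And>x. (f has_derivative f' x) (at x)" "\<And>e. e \<in> Basis \<Longrightarrow> smooth (\<lambda>x. f' x e)"
  shows "smooth f"
proof -
  have "Ck (Suc k) f" for k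
    by (rule Ck_SucI[OF assms(1)]) (use assms(2) in \<open>simp add: smooth_def\<close>)
  then show ?thesis unfolding smooth_def using Ck_SucD by blast
qed

lemma smooth_real_antiderivative:
  fixes g :: "real \<Rightarrow> real"
  assumes "\<And>x. (g has_real_derivative g' x) (at x)" "smooth g'"
  shows "smooth g"
  by (rule smoothI[where f'="\<lambda>x e. g' x * e"])
    (use assms in \<open>auto simp: has_field_derivative_def intro: smooth_const smooth_mult\<close>)

lemma smooth_linear:
  assumes "bounded_linear l" shows "smooth (l :: 'a::euclidean_space \<Rightarrow> real)"
  by (rule smoothI[where f'="\<lambda>_. l"])
    (use assms in \<open>auto intro: bounded_linear_imp_has_derivative smooth_const\<close>)

lemma smooth_ident [smooth_intros]: "smooth (\<lambda>x::real. x)"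
  by (rule smooth_linear) (rule bounded_linear_ident)

lemma smooth_norm_sq [smooth_intros]: "smooth (\<lambda>x::'a::euclidean_space. (norm x)\<^sup>2)"
proof -
  have "smooth (\<lambda>x::'a. \<Sum>b\<in>Basis. (x \<bullet> b) * (x \<bullet> b))"
    by (intro smooth_intros smooth_linear bounded_linear_inner_left)
  then show ?thesis by (simp add: power2_norm_eq_inner euclidean_inner[of x x for x])
qed

lemma dderiv_linear: "smooth f \<Longrightarrow> linear (\<lambda>h. dderiv h f x)"
  by (rule has_derivative_linear[OF smooth_has_derivative])

lemma line_derivative:
  fixes f :: "'a::euclidean_space \<Rightarrow> real"
  assumes "smooth f" shows "((\<lambda>s. f (y + s *\<^sub>R u)) has_real_derivative dderiv u f (y + s *\<^sub>R u)) (at s)"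
proof -
  have "((\<lambda>s. y + s *\<^sub>R u) has_derivative (\<lambda>h. h *\<^sub>R u)) (at s)" by (auto intro!: derivative_eq_intros)
  then have "((\<lambda>s. f (y + s *\<^sub>R u)) has_derivative (\<lambda>h. dderiv (h *\<^sub>R u) f (y + s *\<^sub>R u))) (at s)"
    by (rule has_derivative_compose) (rule smooth_has_derivative[OF assms])
  moreover have "(\<lambda>h. dderiv (h *\<^sub>R u) f (y + s *\<^sub>R u)) = (*) (dderiv u f (y + s *\<^sub>R u))"
    using linear_cmul[OF dderiv_linear[OF assms]] by (auto simp: mult.commute)
  ultimately show ?thesis by (simp add: has_field_derivative_def)
qed

text \<open>Two applications of the mean value theorem: along \<open>u\<close> to the increment of
  \<open>f\<close> over \<open>h *\<^sub>R v\<close>, then along \<open>v\<close> to the derivative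
  in direction \<open>u\<close>. The left-hand side is symmetric in \<open>u\<close> and
  \<open>v\<close>, the right-hand side is not; \<open>dderiv_symmetric\<close> compares the two
  readings as \<open>h\<close> tends to 0.\<close>

lemma second_difference:
  fixes f :: "'a::euclidean_space \<Rightarrow> real"
  assumes f: "smooth f" and h: "0 < h"
  shows "\<exists>s \<tau>. 0 < s \<and> s < h \<and> 0 < \<tau> \<and> \<tau> < h \<and>
    f (x + h *\<^sub>R u + h *\<^sub>R v) - f (x + h *\<^sub>R u) - f (x + h *\<^sub>R v) + f x
      = h * (h * dderiv v (dderiv u f) (x + s *\<^sub>R u + \<tau> *\<^sub>R v))"
proof -
  let ?g = "\<lambda>s. f ((x + h *\<^sub>R v) + s *\<^sub>R u) - f (x + s *\<^sub>R u)"
  have "\<And>s. (?g has_real_derivative (dderiv u f ((x + h *\<^sub>R v) + s *\<^sub>R u) - dderiv u f (x + s *\<^sub>R u))) (at s)"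
    by (intro DERIV_diff line_derivative f)
  then obtain s where s: "0 < s" "s < h" "?g h - ?g 0 = (h - 0) * (dderiv u f ((x + h *\<^sub>R v) + s *\<^sub>R u) - dderiv u f (x + s *\<^sub>R u))"
    using MVT2[OF h, of ?g "\<lambda>s. dderiv u f ((x + h *\<^sub>R v) + s *\<^sub>R u) - dderiv u f (x + s *\<^sub>R u)"] by blast
  have "\<And>\<tau>. ((\<lambda>\<tau>. dderiv u f ((x + s *\<^sub>R u) + \<tau> *\<^sub>R v)) has_real_derivative dderiv v (dderiv u f) ((x + s *\<^sub>R u) + \<tau> *\<^sub>R v)) (at \<tau>)"
    by (intro line_derivative smooth_dderiv f)
  then obtain \<tau> where t: "0 < \<tau>" "\<tau> < h" "dderiv u f ((x + s *\<^sub>R u) + h *\<^sub>R v) - dderiv u f ((x + s *\<^sub>R u) + 0 *\<^sub>R v)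
      = (h - 0) * dderiv v (dderiv u f) ((x + s *\<^sub>R u) + \<tau> *\<^sub>R v)"
    using MVT2[OF h, of "\<lambda>\<tau>. dderiv u f ((x + s *\<^sub>R u) + \<tau> *\<^sub>R v)" "\<lambda>\<tau>. dderiv v (dderiv u f) ((x + s *\<^sub>R u) + \<tau> *\<^sub>R v)"] by blast
  have "f (x + h *\<^sub>R u + h *\<^sub>R v) - f (x + h *\<^sub>R u) - f (x + h *\<^sub>R v) + f x = ?g h - ?g 0" by (simp add: add_ac)
  also have "\<dots> = h * (dderiv u f ((x + s *\<^sub>R u) + h *\<^sub>R v) - dderiv u f ((x + s *\<^sub>R u) + 0 *\<^sub>R v))"
    unfolding s(3) by (simp add: add_ac)
  also have "\<dots> = h * (h * dderiv v (dderiv u f) (x + s *\<^sub>R u + \<tau> *\<^sub>R v))" unfolding t(3) by simp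
  finally show ?thesis using s t by blast
qed

lemma dderiv_symmetric:
  fixes f :: "'a::euclidean_space \<Rightarrow> real"
  assumes f: "smooth f" shows "dderiv u (dderiv v f) x = dderiv v (dderiv u f) x"
proof -
  define h where "h n = 1 / real (Suc n)" for n
  have h: "0 < h n" for n by (simp add: h_def)
  have h0: "h \<longlonglongrightarrow> 0" unfolding h_def by (rule LIMSEQ_Suc[OF lim_1_over_n])
  have lim: "\<exists>D. (\<lambda>n. f (x + h n *\<^sub>R u + h n *\<^sub>R v) - f (x + h n *\<^sub>R u) - f (x + h n *\<^sub>R v) + f x) = (\<lambda>n. h n * (h n * D n))
      \<and> D \<longlonglongrightarrow> dderiv v (dderiv u f) x" for u v
  proof -
    obtain s \<tau> where st: "\<And>n. 0 < s n \<and> s n < h n \<and> 0 < \<tau> n \<and> \<tau> n < h n \<and>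
        f (x + h n *\<^sub>R u + h n *\<^sub>R v) - f (x + h n *\<^sub>R u) - f (x + h n *\<^sub>R v) + f x
        = h n * (h n * dderiv v (dderiv u f) (x + s n *\<^sub>R u + \<tau> n *\<^sub>R v))"
      using second_difference[OF f h, where x=x and u=u and v=v] by metis
    have s0: "s \<longlonglongrightarrow> 0"
      by (rule tendsto_sandwich[OF _ _ tendsto_const h0]; intro always_eventually allI less_imp_le; use st in blast)
    have t0: "\<tau> \<longlonglongrightarrow> 0"
      by (rule tendsto_sandwich[OF _ _ tendsto_const h0]; intro always_eventually allI less_imp_le; use st in blast)
    have "(\<lambda>n. x + s n *\<^sub>R u + \<tau> n *\<^sub>R v) \<longlonglongrightarrow> x + 0 *\<^sub>R u + 0 *\<^sub>R v" by (intro tendsto_intros s0 t0)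
    then have "(\<lambda>n. dderiv v (dderiv u f) (x + s n *\<^sub>R u + \<tau> n *\<^sub>R v)) \<longlonglongrightarrow> dderiv v (dderiv u f) x"
      using continuous_on_tendsto_compose[OF smooth_continuous_on[OF smooth_dderiv[OF smooth_dderiv[OF f]], of UNIV v u],
          of "\<lambda>n. x + s n *\<^sub>R u + \<tau> n *\<^sub>R v" x sequentially] by simp
    with st show ?thesis by (intro exI[of _ "\<lambda>n. dderiv v (dderiv u f) (x + s n *\<^sub>R u + \<tau> n *\<^sub>R v)"]) auto
  qed
  obtain D1 where D1: "(\<lambda>n. f (x + h n *\<^sub>R u + h n *\<^sub>R v) - f (x + h n *\<^sub>R u) - f (x + h n *\<^sub>R v) + f x) = (\<lambda>n. h n * (h n * D1 n))"
      "D1 \<longlonglongrightarrow> dderiv v (dderiv u f) x" using lim[of u v] by blast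
  obtain D2 where D2: "(\<lambda>n. f (x + h n *\<^sub>R v + h n *\<^sub>R u) - f (x + h n *\<^sub>R v) - f (x + h n *\<^sub>R u) + f x) = (\<lambda>n. h n * (h n * D2 n))"
      "D2 \<longlonglongrightarrow> dderiv u (dderiv v f) x" using lim[of v u] by blast
  have "D1 n = D2 n" for n
  proof -
    have "h n * (h n * D1 n) = h n * (h n * D2 n)"
      using fun_cong[OF D1(1), of n] fun_cong[OF D2(1), of n] by (simp add: add_ac algebra_simps)
    then show ?thesis using h[of n] by simp
  qed
  then have "D1 = D2" by blast
  with D1(2) D2(2) show ?thesis using LIMSEQ_unique by blast
qed

subsection \<open>One-dimensional cut-off functions\<close>

text \<open>The polynomial factor makes this class of functions closed under differentiation.\<close>

definition flat_exp :: "real poly \<Rightarrow> real \<Rightarrow> real" where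
  "flat_exp P q = (if q > 0 then poly P (1/q) * exp (-(1/q)) else 0)"

lemma power_times_exp_tendsto_0: "((\<lambda>y. y ^ n * exp (-y)) \<longlongrightarrow> 0) (at_top :: real filter)"
  using tendsto_power_div_exp_0[of n] by (simp add: exp_minus field_simps)

lemma poly_times_exp_tendsto_0: "((\<lambda>y. poly P y * exp (-y)) \<longlongrightarrow> 0) (at_top :: real filter)"
proof -
  have "((\<lambda>y. \<Sum>i\<le>degree P. coeff P i * (y ^ i * exp (-y))) \<longlongrightarrow> (\<Sum>i\<le>degree P. coeff P i * 0)) (at_top :: real filter)"
    by (intro tendsto_sum tendsto_mult tendsto_const power_times_exp_tendsto_0)
  then show ?thesis by (simp add: poly_altdef sum_distrib_right mult.assoc)
qed

lemma flat_exp_tendsto_0: "((\<lambda>h. flat_exp P h) \<longlongrightarrow> 0) (at 0)"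
proof -
  have "((\<lambda>h. flat_exp P h) \<longlongrightarrow> 0) (at_right 0)"
  proof (rule Lim_transform_eventually)
    show "((\<lambda>h. poly P (inverse h) * exp (- inverse h)) \<longlongrightarrow> 0) (at_right (0::real))"
      by (rule filterlim_compose[OF poly_times_exp_tendsto_0 filterlim_inverse_at_top_right])
    show "\<forall>\<^sub>F h in at_right 0. poly P (inverse h) * exp (- inverse h) = flat_exp P h"
      by (auto simp: eventually_at_filter flat_exp_def inverse_eq_divide)
  qed
  moreover have "((\<lambda>h. flat_exp P h) \<longlongrightarrow> 0) (at_left 0)"
    by (rule tendsto_eventually) (auto simp: eventually_at_filter flat_exp_def)
  ultimately show ?thesis by (simp add: filterlim_at_split)
qed

text \<open>In the variable y = 1/q the derivative d/dq is -y^2 d/dy, which takes P(y) exp(-y) to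
  y^2 (P - P')(y) exp(-y); \<open>[:0,0,1:]\<close> is the factor y^2.\<close>

lemma flat_exp_has_derivative:
  "(flat_exp P has_real_derivative flat_exp ([:0,0,1:] * (P - pderiv P)) q) (at q)"
proof -
  consider "q < 0" | "q = 0" | "q > 0" by linarith
  then show ?thesis
  proof cases
    case 1
    have "((\<lambda>_. 0) has_real_derivative 0) (at q)" by simp
    then have "(flat_exp P has_real_derivative 0) (at q)"
      by (rule has_field_derivative_transform_within_open[of _ _ _ "{..<0}"]) (use 1 in \<open>auto simp: flat_exp_def\<close>)
    then show ?thesis using 1 by (simp add: flat_exp_def)
  next
    case 2
    \<comment> \<open>The difference quotient at 0 is again a function of this class: dividing by
      \<open>h\<close> multiplies the polynomial in 1/h by its variable, which is what
      \<open>pCons 0\<close> does.\<close>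
    have "((\<lambda>h. flat_exp (pCons 0 P) h) \<longlongrightarrow> 0) (at 0)" by (rule flat_exp_tendsto_0)
    then have "((\<lambda>h. (flat_exp P h - flat_exp P 0) / (h - 0)) \<longlongrightarrow> 0) (at 0)"
      by (rule Lim_transform_eventually) (auto simp: flat_exp_def eventually_at_filter)
    then show ?thesis using 2 by (simp add: has_field_derivative_iff flat_exp_def)
  next
    case 3
    have "((\<lambda>q. poly P (1/q) * exp (-(1/q))) has_real_derivative flat_exp ([:0,0,1:] * (P - pderiv P)) q) (at q)"
      using 3 by (auto simp: flat_exp_def field_simps power2_eq_square intro!: derivative_eq_intros poly_DERIV[THEN DERIV_chain2])
    then show ?thesis
      by (rule has_field_derivative_transform_within_open[of _ _ _ "{0<..}"]) (use 3 in \<open>auto simp: flat_exp_def\<close>)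
  qed
qed

lemma smooth_flat_exp: "smooth (flat_exp P)"
proof -
  have "Ck k (flat_exp P)" for k
  proof (induction k arbitrary: P)
    case 0
    show ?case
      by (auto intro!: continuous_at_imp_continuous_on DERIV_isCont[OF flat_exp_has_derivative])
  next
    case (Suc k)
    show ?case
      by (rule Ck_SucI[where f'="\<lambda>q e. flat_exp ([:0,0,1:] * (P - pderiv P)) q * e"])
        (use flat_exp_has_derivative Suc in \<open>auto simp: has_field_derivative_def simp del: mult_pCons_left\<close>)
  qed
  then show ?thesis by (simp add: smooth_def)
qed

text \<open>The interval degenerates for \<open>q \<le> 0\<close>, so the fundamental theorem of
  calculus cannot be applied directly at 0 or to the left of it. As \<open>b\<close> vanishes there,
  the base point may be moved to some \<open>a\<close> to the left of \<open>x\<close>.\<close>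

lemma integral_from_0_has_derivative:
  fixes b :: "real \<Rightarrow> real"
  assumes b: "continuous_on UNIV b" and b0: "\<And>q. q \<le> 0 \<Longrightarrow> b q = 0"
  shows "((\<lambda>q. integral {0..q} b) has_real_derivative b x) (at x)"
proof -
  define a where "a = - \<bar>x\<bar> - 1"
  have int: "b integrable_on {c..d}" for c d
    by (rule integrable_continuous_real) (rule continuous_on_subset[OF b], simp)
  have zero: "integral {c..d} b = 0" if "d \<le> 0" for c d
  proof -
    show ?thesis by (intro integral_unique has_integral_is_0) (use that b0 in auto)
  qed
  have eq: "integral {a..u} b = integral {0..u} b" for u
  proof (cases "0 \<le> u")
    case True
    then show ?thesis using Henstock_Kurzweil_Integration.integral_combine[where f=b and a=a and c=0 and b=u] int zero[of 0 a] by (simp add: a_def)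
  qed (simp add: zero)
  have "((\<lambda>u. integral {a..u} b) has_real_derivative b x) (at x within {a..\<bar>x\<bar> + 1})"
    by (rule integral_has_real_derivative) (auto simp: a_def intro: continuous_on_subset[OF b])
  moreover have "at x within {a..\<bar>x\<bar> + 1} = at x"
    by (rule at_within_interior) (auto simp: a_def interior_atLeastAtMost_real)
  ultimately show ?thesis by (simp add: eq)
qed

lemma ex_smooth_bump:
  obtains b :: "real \<Rightarrow> real" where "smooth b" "\<And>q. 0 \<le> b q" "\<And>q. b q \<noteq> 0 \<longleftrightarrow> 1/4 < q \<and> q < 1"
proof
  let ?b = "\<lambda>q. flat_exp [:1:] (1 * q + (-1/4)) * flat_exp [:1:] ((-1) * q + 1)"
  show "smooth ?b"
    by (intro smooth_intros smooth_compose_real[OF smooth_flat_exp])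
qed (auto simp: flat_exp_def)

text \<open>The argument is later a squared distance over a squared scale, so the support
  corresponds to the annulus between half the scale and the scale. The gap below 1/4 keeps away from
  the singularity of powers of \<open>q\<close> at 0.\<close>

definition bump :: "real \<Rightarrow> real" where
  "bump = (SOME b. smooth b \<and> (\<forall>q. 0 \<le> b q) \<and> (\<forall>q. b q \<noteq> 0 \<longleftrightarrow> 1/4 < q \<and> q < 1))"

lemma smooth_bump: "smooth bump" and bump_nonneg: "0 \<le> bump q"
  and bump_nonzero: "bump q \<noteq> 0 \<longleftrightarrow> 1/4 < q \<and> q < 1"
proof -
  have "\<exists>b. smooth b \<and> (\<forall>q. 0 \<le> b q) \<and> (\<forall>q. b q \<noteq> 0 \<longleftrightarrow> 1/4 < q \<and> q < (1::real))"
    using ex_smooth_bump by metis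
  from someI_ex[OF this] show "smooth bump" "0 \<le> bump q" "bump q \<noteq> 0 \<longleftrightarrow> 1/4 < q \<and> q < 1"
    unfolding bump_def[symmetric] by blast+
qed


section \<open>Functions of compact support\<close>

lemma dderiv_eq_0_outside:
  assumes f: "\<And>x. x \<notin> K \<Longrightarrow> f x = 0" and K: "closed K" and x: "x \<notin> K"
  shows "dderiv e f x = 0"
proof -
  have "((\<lambda>_. 0) has_derivative (\<lambda>_. 0)) (at x)" by simp
  then have "(f has_derivative (\<lambda>_. 0)) (at x)"
    by (rule has_derivative_transform_within_open[of _ _ _ _ "- K"]) (use f K x in auto)
  then show ?thesis by (rule dderiv_eqI)
qed

lemma bounded_of_compact_support:
  fixes f :: "'a::euclidean_space \<Rightarrow> real"
  assumes "continuous_on UNIV f" "compact K" "\<And>x. x \<notin> K \<Longrightarrow> f x = 0"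
  shows "\<exists>B\<ge>0. \<forall>x. \<bar>f x\<bar> \<le> B"
proof -
  have "compact (f ` K)"
    by (rule compact_continuous_image[OF continuous_on_subset[OF assms(1)] assms(2)]) simp
  then obtain B where B: "\<And>y. y \<in> f ` K \<Longrightarrow> norm y \<le> B" using compact_imp_bounded bounded_iff by metis
  have "\<bar>f x\<bar> \<le> \<bar>B\<bar>" for x using B[of "f x"] assms(3)[of x] by (cases "x \<in> K") auto
  then show ?thesis by (intro exI[of _ "\<bar>B\<bar>"]) auto
qed

lemma lipschitz_of_compact_support:
  fixes f :: "'a::euclidean_space \<Rightarrow> real"
  assumes f: "smooth f" "compact K" "\<And>x. x \<notin> K \<Longrightarrow> f x = 0"
  shows "\<exists>L\<ge>0. \<forall>x y. \<bar>f x - f y\<bar> \<le> L * norm (x - y)"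
proof -
  have "\<exists>B\<ge>0. \<forall>x. \<bar>dderiv b f x\<bar> \<le> B" for b
    by (rule bounded_of_compact_support[OF smooth_continuous_on[OF smooth_dderiv[OF f(1)]] f(2)])
      (rule dderiv_eq_0_outside[OF f(3)], use f compact_imp_closed in auto)
  then obtain B where B: "\<And>b. B b \<ge> 0" "\<And>b x. \<bar>dderiv b f x\<bar> \<le> B b" by metis
  define L where "L = (\<Sum>b\<in>Basis. B b)"
  have bd: "norm (dderiv h f x) \<le> L * norm h" for h x
  proof -
    have "norm (dderiv h f x) = \<bar>\<Sum>b\<in>Basis. (h \<bullet> b) * dderiv b f x\<bar>"
      using dderiv_basis_sum[OF differentiableI[OF smooth_has_derivative[OF f(1)]], of h x] by simp
    also have "\<dots> \<le> (\<Sum>b\<in>Basis. norm h * B b)"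
      by (intro order_trans[OF sum_abs] sum_mono) (auto simp: abs_mult intro!: mult_mono B Basis_le_norm)
    finally show ?thesis by (simp add: L_def sum_distrib_left mult.commute)
  qed
  have "norm (f x - f y) \<le> L * norm (x - y)" for x y
    by (rule differentiable_bound[where S=UNIV and f'="\<lambda>x h. dderiv h f x"])
      (auto intro: smooth_has_derivative[OF f(1)] onorm_le bd)
  then show ?thesis using B by (intro exI[of _ L]) (auto simp: L_def sum_nonneg)
qed

lemma smooth_test_functionsI:
  assumes "smooth f" "compact K" "K \<subseteq> U" "\<And>x. x \<notin> K \<Longrightarrow> f x = 0"
  shows "f \<in> test_functions U"
proof -
  have "{x. f x \<noteq> 0} \<subseteq> K" using assms(4) by auto
  then have "closure {x. f x \<noteq> 0} \<subseteq> K" using assms(2) by (simp add: closure_minimal compact_imp_closed)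
  moreover from this have "compact (closure {x. f x \<noteq> 0})"
    using compact_Int_closed[OF assms(2) closed_closure[of "{x. f x \<noteq> 0}"]] by (simp add: inf.absorb2)
  ultimately show ?thesis using assms unfolding test_functions_def smooth_def by auto
qed

section \<open>A smooth step and the radial profiles built from it\<close>

definition bump_mass :: real where "bump_mass = integral {0..1} bump"

definition chi :: "real \<Rightarrow> real" where "chi q = integral {0..q} bump / bump_mass"

lemma bump_eq_0: "q \<le> 1/4 \<or> 1 \<le> q \<Longrightarrow> bump q = 0"
  using bump_nonzero[of q] by auto

lemma bump_integral_has_derivative: "((\<lambda>q. integral {0..q} bump) has_real_derivative bump x) (at x)"
  by (rule integral_from_0_has_derivative) (auto intro: smooth_continuous_on smooth_bump bump_eq_0)

lemma bump_integral_mono: "x \<le> y \<Longrightarrow> integral {0..x} bump \<le> integral {0..y} bump"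
  by (rule DERIV_nonneg_imp_nondecreasing) (auto intro: bump_integral_has_derivative bump_nonneg)

lemma bump_mass_pos: "bump_mass > 0"
proof -
  have "integral {0..1/4} bump \<le> integral {0..1/2} bump" by (rule bump_integral_mono) simp
  also have "\<dots> < integral {0..3/4} bump"
  proof (rule DERIV_pos_imp_increasing[where f="\<lambda>q. integral {0..q} bump" and a="1/2" and b="3/4"])
    fix x :: real assume "1/2 \<le> x" "x \<le> 3/4"
    then have "0 < bump x" using bump_nonneg[of x] bump_nonzero[of x] by (simp add: less_le)
    then show "\<exists>y. ((\<lambda>q. integral {0..q} bump) has_real_derivative y) (at x) \<and> 0 < y"
      using bump_integral_has_derivative by blast
  qed simp
  also have "\<dots> \<le> bump_mass" unfolding bump_mass_def by (rule bump_integral_mono) simp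
  finally have "integral {0..1/4} bump < bump_mass" .
  moreover have "integral {0..1/4} bump = 0"
    by (intro integral_unique has_integral_is_0) (auto intro: bump_eq_0)
  ultimately show ?thesis by simp
qed

lemma chi_has_derivative: "(chi has_real_derivative bump q / bump_mass) (at q)"
  unfolding chi_def by (intro DERIV_cdivide bump_integral_has_derivative)

lemma smooth_chi: "smooth chi"
proof (rule smooth_real_antiderivative[OF chi_has_derivative])
  show "smooth (\<lambda>q. bump q / bump_mass)"
    using smooth_mult[OF smooth_bump smooth_const[of "inverse bump_mass"]] by (simp add: field_simps)
qed

lemma chi_mono: "x \<le> y \<Longrightarrow> chi x \<le> chi y"
  using bump_mass_pos bump_integral_mono by (simp add: chi_def divide_right_mono)

lemma chi_eq_0: assumes "q \<le> 1/4" shows "chi q = 0"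
proof -
  have "integral {0..q} bump = 0"
    by (intro integral_unique has_integral_is_0) (use assms in \<open>auto intro: bump_eq_0\<close>)
  then show ?thesis by (simp add: chi_def)
qed

lemma chi_eq_1: assumes "1 \<le> q" shows "chi q = 1"
proof -
  have "chi q = chi 1"
  proof (cases "1 < q")
    case True
    have "(chi has_real_derivative 0) (at x)" if "1 < x" for x
      using chi_has_derivative[of x] bump_eq_0[of x] that by simp
    then show ?thesis
      by (intro DERIV_isconst2[OF True]) (use True in \<open>auto intro: smooth_continuous_on smooth_chi\<close>)
  qed (use assms in simp)
  then show ?thesis using bump_mass_pos by (simp add: chi_def bump_mass_def)
qed

lemma chi_nonneg: "0 \<le> chi q" using chi_mono[of "min q 0" q] chi_eq_0[of "min q 0"] by simp
lemma chi_le_1: "chi q \<le> 1" using chi_mono[of q "max q 1"] chi_eq_1[of "max q 1"] by simp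

text \<open>\<open>f\<close> vanishes near the singularity of \<open>q powr a\<close>. The induction
  runs over all such \<open>f\<close> and all \<open>a\<close> at once, since the derivative is a
  sum of two products of the same form, with \<open>dderiv 1 f\<close> and \<open>a\<close>, and
  with \<open>a * f\<close> and \<open>a - 1\<close>.\<close>

lemma smooth_mult_powr:
  fixes f :: "real \<Rightarrow> real"
  assumes "smooth f" "\<And>q. q < 1/4 \<Longrightarrow> f q = 0"
  shows "smooth (\<lambda>q. f q * q powr a)"
proof -
  have "Ck k (\<lambda>q. f q * q powr a)" if "smooth f" "\<And>q. q < 1/4 \<Longrightarrow> f q = 0" for k and f :: "real \<Rightarrow> real" and a
    using that
  proof (induction k arbitrary: f a)
    case (0 f a)
    have "isCont (\<lambda>q. f q * q powr a) q" for q
    proof (cases "q > 0")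
      case True
      have "isCont f q" using smooth_continuous_on[OF 0(1), of UNIV] by (simp add: continuous_on_eq_continuous_at)
      then show ?thesis using True by (intro continuous_intros) auto
    next
      case False
      have "\<forall>\<^sub>F y in nhds q. f y * y powr a = 0"
        by (rule eventually_mono[OF eventually_nhds_in_open[of "{..<1/4}"]]) (use False 0(2) in auto)
      then show ?thesis using isCont_cong[of "\<lambda>q. f q * q powr a" "\<lambda>_. 0" q] by simp
    qed
    then show ?case by (simp add: continuous_at_imp_continuous_on)
  next
    case (Suc k f a)
    have d0: "dderiv 1 f q = 0" if "q < 1/4" for q
    proof -
      have "((\<lambda>_. 0) has_derivative (\<lambda>_. 0)) (at q)" by simp
      then have "(f has_derivative (\<lambda>_. 0)) (at q)"
        by (rule has_derivative_transform_within_open[of _ _ _ _ "{..<1/4}"]) (use Suc.prems that in auto)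
      then show ?thesis by (rule dderiv_eqI)
    qed
    have fd: "(f has_real_derivative dderiv 1 f q) (at q)" for q
    proof -
      have "dderiv h f q = dderiv 1 f q * h" for h
        using dderiv_basis_sum[OF differentiableI[OF smooth_has_derivative[OF Suc.prems(1)]], of h q] by (simp add: mult.commute)
      then have "(\<lambda>h. dderiv h f q) = (*) (dderiv 1 f q)" by (intro ext)
      then show ?thesis using smooth_has_derivative[OF Suc.prems(1), of q] by (simp add: has_field_derivative_def)
    qed
    define g where "g q = dderiv 1 f q * q powr a + (a * f q) * q powr (a - 1)" for q
    have D: "((\<lambda>q. f q * q powr a) has_real_derivative g q) (at q)" for q
    proof (cases "q > 0")
      case True
      then show ?thesis unfolding g_def
        by (auto intro!: derivative_eq_intros fd simp: algebra_simps powr_diff)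
    next
      case False
      have "((\<lambda>_. 0) has_real_derivative 0) (at q)" by simp
      then have "((\<lambda>q. f q * q powr a) has_real_derivative 0) (at q)"
        by (rule has_field_derivative_transform_within_open[where S="{..<1/4}"]) (use False Suc.prems in auto)
      then show ?thesis using False d0 Suc.prems by (simp add: g_def)
    qed
    have "Ck k g" unfolding g_def
      by (intro Ck_add Suc.IH smooth_dderiv smooth_mult smooth_const Suc.prems) (auto simp: d0 Suc.prems)
    then show ?case
      by (intro Ck_SucI[where f'="\<lambda>q e. g q * e"]) (use D in \<open>auto simp: has_field_derivative_def\<close>)
  qed
  with assms show ?thesis by (simp add: smooth_def)
qed

text \<open>At q = |x|^2/s^2 the power q^{-3/2} is s^3/|x|^3, the radial factor of the Newtonian
  field x/|x|^3; \<open>chi\<close> removes its singularity.\<close>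

definition beta :: "real \<Rightarrow> real" where "beta q = chi q * q powr (-3/2)"

definition beta' :: "real \<Rightarrow> real" where
  "beta' q = bump q / bump_mass * q powr (-3/2) + chi q * ((-3/2) * q powr (-5/2))"

lemma smooth_beta: "smooth beta"
  unfolding beta_def by (intro smooth_mult_powr smooth_chi) (simp add: chi_eq_0)

lemma beta_eq_0: "q \<le> 1/4 \<Longrightarrow> beta q = 0" by (simp add: beta_def chi_eq_0)

lemma beta_has_derivative: "(beta has_real_derivative beta' q) (at q)"
proof (cases "q > 0")
  case True
  then show ?thesis unfolding beta_def beta'_def
    by (auto intro!: derivative_eq_intros chi_has_derivative simp: powr_diff)
next
  case False
  have "((\<lambda>_. 0) has_real_derivative 0) (at q)" by simp
  then have "(beta has_real_derivative 0) (at q)"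
    by (rule has_field_derivative_transform_within_open[where S="{..<1/4}"])
      (use False in \<open>auto simp: beta_eq_0\<close>)
  then show ?thesis using False by (simp add: beta'_def chi_eq_0 bump_eq_0)
qed

definition radial_eta :: "real \<Rightarrow> real" where "radial_eta q = (2 * bump q / bump_mass) * q powr (-1/2)"

lemma smooth_radial_eta: "smooth radial_eta"
proof -
  have "smooth (\<lambda>q. (2 / bump_mass) * bump q)" by (intro smooth_intros smooth_bump)
  then have "smooth (\<lambda>q. 2 * bump q / bump_mass)" by simp
  then show ?thesis unfolding radial_eta_def by (rule smooth_mult_powr) (simp add: bump_eq_0)
qed

lemma radial_eta_nonneg: "0 \<le> radial_eta q"
  using bump_nonneg bump_mass_pos by (simp add: radial_eta_def)

lemma radial_eta_eq_0: "q \<le> 1/4 \<or> 1 \<le> q \<Longrightarrow> radial_eta q = 0"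
  by (simp add: radial_eta_def bump_eq_0)

text \<open>The left-hand side is the divergence in dimension 3 of the field
  \<open>beta(|x|^2) x\<close> at q = |x|^2. The undifferentiated powers cancel, as x/|x|^3 is
  divergence-free off the origin, and only the term with the derivative of \<open>chi\<close>
  remains. It is nonnegative and supported in an annulus, so it can serve as a mollifier.\<close>

lemma radial_eta_eq: "3 * beta q + 2 * q * beta' q = radial_eta q"
proof (cases "q > 0")
  case True
  have 1: "q * q powr (-3/2) = q powr (-1/2)" using True powr_add[of q 1 "-3/2"] by simp
  have 2: "q * q powr (-5/2) = q powr (-3/2)" using True powr_add[of q 1 "-5/2"] by simp
  show ?thesis
    unfolding beta_def beta'_def radial_eta_def 1[symmetric] 2[symmetric] by (simp add: algebra_simps)
qed (simp add: beta_def beta'_def radial_eta_def chi_eq_0 bump_eq_0)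

text \<open>An antiderivative of \<open>- beta / 2\<close>, normalised to be 1 at q = 1. From there
  on it is therefore q^{-1/2}, which is s/|x| at q = |x|^2/s^2.\<close>

definition newton_profile :: "real \<Rightarrow> real" where
  "newton_profile q = 1 - (integral {0..q} beta - integral {0..1} beta) / 2"

lemma newton_profile_has_derivative: "(newton_profile has_real_derivative (- beta q / 2)) (at q)"
proof -
  have "((\<lambda>q. integral {0..q} beta) has_real_derivative beta q) (at q)"
    by (rule integral_from_0_has_derivative) (auto intro: smooth_continuous_on smooth_beta beta_eq_0)
  then show ?thesis unfolding newton_profile_def by (auto intro!: derivative_eq_intros)
qed

lemma smooth_newton_profile: "smooth newton_profile"
proof (rule smooth_real_antiderivative[OF newton_profile_has_derivative])
  have "smooth (\<lambda>q. (-1/2) * beta q)" by (intro smooth_intros smooth_beta)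
  then show "smooth (\<lambda>q. - beta q / 2)" by simp
qed

lemma newton_profile_eq: assumes "1 \<le> q" shows "newton_profile q = q powr (-1/2)"
proof (cases "1 < q")
  case True
  have D: "((\<lambda>q. newton_profile q - q powr (-1/2)) has_real_derivative 0) (at x)" if "1 \<le> x" for x
    using that
    by (auto intro!: derivative_eq_intros newton_profile_has_derivative simp: beta_def chi_eq_1)
  have "newton_profile q - q powr (-1/2) = newton_profile 1 - 1 powr (-1/2)"
    by (rule DERIV_isconst2[OF True])
      (use True D in \<open>auto intro!: continuous_at_imp_continuous_on DERIV_isCont\<close>)
  then show ?thesis by (simp add: newton_profile_def)
qed (use assms in \<open>simp add: newton_profile_def\<close>)

subsection \<open>Regularised Newtonian potentials\<close>

text \<open>\<open>kerf s x\<close> times \<open>x\<close> is the Newtonian field \<open>x / |x|^3\<close>, cut off inside the ball of radius \<open>s\<close>;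
  \<open>eta s\<close> is its divergence and \<open>newton s\<close> a potential of it up to sign.\<close>

definition kerf :: "real \<Rightarrow> real^3 \<Rightarrow> real" where "kerf s x = beta ((norm x)\<^sup>2 / s\<^sup>2) / s^3"
definition newton :: "real \<Rightarrow> real^3 \<Rightarrow> real" where "newton s x = newton_profile ((norm x)\<^sup>2 / s\<^sup>2) / s"
definition eta :: "real \<Rightarrow> real^3 \<Rightarrow> real" where "eta s x = radial_eta ((norm x)\<^sup>2 / s\<^sup>2) / s^3"

lemma has_derivative_norm_sq:
  "((\<lambda>x::'a::euclidean_space. (norm x)\<^sup>2 / c) has_derivative (\<lambda>e. 2 * (x \<bullet> e) / c)) (at x)"
  unfolding power2_norm_eq_inner
  by (auto intro!: derivative_eq_intros simp: inner_commute divide_inverse)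

lemma smooth_radial:
  assumes "smooth f" shows "smooth (\<lambda>x::'a::euclidean_space. f ((norm x)\<^sup>2 / s) / c)"
proof -
  have "smooth (\<lambda>x::'a. inverse c * f (inverse s * (norm x)\<^sup>2))"
    by (intro smooth_mult smooth_const smooth_compose_real[OF assms] smooth_norm_sq)
  then show ?thesis by (simp add: divide_inverse mult.commute)
qed

lemma smooth_newton: "smooth (newton s)" and smooth_kerf: "smooth (kerf s)" and smooth_eta: "smooth (eta s)"
  unfolding newton_def kerf_def eta_def
  by (rule smooth_radial smooth_newton_profile smooth_beta smooth_radial_eta)+

lemma smooth_shift: "smooth f \<Longrightarrow> smooth (\<lambda>y. f (y - x))"
  using smooth_compose_affine[OF bounded_linear_ident, of f "- x"] by simp

lemma real_has_derivative_compose: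
  assumes "(g has_real_derivative d) (at (f x))" "(f has_derivative f') (at x)"
  shows "((\<lambda>x. g (f x)) has_derivative (\<lambda>e. d * f' e)) (at x)"
  using has_derivative_compose[OF assms(2) assms(1)[unfolded has_field_derivative_def]] .

lemma newton_has_derivative:
  assumes "s > 0" shows "(newton s has_derivative (\<lambda>e. - kerf s x * (x \<bullet> e))) (at x)"
proof -
  have "((\<lambda>x. newton_profile ((norm x)\<^sup>2 / s\<^sup>2) / s) has_derivative
     (\<lambda>e. (- beta ((norm x)\<^sup>2 / s\<^sup>2) / 2) * (2 * (x \<bullet> e) / s\<^sup>2) / s)) (at x)"
    by (intro bounded_linear.has_derivative[OF bounded_linear_divide] real_has_derivative_compose[OF newton_profile_has_derivative has_derivative_norm_sq])
  then show ?thesis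
    unfolding newton_def[abs_def] kerf_def
    by (rule has_derivative_eq_rhs) (use assms in \<open>auto simp: field_simps power3_eq_cube power2_eq_square\<close>)
qed

lemma kerf_has_derivative:
  assumes "s > 0"
  shows "(kerf s has_derivative (\<lambda>e. beta' ((norm x)\<^sup>2 / s\<^sup>2) * (2 * (x \<bullet> e) / s\<^sup>2) / s^3)) (at x)"
  unfolding kerf_def[abs_def]
  by (intro bounded_linear.has_derivative[OF bounded_linear_divide] real_has_derivative_compose[OF beta_has_derivative has_derivative_norm_sq])

text \<open>The Laplacian of \<open>newton_test e s x\<close> is a difference of two mollifiers, so that the pressure
  equation tested with it compares mollifications of the pressure at the scales \<open>e\<close> and \<open>s\<close>.\<close>

definition newton_test :: "real \<Rightarrow> real \<Rightarrow> real^3 \<Rightarrow> real^3 \<Rightarrow> real" where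
  "newton_test e s x y = newton s (y - x) - newton e (y - x)"

definition newton_flux :: "real \<Rightarrow> real \<Rightarrow> real^3 \<Rightarrow> real^3" where
  "newton_flux e s z = (kerf e z - kerf s z) *\<^sub>R z"

lemma dderiv_newton_test:
  assumes "0 < e" "0 < s"
  shows "dderiv h (newton_test e s x) y = newton_flux e s (y - x) \<bullet> h"
proof -
  have sh: "((\<lambda>y. y - x) has_derivative (\<lambda>h. h)) (at y)" by (auto intro!: derivative_eq_intros)
  have "(newton_test e s x has_derivative
      (\<lambda>h. - kerf s (y - x) * ((y - x) \<bullet> h) - (- kerf e (y - x) * ((y - x) \<bullet> h)))) (at y)"
    unfolding newton_test_def[abs_def]
    by (intro has_derivative_diff has_derivative_compose[OF sh newton_has_derivative] assms)
  from dderiv_eqI[OF this] show ?thesis by (simp add: newton_flux_def algebra_simps)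
qed

lemma smooth_newton_test: "smooth (newton_test e s x)"
  unfolding newton_test_def[abs_def] by (intro smooth_diff smooth_shift smooth_newton)

lemma newton_eq: assumes "0 < s" "s \<le> norm z" shows "newton s z = 1 / norm z"
proof -
  have "1 \<le> (norm z)\<^sup>2 / s\<^sup>2" using assms by (simp add: power_mono)
  moreover have "((norm z)\<^sup>2 / s\<^sup>2) powr (-1/2) = s / norm z"
  proof -
    have "((norm z)\<^sup>2 / s\<^sup>2) powr (1/2) = norm z / s"
      using assms by (simp add: powr_half_sqrt real_sqrt_divide)
    then show ?thesis using powr_minus[of "(norm z)\<^sup>2 / s\<^sup>2" "1/2"] by (simp add: field_simps)
  qed
  ultimately show ?thesis using assms by (simp add: newton_def newton_profile_eq)
qed

text \<open>Beyond both radii the two potentials are the same function 1/|y - x|. A single potential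
  has no compact support, the difference has; this is why two scales are compared.\<close>

lemma newton_test_eq_0:
  assumes "0 < e" "e \<le> s" "s \<le> norm (y - x)" shows "newton_test e s x y = 0"
  using assms by (simp add: newton_test_def newton_eq)

lemma newton_test_test_functions:
  assumes "0 < e" "e \<le> s" "cball x s \<subseteq> U" shows "newton_test e s x \<in> test_functions U"
  by (rule smooth_test_functionsI[OF smooth_newton_test compact_cball assms(3)])
    (use assms in \<open>auto simp: dist_norm norm_minus_commute intro!: newton_test_eq_0\<close>)

lemma test_functions_dderiv: assumes "f \<in> test_functions U" shows "dderiv e f \<in> test_functions U"
proof -
  let ?K = "closure {x. f x \<noteq> 0}"
  have sm: "smooth f" using assms by (auto simp: test_functions_def smooth_def)
  show ?thesis
  proof (rule smooth_test_functionsI[OF smooth_dderiv[OF sm]])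
    show "compact ?K" "?K \<subseteq> U" using assms by (auto simp: test_functions_def)
    show "dderiv e f x = 0" if "x \<notin> ?K" for x
      by (rule dderiv_eq_0_outside[OF _ closed_closure that]) (use closure_subset[of "{x. f x \<noteq> 0}"] in auto)
  qed
qed

lemma test_functions_smooth: "f \<in> test_functions U \<Longrightarrow> smooth f"
  by (auto simp: test_functions_def smooth_def)

lemma kerf_norm:
  assumes "0 < s" shows "kerf s z * norm z = chi ((norm z)\<^sup>2 / s\<^sup>2) / (norm z)\<^sup>2"
proof (cases "z = 0")
  case False
  have "((norm z)\<^sup>2 / s\<^sup>2) powr (3/2) = (norm z / s)^3"
  proof -
    have "((norm z)\<^sup>2 / s\<^sup>2) = (norm z / s) powr 2" using assms False by (simp add: power_divide)
    then have "((norm z)\<^sup>2 / s\<^sup>2) powr (3/2) = (norm z / s) powr 3" by (simp add: powr_powr)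
    then show ?thesis using assms False by simp
  qed
  then have "((norm z)\<^sup>2 / s\<^sup>2) powr (-3/2) = (s / norm z)^3"
    using powr_minus[of "(norm z)\<^sup>2 / s\<^sup>2" "3/2"] by (simp add: field_simps power_divide)
  then show ?thesis using assms False
    by (simp add: kerf_def beta_def power_divide field_simps power3_eq_cube power2_eq_square)
qed (simp add: kerf_def)

text \<open>Both fields are z/|z|^3 multiplied by a number in [0,1], and the multipliers agree from
  radius \<open>s\<close> on. The bound does not depend on \<open>e\<close>, which lets
  \<open>e\<close> tend to 0 later.\<close>

lemma norm_newton_flux_le:
  assumes "0 < e" "e \<le> s" shows "norm (newton_flux e s z) \<le> 1 / (norm z)\<^sup>2 * indicator (ball 0 s) z"
proof -
  have "norm (newton_flux e s z) = \<bar>kerf e z * norm z - kerf s z * norm z\<bar>"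
    by (simp add: newton_flux_def abs_mult left_diff_distrib[symmetric])
  also have "\<dots> = \<bar>chi ((norm z)\<^sup>2 / e\<^sup>2) - chi ((norm z)\<^sup>2 / s\<^sup>2)\<bar> / (norm z)\<^sup>2"
    using assms by (simp add: kerf_norm diff_divide_distrib[symmetric])
  also have "\<dots> \<le> indicator (ball 0 s) z / (norm z)\<^sup>2"
  proof (cases "norm z < s")
    case True
    then show ?thesis
      using chi_nonneg[of "(norm z)\<^sup>2 / e\<^sup>2"] chi_nonneg[of "(norm z)\<^sup>2 / s\<^sup>2"]
        chi_le_1[of "(norm z)\<^sup>2 / e\<^sup>2"] chi_le_1[of "(norm z)\<^sup>2 / s\<^sup>2"]
      by (intro divide_right_mono) auto
  next
    case False
    then have "1 \<le> (norm z)\<^sup>2 / e\<^sup>2" "1 \<le> (norm z)\<^sup>2 / s\<^sup>2" using assms by (auto simp: power_mono)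
    then show ?thesis using False by (simp add: chi_eq_1)
  qed
  finally show ?thesis by simp
qed

lemma sum_kerf_dderiv:
  assumes s: "0 < s"
  shows "(\<Sum>i\<in>UNIV. dderiv (axis i 1) (\<lambda>z. kerf s z * z $ i) z) = eta s z"
proof -
  define q where "q = (norm z)\<^sup>2 / s\<^sup>2"
  have D: "((\<lambda>z. kerf s z * z $ i) has_derivative
      (\<lambda>e. kerf s z * e $ i + beta' q * (2 * (z \<bullet> e) / s\<^sup>2) / s^3 * z $ i)) (at z)" for i
    unfolding q_def by (intro has_derivative_mult kerf_has_derivative s bounded_linear_imp_has_derivative bounded_linear_vec_nth)
  have d: "dderiv (axis i 1) (\<lambda>z. kerf s z * z $ i) z = kerf s z + beta' q * (2 * (z $ i) / s\<^sup>2) / s^3 * z $ i" for i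
    unfolding dderiv_eqI[OF D] by (simp add: inner_axis)
  have n: "(\<Sum>i\<in>UNIV. z $ i * z $ i) = s\<^sup>2 * q"
    using s by (simp add: q_def power2_norm_eq_inner inner_vec_def)
  have "(\<Sum>i\<in>UNIV. dderiv (axis i 1) (\<lambda>z. kerf s z * z $ i) z)
      = 3 * kerf s z + beta' q * 2 / s\<^sup>2 / s^3 * (\<Sum>i\<in>UNIV. z $ i * z $ i)"
    unfolding d by (simp add: sum.distrib sum_distrib_left sum_divide_distrib algebra_simps)
  also have "\<dots> = (3 * beta q + 2 * q * beta' q) / s^3"
    using s unfolding n kerf_def q_def[symmetric] by (simp add: field_simps)
  also have "\<dots> = eta s z" by (simp only: radial_eta_eq) (simp add: eta_def q_def)
  finally show ?thesis .
qed

lemma dderiv_shift: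
  assumes "f differentiable (at (y - x))"
  shows "dderiv h (\<lambda>y. f (y - x)) y = dderiv h f (y - x)"
proof -
  have sh: "((\<lambda>y. y - x) has_derivative (\<lambda>h. h)) (at y)" by (auto intro!: derivative_eq_intros)
  show ?thesis by (rule dderiv_eqI) (rule has_derivative_compose[OF sh has_derivative_dderiv[OF assms]])
qed

lemma dderiv_diff:
  assumes "smooth f" "smooth g" shows "dderiv h (\<lambda>y. f y - g y) y = dderiv h f y - dderiv h g y"
  by (rule dderiv_eqI) (intro has_derivative_diff smooth_has_derivative assms)

lemma smooth_kerf_nth: "smooth (\<lambda>z. kerf s z * z $ i)"
  by (intro smooth_mult smooth_kerf smooth_linear bounded_linear_vec_nth)

lemma laplace_newton_test:
  assumes "0 < e" "0 < s"
  shows "(\<Sum>i\<in>UNIV. dderiv (axis i 1) (dderiv (axis i 1) (newton_test e s x)) y) = eta e (y - x) - eta s (y - x)"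
proof -
  have "dderiv (axis i 1) (newton_test e s x) = (\<lambda>y. kerf e (y - x) * (y - x) $ i - kerf s (y - x) * (y - x) $ i)" for i
    by (auto simp: dderiv_newton_test[OF assms] newton_flux_def inner_axis algebra_simps)
  moreover have "dderiv (axis i 1) (\<lambda>y. kerf e (y - x) * (y - x) $ i - kerf s (y - x) * (y - x) $ i) y
     = dderiv (axis i 1) (\<lambda>z. kerf e z * z $ i) (y - x) - dderiv (axis i 1) (\<lambda>z. kerf s z * z $ i) (y - x)" for i
    unfolding dderiv_diff[OF smooth_shift[OF smooth_kerf_nth[of e i], of x] smooth_shift[OF smooth_kerf_nth[of s i], of x]]
    by (simp only: dderiv_shift[where f="\<lambda>z. kerf e z * z $ i", OF differentiableI[OF smooth_has_derivative[OF smooth_kerf_nth]]]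
        dderiv_shift[where f="\<lambda>z. kerf s z * z $ i", OF differentiableI[OF smooth_has_derivative[OF smooth_kerf_nth]]])
  ultimately show ?thesis
    by (simp add: sum_subtractf sum_kerf_dderiv assms)
qed

section \<open>Bounds for the mollifiers\<close>

lemma eta_nonneg: "0 < s \<Longrightarrow> 0 \<le> eta s x"
  by (simp add: eta_def radial_eta_nonneg)

lemma eta_eq_0: assumes "0 < s" "s \<le> norm x" shows "eta s x = 0"
proof -
  have "1 \<le> (norm x)\<^sup>2 / s\<^sup>2" using assms by (simp add: power_mono)
  then show ?thesis by (simp add: eta_def radial_eta_eq_0)
qed

lemma eta_scale: "0 < s \<Longrightarrow> eta s x = eta 1 (x /\<^sub>R s) / s^3"
  by (simp add: eta_def power_mult_distrib divide_inverse mult.commute power_inverse)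

text \<open>Scaling reduces both bounds to s = 1, where they follow from smoothness and compact
  support.\<close>

lemma ex_eta_bounds:
  "\<exists>B>0. \<forall>s>0. (\<forall>x. eta s x \<le> B / s^3) \<and> (\<forall>x y. \<bar>eta s x - eta s y\<bar> \<le> B * norm (x - y) / s^4)"
proof -
  have z: "eta 1 x = 0" if "x \<notin> cball 0 1" for x using that by (intro eta_eq_0) auto
  obtain B where B: "B \<ge> 0" "\<And>x. \<bar>eta 1 x\<bar> \<le> B"
    using bounded_of_compact_support[OF smooth_continuous_on[OF smooth_eta] compact_cball z] by metis
  obtain L where L: "L \<ge> 0" "\<And>x y. \<bar>eta 1 x - eta 1 y\<bar> \<le> L * norm (x - y)"
    using lipschitz_of_compact_support[OF smooth_eta compact_cball z] by metis
  have "eta s x \<le> (B + L + 1) / s^3" if "s > 0" for s x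
    using B(2)[of "x /\<^sub>R s"] L(1) that by (simp add: eta_scale[OF that] divide_right_mono)
  moreover have "\<bar>eta s x - eta s y\<bar> \<le> (B + L + 1) * norm (x - y) / s^4" if s: "s > 0" for s x y
  proof -
    have "\<bar>eta s x - eta s y\<bar> = \<bar>eta 1 (x /\<^sub>R s) - eta 1 (y /\<^sub>R s)\<bar> / s^3"
      using s by (simp add: eta_scale[OF s] diff_divide_distrib[symmetric])
    also have "\<dots> \<le> (L * norm (x /\<^sub>R s - y /\<^sub>R s)) / s^3"
      using s L(2) by (intro divide_right_mono) auto
    also have "norm (x /\<^sub>R s - y /\<^sub>R s) = norm (x - y) / s"
      using s unfolding scaleR_right_diff_distrib[symmetric] by (simp add: divide_inverse)
    also have "L * (norm (x - y) / s) / s^3 = L * norm (x - y) / s^4"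
      by (simp add: power4_eq_xxxx power3_eq_cube)
    also have "\<dots> \<le> (B + L + 1) * norm (x - y) / s^4"
      using s B(1) by (intro divide_right_mono mult_right_mono) auto
    finally show ?thesis .
  qed
  ultimately show ?thesis using B(1) L(1) by (intro exI[of _ "B + L + 1"]) auto
qed

definition eta_bound :: real where
  "eta_bound = (SOME B. B > 0 \<and> (\<forall>s>0. (\<forall>x. eta s x \<le> B / s^3) \<and> (\<forall>x y. \<bar>eta s x - eta s y\<bar> \<le> B * norm (x - y) / s^4)))"

lemma eta_bound_pos: "eta_bound > 0"
  and eta_le: "0 < s \<Longrightarrow> eta s x \<le> eta_bound / s^3"
  and eta_lipschitz: "0 < s \<Longrightarrow> \<bar>eta s x - eta s y\<bar> \<le> eta_bound * norm (x - y) / s^4"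
  using someI_ex[OF ex_eta_bounds] unfolding eta_bound_def[symmetric] by auto

lemma eta_borel [measurable]: "eta s \<in> borel_measurable borel" by (rule smooth_borel[OF smooth_eta])
lemma kerf_borel [measurable]: "kerf s \<in> borel_measurable borel" by (rule smooth_borel[OF smooth_kerf])

lemma newton_flux_borel [measurable]: "newton_flux e s \<in> borel_measurable borel"
  unfolding newton_flux_def[abs_def] by measurable

subsection \<open>Approximation in \<open>L\<^sup>1\<close>\<close>

lemma AE_lborel_negligible: assumes "negligible N" shows "AE x in lborel. x \<notin> N"
proof -
  have "N \<in> null_sets lebesgue" using assms by (simp add: negligible_iff_null_sets)
  then have "AE x in completion lborel. x \<notin> N" by (rule AE_not_in)
  then show ?thesis by (simp add: AE_completion_iff)
qed

text \<open>Two truncations precede the approximation: \<open>c m\<close> in space and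
  \<open>cl m\<close> in size. The truncated functions tend to \<open>f\<close> under the majorant
  2|f|, and a sequence of continuous functions that converges to \<open>f\<close> almost everywhere
  converges after the same truncation under a bounded majorant supported in a ball. Without the
  truncation nothing would dominate that sequence.\<close>

lemma L1_dense_continuous:
  fixes f :: "'a::euclidean_space \<Rightarrow> real"
  assumes f: "integrable lborel f" and e: "e > 0"
  shows "\<exists>g r. continuous_on UNIV g \<and> (\<forall>x. r < norm x \<longrightarrow> g x = 0) \<and> integrable lborel g
    \<and> (LINT x|lborel. \<bar>f x - g x\<bar>) < e"
proof -
  have [measurable]: "f \<in> borel_measurable borel" using f borel_measurable_integrable by force
  define c where "c m (x::'a) = max 0 (min 1 (real m - norm x))" for m :: nat and x
  define cl where "cl m (y::real) = max (- real m) (min (real m) y)" for m :: nat and y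
  have c01: "0 \<le> c m x" "c m x \<le> 1" for m x by (auto simp: c_def)
  have ccont: "continuous_on UNIV (c m)" for m unfolding c_def by (intro continuous_intros)
  have clcont: "continuous_on UNIV (cl m)" for m unfolding cl_def by (intro continuous_intros)
  have cl_le: "\<bar>cl m y\<bar> \<le> \<bar>y\<bar>" "\<bar>cl m y\<bar> \<le> real m" for m y by (auto simp: cl_def)
  have [measurable]: "c m \<in> borel_measurable borel" "cl m \<in> borel_measurable borel" for m
    using ccont clcont by (auto intro: borel_measurable_continuous_onI)
  define h where "h m x = c m x * cl m (f x)" for m x
  have h_le: "\<bar>h m x\<bar> \<le> \<bar>f x\<bar>" for m x
    unfolding h_def abs_mult using mult_mono[of "\<bar>c m x\<bar>" 1 "\<bar>cl m (f x)\<bar>" "\<bar>f x\<bar>"] c01[of m x] cl_le(1)[of m "f x"] by auto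
  have "(\<lambda>m. LINT x|lborel. \<bar>f x - h m x\<bar>) \<longlonglongrightarrow> (LINT x|lborel. (\<lambda>_::'a. 0::real) x)"
  proof (rule integral_dominated_convergence[where w="\<lambda>x. 2 * \<bar>f x\<bar>"])
    show "AE x in lborel. (\<lambda>m. \<bar>f x - h m x\<bar>) \<longlonglongrightarrow> 0"
    proof (rule AE_I2, rule tendsto_eventually)
      fix x :: 'a
      obtain m0 :: nat where m0: "norm x + 1 \<le> real m0" using real_arch_simple by blast
      obtain m1 :: nat where m1: "\<bar>f x\<bar> \<le> real m1" using real_arch_simple by blast
      have "\<bar>f x - h m x\<bar> = 0" if "m \<ge> max m0 m1" for m
      proof -
        have "norm x + 1 \<le> real m" "\<bar>f x\<bar> \<le> real m" using that m0 m1 by linarith+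
        then show ?thesis by (simp add: h_def c_def cl_def)
      qed
      then show "\<forall>\<^sub>F m in sequentially. \<bar>f x - h m x\<bar> = 0" unfolding eventually_sequentially by blast
    qed
    show "AE x in lborel. norm \<bar>f x - h m x\<bar> \<le> 2 * \<bar>f x\<bar>" for m
      using h_le[of m] by (intro AE_I2) (smt (verit) real_norm_def)
  qed (use f in \<open>auto simp: h_def[abs_def]\<close>)
  then obtain m where m: "(LINT x|lborel. \<bar>f x - h m x\<bar>) < e / 2"
    using e order_tendstoD(2)[of _ 0 sequentially "e/2"] by (auto simp: eventually_sequentially)
  have "f measurable_on UNIV"
    by (rule lebesgue_measurable_imp_measurable_on) (auto intro: measurable_completion)
  then obtain N g where N: "negligible N" and g: "\<And>n. continuous_on UNIV (g n)"
    and lim: "\<And>x. x \<notin> N \<Longrightarrow> (\<lambda>n. g n x) \<longlonglongrightarrow> f x"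
    unfolding measurable_on_def by auto
  have [measurable]: "g n \<in> borel_measurable borel" for n using g by (rule borel_measurable_continuous_onI)
  define G where "G n x = c m x * cl m (g n x)" for n x
  have Gbd: "\<bar>G n x\<bar> \<le> real m * indicator (ball 0 (real m)) x" for n x
    using mult_mono[of "c m x" 1 "\<bar>cl m (g n x)\<bar>" "real m"] c01[of m x] cl_le(2)[of m "g n x"]
    by (auto simp: G_def abs_mult c_def split: split_indicator)
  have hbd: "\<bar>h m x\<bar> \<le> real m * indicator (ball 0 (real m)) x" for x
    using mult_mono[of "c m x" 1 "\<bar>cl m (f x)\<bar>" "real m"] c01[of m x] cl_le(2)[of m "f x"]
    by (auto simp: h_def abs_mult c_def split: split_indicator)
  have ball_int: "integrable lborel (\<lambda>x::'a. real m * indicator (ball 0 (real m)) x)"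
    by (intro integrable_mult_right integrable_real_indicator) (auto simp: emeasure_lborel_ball_finite[unfolded infinity_ennreal_def])
  have "(\<lambda>n. LINT x|lborel. \<bar>h m x - G n x\<bar>) \<longlonglongrightarrow> (LINT x|lborel. (\<lambda>_::'a. 0::real) x)"
  proof (rule integral_dominated_convergence[where w="\<lambda>x. 2 * (real m * indicator (ball 0 (real m)) x)"])
    show "AE x in lborel. (\<lambda>n. \<bar>h m x - G n x\<bar>) \<longlonglongrightarrow> 0"
    proof (rule AE_mp[OF AE_lborel_negligible[OF N]], rule AE_I2, rule impI)
      fix x assume "x \<notin> N"
      have "(\<lambda>n. \<bar>h m x - G n x\<bar>) \<longlonglongrightarrow> \<bar>h m x - c m x * cl m (f x)\<bar>"
        unfolding G_def
        by (intro tendsto_intros continuous_on_tendsto_compose[OF clcont lim[OF \<open>x \<notin> N\<close>]]) auto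
      then show "(\<lambda>n. \<bar>h m x - G n x\<bar>) \<longlonglongrightarrow> 0" by (simp add: h_def)
    qed
    show "AE x in lborel. norm \<bar>h m x - G n x\<bar> \<le> 2 * (real m * indicator (ball 0 (real m)) x)" for n
      using hbd Gbd[of n] by (intro AE_I2) (smt (verit) real_norm_def)
  qed (use ball_int in \<open>auto simp: h_def[abs_def] G_def[abs_def]\<close>)
  then obtain n where n: "(LINT x|lborel. \<bar>h m x - G n x\<bar>) < e / 2"
    using e order_tendstoD(2)[of _ 0 sequentially "e/2"] by (auto simp: eventually_sequentially)
  have Gi: "integrable lborel (G n)"
    by (rule Bochner_Integration.integrable_bound[OF ball_int]) (use Gbd in \<open>auto simp: G_def[abs_def]\<close>)
  have hi: "integrable lborel (h m)"
    by (rule Bochner_Integration.integrable_bound[OF f]) (use h_le in \<open>auto simp: h_def[abs_def]\<close>)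
  have "(LINT x|lborel. \<bar>f x - G n x\<bar>) \<le> (LINT x|lborel. \<bar>f x - h m x\<bar> + \<bar>h m x - G n x\<bar>)"
    by (rule integral_mono) (use f Gi hi in auto)
  also have "\<dots> < e" using m n f Gi hi by (subst Bochner_Integration.integral_add) auto
  finally have "(LINT x|lborel. \<bar>f x - G n x\<bar>) < e" .
  moreover have "continuous_on UNIV (G n)" unfolding G_def
    by (intro continuous_intros ccont continuous_on_compose2[OF clcont g]) auto
  moreover have "\<forall>x. real m < norm x \<longrightarrow> G n x = 0" by (auto simp: G_def c_def)
  ultimately show ?thesis using Gi by blast
qed

lemma nn_integral_lborel_affine:
  fixes c :: real and t :: "'a::euclidean_space"
  assumes "c \<noteq> 0" and [measurable]: "f \<in> borel_measurable borel"
  shows "(\<integral>\<^sup>+x. f x \<partial>lborel) = ennreal (\<bar>c\<bar> ^ DIM('a)) * (\<integral>\<^sup>+x. f (t + c *\<^sub>R x) \<partial>lborel)"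
  by (subst lborel_affine[OF assms(1), of t])
    (simp add: nn_integral_density nn_integral_distr nn_integral_cmult)

lemma nn_integral_lborel_translate:
  fixes t :: "'a::euclidean_space"
  assumes [measurable]: "f \<in> borel_measurable borel"
  shows "(\<integral>\<^sup>+x. f (x + t) \<partial>lborel) = (\<integral>\<^sup>+x. f x \<partial>lborel)"
  using nn_integral_lborel_affine[of 1 f t] by (simp add: add.commute)

text \<open>Reduces to a continuous function of compact support, which is uniformly continuous.
  Shifts are kept shorter than 1 so that all points involved lie in one compact ball.\<close>

lemma L1_translation:
  fixes f :: "'a::euclidean_space \<Rightarrow> real"
  assumes f: "integrable lborel f" and e: "e > 0"
  shows "\<exists>d>0. \<forall>h. norm h < d \<longrightarrow> (\<integral>\<^sup>+x. ennreal \<bar>f (x + h) - f x\<bar> \<partial>lborel) \<le> ennreal e"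
proof -
  have [measurable]: "f \<in> borel_measurable borel" using f borel_measurable_integrable by force
  obtain g r where g: "continuous_on UNIV g" "\<And>x. r < norm x \<Longrightarrow> g x = 0" "integrable lborel g"
    and fg: "(LINT x|lborel. \<bar>f x - g x\<bar>) < e / 3"
    using L1_dense_continuous[OF f, of "e/3"] e by auto
  have [measurable]: "g \<in> borel_measurable borel" using g(1) by (rule borel_measurable_continuous_onI)
  have fg': "(\<integral>\<^sup>+x. ennreal \<bar>f x - g x\<bar> \<partial>lborel) \<le> ennreal (e/3)"
    by (subst nn_integral_eq_integral) (use f g(3) fg in \<open>auto intro: ennreal_leI\<close>)
  define r' where "r' = max r 0 + 1"
  define M where "M = measure lborel (cball (0::'a) r') + 1"
  have M: "M > 0" by (simp add: M_def measure_nonneg add_nonneg_pos)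
  have "uniformly_continuous_on (cball 0 (r' + 1)) g"
    by (rule compact_uniformly_continuous) (auto intro: continuous_on_subset[OF g(1)])
  then obtain d where d: "d > 0" and du: "\<And>x y. x \<in> cball 0 (r'+1) \<Longrightarrow> y \<in> cball 0 (r'+1) \<Longrightarrow> dist y x < d \<Longrightarrow> dist (g y) (g x) < e / (3 * M)"
    unfolding uniformly_continuous_on_def using e M by (metis divide_pos_pos mult_pos_pos zero_less_numeral)
  have "(\<integral>\<^sup>+x. ennreal \<bar>f (x + h) - f x\<bar> \<partial>lborel) \<le> ennreal e" if h: "norm h < min d 1" for h
  proof -
    have gh: "ennreal \<bar>g (x + h) - g x\<bar> \<le> ennreal (e / (3 * M)) * indicator (cball 0 r') x" for x
    proof (cases "x \<in> cball 0 r'")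
      case True
      have "norm (x + h) \<le> r' + 1" using norm_triangle_ineq[of x h] True h by simp
      then have "dist (g (x + h)) (g x) < e / (3 * M)" using True h norm_minus_cancel[of "x + h"] by (intro du) (auto simp: dist_norm)
      then show ?thesis using True by (auto simp: dist_real_def intro!: ennreal_leI)
    next
      case False
      then have "r' < norm x" by simp
      moreover have "norm x \<le> norm (x + h) + norm h" using norm_triangle_ineq[of "x + h" "- h"] by simp
      ultimately have "r < norm x" "r < norm (x + h)" using h by (auto simp: r'_def)
      then show ?thesis using g(2) by simp
    qed
    have "(\<integral>\<^sup>+x. ennreal \<bar>g (x + h) - g x\<bar> \<partial>lborel) \<le> (\<integral>\<^sup>+x. ennreal (e / (3 * M)) * indicator (cball 0 r') x \<partial>(lborel :: 'a measure))"
      by (intro nn_integral_mono gh)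
    also have "\<dots> = ennreal (e / (3 * M)) * ennreal (measure lborel (cball (0::'a) r'))"
      by (subst nn_integral_cmult_indicator) (auto simp: emeasure_eq_ennreal_measure emeasure_lborel_cball_finite[unfolded infinity_ennreal_def] less_top)
    also have "\<dots> = ennreal (e / (3 * M) * measure lborel (cball (0::'a) r'))"
      using e M by (intro ennreal_mult[symmetric]) auto
    also have "\<dots> \<le> ennreal (e / (3 * M) * M)"
      using e M by (intro ennreal_leI mult_left_mono) (auto simp: M_def)
    also have "\<dots> = ennreal (e/3)" using M by simp
    finally have gi: "(\<integral>\<^sup>+x. ennreal \<bar>g (x + h) - g x\<bar> \<partial>lborel) \<le> ennreal (e/3)" .
    have "(\<integral>\<^sup>+x. ennreal \<bar>f (x + h) - f x\<bar> \<partial>lborel)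
        \<le> (\<integral>\<^sup>+x. (ennreal \<bar>f (x + h) - g (x + h)\<bar> + ennreal \<bar>g (x + h) - g x\<bar>) + ennreal \<bar>f x - g x\<bar> \<partial>lborel)"
      by (intro nn_integral_mono) (auto simp: ennreal_plus[symmetric] simp del: ennreal_plus intro!: ennreal_leI)
    also have "\<dots> = (\<integral>\<^sup>+x. ennreal \<bar>f (x + h) - g (x + h)\<bar> \<partial>lborel) + (\<integral>\<^sup>+x. ennreal \<bar>g (x + h) - g x\<bar> \<partial>lborel)
        + (\<integral>\<^sup>+x. ennreal \<bar>f x - g x\<bar> \<partial>lborel)"
      by (simp add: nn_integral_add)
    also have "\<dots> \<le> ennreal (e/3) + ennreal (e/3) + ennreal (e/3)"
      using nn_integral_lborel_translate[of "\<lambda>x. ennreal \<bar>f x - g x\<bar>" h] fg' gi by (intro add_mono) auto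
    also have "\<dots> = ennreal e" using e by (simp add: ennreal_plus[symmetric] del: ennreal_plus)
    finally show ?thesis .
  qed
  then show ?thesis using d by (intro exI[of _ "min d 1"]) auto
qed

text \<open>If the integral diverges, it is 0 by convention and the bound is trivial.\<close>

lemma ennreal_abs_integral_le: "ennreal \<bar>integral\<^sup>L M f\<bar> \<le> (\<integral>\<^sup>+x. ennreal \<bar>f x\<bar> \<partial>M)" for f :: "_ \<Rightarrow> real"
proof (cases "integrable M f")
  case True
  then show ?thesis using integral_norm_bound_ennreal[OF True] by simp
qed (simp add: not_integrable_integral_eq)

text \<open>The mollifiers \<open>eta s\<close> are not normalised. Their common mass is the flux of
  x/|x|^3 through the unit sphere, 4 pi, and it appears as a factor wherever a normalised mollifier
  would give 1.\<close>

definition eta_mass :: real where "eta_mass = (LINT x|lborel. eta 1 x)"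

lemma integrable_bounded_ball:
  fixes f :: "'a::euclidean_space \<Rightarrow> real"
  assumes [measurable]: "f \<in> borel_measurable borel" and "\<And>x. \<bar>f x\<bar> \<le> B" "\<And>x. r < norm x \<Longrightarrow> f x = 0"
  shows "integrable lborel f"
proof (rule Bochner_Integration.integrable_bound)
  show "integrable lborel (\<lambda>x::'a. B * indicator (cball 0 r) x)"
    by (intro integrable_mult_right integrable_real_indicator) (auto simp: emeasure_lborel_cball_finite[unfolded infinity_ennreal_def])
  show "AE x in lborel. norm (f x) \<le> norm (B * indicator (cball 0 r) x)"
  proof (rule AE_I2)
    fix x :: 'a
    show "norm (f x) \<le> norm (B * indicator (cball 0 r) x)"
      using assms(2)[of x] assms(3)[of x] by (cases "r < norm x") auto
  qed
qed simp

lemma integrable_eta: assumes "0 < s" shows "integrable lborel (eta s)"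
  by (rule integrable_bounded_ball[where r=s and B="eta_bound / s^3"])
    (use assms eta_le eta_nonneg eta_eq_0 in auto)

lemma nn_integral_eta: assumes "0 < s" shows "(\<integral>\<^sup>+x. ennreal (eta s x) \<partial>lborel) = ennreal eta_mass"
proof -
  have "(\<integral>\<^sup>+x. ennreal (eta s x) \<partial>lborel) = ennreal (s^3) * (\<integral>\<^sup>+x. ennreal (eta s (s *\<^sub>R x)) \<partial>lborel)"
    using nn_integral_lborel_affine[of s "\<lambda>x. ennreal (eta s x)" 0] assms by simp
  also have "\<dots> = (\<integral>\<^sup>+x. ennreal (s^3) * ennreal (eta s (s *\<^sub>R x)) \<partial>lborel)"
    by (rule nn_integral_cmult[symmetric]) simp
  also have "\<dots> = (\<integral>\<^sup>+x. ennreal (eta 1 x) \<partial>lborel)"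
    using assms by (intro nn_integral_cong) (simp add: ennreal_mult[symmetric] eta_nonneg eta_scale[of s])
  also have "\<dots> = ennreal eta_mass"
    unfolding eta_mass_def by (rule nn_integral_eq_integral[OF integrable_eta]) (auto simp: eta_nonneg)
  finally show ?thesis .
qed

text \<open>If the mass were 0, \<open>eta 1\<close> would vanish almost everywhere, but it is
  positive on the open annulus between the radii 1/2 and 1.\<close>

lemma eta_mass_pos: "eta_mass > 0"
proof -
  have "0 \<le> eta_mass" unfolding eta_mass_def by (rule Bochner_Integration.integral_nonneg) (simp add: eta_nonneg)
  moreover have "eta_mass \<noteq> 0"
  proof
    assume "eta_mass = 0"
    then have "AE x in lborel. eta 1 x = 0"
      unfolding eta_mass_def by (subst (asm) integral_nonneg_eq_0_iff_AE) (auto simp: integrable_eta eta_nonneg)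
    then obtain N where N: "N \<in> null_sets lborel" "{x. eta 1 x \<noteq> 0} \<subseteq> N"
      by (auto simp: eventually_ae_filter)
    have sub: "ball 0 1 - cball 0 (1/2) \<subseteq> N"
    proof
      fix x :: "real^3" assume "x \<in> ball 0 1 - cball 0 (1/2)"
      then have x: "norm x < 1" "1/2 < norm x" by auto
      then have "(norm x)\<^sup>2 < 1\<^sup>2" "(1/2)\<^sup>2 < (norm x)\<^sup>2" by (intro power_strict_mono; simp)+
      then have "bump ((norm x)\<^sup>2) \<noteq> 0" by (simp add: bump_nonzero power2_eq_square)
      then have "eta 1 x \<noteq> 0" using bump_mass_pos x by (auto simp: eta_def radial_eta_def)
      then show "x \<in> N" using N(2) by auto
    qed
    have "negligible N" using N(1) by (simp add: negligible_iff_null_sets null_sets_completionI)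
    then have "negligible (ball 0 1 - cball 0 (1/2) :: (real^3) set)" using sub negligible_subset by blast
    moreover have "open (ball 0 1 - cball 0 (1/2) :: (real^3) set)" by (intro open_Diff) auto
    moreover have "(3/4) *\<^sub>R axis 1 1 \<in> (ball 0 1 - cball 0 (1/2) :: (real^3) set)" by (auto simp: norm_axis_1)
    ultimately have False using open_not_negligible by blast
    then show False .
  qed
  ultimately show ?thesis by simp
qed

definition mollify :: "real \<Rightarrow> (real^3 \<Rightarrow> real) \<Rightarrow> real^3 \<Rightarrow> real" where
  "mollify s f x = (LINT y|lborel. f y * eta s (y - x))"

lemma integrable_mult_bounded:
  fixes f g :: "'a::euclidean_space \<Rightarrow> real"
  assumes f: "integrable lborel f" and [measurable]: "g \<in> borel_measurable borel" and "\<And>x. \<bar>g x\<bar> \<le> B"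
  shows "integrable lborel (\<lambda>x. f x * g x)"
proof (rule Bochner_Integration.integrable_bound)
  show "integrable lborel (\<lambda>x. B * f x)" using f by simp
  have [measurable]: "f \<in> borel_measurable borel" using f borel_measurable_integrable by force
  show "(\<lambda>x. f x * g x) \<in> borel_measurable lborel" by simp
  show "AE x in lborel. norm (f x * g x) \<le> norm (B * f x)"
  proof (rule AE_I2)
    fix x :: 'a
    have "\<bar>g x\<bar> \<le> \<bar>B\<bar>" using assms(3)[of x] by linarith
    then show "norm (f x * g x) \<le> norm (B * f x)"
      using mult_left_mono[of "\<bar>g x\<bar>" "\<bar>B\<bar>" "\<bar>f x\<bar>"] by (simp add: abs_mult mult.commute)
  qed
qed

lemma abs_eta_le: "0 < s \<Longrightarrow> \<bar>eta s x\<bar> \<le> eta_bound / s^3"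
  using eta_le eta_nonneg by (simp add: abs_of_nonneg)

lemma integrable_mult_eta:
  assumes "integrable lborel f" "0 < s" shows "integrable lborel (\<lambda>y. f y * eta s (y - x))"
  by (rule integrable_mult_bounded[OF assms(1) _ abs_eta_le[OF assms(2)]]) simp

lemma integral_eta_shift: "0 < s \<Longrightarrow> (LINT y|lborel. eta s (y - x)) = eta_mass"
  using nn_integral_eta[of s] nn_integral_lborel_translate[of "\<lambda>y. ennreal (eta s y)" "- x"] eta_mass_pos
  by (subst integral_eq_nn_integral) (auto simp: eta_nonneg)

lemma integrable_eta_shift: "0 < s \<Longrightarrow> integrable lborel (\<lambda>y. eta s (y - x))"
  by (rule integrable_bounded_ball[where r="s + norm x" and B="eta_bound / s^3"])
    (auto simp: abs_eta_le intro!: eta_eq_0 intro: order_trans[OF _ norm_triangle_ineq2])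

lemma mollify_borel [measurable]:
  assumes [measurable]: "f \<in> borel_measurable borel" shows "mollify s f \<in> borel_measurable borel"
  unfolding mollify_def[abs_def] by measurable

text \<open>\<open>mollify s f x - eta_mass * f x\<close> is a weighted integral of the differences
  f(x + h) - f(x) with |h| < s, and translation is continuous in L^1.\<close>

lemma mollify_L1:
  assumes f: "integrable lborel f" and e: "e > 0"
  shows "\<exists>d>0. \<forall>s. 0 < s \<and> s < d \<longrightarrow> (\<integral>\<^sup>+x. ennreal \<bar>mollify s f x - eta_mass * f x\<bar> \<partial>lborel) \<le> ennreal e"
proof -
  have [measurable]: "f \<in> borel_measurable borel" using f borel_measurable_integrable by force
  obtain d where d: "d > 0" and dh: "\<And>h. norm h < d \<Longrightarrow> (\<integral>\<^sup>+x. ennreal \<bar>f (x + h) - f x\<bar> \<partial>lborel) \<le> ennreal (e / eta_mass)"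
    using L1_translation[OF f, of "e / eta_mass"] e eta_mass_pos by auto
  have "(\<integral>\<^sup>+x. ennreal \<bar>mollify s f x - eta_mass * f x\<bar> \<partial>lborel) \<le> ennreal e" if s: "0 < s" "s < d" for s
  proof -
    have pt: "ennreal \<bar>mollify s f x - eta_mass * f x\<bar> \<le> (\<integral>\<^sup>+h. ennreal (eta s h) * ennreal \<bar>f (x + h) - f x\<bar> \<partial>lborel)" for x
    proof -
      have "mollify s f x - eta_mass * f x = (LINT y|lborel. f y * eta s (y - x) - f x * eta s (y - x))"
        using s by (subst Bochner_Integration.integral_diff)
          (simp_all add: mollify_def integral_eta_shift integrable_mult_eta[OF f] integrable_eta_shift)
      then have "ennreal \<bar>mollify s f x - eta_mass * f x\<bar> \<le> (\<integral>\<^sup>+y. ennreal \<bar>f y * eta s (y - x) - f x * eta s (y - x)\<bar> \<partial>lborel)"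
        by (simp only: ennreal_abs_integral_le)
      also have "\<dots> = (\<integral>\<^sup>+y. ennreal (eta s (y - x)) * ennreal \<bar>f y - f x\<bar> \<partial>lborel)"
        using s by (intro nn_integral_cong)
          (simp add: ennreal_mult[symmetric] eta_nonneg left_diff_distrib[symmetric] abs_mult mult.commute)
      also have "\<dots> = (\<integral>\<^sup>+h. ennreal (eta s h) * ennreal \<bar>f (x + h) - f x\<bar> \<partial>lborel)"
        using nn_integral_lborel_translate[of "\<lambda>y. ennreal (eta s (y - x)) * ennreal \<bar>f y - f x\<bar>" x]
        by (simp add: add.commute)
      finally show ?thesis .
    qed
    have "(\<integral>\<^sup>+x. ennreal \<bar>mollify s f x - eta_mass * f x\<bar> \<partial>lborel)
        \<le> (\<integral>\<^sup>+x. \<integral>\<^sup>+h. ennreal (eta s h) * ennreal \<bar>f (x + h) - f x\<bar> \<partial>lborel \<partial>lborel)"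
      by (intro nn_integral_mono pt)
    also have "\<dots> = (\<integral>\<^sup>+h. \<integral>\<^sup>+x. ennreal (eta s h) * ennreal \<bar>f (x + h) - f x\<bar> \<partial>lborel \<partial>lborel)"
      by (rule lborel_pair.Fubini') simp
    also have "\<dots> = (\<integral>\<^sup>+h. ennreal (eta s h) * (\<integral>\<^sup>+x. ennreal \<bar>f (x + h) - f x\<bar> \<partial>lborel) \<partial>lborel)"
      by (simp add: nn_integral_cmult)
    also have "\<dots> \<le> (\<integral>\<^sup>+h. ennreal (eta s h) * ennreal (e / eta_mass) \<partial>lborel)"
    proof (intro nn_integral_mono)
      fix h :: "real^3"
      show "ennreal (eta s h) * (\<integral>\<^sup>+x. ennreal \<bar>f (x + h) - f x\<bar> \<partial>lborel) \<le> ennreal (eta s h) * ennreal (e / eta_mass)"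
        using dh[of h] s eta_eq_0[of s h] by (cases "norm h < s") (auto intro!: mult_left_mono)
    qed
    also have "\<dots> = ennreal eta_mass * ennreal (e / eta_mass)"
      by (simp add: nn_integral_multc nn_integral_eta s)
    also have "\<dots> = ennreal e"
      using eta_mass_pos e by (simp add: ennreal_mult[symmetric])
    finally show ?thesis .
  qed
  then show ?thesis using d by blast
qed

lemma mollify_AE_subseq:
  assumes f: "integrable lborel f" and s: "\<And>n. 0 < s n" "s \<longlonglongrightarrow> 0"
  obtains r :: "nat \<Rightarrow> nat" where "strict_mono r" "AE x in lborel. (\<lambda>n. mollify (s (r n)) f x) \<longlonglongrightarrow> eta_mass * f x"
proof -
  have [measurable]: "f \<in> borel_measurable borel" using f borel_measurable_integrable by force
  obtain d where d: "d > 0" "\<And>s. 0 < s \<Longrightarrow> s < d \<Longrightarrow> (\<integral>\<^sup>+x. ennreal \<bar>mollify s f x - eta_mass * f x\<bar> \<partial>lborel) \<le> ennreal 1"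
    using mollify_L1[OF f, of 1] by auto
  have "\<forall>\<^sub>F n in sequentially. s n < d" using order_tendstoD(2)[OF s(2) d(1)] .
  then obtain n0 where n0: "\<And>n. n \<ge> n0 \<Longrightarrow> s n < d" unfolding eventually_sequentially by blast
  \<comment> \<open>The shift by \<open>n0\<close> makes every \<open>u n\<close> integrable, not
    only the late ones.\<close>
  define u where "u n x = mollify (s (n + n0)) f x - eta_mass * f x" for n x
  have ui: "integrable lborel (u n)" for n
    unfolding u_def using d(2)[OF s(1) n0, of "n + n0"]
    by (intro integrableI_bounded) (auto intro: le_less_trans)
  have "(\<lambda>n. LINT x|lborel. norm (u n x)) \<longlonglongrightarrow> 0"
  proof (rule tendsto_sandwich[OF _ _ tendsto_const])
    show "(\<lambda>n. LINT x|lborel. norm (u n x)) \<longlonglongrightarrow> 0"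
    proof (rule LIMSEQ_I)
      fix e :: real assume e: "0 < e"
      obtain d' where d': "d' > 0" "\<And>s. 0 < s \<Longrightarrow> s < d' \<Longrightarrow> (\<integral>\<^sup>+x. ennreal \<bar>mollify s f x - eta_mass * f x\<bar> \<partial>lborel) \<le> ennreal (e/2)"
        using mollify_L1[OF f, of "e/2"] e by auto
      obtain n1 where n1: "\<And>n. n \<ge> n1 \<Longrightarrow> s n < d'"
        using order_tendstoD(2)[OF s(2) d'(1)] unfolding eventually_sequentially by blast
      have "norm ((LINT x|lborel. norm (u n x)) - 0) < e" if "n \<ge> n1" for n
      proof -
        have "ennreal (LINT x|lborel. norm (u n x)) = (\<integral>\<^sup>+x. ennreal (norm (u n x)) \<partial>lborel)"
          by (rule nn_integral_eq_integral[symmetric]) (use ui in auto)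
        also have "\<dots> \<le> ennreal (e/2)" using d'(2)[OF s(1) n1, of "n + n0"] that by (simp add: u_def)
        finally have "(LINT x|lborel. norm (u n x)) \<le> e/2" using e by (simp add: ennreal_le_iff)
        then show ?thesis using e by simp
      qed
      then show "\<exists>no. \<forall>n\<ge>no. norm ((LINT x|lborel. norm (u n x)) - 0) < e" by blast
    qed
  qed auto
  then obtain r where r: "strict_mono r" "AE x in lborel. (\<lambda>n. u (r n) x) \<longlonglongrightarrow> 0"
    using tendsto_L1_AE_subseq[of lborel u] ui by blast
  show ?thesis
  proof (rule that[of "\<lambda>n. r n + n0"])
    show "strict_mono (\<lambda>n. r n + n0)" using r(1) by (simp add: strict_mono_def)
    show "AE x in lborel. (\<lambda>n. mollify (s (r n + n0)) f x) \<longlonglongrightarrow> eta_mass * f x"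
      using r(2) unfolding u_def by eventually_elim (simp add: LIM_zero_iff)
  qed
qed

text \<open>Turns bounds on differences of mollifications, uniform in the smaller scale, into a
  bound on \<open>f\<close> itself at almost every point. Countably many scales suffice,
  \<open>s / (real n + 2)\<close>, all of them below \<open>s\<close>.\<close>

lemma mollify_limit_bound:
  assumes f: "integrable lborel f" and s: "0 < s"
    and bd: "AE x in lborel. x \<in> U \<longrightarrow> (\<forall>n. ennreal \<bar>mollify (s / (real n + 2)) f x - mollify s f x\<bar> \<le> M x)"
  shows "AE x in lborel. x \<in> U \<longrightarrow> ennreal \<bar>eta_mass * f x - mollify s f x\<bar> \<le> M x"
proof -
  have "(\<lambda>n. s / (real n + 2)) \<longlonglongrightarrow> 0"
    using LIMSEQ_ignore_initial_segment[OF lim_const_over_n[of s], of 2] by (simp add: add.commute)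
  then obtain r :: "nat \<Rightarrow> nat" where r: "strict_mono r"
    "AE x in lborel. (\<lambda>n. mollify (s / (real (r n) + 2)) f x) \<longlonglongrightarrow> eta_mass * f x"
    using mollify_AE_subseq[OF f, of "\<lambda>n. s / (real n + 2)"] s by auto
  from r(2) bd show ?thesis
  proof eventually_elim
    case (elim x)
    show ?case
    proof
      assume "x \<in> U"
      then have b: "ennreal \<bar>mollify (s / (real (r n) + 2)) f x - mollify s f x\<bar> \<le> M x" for n using elim by blast
      have "(\<lambda>n. ennreal \<bar>mollify (s / (real (r n) + 2)) f x - mollify s f x\<bar>) \<longlonglongrightarrow> ennreal \<bar>eta_mass * f x - mollify s f x\<bar>"
        by (intro tendsto_ennrealI tendsto_intros elim)
      then show "ennreal \<bar>eta_mass * f x - mollify s f x\<bar> \<le> M x"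
        by (rule LIMSEQ_le_const2) (use b in blast)
    qed
  qed
qed

subsection \<open>The fundamental lemma of the calculus of variations\<close>

text \<open>By the Lebesgue differentiation theorem the averages over [x, x + h] tend to F(x) at
  almost every x, and for small h they are 0.\<close>

lemma AE_zero_of_interval_integrals:
  fixes F :: "real \<Rightarrow> real"
  assumes F: "integrable lborel F" and z: "\<And>a b. l < a \<Longrightarrow> a < b \<Longrightarrow> b < u \<Longrightarrow> (LINT t|lborel. F t * indicator {a..b} t) = 0"
  shows "AE t in lborel. l < t \<and> t < u \<longrightarrow> F t = 0"
proof -
  have si: "set_integrable lborel (cbox a b) F" for a b :: real
    unfolding set_integrable_def using integrable_mult_indicator[of "cbox a b" lborel F] F by simp
  have io: "F integrable_on cbox a b" for a b using set_borel_integral_eq_integral(1)[OF si] by blast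
  obtain N where N: "negligible N" and Ne: "\<And>x e. x \<notin> N \<Longrightarrow> 0 < e \<Longrightarrow>
      \<exists>d>0. \<forall>h. 0 < h \<and> h < d \<longrightarrow> norm (integral (cbox x (x + h *\<^sub>R One)) F /\<^sub>R h ^ DIM(real) - F x) < e"
    using integrable_ccontinuous_explicit[OF io] by blast
  have "F x = 0" if x: "x \<notin> N" "l < x" "x < u" for x
  proof (rule ccontr)
    assume "F x \<noteq> 0"
    then obtain d where d: "d > 0" "\<And>h. 0 < h \<Longrightarrow> h < d \<Longrightarrow> norm (integral (cbox x (x + h *\<^sub>R One)) F /\<^sub>R h ^ DIM(real) - F x) < \<bar>F x\<bar>"
      using Ne[OF x(1), of "\<bar>F x\<bar>"] by auto
    define h where "h = min d (u - x) / 2"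
    have h: "0 < h" "h < d" "x + h < u" using d x by (auto simp: h_def min_def field_simps)
    have "integral (cbox x (x + h)) F = (LINT t|lborel. indicator (cbox x (x + h)) t *\<^sub>R F t)"
      using set_borel_integral_eq_integral(2)[OF si] by (simp add: set_lebesgue_integral_def)
    also have "\<dots> = 0" using z[of x "x + h"] x h by (simp add: mult.commute cbox_interval)
    finally show False using d(2)[OF h(1,2)] by simp
  qed
  then show ?thesis using AE_lborel_negligible[OF N] by (auto elim: eventually_mono)
qed

lemma AE_zero_of_test_functions:
  fixes F :: "real \<Rightarrow> real"
  assumes F: "integrable lborel F" and z: "\<And>\<zeta>. \<zeta> \<in> test_functions {l<..<u} \<Longrightarrow> (LINT t|lborel. F t * \<zeta> t) = 0"
  shows "AE t in lborel. l < t \<and> t < u \<longrightarrow> F t = 0"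
proof (rule AE_zero_of_interval_integrals[OF F])
  fix a b assume ab: "l < a" "a < b" "b < u"
  have [measurable]: "F \<in> borel_measurable borel" using F borel_measurable_integrable by force
  \<comment> \<open>chi(n(t - a)) chi(n(b - t)) is supported in [a, b] and equals 1 at distance at
    least 1/n from both ends, so it tends to the indicator of the open interval while staying in
    [0, 1].\<close>
  define \<zeta> where "\<zeta> n t = chi (real n * t + (- real n * a)) * chi ((- real n) * t + real n * b)" for n t
  have sm: "smooth (\<zeta> n)" for n
    unfolding \<zeta>_def by (intro smooth_mult smooth_add smooth_const smooth_ident smooth_compose_real[OF smooth_chi])
  have z0: "\<zeta> n t = 0" if "t \<notin> {a..b}" for n t
  proof -
    have "real n * (t - a) \<le> 0 \<or> real n * (b - t) \<le> 0" using that by (auto simp: mult_nonneg_nonpos)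
    then show ?thesis by (auto simp: \<zeta>_def chi_eq_0 algebra_simps)
  qed
  have le1: "\<bar>\<zeta> n t\<bar> \<le> 1" for n t
    unfolding \<zeta>_def abs_mult by (intro mult_le_one) (auto simp: chi_nonneg chi_le_1)
  have t0: "(LINT t|lborel. F t * \<zeta> n t) = 0" for n
    by (rule z[OF smooth_test_functionsI[OF sm compact_Icc]]) (use ab z0 in auto)
  have [measurable]: "\<zeta> n \<in> borel_measurable borel" for n by (rule smooth_borel[OF sm])
  have "(\<lambda>n. LINT t|lborel. F t * \<zeta> n t) \<longlonglongrightarrow> (LINT t|lborel. F t * indicator {a<..<b} t)"
  proof (rule integral_dominated_convergence[where w="\<lambda>t. \<bar>F t\<bar>"])
    show "AE t in lborel. (\<lambda>n. F t * \<zeta> n t) \<longlonglongrightarrow> F t * indicator {a<..<b} t"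
    proof (intro AE_I2 tendsto_mult tendsto_const)
      fix t :: real
      show "(\<lambda>n. \<zeta> n t) \<longlonglongrightarrow> indicator {a<..<b} t"
      proof (rule tendsto_eventually)
        show "\<forall>\<^sub>F n in sequentially. \<zeta> n t = indicator {a<..<b} t"
        proof (cases "t \<in> {a<..<b}")
          case True
          obtain n1 :: nat where n1: "1 / (t - a) \<le> real n1" using real_arch_simple by blast
          obtain n2 :: nat where n2: "1 / (b - t) \<le> real n2" using real_arch_simple by blast
          have "\<zeta> n t = 1" if "n \<ge> max n1 n2" for n
          proof -
            have "1 / (t - a) \<le> real n" "1 / (b - t) \<le> real n" using that n1 n2 by linarith+
            then have "1 \<le> real n * (t - a)" "1 \<le> real n * (b - t)" using True by (auto simp: field_simps)
            then show ?thesis by (auto simp: \<zeta>_def chi_eq_1 algebra_simps)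
          qed
          then show ?thesis using True unfolding eventually_sequentially by (intro exI[of _ "max n1 n2"]) auto
        next
          case False
          have "\<zeta> n t = 0" for n
          proof -
            have "real n * (t - a) \<le> 0 \<or> real n * (b - t) \<le> 0" using False by (auto simp: mult_nonneg_nonpos)
            then show ?thesis by (auto simp: \<zeta>_def chi_eq_0 algebra_simps)
          qed
          then show ?thesis using False by simp
        qed
      qed
    qed
    show "AE t in lborel. norm (F t * \<zeta> n t) \<le> \<bar>F t\<bar>" for n
      using le1[of n] by (intro AE_I2) (auto simp: abs_mult intro!: mult_left_le)
  qed (use F in auto)
  then have "(LINT t|lborel. F t * indicator {a<..<b} t) = 0" by (simp add: t0 LIMSEQ_const_iff)
  also have "(LINT t|lborel. F t * indicator {a<..<b} t) = (LINT t|lborel. F t * indicator {a..b} t)"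
  proof (rule integral_cong_AE)
    have "AE t in lborel. t \<noteq> a" "AE t in lborel. t \<noteq> b" by (auto intro: AE_lborel_singleton)
    then show "AE t in lborel. F t * indicator {a<..<b} t = F t * indicator {a..b} t"
      by eventually_elim (auto split: split_indicator)
  qed auto
  finally show "(LINT t|lborel. F t * indicator {a..b} t) = 0" .
qed

subsection \<open>Riesz kernels\<close>

text \<open>The value at the origin is 0, because \<open>0 powr b = 0\<close> for every
  \<open>b\<close>. Integrals do not see this, but pointwise lower bounds for the kernel have to
  exclude the origin.\<close>

definition riesz :: "real \<Rightarrow> real^3 \<Rightarrow> ennreal" where "riesz a z = ennreal (norm z powr (- a))"

lemma sets_borel_ball [measurable]: "ball (a::'a::metric_space) r \<in> sets borel" by simp

lemma nn_integral_scale: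
  fixes f :: "real^3 \<Rightarrow> ennreal"
  assumes "c > 0" "f \<in> borel_measurable borel"
  shows "(\<integral>\<^sup>+x. f x \<partial>lborel) = ennreal (c ^ 3) * (\<integral>\<^sup>+x. f (c *\<^sub>R x) \<partial>lborel)"
  using nn_integral_lborel_affine[of c f 0] assms by simp

lemma riesz_borel [measurable]: "riesz a \<in> borel_measurable borel"
  unfolding riesz_def[abs_def] by measurable

lemma riesz_mult: "riesz a z * riesz b z = riesz (a + b) z"
  by (simp add: riesz_def ennreal_mult[symmetric] powr_add[symmetric])

lemma riesz_square: "(riesz a z)\<^sup>2 = riesz (2 * a) z"
  by (simp add: power2_eq_square riesz_mult)

lemma riesz_commute: "riesz a (x - y) = riesz a (y - x)"
  by (simp add: riesz_def norm_minus_commute)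

lemma riesz_scale: "c > 0 \<Longrightarrow> riesz a (c *\<^sub>R z) = ennreal (c powr (- a)) * riesz a z"
  by (simp add: riesz_def powr_mult ennreal_mult)

lemma indicator_ball_scale: "c > 0 \<Longrightarrow> indicator (ball 0 (c * r)) (c *\<^sub>R z) = (indicator (ball 0 r) (z::real^3) :: ennreal)"
  by (auto simp: indicator_def)

text \<open>Self-similarity in place of polar coordinates. By scaling, the part of the truncated
  integral over the ball of half the radius is at most 2^{a-3} times the whole, and the rest is
  bounded, so that J \<le> 2^a V + 2^{a-3} J. Truncating the kernel at \<open>m\<close> makes
  \<open>J m\<close> finite, which allows it to be absorbed; the resulting bound does not depend on
  \<open>m\<close>.\<close>

lemma riesz_unit_ball_finite:
  assumes a: "0 \<le> a" "a < 3"
  shows "(\<integral>\<^sup>+z. indicator (ball 0 1) z * riesz a z \<partial>lborel) < top"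
proof -
  define J where "J m = (\<integral>\<^sup>+z. indicator (ball 0 1) z * min (riesz a z) (of_nat m) \<partial>lborel)" for m :: nat
  define V where "V = measure lborel (ball (0::real^3) 1)"
  have V: "emeasure lborel (ball (0::real^3) 1) = ennreal V"
    unfolding V_def by (intro emeasure_eq_ennreal_measure) (simp add: emeasure_lborel_ball_finite[unfolded infinity_ennreal_def] less_top)
  have lam: "2 powr (a - 3) < 1" using a powr_less_mono[of "a - 3" 0 2] by simp
  have J_le: "J m \<le> ennreal (2 powr a * V / (1 - 2 powr (a - 3)))" for m
  proof -
    have "J m \<le> (\<integral>\<^sup>+z. of_nat m * indicator (ball (0::real^3) 1) z \<partial>lborel)"
      unfolding J_def by (intro nn_integral_mono) (auto split: split_indicator)
    also have "\<dots> = of_nat m * ennreal V" by (subst nn_integral_cmult_indicator) (auto simp: V)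
    also have "\<dots> < top" by (simp add: ennreal_mult_less_top of_nat_less_top)
    finally have fin: "J m < top" .
    have "J m \<le> (\<integral>\<^sup>+z. ennreal (2 powr a) * indicator (ball 0 1) z
        + indicator (ball 0 (1/2)) z * min (riesz a z) (of_nat m) \<partial>lborel)"
      unfolding J_def
    proof (intro nn_integral_mono)
      fix z :: "real^3"
      show "indicator (ball 0 1) z * min (riesz a z) (of_nat m)
         \<le> ennreal (2 powr a) * indicator (ball 0 1) z + indicator (ball 0 (1/2)) z * min (riesz a z) (of_nat m)"
      proof (cases "norm z < 1/2")
        case False
        have "norm z powr (-a) \<le> (1/2) powr (-a)" using False a by (intro powr_mono2') auto
        then have "riesz a z \<le> ennreal (2 powr a)" by (auto simp: riesz_def powr_minus_divide powr_divide intro!: ennreal_leI)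
        then show ?thesis by (auto split: split_indicator simp: min.coboundedI1)
      qed (auto split: split_indicator)
    qed
    also have "\<dots> = ennreal (2 powr a) * ennreal V + (\<integral>\<^sup>+z. indicator (ball 0 (1/2)) z * min (riesz a z) (of_nat m) \<partial>lborel)"
      by (subst nn_integral_add) (auto simp: nn_integral_cmult_indicator V)
    also have "(\<integral>\<^sup>+z. indicator (ball 0 (1/2)) z * min (riesz a z) (of_nat m) \<partial>lborel)
       = ennreal ((1/2)^3) * (\<integral>\<^sup>+z. indicator (ball 0 (1/2)) ((1/2) *\<^sub>R z) * min (riesz a ((1/2) *\<^sub>R z)) (of_nat m) \<partial>lborel)"
      by (rule nn_integral_scale[where c="1/2" and f="\<lambda>z. indicator (ball 0 (1/2)) z * min (riesz a z) (of_nat m)"]) (simp, measurable)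
    also have "\<dots> \<le> ennreal ((1/2)^3) * (\<integral>\<^sup>+z. ennreal (2 powr a) * (indicator (ball 0 1) z * min (riesz a z) (of_nat m)) \<partial>lborel)"
    proof (intro mult_left_mono nn_integral_mono)
      fix z :: "real^3"
      have 1: "indicator (ball 0 (1/2)) ((1/2) *\<^sub>R z) = (indicator (ball 0 1) z :: ennreal)"
        by (auto simp: indicator_def)
      have "(1/2::real) powr (-a) = 2 powr a" by (simp add: powr_minus_divide powr_divide)
      then have 2: "riesz a ((1/2) *\<^sub>R z) = ennreal (2 powr a) * riesz a z" using riesz_scale[of "1/2" a z] by simp
      have 3: "1 \<le> ennreal (2 powr a)" using a by (simp add: ge_one_powr_ge_zero)
      have "of_nat m \<le> ennreal (2 powr a) * of_nat m" using mult_right_mono[OF 3, of "of_nat m"] by simp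
      then have "min (ennreal (2 powr a) * riesz a z) (of_nat m) \<le> ennreal (2 powr a) * min (riesz a z) (of_nat m)"
        by (cases "riesz a z \<le> of_nat m") (auto simp: min_def)
      then show "indicator (ball 0 (1/2)) ((1/2) *\<^sub>R z) * min (riesz a ((1/2) *\<^sub>R z)) (of_nat m)
          \<le> ennreal (2 powr a) * (indicator (ball 0 1) z * min (riesz a z) (of_nat m))"
        unfolding 1 2 by (auto split: split_indicator)
    qed simp
    also have "\<dots> = ennreal (2 powr (a - 3)) * J m"
      by (subst nn_integral_cmult)
        (auto simp: J_def mult.assoc[symmetric] ennreal_mult[symmetric] powr_diff power_divide)
    finally have le: "J m \<le> ennreal (2 powr a) * ennreal V + ennreal (2 powr (a - 3)) * J m"
      by (simp add: add_left_mono)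
    obtain j where j: "J m = ennreal j" "j \<ge> 0" using fin by (cases "J m") auto
    have "ennreal j \<le> ennreal (2 powr a * V + 2 powr (a - 3) * j)"
      using le j by (simp add: ennreal_mult V_def)
    then have "j \<le> 2 powr a * V + 2 powr (a - 3) * j" using j by (subst (asm) ennreal_le_iff) (auto simp: V_def)
    then have "j * (1 - 2 powr (a - 3)) \<le> 2 powr a * V" by (simp add: algebra_simps)
    then show ?thesis unfolding j using lam by (intro ennreal_leI) (simp add: field_simps)
  qed
  have "(\<integral>\<^sup>+z. indicator (ball 0 1) z * riesz a z \<partial>lborel) = (\<integral>\<^sup>+z. (SUP m. indicator (ball 0 1) z * min (riesz a z) (of_nat m)) \<partial>lborel)"
  proof (intro nn_integral_cong)
    fix z :: "real^3"
    obtain m0 :: nat where m0: "norm z powr (-a) \<le> real m0" using real_arch_simple by blast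
    have "riesz a z \<le> of_nat m0" unfolding riesz_def using m0 by (metis ennreal_leI ennreal_of_nat_eq_real_of_nat)
    then have "riesz a z = min (riesz a z) (of_nat m0)" by simp
    then have "riesz a z \<le> (SUP m. min (riesz a z) (of_nat m))" by (metis SUP_upper UNIV_I)
    moreover have "(SUP m. min (riesz a z) (of_nat m)) \<le> riesz a z" by (intro SUP_least) simp
    ultimately show "indicator (ball 0 1) z * riesz a z = (SUP m. indicator (ball 0 1) z * min (riesz a z) (of_nat m))"
      by (auto simp: SUP_mult_left_ennreal[symmetric])
  qed
  also have "\<dots> = (SUP m. J m)"
    unfolding J_def
    by (intro nn_integral_monotone_convergence_SUP)
      (auto simp: incseq_def le_fun_def min_def split: split_indicator intro: order_trans)
  also have "\<dots> \<le> ennreal (2 powr a * V / (1 - 2 powr (a - 3)))" by (intro SUP_least J_le)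
  finally show ?thesis using ennreal_less_top le_less_trans by blast
qed

text \<open>For 0 \<le> a < 3 the integral is finite and \<open>enn2real\<close> is faithful. The
  factor 8 bounds 2^{3-a}, the cost of passing from radius r to 2r: seen from one of its points, a
  ball of radius r lies in a ball of radius 2r.\<close>

definition riesz_const :: "real \<Rightarrow> real" where
  "riesz_const a = 8 * enn2real (\<integral>\<^sup>+z. indicator (ball 0 1) z * riesz a z \<partial>lborel)"

lemma riesz_const_nonneg: "0 \<le> riesz_const a" by (simp add: riesz_const_def)

lemma nn_integral_riesz_ball:
  assumes a: "0 \<le> a" "a < 3" and r: "0 < r"
  shows "(\<integral>\<^sup>+z. indicator (ball 0 (2*r)) z * riesz a z \<partial>lborel) \<le> ennreal (riesz_const a * r powr (3 - a))"
proof -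
  define J where "J = enn2real (\<integral>\<^sup>+z. indicator (ball 0 1) z * riesz a z \<partial>lborel)"
  have J: "(\<integral>\<^sup>+z. indicator (ball 0 1) z * riesz a z \<partial>lborel) = ennreal J" "J \<ge> 0"
    using riesz_unit_ball_finite[OF a] by (auto simp: J_def)
  have "(\<integral>\<^sup>+z. indicator (ball 0 (2*r)) z * riesz a z \<partial>lborel)
      = ennreal ((2*r)^3) * (\<integral>\<^sup>+z. indicator (ball 0 (2*r)) ((2*r) *\<^sub>R z) * riesz a ((2*r) *\<^sub>R z) \<partial>lborel)"
    by (rule nn_integral_scale[where c="2*r" and f="\<lambda>z. indicator (ball 0 (2*r)) z * riesz a z"]) (use r in simp, measurable)
  also have "\<dots> = ennreal ((2*r)^3) * (\<integral>\<^sup>+z. ennreal ((2*r) powr (-a)) * (indicator (ball 0 1) z * riesz a z) \<partial>lborel)"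
    using indicator_ball_scale[of "2*r" 1] riesz_scale[of "2*r" a] r by (simp add: mult.left_commute)
  also have "\<dots> = ennreal ((2*r)^3 * (2*r) powr (-a) * J)"
    using r J by (simp add: nn_integral_cmult ennreal_mult mult.assoc)
  also have "(2*r)^3 * (2*r) powr (-a) = (2*r) powr (3 - a)"
    using r by (simp add: powr_diff powr_minus_divide)
  also have "ennreal ((2*r) powr (3 - a) * J) \<le> ennreal (8 * r powr (3 - a) * J)"
  proof (rule ennreal_leI)
    have "2 powr (3 - a) \<le> (2::real) powr 3" using a by (intro powr_mono) auto
    then show "(2*r) powr (3 - a) * J \<le> 8 * r powr (3 - a) * J"
      using r J by (intro mult_right_mono) (auto simp: powr_mult)
  qed
  finally show ?thesis unfolding riesz_const_def J_def[symmetric] by (simp only: mult_ac)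
qed

lemma nn_integral_riesz_shift:
  assumes a: "0 \<le> a" "a < 3" and r: "0 < r" and y: "y \<in> ball 0 r"
  shows "(\<integral>\<^sup>+x. indicator (ball 0 r) x * riesz a (x - y) \<partial>lborel) \<le> ennreal (riesz_const a * r powr (3 - a))"
proof -
  have "(\<integral>\<^sup>+x. indicator (ball 0 r) x * riesz a (x - y) \<partial>lborel) = (\<integral>\<^sup>+z. indicator (ball 0 r) (z + y) * riesz a z \<partial>lborel)"
    using nn_integral_lborel_translate[of "\<lambda>x. indicator (ball 0 r) x * riesz a (x - y)" y] by simp
  also have "\<dots> \<le> (\<integral>\<^sup>+z. indicator (ball 0 (2*r)) z * riesz a z \<partial>lborel)"
  proof (intro nn_integral_mono mult_right_mono)
    fix z :: "real^3"
    have "norm z \<le> norm (z + y) + norm y" using norm_triangle_ineq[of "z + y" "- y"] by simp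
    then show "indicator (ball 0 r) (z + y) \<le> (indicator (ball 0 (2*r)) z :: ennreal)"
      using y by (auto simp: indicator_def)
  qed simp
  also have "\<dots> \<le> ennreal (riesz_const a * r powr (3 - a))" by (rule nn_integral_riesz_ball[OF a r])
  finally show ?thesis .
qed

section \<open>Riesz potentials of densities on a ball\<close>

definition potential :: "real \<Rightarrow> real \<Rightarrow> (real^3 \<Rightarrow> ennreal) \<Rightarrow> real^3 \<Rightarrow> ennreal" where
  "potential a r f x = (\<integral>\<^sup>+y. indicator (ball 0 r) y * f y * riesz a (x - y) \<partial>lborel)"

lemma potential_borel [measurable]:
  assumes [measurable]: "f \<in> borel_measurable borel"
  shows "potential a r f \<in> borel_measurable borel"
  unfolding potential_def[abs_def] by measurable

text \<open>Cauchy-Schwarz after writing the kernel as a product of two powers. The exponents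
  \<open>a\<close> and \<open>b\<close> may be chosen freely with a given sum, and so may the
  factors of the density; the slice estimates rest on such choices.\<close>

lemma potential_CS:
  assumes [measurable]: "f \<in> borel_measurable borel" "h \<in> borel_measurable borel"
  shows "(potential ((a + b) / 2) r (\<lambda>y. f y * h y) x)\<^sup>2 \<le> potential a r (\<lambda>y. (f y)\<^sup>2) x * potential b r (\<lambda>y. (h y)\<^sup>2) x"
proof -
  have eq: "potential ((a + b) / 2) r (\<lambda>y. f y * h y) x
     = (\<integral>\<^sup>+y. (indicator (ball 0 r) y * f y * riesz (a/2) (x - y)) * (indicator (ball 0 r) y * h y * riesz (b/2) (x - y)) \<partial>lborel)"
    unfolding potential_def
  proof (intro nn_integral_cong)
    fix y
    have 1: "riesz ((a + b) / 2) (x - y) = riesz (a/2) (x - y) * riesz (b/2) (x - y)"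
      by (simp add: riesz_mult add_divide_distrib)
    have 2: "indicator (ball 0 r) y * indicator (ball 0 r) y = (indicator (ball 0 r) y :: ennreal)"
      by (auto split: split_indicator)
    have "indicator (ball 0 r) y * f y * riesz (a / 2) (x - y) * (indicator (ball 0 r) y * h y * riesz (b / 2) (x - y))
      = (indicator (ball 0 r) y * indicator (ball 0 r) y) * (f y * h y) * (riesz (a/2) (x - y) * riesz (b/2) (x - y))"
      by (simp only: mult_ac)
    then show "indicator (ball 0 r) y * (f y * h y) * riesz ((a + b) / 2) (x - y)
      = indicator (ball 0 r) y * f y * riesz (a / 2) (x - y) * (indicator (ball 0 r) y * h y * riesz (b / 2) (x - y))"
      by (simp only: 1 2)
  qed
  have "(potential ((a + b) / 2) r (\<lambda>y. f y * h y) x)\<^sup>2 \<le> (\<integral>\<^sup>+y. (indicator (ball 0 r) y * f y * riesz (a/2) (x - y))\<^sup>2 \<partial>lborel)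
      * (\<integral>\<^sup>+y. (indicator (ball 0 r) y * h y * riesz (b/2) (x - y))\<^sup>2 \<partial>lborel)"
    unfolding eq by (rule Cauchy_Schwarz_nn_integral) measurable
  also have "\<dots> = potential a r (\<lambda>y. (f y)\<^sup>2) x * potential b r (\<lambda>y. (h y)\<^sup>2) x"
    unfolding potential_def
    by (intro arg_cong2[where f="(*)"] nn_integral_cong; simp add: power_mult_distrib riesz_square split: split_indicator)
  finally show ?thesis .
qed

lemma potential_L1:
  assumes a: "0 \<le> a" "a < 3" and r: "0 < r" and [measurable]: "f \<in> borel_measurable borel"
  shows "(\<integral>\<^sup>+x. indicator (ball 0 r) x * potential a r f x \<partial>lborel)
    \<le> ennreal (riesz_const a * r powr (3 - a)) * (\<integral>\<^sup>+y. indicator (ball 0 r) y * f y \<partial>lborel)"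
proof -
  have "(\<integral>\<^sup>+x. indicator (ball 0 r) x * potential a r f x \<partial>lborel)
      = (\<integral>\<^sup>+x. \<integral>\<^sup>+y. indicator (ball 0 r) x * (indicator (ball 0 r) y * f y * riesz a (x - y)) \<partial>lborel \<partial>lborel)"
    unfolding potential_def by (simp add: nn_integral_cmult)
  also have "\<dots> = (\<integral>\<^sup>+y. \<integral>\<^sup>+x. indicator (ball 0 r) x * (indicator (ball 0 r) y * f y * riesz a (x - y)) \<partial>lborel \<partial>lborel)"
    by (rule lborel_pair.Fubini') simp
  also have "\<dots> = (\<integral>\<^sup>+y. (indicator (ball 0 r) y * f y) * (\<integral>\<^sup>+x. indicator (ball 0 r) x * riesz a (x - y) \<partial>lborel) \<partial>lborel)"
    by (simp add: nn_integral_cmult[symmetric] mult_ac)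
  also have "\<dots> \<le> (\<integral>\<^sup>+y. (indicator (ball 0 r) y * f y) * ennreal (riesz_const a * r powr (3 - a)) \<partial>lborel)"
  proof (intro nn_integral_mono)
    fix y :: "real^3"
    show "(indicator (ball 0 r) y * f y) * (\<integral>\<^sup>+x. indicator (ball 0 r) x * riesz a (x - y) \<partial>lborel)
        \<le> (indicator (ball 0 r) y * f y) * ennreal (riesz_const a * r powr (3 - a))"
      using nn_integral_riesz_shift[OF a r, of y] by (cases "y \<in> ball 0 r") (auto intro!: mult_left_mono)
  qed
  also have "\<dots> = ennreal (riesz_const a * r powr (3 - a)) * (\<integral>\<^sup>+y. indicator (ball 0 r) y * f y \<partial>lborel)"
    by (subst nn_integral_multc) (auto simp: mult.commute)
  finally show ?thesis .
qed

lemma potential_one: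
  assumes a: "0 \<le> a" "a < 3" and r: "0 < r" and x: "x \<in> ball 0 r"
  shows "potential a r (\<lambda>_. 1) x \<le> ennreal (riesz_const a * r powr (3 - a))"
  using nn_integral_riesz_shift[OF a r x] by (simp add: potential_def riesz_commute[of _ x])

text \<open>Cauchy-Schwarz with respect to the measure f dy bounds the square by the total mass
  times the potential of order 2a, whose kernel is still locally integrable.\<close>

lemma potential_L2_of_L1:
  assumes a: "0 \<le> a" "2 * a < 3" and r: "0 < r" and [measurable]: "f \<in> borel_measurable borel"
  shows "(\<integral>\<^sup>+x. indicator (ball 0 r) x * (potential a r f x)\<^sup>2 \<partial>lborel)
    \<le> ennreal (riesz_const (2*a) * r powr (3 - 2*a)) * (\<integral>\<^sup>+y. indicator (ball 0 r) y * f y \<partial>lborel)\<^sup>2"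
proof -
  define F where "F = (\<integral>\<^sup>+y. indicator (ball 0 r) y * f y \<partial>lborel)"
  define D where "D = density lborel (\<lambda>y. indicator (ball 0 r) y * f y)"
  have pt: "(potential a r f x)\<^sup>2 \<le> F * potential (2*a) r f x" for x
  proof -
    have eq: "potential a r f x = (\<integral>\<^sup>+y. 1 * riesz a (x - y) \<partial>D)"
      unfolding D_def potential_def by (subst nn_integral_density) auto
    have "(potential a r f x)\<^sup>2 \<le> (\<integral>\<^sup>+y. 1\<^sup>2 \<partial>D) * (\<integral>\<^sup>+y. (riesz a (x - y))\<^sup>2 \<partial>D)"
      unfolding eq by (rule Cauchy_Schwarz_nn_integral) (auto simp: D_def)
    also have "(\<integral>\<^sup>+y. 1\<^sup>2 \<partial>D) = F" unfolding D_def F_def by (subst nn_integral_density) auto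
    also have "(\<integral>\<^sup>+y. (riesz a (x - y))\<^sup>2 \<partial>D) = potential (2*a) r f x"
      unfolding D_def potential_def riesz_square by (subst nn_integral_density) auto
    finally show ?thesis .
  qed
  have "(\<integral>\<^sup>+x. indicator (ball 0 r) x * (potential a r f x)\<^sup>2 \<partial>lborel)
     \<le> (\<integral>\<^sup>+x. F * (indicator (ball 0 r) x * potential (2*a) r f x) \<partial>lborel)"
    using pt by (intro nn_integral_mono) (auto split: split_indicator)
  also have "\<dots> = F * (\<integral>\<^sup>+x. indicator (ball 0 r) x * potential (2*a) r f x \<partial>lborel)"
    by (rule nn_integral_cmult) measurable
  also have "\<dots> \<le> F * (ennreal (riesz_const (2*a) * r powr (3 - 2*a)) * F)"
    unfolding F_def by (intro mult_left_mono potential_L1) (use a r in auto)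
  finally show ?thesis unfolding F_def[symmetric] by (simp add: power2_eq_square mult_ac)
qed

text \<open>The argument of Schur's test: half of the kernel goes with \<open>f\<close>, the other
  half with 1, and \<open>potential_one\<close> bounds the latter uniformly on the ball.\<close>

lemma potential_L2_of_L2:
  assumes a: "0 \<le> a" "a < 3" and r: "0 < r" and [measurable]: "f \<in> borel_measurable borel"
  shows "(\<integral>\<^sup>+x. indicator (ball 0 r) x * (potential a r f x)\<^sup>2 \<partial>lborel)
    \<le> (ennreal (riesz_const a * r powr (3 - a)))\<^sup>2 * (\<integral>\<^sup>+y. indicator (ball 0 r) y * (f y)\<^sup>2 \<partial>lborel)"
proof -
  let ?c = "ennreal (riesz_const a * r powr (3 - a))"
  have "(\<integral>\<^sup>+x. indicator (ball 0 r) x * (potential a r f x)\<^sup>2 \<partial>lborel)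
     \<le> (\<integral>\<^sup>+x. ?c * (indicator (ball 0 r) x * potential a r (\<lambda>y. (f y)\<^sup>2) x) \<partial>lborel)"
  proof (intro nn_integral_mono)
    fix x :: "real^3"
    show "indicator (ball 0 r) x * (potential a r f x)\<^sup>2 \<le> ?c * (indicator (ball 0 r) x * potential a r (\<lambda>y. (f y)\<^sup>2) x)"
    proof (cases "x \<in> ball 0 r")
      case True
      have "(potential a r f x)\<^sup>2 \<le> potential a r (\<lambda>y. (f y)\<^sup>2) x * potential a r (\<lambda>_. 1) x"
        using potential_CS[of f "\<lambda>_. 1" a a r x] by simp
      also have "\<dots> \<le> potential a r (\<lambda>y. (f y)\<^sup>2) x * ?c"
        by (intro mult_left_mono potential_one a r True) simp
      finally show ?thesis using True by (simp add: mult.commute)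
    qed simp
  qed
  also have "\<dots> = ?c * (\<integral>\<^sup>+x. indicator (ball 0 r) x * potential a r (\<lambda>y. (f y)\<^sup>2) x \<partial>lborel)"
    by (rule nn_integral_cmult) measurable
  also have "\<dots> \<le> ?c * (?c * (\<integral>\<^sup>+y. indicator (ball 0 r) y * (f y)\<^sup>2 \<partial>lborel))"
    by (intro mult_left_mono potential_L1 a r) auto
  finally show ?thesis by (simp add: power2_eq_square mult_ac)
qed

subsection \<open>Weak gradients and mollification\<close>

lemma test_functions_bounded:
  assumes "\<phi> \<in> test_functions U" shows "\<exists>B. \<forall>x. \<bar>\<phi> x\<bar> \<le> B"
proof -
  have "\<exists>B\<ge>0. \<forall>x. \<bar>\<phi> x\<bar> \<le> B"
    using assms closure_subset[of "{x. \<phi> x \<noteq> 0}"]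
    by (intro bounded_of_compact_support[OF smooth_continuous_on[OF test_functions_smooth[OF assms]],
          where K="closure {x. \<phi> x \<noteq> 0}"]) (auto simp: test_functions_def)
  then show ?thesis by auto
qed

lemma test_functions_borel: "\<phi> \<in> test_functions U \<Longrightarrow> \<phi> \<in> borel_measurable borel"
  by (rule smooth_borel[OF test_functions_smooth])

lemma integrable_mult_test:
  assumes "integrable lborel f" "\<phi> \<in> test_functions U" shows "integrable lborel (\<lambda>x. f x * \<phi> x)"
  using test_functions_bounded[OF assms(2)] integrable_mult_bounded[OF assms(1) test_functions_borel[OF assms(2)]] by auto

lemma dderiv_axis_sum:
  fixes f :: "real^'n \<Rightarrow> real"
  assumes "smooth f" shows "dderiv h f x = (\<Sum>j\<in>UNIV. h $ j * dderiv (axis j 1) f x)"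
proof -
  interpret linear "\<lambda>e. dderiv e f x"
    using smooth_has_derivative[OF assms] by (rule has_derivative_linear)
  have "dderiv h f x = dderiv (\<Sum>j\<in>UNIV. (h $ j) *\<^sub>R axis j 1) f x"
    using basis_expansion[of h] by (simp add: scalar_mult_eq_scaleR)
  also have "\<dots> = (\<Sum>j\<in>UNIV. h $ j * dderiv (axis j 1) f x)" by (simp add: sum scale)
  finally show ?thesis .
qed

lemma integrable_of_integrable_square:
  fixes f :: "'a::euclidean_space \<Rightarrow> 'b::euclidean_space"
  assumes [measurable]: "f \<in> borel_measurable borel" and z: "\<And>x. x \<notin> ball 0 1 \<Longrightarrow> f x = 0"
    and sq: "integrable lborel (\<lambda>x. (norm (f x))\<^sup>2)"
  shows "integrable lborel f"
proof (rule Bochner_Integration.integrable_bound)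
  show "integrable lborel (\<lambda>x::'a. indicator (ball 0 1) x + (norm (f x))\<^sup>2)"
    by (intro Bochner_Integration.integrable_add sq integrable_real_indicator)
      (auto simp: emeasure_lborel_ball_finite[unfolded infinity_ennreal_def])
  show "AE x in lborel. norm (f x) \<le> norm (indicator (ball 0 1) x + (norm (f x))\<^sup>2 :: real)"
  proof (rule AE_I2)
    fix x :: 'a
    have "norm (f x) \<le> 1 + (norm (f x))\<^sup>2" using zero_le_power2[of "norm (f x) - 1/2"] by (simp add: power2_diff power_divide)
    then show "norm (f x) \<le> norm (indicator (ball 0 1) x + (norm (f x))\<^sup>2 :: real)"
      using z[of x] by (cases "x \<in> ball 0 1") auto
  qed
qed simp

text \<open>\<open>W12_gradient\<close> on the unit ball for Borel functions extended by 0, with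
  integrals over the whole space. Test functions vanish near the boundary of the ball, so the
  extension creates no boundary terms.\<close>

definition weak_grad :: "(real^3 \<Rightarrow> real^3) \<Rightarrow> (real^3 \<Rightarrow> real^3^3) \<Rightarrow> bool" where
  "weak_grad u g \<longleftrightarrow> u \<in> borel_measurable borel \<and> g \<in> borel_measurable borel \<and>
     (\<forall>x. x \<notin> ball 0 1 \<longrightarrow> u x = 0 \<and> g x = 0) \<and>
     integrable lborel (\<lambda>x. (norm (u x))\<^sup>2) \<and> integrable lborel (\<lambda>x. (norm (g x))\<^sup>2) \<and>
     (\<forall>i j. \<forall>\<phi>\<in>test_functions (ball 0 1).
        (LINT x|lborel. u x $ i * dderiv (axis j 1) \<phi> x) = - (LINT x|lborel. g x $ i $ j * \<phi> x))"

lemma weak_gradD: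
  assumes "weak_grad u g"
  shows "u \<in> borel_measurable borel" "g \<in> borel_measurable borel"
    "integrable lborel u" "integrable lborel g"
    "integrable lborel (\<lambda>x. u x $ i)" "integrable lborel (\<lambda>x. g x $ i $ j)"
    "integrable lborel (\<lambda>x. (norm (u x))\<^sup>2)" "integrable lborel (\<lambda>x. (norm (g x))\<^sup>2)"
    "\<phi> \<in> test_functions (ball 0 1) \<Longrightarrow>
        (LINT x|lborel. u x $ i * dderiv (axis j 1) \<phi> x) = - (LINT x|lborel. g x $ i $ j * \<phi> x)"
proof -
  show m: "u \<in> borel_measurable borel" "g \<in> borel_measurable borel"
    and sq: "integrable lborel (\<lambda>x. (norm (u x))\<^sup>2)" "integrable lborel (\<lambda>x. (norm (g x))\<^sup>2)"
    and "\<phi> \<in> test_functions (ball 0 1) \<Longrightarrow>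
        (LINT x|lborel. u x $ i * dderiv (axis j 1) \<phi> x) = - (LINT x|lborel. g x $ i $ j * \<phi> x)"
    using assms unfolding weak_grad_def by blast+
  show ui: "integrable lborel u" and gi: "integrable lborel g"
    using assms unfolding weak_grad_def by (auto intro: integrable_of_integrable_square)
  show "integrable lborel (\<lambda>x. u x $ i)"
    by (rule integrable_bounded_linear[OF bounded_linear_vec_nth ui])
  show "integrable lborel (\<lambda>x. g x $ i $ j)"
    by (rule integrable_bounded_linear[OF bounded_linear_vec_nth integrable_bounded_linear[OF bounded_linear_vec_nth gi]])
qed

text \<open>The Laplacian of \<open>newton_test e s x\<close> is the difference of the two
  mollifiers centred at \<open>x\<close>. One of its two derivatives is moved onto \<open>u\<close>,
  and the other leaves the field \<open>newton_flux\<close>.\<close>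

lemma mollify_diff_eq:
  assumes wg: "weak_grad u g" and e: "0 < e" "e \<le> s" "cball x s \<subseteq> ball 0 1"
  shows "mollify e (\<lambda>y. u y $ i) x - mollify s (\<lambda>y. u y $ i) x
     = - (LINT y|lborel. g y $ i \<bullet> newton_flux e s (y - x))"
proof -
  note wgD = weak_gradD[OF wg]
  have s: "0 < s" using e by simp
  let ?\<phi> = "newton_test e s x"
  have t: "?\<phi> \<in> test_functions (ball 0 1)" by (rule newton_test_test_functions[OF e])
  have t1: "dderiv (axis j 1) ?\<phi> \<in> test_functions (ball 0 1)" for j :: 3 by (rule test_functions_dderiv[OF t])
  have t2: "dderiv (axis j 1) (dderiv (axis j 1) ?\<phi>) \<in> test_functions (ball 0 1)" for j :: 3 by (rule test_functions_dderiv[OF t1])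
  have "mollify e (\<lambda>y. u y $ i) x - mollify s (\<lambda>y. u y $ i) x
     = (LINT y|lborel. u y $ i * (eta e (y - x) - eta s (y - x)))"
    unfolding mollify_def right_diff_distrib using e(1) s
    by (subst Bochner_Integration.integral_diff) (simp_all add: integrable_mult_eta[OF wgD(5)])
  also have "\<dots> = (LINT y|lborel. (\<Sum>j\<in>UNIV. u y $ i * dderiv (axis j 1) (dderiv (axis j 1) ?\<phi>) y))"
    by (simp only: laplace_newton_test[OF e(1) s, symmetric] sum_distrib_left)
  also have "\<dots> = (\<Sum>j\<in>UNIV. (LINT y|lborel. u y $ i * dderiv (axis j 1) (dderiv (axis j 1) ?\<phi>) y))"
    by (rule Bochner_Integration.integral_sum) (rule integrable_mult_test[OF wgD(5) t2])
  also have "\<dots> = (\<Sum>j\<in>UNIV. - (LINT y|lborel. g y $ i $ j * dderiv (axis j 1) ?\<phi> y))"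
    by (simp only: wgD(9)[OF t1])
  also have "\<dots> = - (LINT y|lborel. (\<Sum>j\<in>UNIV. g y $ i $ j * dderiv (axis j 1) ?\<phi> y))"
    by (subst Bochner_Integration.integral_sum) (auto intro: integrable_mult_test[OF wgD(6) t1] simp: sum_negf)
  also have "\<dots> = - (LINT y|lborel. g y $ i \<bullet> newton_flux e s (y - x))"
    unfolding inner_vec_def by (simp add: dderiv_newton_test[OF e(1) s] inner_axis)
  finally show ?thesis .
qed

text \<open>The flux is at most |y - x|^{-2} on the ball of radius \<open>s\<close> about
  \<open>x\<close>, and that ball lies inside the ball of radius \<open>R\<close>. So the bound
  contains neither \<open>e\<close> nor \<open>s\<close>.\<close>

lemma flux_potential_bound:
  fixes f :: "real^3 \<Rightarrow> real^3"
  assumes e: "0 < e" "e \<le> s" "ball x s \<subseteq> ball 0 R" and fh: "\<And>y. norm (f y) \<le> h y"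
  shows "ennreal \<bar>LINT y|lborel. f y \<bullet> newton_flux e s (y - x)\<bar> \<le> potential 2 R (\<lambda>y. ennreal (h y)) x"
proof -
  have "ennreal \<bar>LINT y|lborel. f y \<bullet> newton_flux e s (y - x)\<bar> \<le> (\<integral>\<^sup>+y. ennreal \<bar>f y \<bullet> newton_flux e s (y - x)\<bar> \<partial>lborel)"
    by (rule ennreal_abs_integral_le)
  also have "\<dots> \<le> potential 2 R (\<lambda>y. ennreal (h y)) x"
    unfolding potential_def
  proof (intro nn_integral_mono)
    fix y
    have h0: "0 \<le> h y" using fh[of y] norm_ge_zero[of "f y"] by linarith
    have "\<bar>f y \<bullet> newton_flux e s (y - x)\<bar> \<le> norm (f y) * norm (newton_flux e s (y - x))" by (rule Cauchy_Schwarz_ineq2)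
    also have "\<dots> \<le> h y * (1 / (norm (y - x))\<^sup>2 * indicator (ball 0 s) (y - x))"
      by (intro mult_mono fh norm_newton_flux_le e h0) auto
    also have "\<dots> \<le> indicator (ball 0 R) y * h y * norm (x - y) powr (-2)"
    proof (cases "y \<in> ball x s")
      case True
      then have "y \<in> ball 0 R" using e by blast
      moreover have "1 / (norm (y - x))\<^sup>2 = norm (x - y) powr (-2)"
        by (cases "y = x") (auto simp: powr_minus_divide norm_minus_commute)
      ultimately show ?thesis using h0 by (simp add: indicator_def)
    next
      case False
      then have "indicator (ball 0 s) (y - x) = (0::real)" by (auto simp: indicator_def dist_norm norm_minus_commute)
      then show ?thesis using h0 by simp
    qed
    finally have "ennreal \<bar>f y \<bullet> newton_flux e s (y - x)\<bar> \<le> ennreal (indicator (ball 0 R) y * h y * norm (x - y) powr (-2))"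
      by (rule ennreal_leI)
    also have "\<dots> = indicator (ball 0 R) y * ennreal (h y) * riesz 2 (x - y)"
      using h0 by (simp add: ennreal_mult riesz_def ennreal_indicator)
    finally show "ennreal \<bar>f y \<bullet> newton_flux e s (y - x)\<bar> \<le> indicator (ball 0 R) y * ennreal (h y) * riesz 2 (x - y)" .
  qed
  finally show ?thesis .
qed

text \<open>Dominated convergence of the difference quotients: \<open>eta s\<close> is Lipschitz, so
  they are bounded by a multiple of |f|.\<close>

lemma mollify_line_derivative:
  assumes f: "integrable lborel f" and s: "0 < s"
  shows "((\<lambda>\<tau>. mollify s f (\<tau> *\<^sub>R x)) has_real_derivative
     (LINT y|lborel. f y * (- dderiv x (eta s) (y - \<tau> *\<^sub>R x)))) (at \<tau>)"
proof -
  have [measurable]: "f \<in> borel_measurable borel" using f borel_measurable_integrable by force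
  have [measurable]: "dderiv x (eta s) \<in> borel_measurable borel" by (intro smooth_borel smooth_dderiv smooth_eta)
  define L where "L = eta_bound * norm x / s^4"
  have L: "\<bar>eta s (y - a *\<^sub>R x) - eta s (y - b *\<^sub>R x)\<bar> \<le> L * \<bar>a - b\<bar>" for y a b
  proof -
    have "norm ((y - a *\<^sub>R x) - (y - b *\<^sub>R x)) = \<bar>a - b\<bar> * norm x"
      by (simp add: scaleR_left_diff_distrib[symmetric] norm_minus_commute abs_minus_commute del: scaleR_left_diff_distrib)
    then show ?thesis using eta_lipschitz[OF s, of "y - a *\<^sub>R x" "y - b *\<^sub>R x"] by (simp add: L_def mult_ac)
  qed
  have "((\<lambda>\<sigma>. (mollify s f (\<sigma> *\<^sub>R x) - mollify s f (\<tau> *\<^sub>R x)) / (\<sigma> - \<tau>))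
      \<longlongrightarrow> (LINT y|lborel. f y * (- dderiv x (eta s) (y - \<tau> *\<^sub>R x)))) (at \<tau>)"
    unfolding tendsto_at_iff_sequentially
  proof (intro allI impI)
    fix X :: "nat \<Rightarrow> real" assume X: "\<forall>i. X i \<in> UNIV - {\<tau>}" "X \<longlonglongrightarrow> \<tau>"
    define q where "q n y = f y * ((eta s (y - X n *\<^sub>R x) - eta s (y - \<tau> *\<^sub>R x)) / (X n - \<tau>))" for n y
    have "(\<lambda>n. LINT y|lborel. q n y) \<longlonglongrightarrow> (LINT y|lborel. f y * (- dderiv x (eta s) (y - \<tau> *\<^sub>R x)))"
    proof (rule integral_dominated_convergence[where w="\<lambda>y. \<bar>f y\<bar> * L"])
      show "AE y in lborel. (\<lambda>n. q n y) \<longlonglongrightarrow> f y * (- dderiv x (eta s) (y - \<tau> *\<^sub>R x))"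
      proof (intro AE_I2)
        fix y
        have "((\<lambda>\<sigma>. y - \<sigma> *\<^sub>R x) has_derivative (\<lambda>h. - (h *\<^sub>R x))) (at \<tau>)"
          by (auto intro!: derivative_eq_intros)
        then have "((\<lambda>\<sigma>. eta s (y - \<sigma> *\<^sub>R x)) has_derivative (\<lambda>h. dderiv (- (h *\<^sub>R x)) (eta s) (y - \<tau> *\<^sub>R x))) (at \<tau>)"
          by (rule has_derivative_compose[OF _ smooth_has_derivative[OF smooth_eta]])
        moreover have "dderiv (- (h *\<^sub>R x)) (eta s) z = - dderiv x (eta s) z * h" for h z
        proof -
          interpret linear "\<lambda>e. dderiv e (eta s) z"
            using smooth_has_derivative[OF smooth_eta] by (rule has_derivative_linear)
          show ?thesis by (simp add: neg scale)
        qed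
        ultimately have "((\<lambda>\<sigma>. eta s (y - \<sigma> *\<^sub>R x)) has_real_derivative (- dderiv x (eta s) (y - \<tau> *\<^sub>R x))) (at \<tau>)"
          unfolding has_field_derivative_def by (simp only:)
        then have "((\<lambda>\<sigma>. (eta s (y - \<sigma> *\<^sub>R x) - eta s (y - \<tau> *\<^sub>R x)) / (\<sigma> - \<tau>)) \<longlongrightarrow> - dderiv x (eta s) (y - \<tau> *\<^sub>R x)) (at \<tau>)"
          unfolding has_field_derivative_iff .
        then have "(\<lambda>n. (eta s (y - X n *\<^sub>R x) - eta s (y - \<tau> *\<^sub>R x)) / (X n - \<tau>)) \<longlonglongrightarrow> - dderiv x (eta s) (y - \<tau> *\<^sub>R x)"
          using X unfolding tendsto_at_iff_sequentially comp_def by blast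
        then show "(\<lambda>n. q n y) \<longlonglongrightarrow> f y * (- dderiv x (eta s) (y - \<tau> *\<^sub>R x))"
          unfolding q_def by (intro tendsto_mult tendsto_const)
      qed
      show "AE y in lborel. norm (q n y) \<le> \<bar>f y\<bar> * L" for n
      proof (intro AE_I2)
        fix y
        have "\<bar>(eta s (y - X n *\<^sub>R x) - eta s (y - \<tau> *\<^sub>R x)) / (X n - \<tau>)\<bar> \<le> L"
          using L[of y "X n" \<tau>] X(1) by (simp add: abs_divide divide_le_eq)
        then show "norm (q n y) \<le> \<bar>f y\<bar> * L" by (simp add: q_def abs_mult mult_left_mono del: times_divide_eq_right)
      qed
    qed (use f in \<open>auto simp: q_def[abs_def]\<close>)
    moreover have "(LINT y|lborel. q n y) = (mollify s f (X n *\<^sub>R x) - mollify s f (\<tau> *\<^sub>R x)) / (X n - \<tau>)" for n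
    proof -
      have "(LINT y|lborel. q n y) = (LINT y|lborel. (f y * eta s (y - X n *\<^sub>R x) - f y * eta s (y - \<tau> *\<^sub>R x)) / (X n - \<tau>))"
        by (simp add: q_def right_diff_distrib)
      also have "\<dots> = (LINT y|lborel. (f y * eta s (y - X n *\<^sub>R x) - f y * eta s (y - \<tau> *\<^sub>R x))) / (X n - \<tau>)"
        by (rule integral_divide_zero)
      also have "(LINT y|lborel. (f y * eta s (y - X n *\<^sub>R x) - f y * eta s (y - \<tau> *\<^sub>R x))) = mollify s f (X n *\<^sub>R x) - mollify s f (\<tau> *\<^sub>R x)"
        unfolding mollify_def using s by (subst Bochner_Integration.integral_diff) (simp_all add: integrable_mult_eta[OF f])
      finally show ?thesis .
    qed
    ultimately show "((\<lambda>\<sigma>. (mollify s f (\<sigma> *\<^sub>R x) - mollify s f (\<tau> *\<^sub>R x)) / (\<sigma> - \<tau>)) \<circ> X)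
      \<longlonglongrightarrow> (LINT y|lborel. f y * (- dderiv x (eta s) (y - \<tau> *\<^sub>R x)))" by (simp add: comp_def)
  qed
  then show ?thesis by (simp only: has_field_derivative_iff)
qed

text \<open>Along the segment from 0 to \<open>x\<close> the derivative falls on the mollifier, and
  the weak gradient moves it to \<open>u\<close>. What remains is a weighted mean of the gradient,
  bounded by the supremum of \<open>eta s\<close> times an L^1 norm.\<close>

lemma mollify_oscillation:
  assumes wg: "weak_grad u g" and s: "0 < s" and x: "norm x + s < 1" "norm x + s \<le> R"
  shows "\<bar>mollify s (\<lambda>y. u y $ i) x - mollify s (\<lambda>y. u y $ i) 0\<bar>
    \<le> norm x * (eta_bound / s^3) * (LINT y|lborel. indicator (ball 0 R) y * norm (g y))"
proof -
  note wgD = weak_gradD[OF wg]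
  have [measurable]: "g \<in> borel_measurable borel" by (rule wgD)
  let ?f = "\<lambda>y. u y $ i"
  let ?K = "norm x * (eta_bound / s^3) * (LINT y|lborel. indicator (ball 0 R) y * norm (g y))"
  have ig: "integrable lborel (\<lambda>y. indicator (ball 0 R) y * norm (g y))"
    using integrable_mult_indicator[of "ball 0 R" lborel "\<lambda>y. norm (g y)"] wgD(4) by auto
  have D: "\<bar>LINT y|lborel. ?f y * (- dderiv x (eta s) (y - \<tau> *\<^sub>R x))\<bar> \<le> ?K" if \<tau>: "0 \<le> \<tau>" "\<tau> \<le> 1" for \<tau>
  proof -
    define z where "z = \<tau> *\<^sub>R x"
    have z: "norm z \<le> norm x" using \<tau> by (simp add: z_def mult_left_le_one_le)
    let ?\<psi> = "\<lambda>y. eta s (y - z)"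
    have sm: "smooth ?\<psi>" by (rule smooth_shift[OF smooth_eta])
    have \<psi>0: "?\<psi> y = 0" if "y \<notin> cball z s" for y
      using that s by (intro eta_eq_0) (auto simp: dist_norm norm_minus_commute)
    have sub: "y \<in> ball 0 1" "y \<in> ball 0 R" if "y \<in> ball z s" for y
      using that z x norm_triangle_ineq[of z "y - z"] by (auto simp: dist_norm norm_minus_commute)
    have "cball z s \<subseteq> ball 0 1"
      using z x norm_triangle_ineq[of z "y - z" for y]
      by (auto simp: dist_norm norm_minus_commute) (smt (verit) add.commute diff_add_cancel norm_minus_commute norm_triangle_ineq)
    then have t: "?\<psi> \<in> test_functions (ball 0 1)"
      by (rule smooth_test_functionsI[OF sm compact_cball]) (rule \<psi>0)
    have t1: "dderiv (axis j 1) ?\<psi> \<in> test_functions (ball 0 1)" for j :: 3 by (rule test_functions_dderiv[OF t])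
    have "dderiv x (eta s) (y - z) = (\<Sum>j\<in>UNIV. x $ j * dderiv (axis j 1) ?\<psi> y)" for y
      using dderiv_axis_sum[OF sm, of x y]
        dderiv_shift[where f="eta s" and y=y and x=z and h=x, OF differentiableI[OF smooth_has_derivative[OF smooth_eta]]] by simp
    then have "(LINT y|lborel. ?f y * (- dderiv x (eta s) (y - z)))
       = (LINT y|lborel. (\<Sum>j\<in>UNIV. (- x $ j) * (?f y * dderiv (axis j 1) ?\<psi> y)))"
      by (intro Bochner_Integration.integral_cong refl) (simp add: sum_distrib_left sum_negf mult_ac)
    also have "\<dots> = (\<Sum>j\<in>UNIV. (- x $ j) * (LINT y|lborel. ?f y * dderiv (axis j 1) ?\<psi> y))"
      by (subst Bochner_Integration.integral_sum) (auto intro!: integrable_mult_right integrable_mult_test[OF wgD(5) t1])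
    also have "\<dots> = (\<Sum>j\<in>UNIV. x $ j * (LINT y|lborel. g y $ i $ j * ?\<psi> y))"
      by (simp add: wgD(9)[OF t])
    also have "\<dots> = (LINT y|lborel. (\<Sum>j\<in>UNIV. x $ j * (g y $ i $ j * ?\<psi> y)))"
      by (subst Bochner_Integration.integral_sum) (auto intro!: integrable_mult_right integrable_mult_test[OF wgD(6) t])
    also have "\<dots> = (LINT y|lborel. (g y $ i \<bullet> x) * ?\<psi> y)"
      by (simp add: inner_vec_def sum_distrib_left sum_distrib_right mult_ac)
    finally have eq: "(LINT y|lborel. ?f y * (- dderiv x (eta s) (y - z))) = (LINT y|lborel. (g y $ i \<bullet> x) * ?\<psi> y)" .
    have "\<bar>LINT y|lborel. (g y $ i \<bullet> x) * ?\<psi> y\<bar> \<le> (LINT y|lborel. norm x * (eta_bound / s^3) * (indicator (ball 0 R) y * norm (g y)))"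
    proof (rule integral_abs_bound[THEN order_trans], rule integral_mono')
      show "integrable lborel (\<lambda>y. norm x * (eta_bound / s^3) * (indicator (ball 0 R) y * norm (g y)))"
        by (intro integrable_mult_right ig)
      fix y
      show "\<bar>(g y $ i \<bullet> x) * ?\<psi> y\<bar> \<le> norm x * (eta_bound / s^3) * (indicator (ball 0 R) y * norm (g y))"
      proof (cases "y \<in> ball z s")
        case True
        have "\<bar>g y $ i \<bullet> x\<bar> \<le> norm (g y) * norm x"
          by (intro order_trans[OF Cauchy_Schwarz_ineq2] mult_right_mono Finite_Cartesian_Product.norm_nth_le) auto
        then have "\<bar>(g y $ i \<bullet> x) * ?\<psi> y\<bar> \<le> (norm (g y) * norm x) * (eta_bound / s^3)"
          unfolding abs_mult by (intro mult_mono abs_eta_le s) auto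
        then show ?thesis using sub(2)[OF True] by (simp add: mult_ac)
      next
        case False
        then have "?\<psi> y = 0" using s by (intro eta_eq_0) (auto simp: dist_norm norm_minus_commute)
        then show ?thesis using eta_bound_pos s by simp
      qed
      show "0 \<le> norm x * (eta_bound / s^3) * (indicator (ball 0 R) y * norm (g y))"
        using eta_bound_pos s by simp
    qed
    also have "\<dots> = ?K" by (rule integral_mult_right_zero)
    finally show ?thesis using eq by (simp add: z_def)
  qed
  obtain \<tau> where "0 < \<tau>" "\<tau> < 1" and
    "mollify s ?f (1 *\<^sub>R x) - mollify s ?f (0 *\<^sub>R x) = (1 - 0) * (LINT y|lborel. ?f y * (- dderiv x (eta s) (y - \<tau> *\<^sub>R x)))"
    using MVT2[of 0 1 "\<lambda>\<tau>. mollify s ?f (\<tau> *\<^sub>R x)" "\<lambda>\<tau>. LINT y|lborel. ?f y * (- dderiv x (eta s) (y - \<tau> *\<^sub>R x))"]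
      mollify_line_derivative[OF wgD(5) s] by auto
  then show ?thesis using D[of \<tau>] by simp
qed

subsection \<open>A local Poincare inequality\<close>

text \<open>A mean over the ball of radius \<open>s\<close> with the smooth weight
  \<open>eta s\<close>. Unlike the plain average it is a value of a mollification and can be
  compared with \<open>u\<close> by means of test functions.\<close>

definition avg :: "real \<Rightarrow> (real^3 \<Rightarrow> real^3) \<Rightarrow> real^3" where
  "avg s u = (\<chi> i. mollify s (\<lambda>y. u y $ i) 0 / eta_mass)"

text \<open>In the bracket, 1 stands for the difference between a function and its mollification at
  the same point, and \<open>16 * eta_bound\<close> for the oscillation of the mollification; 3 is
  the number of components.\<close>

definition poincare_const :: real where "poincare_const = 3 * (1 + 16 * eta_bound) / eta_mass"

lemma poincare_const_pos: "poincare_const > 0"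
  using eta_mass_pos eta_bound_pos by (simp add: poincare_const_def)

text \<open>Two points of the ball are at most 2R apart, so the kernel is at least 1/(4R^2) there.
  The diagonal, where the kernel is 0 by convention, is a null set.\<close>

lemma far_field_le_potential:
  assumes [measurable]: "h \<in> borel_measurable borel" and R: "0 < R" and x: "x \<in> ball 0 R"
    and i: "integrable lborel (\<lambda>y. indicator (ball 0 R) y * h y)" and h: "\<And>y. 0 \<le> h y" and c: "0 \<le> c"
  shows "ennreal (c / (4 * R\<^sup>2) * (LINT y|lborel. indicator (ball 0 R) y * h y)) \<le> ennreal c * potential 2 R (\<lambda>y. ennreal (h y)) x"
proof -
  have "ennreal (c / (4 * R\<^sup>2) * (LINT y|lborel. indicator (ball 0 R) y * h y))
      = ennreal (c / (4 * R\<^sup>2)) * (\<integral>\<^sup>+y. ennreal (indicator (ball 0 R) y * h y) \<partial>lborel)"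
    using c h R nn_integral_eq_integral[OF i]
      ennreal_mult[of "c / (4 * R\<^sup>2)" "LINT y|lborel. indicator (ball 0 R) y * h y"]
    by (simp only: AE_I2 divide_nonneg_nonneg mult_nonneg_nonneg indicator_pos_le Bochner_Integration.integral_nonneg zero_le_power2 zero_le_numeral)
  also have "\<dots> = (\<integral>\<^sup>+y. ennreal (c / (4 * R\<^sup>2)) * ennreal (indicator (ball 0 R) y * h y) \<partial>lborel)"
    by (rule nn_integral_cmult[symmetric]) measurable
  also have "\<dots> \<le> (\<integral>\<^sup>+y. ennreal c * (indicator (ball 0 R) y * ennreal (h y) * riesz 2 (x - y)) \<partial>lborel)"
  proof (intro nn_integral_mono_AE)
    have "AE y in lborel. y \<noteq> x" by (rule AE_lborel_singleton)
    then show "AE y in lborel. ennreal (c / (4 * R\<^sup>2)) * ennreal (indicator (ball 0 R) y * h y)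
        \<le> ennreal c * (indicator (ball 0 R) y * ennreal (h y) * riesz 2 (x - y))"
    proof eventually_elim
      case (elim y)
      show ?case
      proof (cases "y \<in> ball 0 R")
        case True
        have n: "norm (x - y) \<le> 2 * R" using norm_triangle_ineq4[of x y] True x by simp
        have "(norm (x - y))\<^sup>2 \<le> (2 * R)\<^sup>2" by (rule power_mono[OF n]) simp
        then have "1 / (4 * R\<^sup>2) \<le> norm (x - y) powr (-2)"
          using elim R by (auto simp: powr_minus_divide power_mult_distrib intro!: divide_left_mono)
        then have "c * (1 / (4 * R\<^sup>2)) * h y \<le> c * norm (x - y) powr (-2) * h y"
          by (intro mult_right_mono mult_left_mono c h)
        then have "ennreal (c * (1 / (4 * R\<^sup>2)) * h y) \<le> ennreal (c * norm (x - y) powr (-2) * h y)" by (rule ennreal_leI)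
        then show ?thesis using True c h R by (simp add: riesz_def ennreal_mult[symmetric] mult_ac)
      qed simp
    qed
  qed
  also have "\<dots> = ennreal c * potential 2 R (\<lambda>y. ennreal (h y)) x"
    unfolding potential_def by (rule nn_integral_cmult) measurable
  finally show ?thesis .
qed

text \<open>The difference splits at the mollification in \<open>x\<close>. The inner part is a
  potential of the gradient by the flux representation, with the smaller scale tending to 0. The
  outer part is an oscillation of the mollification, at most a multiple of R^{-2} times the integral
  of |g|, and this is dominated by the same potential.\<close>

lemma poincare_component:
  assumes wg: "weak_grad u g" and R: "0 < R" "R \<le> 1"
  shows "AE x in lborel. x \<in> ball 0 (R/2) \<longrightarrow> ennreal \<bar>eta_mass * (u x $ i) - mollify (R/2) (\<lambda>y. u y $ i) 0\<bar>
     \<le> ennreal (1 + 16 * eta_bound) * potential 2 R (\<lambda>y. ennreal (norm (g y))) x"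
proof -
  note wgD = weak_gradD[OF wg]
  have [measurable]: "g \<in> borel_measurable borel" by (rule wgD)
  let ?s = "R/2"
  let ?f = "\<lambda>y. u y $ i"
  let ?P = "potential 2 R (\<lambda>y. ennreal (norm (g y)))"
  have s: "0 < ?s" using R by simp
  have sub: "cball x ?s \<subseteq> ball 0 R" if "x \<in> ball 0 ?s" for x :: "real^3"
  proof
    fix y assume "y \<in> cball x ?s"
    then show "y \<in> ball 0 R" using that norm_triangle_ineq[of x "y - x"] by (simp add: dist_norm norm_minus_commute)
  qed
  have "AE x in lborel. x \<in> ball 0 ?s \<longrightarrow> (\<forall>n. ennreal \<bar>mollify (?s / (real n + 2)) ?f x - mollify ?s ?f x\<bar> \<le> ?P x)"
  proof (intro AE_I2 impI allI)
    fix x :: "real^3" and n assume x: "x \<in> ball 0 ?s"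
    define e where "e = ?s / (real n + 2)"
    have e: "0 < e" "e \<le> ?s" using R by (auto simp: e_def field_simps)
    have c1: "cball x ?s \<subseteq> ball 0 1" using sub[OF x] R by (meson order_trans subset_ball)
    have b1: "ball x ?s \<subseteq> ball 0 R" using sub[OF x] ball_subset_cball by blast
    have "ennreal \<bar>mollify e ?f x - mollify ?s ?f x\<bar> = ennreal \<bar>LINT y|lborel. g y $ i \<bullet> newton_flux e ?s (y - x)\<bar>"
      by (simp add: mollify_diff_eq[OF wg e c1])
    also have "\<dots> \<le> ?P x"
      by (rule flux_potential_bound[OF e b1]) (rule Finite_Cartesian_Product.norm_nth_le)
    finally show "ennreal \<bar>mollify (?s / (real n + 2)) ?f x - mollify ?s ?f x\<bar> \<le> ?P x" by (simp add: e_def)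
  qed
  from mollify_limit_bound[OF wgD(5) s this] show ?thesis
  proof eventually_elim
    case (elim x)
    show ?case
    proof
      assume x: "x \<in> ball 0 ?s"
      have nx: "norm x < R/2" using x by simp
      let ?I = "LINT y|lborel. indicator (ball 0 R) y * norm (g y)"
      have I0: "0 \<le> ?I" by (rule Bochner_Integration.integral_nonneg) simp
      have "\<bar>mollify ?s ?f x - mollify ?s ?f 0\<bar> \<le> norm x * (eta_bound / ?s^3) * ?I"
        by (rule mollify_oscillation[OF wg s]) (use nx R in auto)
      also have "\<dots> \<le> (R/2) * (eta_bound / ?s^3) * ?I"
        using nx eta_bound_pos R I0 by (intro mult_right_mono) auto
      \<comment> \<open>The factor 16: (R/2) / (R/2)^3 = 4/R^2 = 16/(4R^2).\<close>
      also have "\<dots> = (16 * eta_bound) / (4 * R\<^sup>2) * ?I"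
        using R by (simp add: power2_eq_square power3_eq_cube field_simps)
      finally have "ennreal \<bar>mollify ?s ?f x - mollify ?s ?f 0\<bar> \<le> ennreal ((16 * eta_bound) / (4 * R\<^sup>2) * ?I)" by (rule ennreal_leI)
      also have "\<dots> \<le> ennreal (16 * eta_bound) * ?P x"
      proof (rule far_field_le_potential)
        show "integrable lborel (\<lambda>y. indicator (ball 0 R) y * norm (g y))"
          using integrable_mult_indicator[of "ball 0 R" lborel "\<lambda>y. norm (g y)"] wgD(4) by auto
      qed (use x R eta_bound_pos in auto)
      finally have 2: "ennreal \<bar>mollify ?s ?f x - mollify ?s ?f 0\<bar> \<le> ennreal (16 * eta_bound) * ?P x" .
      have "ennreal \<bar>eta_mass * ?f x - mollify ?s ?f 0\<bar>
          \<le> ennreal \<bar>eta_mass * ?f x - mollify ?s ?f x\<bar> + ennreal \<bar>mollify ?s ?f x - mollify ?s ?f 0\<bar>"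
        by (auto simp: ennreal_plus[symmetric] simp del: ennreal_plus intro!: ennreal_leI)
      also have "\<dots> \<le> ?P x + ennreal (16 * eta_bound) * ?P x"
        using elim x 2 by (intro add_mono) auto
      also have "\<dots> = ennreal (1 + 16 * eta_bound) * ?P x"
        using eta_bound_pos by (simp add: ennreal_plus distrib_right)
      finally show "ennreal \<bar>eta_mass * ?f x - mollify ?s ?f 0\<bar> \<le> ennreal (1 + 16 * eta_bound) * ?P x" .
    qed
  qed
qed

lemma poincare_pointwise:
  assumes wg: "weak_grad u g" and R: "0 < R" "R \<le> 1"
  shows "AE x in lborel. x \<in> ball 0 (R/2) \<longrightarrow> ennreal (norm (u x - avg (R/2) u))
     \<le> ennreal poincare_const * potential 2 R (\<lambda>y. ennreal (norm (g y))) x"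
proof -
  have "AE x in lborel. \<forall>i. x \<in> ball 0 (R/2) \<longrightarrow> ennreal \<bar>eta_mass * (u x $ i) - mollify (R/2) (\<lambda>y. u y $ i) 0\<bar>
     \<le> ennreal (1 + 16 * eta_bound) * potential 2 R (\<lambda>y. ennreal (norm (g y))) x"
    by (rule eventually_all_finite) (rule poincare_component[OF wg R])
  then show ?thesis
  proof eventually_elim
    case (elim x)
    show ?case
    proof
      assume x: "x \<in> ball 0 (R/2)"
      let ?d = "\<lambda>i. \<bar>eta_mass * (u x $ i) - mollify (R/2) (\<lambda>y. u y $ i) 0\<bar>"
      have "norm (u x - avg (R/2) u) \<le> (\<Sum>i\<in>UNIV. \<bar>(u x - avg (R/2) u) $ i\<bar>)" by (rule norm_le_l1_cart)
      also have "\<dots> = (\<Sum>i\<in>UNIV. ?d i / eta_mass)"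
      proof (rule sum.cong)
        fix i
        have "(u x - avg (R/2) u) $ i = (eta_mass * (u x $ i) - mollify (R/2) (\<lambda>y. u y $ i) 0) / eta_mass"
          using eta_mass_pos by (simp add: avg_def field_simps)
        then show "\<bar>(u x - avg (R/2) u) $ i\<bar> = ?d i / eta_mass" using eta_mass_pos by (simp add: abs_divide)
      qed simp
      finally have "ennreal (norm (u x - avg (R/2) u)) \<le> ennreal (\<Sum>i\<in>UNIV. ?d i / eta_mass)" by (rule ennreal_leI)
      also have "\<dots> = (\<Sum>i\<in>UNIV. ennreal (1 / eta_mass) * ennreal (?d i))"
        using eta_mass_pos by (subst sum_ennreal[symmetric]) (auto simp: ennreal_mult[symmetric])
      also have "\<dots> \<le> (\<Sum>i\<in>(UNIV::3 set). ennreal (1 / eta_mass) * (ennreal (1 + 16 * eta_bound) * potential 2 R (\<lambda>y. ennreal (norm (g y))) x))"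
        using elim x by (intro sum_mono mult_left_mono) auto
      also have "\<dots> = (ennreal 3 * ennreal (1 / eta_mass) * ennreal (1 + 16 * eta_bound)) * potential 2 R (\<lambda>y. ennreal (norm (g y))) x"
        by (simp add: mult.assoc)
      also have "ennreal 3 * ennreal (1 / eta_mass) * ennreal (1 + 16 * eta_bound) = ennreal poincare_const"
        unfolding poincare_const_def using eta_mass_pos eta_bound_pos by (subst ennreal_mult[symmetric], simp, simp)+ simp
      finally show "ennreal (norm (u x - avg (R/2) u)) \<le> ennreal poincare_const * potential 2 R (\<lambda>y. ennreal (norm (g y))) x" .
    qed
  qed
qed

lemma measure_ball_3: "0 \<le> r \<Longrightarrow> measure lborel (ball (a::real^3) r) = unit_ball_vol 3 * r^3"
  using content_ball[of r a] by simp

text \<open>Expands the nonnegative integral of (f - m)^2 over the ball, where \<open>m\<close> is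
  the mean.\<close>

lemma integral_square_le:
  fixes f :: "real^3 \<Rightarrow> real"
  assumes [measurable]: "f \<in> borel_measurable borel" and r: "0 < r"
    and i2: "integrable lborel (\<lambda>x. indicator (ball 0 r) x * (f x)\<^sup>2)"
  shows "(LINT x|lborel. indicator (ball 0 r) x * f x)\<^sup>2 \<le> unit_ball_vol 3 * r^3 * (LINT x|lborel. indicator (ball 0 r) x * (f x)\<^sup>2)"
proof -
  define V where "V = measure lborel (ball (0::real^3) r)"
  have V: "V > 0" using r by (simp add: V_def measure_ball_3)
  have iB: "integrable lborel (indicator (ball (0::real^3) r) :: _ \<Rightarrow> real)"
    by (rule integrable_real_indicator) (auto simp: emeasure_lborel_ball_finite[unfolded infinity_ennreal_def])
  have i1: "integrable lborel (\<lambda>x. indicator (ball 0 r) x * f x)"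
  proof (rule Bochner_Integration.integrable_bound)
    show "integrable lborel (\<lambda>x. indicator (ball 0 r) x + indicator (ball 0 r) x * (f x)\<^sup>2)"
      by (intro Bochner_Integration.integrable_add iB i2)
    show "AE x in lborel. norm (indicator (ball 0 r) x * f x) \<le> norm (indicator (ball 0 r) x + indicator (ball 0 r) x * (f x)\<^sup>2)"
    proof (rule AE_I2)
      fix x
      have "\<bar>f x\<bar> \<le> 1 + (f x)\<^sup>2" using zero_le_power2[of "\<bar>f x\<bar> - 1/2"] by (simp add: power2_diff power_divide)
      then show "norm (indicator (ball 0 r) x * f x) \<le> norm (indicator (ball 0 r) x + indicator (ball 0 r) x * (f x)\<^sup>2)"
        by (simp add: indicator_def)
    qed
  qed simp
  define m where "m = (LINT x|lborel. indicator (ball 0 r) x * f x) / V"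
  have "0 \<le> (LINT x|lborel. indicator (ball 0 r) x * (f x - m)\<^sup>2)"
    by (rule Bochner_Integration.integral_nonneg) simp
  also have "\<dots> = (LINT x|lborel. indicator (ball 0 r) x * (f x)\<^sup>2 - 2 * m * (indicator (ball 0 r) x * f x) + m\<^sup>2 * indicator (ball 0 r) x)"
    by (intro Bochner_Integration.integral_cong refl) (simp add: power2_diff algebra_simps)
  also have "\<dots> = (LINT x|lborel. indicator (ball 0 r) x * (f x)\<^sup>2) - 2 * m * (m * V) + m\<^sup>2 * V"
    using V by (simp add: i1 i2 iB V_def[symmetric] m_def)
  finally have "m\<^sup>2 * V \<le> (LINT x|lborel. indicator (ball 0 r) x * (f x)\<^sup>2)" by (simp add: power2_eq_square mult_ac)
  then have "V * (m\<^sup>2 * V) \<le> V * (LINT x|lborel. indicator (ball 0 r) x * (f x)\<^sup>2)" using V by (intro mult_left_mono) auto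
  moreover have "V * (m\<^sup>2 * V) = (LINT x|lborel. indicator (ball 0 r) x * f x)\<^sup>2" using V by (simp add: m_def power2_eq_square)
  moreover have "unit_ball_vol 3 * r^3 = V" using r by (simp add: V_def measure_ball_3)
  ultimately show ?thesis by (simp only:)
qed

definition avg_const :: real where "avg_const = (3 * eta_bound / eta_mass)\<^sup>2 * unit_ball_vol 3"

lemma avg_const_nonneg: "0 \<le> avg_const" by (simp add: avg_const_def)

text \<open>The weight is at most \<open>eta_bound / s^3\<close> and supported in the ball;
  \<open>integral_square_le\<close> passes from |u| to |u|^2.\<close>

lemma norm_avg_le:
  assumes u[measurable]: "u \<in> borel_measurable borel" and i1: "integrable lborel u" and i2: "integrable lborel (\<lambda>x. (norm (u x))\<^sup>2)" and s: "0 < s"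
  shows "(norm (avg s u))\<^sup>2 \<le> avg_const / s^3 * (LINT x|lborel. indicator (ball 0 s) x * (norm (u x))\<^sup>2)"
proof -
  let ?I = "LINT x|lborel. indicator (ball 0 s) x * norm (u x)"
  have ii: "integrable lborel (\<lambda>y. indicator (ball 0 s) y * norm (u y))"
    using integrable_mult_indicator[of "ball 0 s" lborel "\<lambda>y. norm (u y)"] i1 by auto
  have ii2: "integrable lborel (\<lambda>y. indicator (ball 0 s) y * (norm (u y))\<^sup>2)"
    using integrable_mult_indicator[of "ball 0 s" lborel "\<lambda>y. (norm (u y))\<^sup>2"] i2 by auto
  have c: "\<bar>mollify s (\<lambda>y. u y $ i) 0\<bar> \<le> eta_bound / s^3 * ?I" for i
  proof -
    have "\<bar>mollify s (\<lambda>y. u y $ i) 0\<bar> \<le> (LINT y|lborel. eta_bound / s^3 * (indicator (ball 0 s) y * norm (u y)))"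
      unfolding mollify_def
    proof (rule integral_abs_bound[THEN order_trans], rule integral_mono')
      show "integrable lborel (\<lambda>y. eta_bound / s^3 * (indicator (ball 0 s) y * norm (u y)))"
        by (intro integrable_mult_right ii)
      fix y
      show "\<bar>u y $ i * eta s (y - 0)\<bar> \<le> eta_bound / s^3 * (indicator (ball 0 s) y * norm (u y))"
      proof (cases "y \<in> ball 0 s")
        case True
        have "\<bar>u y $ i\<bar> * \<bar>eta s y\<bar> \<le> norm (u y) * (eta_bound / s^3)"
          by (intro mult_mono component_le_norm_cart abs_eta_le s) auto
        then show ?thesis using True by (simp add: abs_mult mult.commute)
      next
        case False
        then have "eta s y = 0" using s by (intro eta_eq_0) auto
        then show ?thesis using False by simp
      qed
      show "0 \<le> eta_bound / s^3 * (indicator (ball 0 s) y * norm (u y))" using eta_bound_pos s by simp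
    qed
    then show ?thesis by simp
  qed
  have I0: "0 \<le> ?I" by (rule Bochner_Integration.integral_nonneg) simp
  have "norm (avg s u) \<le> (\<Sum>i\<in>UNIV. \<bar>avg s u $ i\<bar>)" by (rule norm_le_l1_cart)
  also have "\<dots> \<le> (\<Sum>i\<in>(UNIV::3 set). eta_bound / s^3 * ?I / eta_mass)"
  proof (rule sum_mono)
    fix i :: 3
    have "\<bar>avg s u $ i\<bar> = \<bar>mollify s (\<lambda>y. u y $ i) 0\<bar> / eta_mass"
      using eta_mass_pos by (simp add: avg_def abs_divide)
    also have "\<dots> \<le> eta_bound / s^3 * ?I / eta_mass"
      using eta_mass_pos by (intro divide_right_mono c) simp
    finally show "\<bar>avg s u $ i\<bar> \<le> eta_bound / s^3 * ?I / eta_mass" .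
  qed
  also have "\<dots> = (3 * eta_bound / eta_mass) / s^3 * ?I" by (simp add: mult_ac)
  finally have "norm (avg s u) \<le> (3 * eta_bound / eta_mass) / s^3 * ?I" .
  then have "(norm (avg s u))\<^sup>2 \<le> ((3 * eta_bound / eta_mass) / s^3 * ?I)\<^sup>2" by (rule power_mono) simp
  also have "\<dots> = (3 * eta_bound / eta_mass)\<^sup>2 / (s^3)\<^sup>2 * ?I\<^sup>2" by (simp add: power_mult_distrib power_divide)
  also have "\<dots> \<le> (3 * eta_bound / eta_mass)\<^sup>2 / (s^3)\<^sup>2 * (unit_ball_vol 3 * s^3 * (LINT x|lborel. indicator (ball 0 s) x * (norm (u x))\<^sup>2))"
    using s ii2 by (intro mult_left_mono integral_square_le) auto
  also have "\<dots> = avg_const / s^3 * (LINT x|lborel. indicator (ball 0 s) x * (norm (u x))\<^sup>2)"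
  proof -
    have "a / S\<^sup>2 * (v * S * J) = a * v / S * J" if "S \<noteq> 0" for a v S J :: real
      using that by (simp add: power2_eq_square)
    note this[of "s^3"]
    moreover have "s^3 \<noteq> 0" using s by simp
    ultimately show ?thesis unfolding avg_const_def by blast
  qed
  finally show ?thesis .
qed

subsection \<open>Estimates on a time slice\<close>

lemma ennreal_square_le:
  assumes "x\<^sup>2 \<le> ennreal a" "0 \<le> a" shows "x \<le> ennreal (sqrt a)"
proof (cases x)
  case (real r)
  then have "r\<^sup>2 \<le> a" using assms by (simp add: ennreal_power)
  then show ?thesis using real by (auto intro: real_le_rsqrt ennreal_leI)
next
  case top
  then show ?thesis using assms by (simp add: power2_eq_square ennreal_top_mult top_unique)
qed

lemma nn_integral_CS_sqrt:
  assumes "f \<in> borel_measurable M" "g \<in> borel_measurable M"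
    and f: "(\<integral>\<^sup>+x. (f x)\<^sup>2 \<partial>M) \<le> ennreal \<alpha>" and g: "(\<integral>\<^sup>+x. (g x)\<^sup>2 \<partial>M) \<le> ennreal \<beta>"
    and "0 \<le> \<alpha>" "0 \<le> \<beta>"
  shows "(\<integral>\<^sup>+x. f x * g x \<partial>M) \<le> ennreal (sqrt (\<alpha> * \<beta>))"
proof (rule ennreal_square_le)
  have "(\<integral>\<^sup>+x. f x * g x \<partial>M)\<^sup>2 \<le> (\<integral>\<^sup>+x. (f x)\<^sup>2 \<partial>M) * (\<integral>\<^sup>+x. (g x)\<^sup>2 \<partial>M)"
    by (rule Cauchy_Schwarz_nn_integral[OF assms(1,2)])
  also have "\<dots> \<le> ennreal \<alpha> * ennreal \<beta>" by (rule mult_mono[OF f g]) auto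
  also have "\<dots> = ennreal (\<alpha> * \<beta>)" using assms by (simp add: ennreal_mult)
  finally show "(\<integral>\<^sup>+x. f x * g x \<partial>M)\<^sup>2 \<le> ennreal (\<alpha> * \<beta>)" .
qed (use assms in simp)

lemma indicator_power2: "(indicator S x :: ennreal)\<^sup>2 = indicator S x"
  by (auto split: split_indicator)

section \<open>Constants of the slice estimates\<close>

definition oscillation_const :: real where "oscillation_const = poincare_const\<^sup>2 * riesz_const (11/4)"

lemma oscillation_const_nonneg: "0 \<le> oscillation_const" by (simp add: oscillation_const_def riesz_const_nonneg)

text \<open>From |u - c|^2 \<le> 2|u|^2 + 2|c|^2. The factor 8 in the bound for |c|^2 is cancelled
  by the volume of the ball of radius R/2.\<close>

definition deviation_const :: real where "deviation_const = 2 + 2 * avg_const * unit_ball_vol 3"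

lemma deviation_const_nonneg: "0 \<le> deviation_const" using avg_const_nonneg by (simp add: deviation_const_def)

definition cubic_const :: real where "cubic_const = sqrt deviation_const * oscillation_const * sqrt (riesz_const (5/2))"

definition quartic_const :: real where "quartic_const = riesz_const (5/2) * riesz_const (11/4) * oscillation_const"

lemma quartic_const_nonneg: "0 \<le> quartic_const" by (simp add: quartic_const_def riesz_const_nonneg oscillation_const_nonneg)

definition pressure_const :: real where "pressure_const = sqrt (sqrt ((riesz_const (11/4))\<^sup>2 * (riesz_const (5/2) * quartic_const))) * sqrt deviation_const"

lemma cubic_const_nonneg: "0 \<le> cubic_const" using deviation_const_nonneg oscillation_const_nonneg riesz_const_nonneg by (simp add: cubic_const_def)

text \<open>4 comes from (p + q)^3 \<le> 4p^3 + 4q^3, the power 3/2 of \<open>8 * avg_const\<close>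
  from the bound for |c|^2, and the volume from integrating a constant over a ball.\<close>

definition mean_const :: real where "mean_const = 4 * (8 * avg_const) powr (3/2) * unit_ball_vol 3"

lemma mean_const_nonneg: "0 \<le> mean_const" by (simp add: mean_const_def)

lemma pressure_const_nonneg: "0 \<le> pressure_const" using deviation_const_nonneg quartic_const_nonneg riesz_const_nonneg by (simp add: pressure_const_def)

lemma nn_integral_ball_mono:
  fixes f h :: "real^3 \<Rightarrow> ennreal"
  assumes "AE x in lborel. x \<in> ball 0 r \<longrightarrow> f x \<le> h x" "r \<le> r'"
  shows "(\<integral>\<^sup>+x. indicator (ball 0 r) x * f x \<partial>lborel) \<le> (\<integral>\<^sup>+x. indicator (ball 0 r') x * h x \<partial>lborel)"
  by (rule nn_integral_mono_AE) (use assms(1) in eventually_elim, use assms(2) in \<open>auto simp: indicator_def\<close>)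

text \<open>One time slice. \<open>a2\<close> is an upper bound for the energy, because it will be
  the same for almost all times; \<open>g2\<close> is exact, because it will be integrated in time.
  Hence the integral estimates carried over to cylinders, \<open>w2\<close>, \<open>w3\<close> and
  \<open>P32\<close>, are linear in \<open>g2\<close>.\<close>

locale slice =
  fixes u :: "real^3 \<Rightarrow> real^3" and g :: "real^3 \<Rightarrow> real^3^3" and R a2 g2 :: real
  assumes wg: "weak_grad u g" and R: "0 < R" "R \<le> 1"
    and a2: "(LINT x|lborel. indicator (ball 0 R) x * (norm (u x))\<^sup>2) \<le> a2"
    and g2: "(LINT x|lborel. indicator (ball 0 R) x * (norm (g x))\<^sup>2) = g2"
begin

definition c :: "real^3" where "c = avg (R/2) u"
definition w :: "real^3 \<Rightarrow> real^3" where "w x = u x - c"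

lemma u_borel [measurable]: "u \<in> borel_measurable borel" and g_borel [measurable]: "g \<in> borel_measurable borel"
  using weak_gradD[OF wg] by auto

lemma w_borel [measurable]: "w \<in> borel_measurable borel" unfolding w_def[abs_def] by measurable

lemma integrable_ball: "integrable lborel (\<lambda>x. indicator (ball 0 r) x * (norm (u x))\<^sup>2)"
    "integrable lborel (\<lambda>x. indicator (ball 0 r) x * (norm (g x))\<^sup>2)"
  using integrable_mult_indicator[of "ball 0 r" lborel "\<lambda>x. (norm (u x))\<^sup>2"]
    integrable_mult_indicator[of "ball 0 r" lborel "\<lambda>x. (norm (g x))\<^sup>2"] weak_gradD[OF wg] by auto

lemma a2_nonneg: "0 \<le> a2"
  using a2 by (rule order_trans[rotated]) (rule Bochner_Integration.integral_nonneg, simp)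

lemma g2_nonneg: "0 \<le> g2"
  unfolding g2[symmetric] by (rule Bochner_Integration.integral_nonneg) simp

lemma nn_g2: "(\<integral>\<^sup>+x. indicator (ball 0 R) x * (ennreal (norm (g x)))\<^sup>2 \<partial>lborel) = ennreal g2"
  unfolding g2[symmetric]
  by (subst nn_integral_eq_integral[OF integrable_ball(2), symmetric])
    (auto simp: ennreal_mult ennreal_power ennreal_indicator)

lemma nn_g2_half: "(\<integral>\<^sup>+x. indicator (ball 0 (R/2)) x * (ennreal (norm (g x)))\<^sup>2 \<partial>lborel) \<le> ennreal g2"
  unfolding nn_g2[symmetric] using R
  by (intro nn_integral_mono mult_right_mono) (auto simp: indicator_def)

lemma u2_half: "(LINT x|lborel. indicator (ball 0 (R/2)) x * (norm (u x))\<^sup>2) \<le> a2"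
proof -
  have "(LINT x|lborel. indicator (ball 0 (R/2)) x * (norm (u x))\<^sup>2) \<le> (LINT x|lborel. indicator (ball 0 R) x * (norm (u x))\<^sup>2)"
    by (rule integral_mono[OF integrable_ball(1) integrable_ball(1)]) (use R in \<open>auto simp: indicator_def\<close>)
  with a2 show ?thesis by simp
qed

lemma c_bound: "(norm c)\<^sup>2 \<le> 8 * avg_const * a2 / R^3"
proof -
  have "(norm c)\<^sup>2 \<le> avg_const / (R/2)^3 * (LINT x|lborel. indicator (ball 0 (R/2)) x * (norm (u x))\<^sup>2)"
    unfolding c_def using weak_gradD[OF wg] R by (intro norm_avg_le) auto
  also have "\<dots> \<le> avg_const / (R/2)^3 * a2"
    using R avg_const_nonneg by (intro mult_left_mono u2_half) auto
  also have "\<dots> = 8 * avg_const * a2 / R^3" by (simp add: power_divide)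
  finally show ?thesis .
qed

text \<open>In the Poincare inequality the kernel of order 2 is split as 2 = (5/4 + 11/4)/2. Order
  11/4 is below 3, so the factor without gradient is bounded; and twice 5/4 is still below 3, so the
  remaining potential of the L^1 function |g|^2 is square integrable.\<close>

lemma w_sq_pointwise:
  "AE x in lborel. x \<in> ball 0 (R/2) \<longrightarrow> (ennreal (norm (w x)))\<^sup>2
     \<le> ennreal (oscillation_const * R powr (1/4)) * potential (5/4) R (\<lambda>y. (ennreal (norm (g y)))\<^sup>2) x"
  using poincare_pointwise[OF wg R]
proof eventually_elim
  case (elim x)
  show ?case
  proof
    assume x: "x \<in> ball 0 (R/2)"
    then have xR: "x \<in> ball 0 R" using R by auto
    let ?P = "potential 2 R (\<lambda>y. ennreal (norm (g y))) x"
    let ?G = "potential (5/4) R (\<lambda>y. (ennreal (norm (g y)))\<^sup>2) x"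
    have "?P\<^sup>2 \<le> ?G * potential (11/4) R (\<lambda>_. 1) x"
      using potential_CS[of "\<lambda>y. ennreal (norm (g y))" "\<lambda>_. 1" "5/4" "11/4" R x] by simp
    also have "\<dots> \<le> ?G * ennreal (riesz_const (11/4) * R powr (1/4))"
      using potential_one[of "11/4" R x] R xR by (intro mult_left_mono) auto
    finally have P: "?P\<^sup>2 \<le> ?G * ennreal (riesz_const (11/4) * R powr (1/4))" .
    have "(ennreal (norm (w x)))\<^sup>2 \<le> (ennreal poincare_const * ?P)\<^sup>2"
      using elim x by (intro power_mono) (auto simp: w_def c_def)
    also have "\<dots> = ennreal (poincare_const\<^sup>2) * ?P\<^sup>2"
      using poincare_const_pos by (simp add: power_mult_distrib ennreal_power)
    also have "\<dots> \<le> ennreal (poincare_const\<^sup>2) * (?G * ennreal (riesz_const (11/4) * R powr (1/4)))"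
      by (intro mult_left_mono P) simp
    also have "\<dots> = (ennreal (poincare_const\<^sup>2) * ennreal (riesz_const (11/4) * R powr (1/4))) * ?G" by (simp only: mult_ac)
    also have "ennreal (poincare_const\<^sup>2) * ennreal (riesz_const (11/4) * R powr (1/4)) = ennreal (oscillation_const * R powr (1/4))"
      using riesz_const_nonneg by (subst ennreal_mult[symmetric]) (auto simp: oscillation_const_def mult.assoc)
    finally show "(ennreal (norm (w x)))\<^sup>2 \<le> ennreal (oscillation_const * R powr (1/4)) * ?G" .
  qed
qed

lemma w2: "(\<integral>\<^sup>+x. indicator (ball 0 (R/2)) x * (ennreal (norm (w x)))\<^sup>2 \<partial>lborel) \<le> ennreal (oscillation_const * riesz_const (5/4) * R\<^sup>2 * g2)"
proof -
  let ?G = "potential (5/4) R (\<lambda>y. (ennreal (norm (g y)))\<^sup>2)"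
  have "(\<integral>\<^sup>+x. indicator (ball 0 (R/2)) x * (ennreal (norm (w x)))\<^sup>2 \<partial>lborel)
     \<le> (\<integral>\<^sup>+x. indicator (ball 0 R) x * (ennreal (oscillation_const * R powr (1/4)) * ?G x) \<partial>lborel)"
    by (rule nn_integral_ball_mono[OF w_sq_pointwise]) (use R in simp)
  also have "\<dots> = ennreal (oscillation_const * R powr (1/4)) * (\<integral>\<^sup>+x. indicator (ball 0 R) x * ?G x \<partial>lborel)"
    by (subst nn_integral_cmult[symmetric]) (auto simp: mult_ac)
  also have "\<dots> \<le> ennreal (oscillation_const * R powr (1/4)) * (ennreal (riesz_const (5/4) * R powr (3 - 5/4)) *
      (\<integral>\<^sup>+x. indicator (ball 0 R) x * (ennreal (norm (g x)))\<^sup>2 \<partial>lborel))"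
    using R by (intro mult_left_mono potential_L1) auto
  also have "\<dots> = ennreal (oscillation_const * R powr (1/4) * (riesz_const (5/4) * R powr (3 - 5/4) * g2))"
    unfolding nn_g2 using oscillation_const_nonneg g2_nonneg by (simp add: ennreal_mult riesz_const_nonneg)
  also have "oscillation_const * R powr (1/4) * (riesz_const (5/4) * R powr (3 - 5/4) * g2) = oscillation_const * riesz_const (5/4) * R\<^sup>2 * g2"
  proof -
    have "R powr (1/4) * R powr (3 - 5/4) = R\<^sup>2" using R by (simp add: powr_add[symmetric])
    then have "oscillation_const * riesz_const (5/4) * (R powr (1/4) * R powr (3 - 5/4)) * g2 = oscillation_const * riesz_const (5/4) * R\<^sup>2 * g2" by (simp only:)
    then show ?thesis by (simp only: mult_ac)
  qed
  finally show ?thesis .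
qed

text \<open>The potential of order 5/4 takes |g|^2 from L^1 to L^2, so \<open>w\<close> is in L^4.
  This estimate does the work of a Sobolev embedding.\<close>

lemma w4: "(\<integral>\<^sup>+x. indicator (ball 0 (R/2)) x * (ennreal (norm (w x)))^4 \<partial>lborel) \<le> ennreal (oscillation_const\<^sup>2 * riesz_const (5/2) * R * g2\<^sup>2)"
proof -
  let ?G = "potential (5/4) R (\<lambda>y. (ennreal (norm (g y)))\<^sup>2)"
  have "AE x in lborel. x \<in> ball 0 (R/2) \<longrightarrow> (ennreal (norm (w x)))^4 \<le> (ennreal (oscillation_const * R powr (1/4)) * ?G x)\<^sup>2"
    using w_sq_pointwise
  proof eventually_elim
    case (elim x)
    then show ?case
      using power_mono[of "(ennreal (norm (w x)))\<^sup>2" "ennreal (oscillation_const * R powr (1/4)) * ?G x" 2] by auto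
  qed
  then have "(\<integral>\<^sup>+x. indicator (ball 0 (R/2)) x * (ennreal (norm (w x)))^4 \<partial>lborel)
     \<le> (\<integral>\<^sup>+x. indicator (ball 0 R) x * (ennreal (oscillation_const * R powr (1/4)) * ?G x)\<^sup>2 \<partial>lborel)"
    by (rule nn_integral_ball_mono) (use R in simp)
  also have "\<dots> = (ennreal (oscillation_const * R powr (1/4)))\<^sup>2 * (\<integral>\<^sup>+x. indicator (ball 0 R) x * (?G x)\<^sup>2 \<partial>lborel)"
    by (subst nn_integral_cmult[symmetric]) (auto simp: power_mult_distrib mult_ac)
  also have "\<dots> \<le> (ennreal (oscillation_const * R powr (1/4)))\<^sup>2 * (ennreal (riesz_const (2*(5/4)) * R powr (3 - 2*(5/4))) *
      (\<integral>\<^sup>+x. indicator (ball 0 R) x * (ennreal (norm (g x)))\<^sup>2 \<partial>lborel)\<^sup>2)"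
    using R by (intro mult_left_mono potential_L2_of_L1) auto
  also have "\<dots> = ennreal ((oscillation_const * R powr (1/4))\<^sup>2 * (riesz_const (5/2) * R powr (1/2) * g2\<^sup>2))"
    unfolding nn_g2 using oscillation_const_nonneg g2_nonneg
    by (simp add: ennreal_mult riesz_const_nonneg ennreal_power[symmetric] power_mult_distrib)
  also have "(oscillation_const * R powr (1/4))\<^sup>2 * (riesz_const (5/2) * R powr (1/2) * g2\<^sup>2) = oscillation_const\<^sup>2 * riesz_const (5/2) * R * g2\<^sup>2"
  proof -
    have "(R powr (1/4))\<^sup>2 * R powr (1/2) = R" using R by (simp add: powr_add[symmetric] power2_eq_square)
    then have "oscillation_const\<^sup>2 * riesz_const (5/2) * ((R powr (1/4))\<^sup>2 * R powr (1/2)) * g2\<^sup>2 = oscillation_const\<^sup>2 * riesz_const (5/2) * R * g2\<^sup>2" by simp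
    then show ?thesis by (simp only: power_mult_distrib mult_ac)
  qed
  finally show ?thesis .
qed

text \<open>A bound without the gradient, to be combined with bounds that contain too high a power
  of \<open>g2\<close>.\<close>

lemma w2_energy: "(\<integral>\<^sup>+x. indicator (ball 0 (R/2)) x * (ennreal (norm (w x)))\<^sup>2 \<partial>lborel) \<le> ennreal (deviation_const * a2)"
proof -
  have iB: "integrable lborel (indicator (ball (0::real^3) (R/2)) :: _ \<Rightarrow> real)"
    by (rule integrable_real_indicator) (auto simp: emeasure_lborel_ball_finite[unfolded infinity_ennreal_def])
  have I: "integrable lborel (\<lambda>x. 2 * (indicator (ball 0 (R/2)) x * (norm (u x))\<^sup>2) + 2 * (norm c)\<^sup>2 * indicator (ball 0 (R/2)) x)"
    by (intro Bochner_Integration.integrable_add integrable_mult_right integrable_ball iB)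
  have "(\<integral>\<^sup>+x. indicator (ball 0 (R/2)) x * (ennreal (norm (w x)))\<^sup>2 \<partial>lborel)
     \<le> (\<integral>\<^sup>+x. ennreal (2 * (indicator (ball 0 (R/2)) x * (norm (u x))\<^sup>2) + 2 * (norm c)\<^sup>2 * indicator (ball 0 (R/2)) x) \<partial>lborel)"
  proof (intro nn_integral_mono)
    fix x
    have "norm (w x) \<le> norm (u x) + norm c" unfolding w_def by (rule norm_triangle_ineq4)
    then have "(norm (w x))\<^sup>2 \<le> (norm (u x) + norm c)\<^sup>2" by (rule power_mono) simp
    also have "\<dots> \<le> 2 * (norm (u x))\<^sup>2 + 2 * (norm c)\<^sup>2"
      using zero_le_power2[of "norm (u x) - norm c"] by (simp add: power2_sum power2_diff)
    finally show "indicator (ball 0 (R/2)) x * (ennreal (norm (w x)))\<^sup>2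
       \<le> ennreal (2 * (indicator (ball 0 (R/2)) x * (norm (u x))\<^sup>2) + 2 * (norm c)\<^sup>2 * indicator (ball 0 (R/2)) x)"
      by (cases "x \<in> ball 0 (R/2)") (simp_all add: ennreal_power ennreal_leI del: ennreal_plus)
  qed
  also have "\<dots> = ennreal (LINT x|lborel. 2 * (indicator (ball 0 (R/2)) x * (norm (u x))\<^sup>2) + 2 * (norm c)\<^sup>2 * indicator (ball 0 (R/2)) x)"
    by (rule nn_integral_eq_integral[OF I]) simp
  also have "(LINT x|lborel. 2 * (indicator (ball 0 (R/2)) x * (norm (u x))\<^sup>2) + 2 * (norm c)\<^sup>2 * indicator (ball 0 (R/2)) x)
     = 2 * (LINT x|lborel. indicator (ball 0 (R/2)) x * (norm (u x))\<^sup>2) + 2 * (norm c)\<^sup>2 * (unit_ball_vol 3 * (R/2)^3)"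
    using R iB integrable_ball(1) by (simp add: measure_ball_3)
  also have "ennreal \<dots> \<le> ennreal (deviation_const * a2)"
  proof (rule ennreal_leI)
    have "2 * (norm c)\<^sup>2 * (unit_ball_vol 3 * (R/2)^3) \<le> 2 * (8 * avg_const * a2 / R^3) * (unit_ball_vol 3 * (R/2)^3)"
      using c_bound R by (intro mult_right_mono mult_left_mono) auto
    also have "\<dots> = 2 * avg_const * unit_ball_vol 3 * a2" using R by (simp add: power_divide)
    finally have "2 * (norm c)\<^sup>2 * (unit_ball_vol 3 * (R/2)^3) \<le> 2 * avg_const * unit_ball_vol 3 * a2" .
    moreover have "deviation_const * a2 = 2 * a2 + 2 * avg_const * unit_ball_vol 3 * a2" by (simp add: deviation_const_def algebra_simps)
    ultimately show "2 * (LINT x|lborel. indicator (ball 0 (R/2)) x * (norm (u x))\<^sup>2) + 2 * (norm c)\<^sup>2 * (unit_ball_vol 3 * (R/2)^3) \<le> deviation_const * a2"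
      using u2_half by linarith
  qed
  finally show ?thesis .
qed

text \<open>|w|^3 = |w| |w|^2, with \<open>w2_energy\<close> for the one factor and
  \<open>w4\<close> for the other. The square root of g2^2 from \<open>w4\<close> makes the result
  linear in \<open>g2\<close>.\<close>

lemma w3: "(\<integral>\<^sup>+x. indicator (ball 0 (R/2)) x * (ennreal (norm (w x)))^3 \<partial>lborel) \<le> ennreal (cubic_const * sqrt (a2 * R) * g2)"
proof -
  have "(\<integral>\<^sup>+x. indicator (ball 0 (R/2)) x * (ennreal (norm (w x)))^3 \<partial>lborel)
     = (\<integral>\<^sup>+x. (indicator (ball 0 (R/2)) x * ennreal (norm (w x))) * (indicator (ball 0 (R/2)) x * (ennreal (norm (w x)))\<^sup>2) \<partial>lborel)"
    by (intro nn_integral_cong) (auto simp: indicator_def power3_eq_cube power2_eq_square mult_ac)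
  also have "\<dots> \<le> ennreal (sqrt ((deviation_const * a2) * (oscillation_const\<^sup>2 * riesz_const (5/2) * R * g2\<^sup>2)))"
  proof (rule nn_integral_CS_sqrt)
    show "(\<integral>\<^sup>+x. (indicator (ball 0 (R/2)) x * ennreal (norm (w x)))\<^sup>2 \<partial>lborel) \<le> ennreal (deviation_const * a2)"
      using w2_energy by (simp add: power_mult_distrib indicator_power2)
    show "(\<integral>\<^sup>+x. (indicator (ball 0 (R/2)) x * (ennreal (norm (w x)))\<^sup>2)\<^sup>2 \<partial>lborel) \<le> ennreal (oscillation_const\<^sup>2 * riesz_const (5/2) * R * g2\<^sup>2)"
      using w4 by (simp add: power_mult_distrib indicator_power2)
  qed (use deviation_const_nonneg a2_nonneg oscillation_const_nonneg R riesz_const_nonneg in auto)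
  also have "sqrt ((deviation_const * a2) * (oscillation_const\<^sup>2 * riesz_const (5/2) * R * g2\<^sup>2)) = cubic_const * sqrt (a2 * R) * g2"
    using oscillation_const_nonneg g2_nonneg by (simp add: real_sqrt_mult cubic_const_def)
  finally show ?thesis .
qed

text \<open>Majorant of \<open>eta_mass\<close> times the pressure minus its mollification: with
  \<open>w\<close> in place of \<open>u\<close> in the convective term, the pressure equation
  represents that difference by an integral of g w against a kernel of order 2.\<close>

definition P :: "real^3 \<Rightarrow> ennreal" where "P = potential 2 (R/2) (\<lambda>y. ennreal (norm (g y)) * ennreal (norm (w y)))"

lemma P_borel [measurable]: "P \<in> borel_measurable borel" unfolding P_def by measurable

text \<open>Again 2 = (5/4 + 11/4)/2, with order 5/4 for |g|^2 and order 11/4 for |w|^2: the former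
  potential is in L^2 by \<open>potential_L2_of_L1\<close>, the latter by
  \<open>potential_L2_of_L2\<close> and \<open>w4\<close>. The bound is quadratic in
  \<open>g2\<close> and thus not suited to integration in time; it is the input to
  \<open>P32\<close>.\<close>

lemma P2: "(\<integral>\<^sup>+x. indicator (ball 0 (R/2)) x * (P x)\<^sup>2 \<partial>lborel) \<le> ennreal (quartic_const * R * g2\<^sup>2)"
proof -
  let ?S = "R/2"
  let ?G = "potential (5/4) ?S (\<lambda>y. (ennreal (norm (g y)))\<^sup>2)"
  let ?W = "potential (11/4) ?S (\<lambda>y. (ennreal (norm (w y)))\<^sup>2)"
  have S: "0 < ?S" using R by simp
  have "(P x)\<^sup>2 \<le> ?G x * ?W x" for x
    using potential_CS[of "\<lambda>y. ennreal (norm (g y))" "\<lambda>y. ennreal (norm (w y))" "5/4" "11/4" ?S x]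
    by (simp add: P_def)
  then have "(\<integral>\<^sup>+x. indicator (ball 0 ?S) x * (P x)\<^sup>2 \<partial>lborel)
      \<le> (\<integral>\<^sup>+x. (indicator (ball 0 ?S) x * ?G x) * (indicator (ball 0 ?S) x * ?W x) \<partial>lborel)"
    by (intro nn_integral_mono) (auto simp: indicator_def)
  also have "\<dots> \<le> ennreal (sqrt ((riesz_const (5/2) * ?S powr (1/2) * g2\<^sup>2) * ((riesz_const (11/4) * ?S powr (1/4))\<^sup>2 * (oscillation_const\<^sup>2 * riesz_const (5/2) * R * g2\<^sup>2))))"
  proof (rule nn_integral_CS_sqrt)
    have "(\<integral>\<^sup>+x. (indicator (ball 0 ?S) x * ?G x)\<^sup>2 \<partial>lborel) = (\<integral>\<^sup>+x. indicator (ball 0 ?S) x * (?G x)\<^sup>2 \<partial>lborel)"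
      by (simp add: power_mult_distrib indicator_power2)
    also have "\<dots> \<le> ennreal (riesz_const (2*(5/4)) * ?S powr (3 - 2*(5/4))) * (\<integral>\<^sup>+y. indicator (ball 0 ?S) y * (ennreal (norm (g y)))\<^sup>2 \<partial>lborel)\<^sup>2"
      by (rule potential_L2_of_L1) (use S in auto)
    also have "\<dots> \<le> ennreal (riesz_const (2*(5/4)) * ?S powr (3 - 2*(5/4))) * (ennreal g2)\<^sup>2"
      by (intro mult_left_mono power_mono nn_g2_half) auto
    also have "\<dots> = ennreal (riesz_const (5/2) * ?S powr (1/2) * g2\<^sup>2)"
      using g2_nonneg by (simp add: ennreal_mult riesz_const_nonneg ennreal_power)
    finally show "(\<integral>\<^sup>+x. (indicator (ball 0 ?S) x * ?G x)\<^sup>2 \<partial>lborel) \<le> ennreal (riesz_const (5/2) * ?S powr (1/2) * g2\<^sup>2)" .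
    have "(\<integral>\<^sup>+x. (indicator (ball 0 ?S) x * ?W x)\<^sup>2 \<partial>lborel) = (\<integral>\<^sup>+x. indicator (ball 0 ?S) x * (?W x)\<^sup>2 \<partial>lborel)"
      by (simp add: power_mult_distrib indicator_power2)
    also have "\<dots> \<le> (ennreal (riesz_const (11/4) * ?S powr (3 - 11/4)))\<^sup>2 * (\<integral>\<^sup>+y. indicator (ball 0 ?S) y * ((ennreal (norm (w y)))\<^sup>2)\<^sup>2 \<partial>lborel)"
      by (rule potential_L2_of_L2) (use S in auto)
    also have "\<dots> \<le> (ennreal (riesz_const (11/4) * ?S powr (3 - 11/4)))\<^sup>2 * ennreal (oscillation_const\<^sup>2 * riesz_const (5/2) * R * g2\<^sup>2)"
      using w4 by (intro mult_left_mono) auto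
    also have "\<dots> = ennreal ((riesz_const (11/4) * ?S powr (1/4))\<^sup>2 * (oscillation_const\<^sup>2 * riesz_const (5/2) * R * g2\<^sup>2))"
      using R g2_nonneg oscillation_const_nonneg by (simp add: ennreal_mult riesz_const_nonneg ennreal_power[symmetric] power_mult_distrib)
    finally show "(\<integral>\<^sup>+x. (indicator (ball 0 ?S) x * ?W x)\<^sup>2 \<partial>lborel) \<le> ennreal ((riesz_const (11/4) * ?S powr (1/4))\<^sup>2 * (oscillation_const\<^sup>2 * riesz_const (5/2) * R * g2\<^sup>2))" .
  qed (use R riesz_const_nonneg in auto)
  also have "\<dots> \<le> ennreal (quartic_const * R * g2\<^sup>2)"
  proof (rule ennreal_leI, rule real_le_lsqrt)
    have "?S powr (1/2) * (?S powr (1/4))\<^sup>2 = ?S" using S by (simp add: powr_add[symmetric] power2_eq_square)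
    then have "(riesz_const (5/2) * ?S powr (1/2) * g2\<^sup>2) * ((riesz_const (11/4) * ?S powr (1/4))\<^sup>2 * (oscillation_const\<^sup>2 * riesz_const (5/2) * R * g2\<^sup>2))
       = (riesz_const (5/2) * riesz_const (11/4) * oscillation_const * g2\<^sup>2)\<^sup>2 * (?S * R)"
      by (simp add: power2_eq_square mult_ac)
    also have "\<dots> \<le> (riesz_const (5/2) * riesz_const (11/4) * oscillation_const * g2\<^sup>2)\<^sup>2 * (R * R)"
      using R by (intro mult_left_mono mult_right_mono) auto
    also have "\<dots> = (quartic_const * R * g2\<^sup>2)\<^sup>2" by (simp add: quartic_const_def power2_eq_square mult_ac)
    finally show "(riesz_const (5/2) * ?S powr (1/2) * g2\<^sup>2) * ((riesz_const (11/4) * ?S powr (1/4))\<^sup>2 * (oscillation_const\<^sup>2 * riesz_const (5/2) * R * g2\<^sup>2)) \<le> (quartic_const * R * g2\<^sup>2)\<^sup>2" .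
  qed (use quartic_const_nonneg R in auto)
  finally show ?thesis .
qed

text \<open>A duality argument. P^{3/2} = P sqrt(P), and by Tonelli its integral is that of |g| |w|
  against the potential of sqrt(P). That potential is bounded pointwise by the fourth root of the
  bound in \<open>P2\<close>, of order sqrt(g2), while the integral of |g| |w| contributes another
  sqrt(g2). The total is linear in \<open>g2\<close>.\<close>

lemma P32:
  assumes q: "\<And>x. 0 \<le> q x" and qP: "AE x in lborel. x \<in> ball 0 (R/2) \<longrightarrow> ennreal (q x) \<le> P x" "r \<le> R/2"
  shows "(\<integral>\<^sup>+x. indicator (ball 0 r) x * ennreal (q x powr (3/2)) \<partial>lborel) \<le> ennreal (pressure_const * sqrt (R * a2) * g2)"
proof -
  let ?S = "R/2"
  have S: "0 < ?S" using R by simp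
  \<comment> \<open>\<open>P2\<close> makes \<open>P\<close> finite almost everywhere on the ball,
    so that its real value \<open>p\<close> represents it and has a real square root.\<close>
  define p where "p x = enn2real (P x)" for x
  have p_borel [measurable]: "p \<in> borel_measurable borel" unfolding p_def[abs_def] by measurable
  have p0: "0 \<le> p x" for x by (simp add: p_def)
  have pP: "ennreal (p x) \<le> P x" for x unfolding p_def by (cases "P x") auto
  have "(\<integral>\<^sup>+x. indicator (ball 0 ?S) x * (P x)\<^sup>2 \<partial>lborel) \<noteq> \<infinity>"
    using P2 by (metis ennreal_less_top infinity_ennreal_def leD)
  then have "AE x in lborel. indicator (ball 0 ?S) x * (P x)\<^sup>2 \<noteq> \<infinity>"
    by (intro nn_integral_PInf_AE) auto
  then have fin: "AE x in lborel. x \<in> ball 0 ?S \<longrightarrow> P x = ennreal (p x)"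
    by eventually_elim (auto simp: p_def power2_eq_square less_top[symmetric] ennreal_enn2real_if ennreal_mult_eq_top_iff)
  let ?f = "\<lambda>y. ennreal (norm (g y)) * ennreal (norm (w y))"
  let ?h = "\<lambda>x. ennreal (sqrt (p x))"
  have "(\<integral>\<^sup>+x. indicator (ball 0 r) x * ennreal (q x powr (3/2)) \<partial>lborel) \<le> (\<integral>\<^sup>+x. indicator (ball 0 ?S) x * (P x * ?h x) \<partial>lborel)"
  proof (rule nn_integral_mono_AE)
    show "AE x in lborel. indicator (ball 0 r) x * ennreal (q x powr (3/2)) \<le> indicator (ball 0 ?S) x * (P x * ?h x)"
      using fin qP(1)
    proof eventually_elim
      case (elim x)
      show ?case
      proof (cases "x \<in> ball 0 r")
        case True
        then have x: "x \<in> ball 0 ?S" using qP(2) by auto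
        then have "q x \<le> p x" using elim p0 by (auto simp: ennreal_le_iff)
        then have "q x powr (3/2) \<le> p x powr (3/2)" using q by (intro powr_mono2) auto
        also have "p x powr (3/2) = p x * sqrt (p x)"
        proof (cases "p x = 0")
          case False
          then show ?thesis using p0[of x] powr_add[of "p x" 1 "1/2"] by (simp add: powr_half_sqrt)
        qed simp
        finally have "ennreal (q x powr (3/2)) \<le> P x * ?h x"
          using elim(1) x p0[of x] by (simp add: ennreal_mult[symmetric] ennreal_leI)
        then show ?thesis using True x by simp
      qed simp
    qed
  qed
  also have "\<dots> = (\<integral>\<^sup>+x. \<integral>\<^sup>+y. indicator (ball 0 ?S) x * ?h x * (indicator (ball 0 ?S) y * ?f y * riesz 2 (x - y)) \<partial>lborel \<partial>lborel)"
    unfolding P_def potential_def by (subst nn_integral_cmult) (auto simp: mult_ac)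
  also have "\<dots> = (\<integral>\<^sup>+y. \<integral>\<^sup>+x. indicator (ball 0 ?S) x * ?h x * (indicator (ball 0 ?S) y * ?f y * riesz 2 (x - y)) \<partial>lborel \<partial>lborel)"
    by (rule lborel_pair.Fubini') simp
  also have "\<dots> = (\<integral>\<^sup>+y. indicator (ball 0 ?S) y * ?f y * potential 2 ?S ?h y \<partial>lborel)"
    unfolding potential_def by (subst nn_integral_cmult[symmetric]) (auto simp: mult_ac riesz_commute)
  also have "\<dots> \<le> (\<integral>\<^sup>+y. indicator (ball 0 ?S) y * ?f y * ennreal (sqrt (sqrt ((riesz_const (11/4) * ?S powr (1/4))\<^sup>2 * (riesz_const (5/2) * ?S powr (1/2) * (quartic_const * R * g2\<^sup>2))))) \<partial>lborel)"
  proof (rule nn_integral_mono)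
    fix y
    show "indicator (ball 0 ?S) y * ?f y * potential 2 ?S ?h y
      \<le> indicator (ball 0 ?S) y * ?f y * ennreal (sqrt (sqrt ((riesz_const (11/4) * ?S powr (1/4))\<^sup>2 * (riesz_const (5/2) * ?S powr (1/2) * (quartic_const * R * g2\<^sup>2)))))"
    proof (cases "y \<in> ball 0 ?S")
      case True
      have h2: "(?h x)\<^sup>2 = ennreal (p x)" for x using p0[of x] by (simp add: ennreal_power)
      \<comment> \<open>Two splittings in a row, 2 = (11/4 + 5/4)/2 and 5/4 = (5/2 + 0)/2. The
        potential of order 0 is at most the plain integral of p^2, which \<open>P2\<close>
        bounds.\<close>
      have A: "(potential 2 ?S ?h y)\<^sup>2 \<le> potential (11/4) ?S (\<lambda>_. 1) y * potential (5/4) ?S (\<lambda>x. ennreal (p x)) y"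
        using potential_CS[of "\<lambda>_. 1" ?h "11/4" "5/4" ?S y] by (simp add: h2)
      have B: "(potential (5/4) ?S (\<lambda>x. ennreal (p x)) y)\<^sup>2 \<le> potential (5/2) ?S (\<lambda>_. 1) y * potential 0 ?S (\<lambda>x. (ennreal (p x))\<^sup>2) y"
        using potential_CS[of "\<lambda>_. 1" "\<lambda>x. ennreal (p x)" "5/2" 0 ?S y] by simp
      have B2: "potential 0 ?S (\<lambda>x. (ennreal (p x))\<^sup>2) y \<le> ennreal (quartic_const * R * g2\<^sup>2)"
      proof -
        have "potential 0 ?S (\<lambda>x. (ennreal (p x))\<^sup>2) y \<le> (\<integral>\<^sup>+x. indicator (ball 0 ?S) x * (P x)\<^sup>2 \<partial>lborel)"
          unfolding potential_def
        proof (intro nn_integral_mono)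
          fix x
          have "riesz 0 (y - x) \<le> 1" by (simp add: riesz_def)
          then have "indicator (ball 0 ?S) x * (ennreal (p x))\<^sup>2 * riesz 0 (y - x) \<le> indicator (ball 0 ?S) x * (P x)\<^sup>2 * 1"
            by (intro mult_mono power_mono pP) auto
          then show "indicator (ball 0 ?S) x * (ennreal (p x))\<^sup>2 * riesz 0 (y - x) \<le> indicator (ball 0 ?S) x * (P x)\<^sup>2" by simp
        qed
        with P2 show ?thesis by (rule order_trans[rotated])
      qed
      have C1: "potential (11/4) ?S (\<lambda>_. 1) y \<le> ennreal (riesz_const (11/4) * ?S powr (1/4))"
        using potential_one[of "11/4" ?S y] S True by simp
      have C2: "potential (5/2) ?S (\<lambda>_. 1) y \<le> ennreal (riesz_const (5/2) * ?S powr (1/2))"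
        using potential_one[of "5/2" ?S y] S True by simp
      have "((potential 2 ?S ?h y)\<^sup>2)\<^sup>2 \<le> (potential (11/4) ?S (\<lambda>_. 1) y * potential (5/4) ?S (\<lambda>x. ennreal (p x)) y)\<^sup>2"
        by (intro power_mono A) simp
      also have "\<dots> = (potential (11/4) ?S (\<lambda>_. 1) y)\<^sup>2 * (potential (5/4) ?S (\<lambda>x. ennreal (p x)) y)\<^sup>2"
        by (rule power_mult_distrib)
      also have "\<dots> \<le> (ennreal (riesz_const (11/4) * ?S powr (1/4)))\<^sup>2 * (ennreal (riesz_const (5/2) * ?S powr (1/2)) * ennreal (quartic_const * R * g2\<^sup>2))"
        by (intro mult_mono power_mono C1 order_trans[OF B] C2 B2) auto
      also have "\<dots> = ennreal ((riesz_const (11/4) * ?S powr (1/4))\<^sup>2 * (riesz_const (5/2) * ?S powr (1/2) * (quartic_const * R * g2\<^sup>2)))"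
        using quartic_const_nonneg R g2_nonneg by (simp add: ennreal_mult riesz_const_nonneg ennreal_power[symmetric] power_mult_distrib)
      finally have "((potential 2 ?S ?h y)\<^sup>2)\<^sup>2 \<le> ennreal ((riesz_const (11/4) * ?S powr (1/4))\<^sup>2 * (riesz_const (5/2) * ?S powr (1/2) * (quartic_const * R * g2\<^sup>2)))" .
      then have "(potential 2 ?S ?h y)\<^sup>2 \<le> ennreal (sqrt ((riesz_const (11/4) * ?S powr (1/4))\<^sup>2 * (riesz_const (5/2) * ?S powr (1/2) * (quartic_const * R * g2\<^sup>2))))"
        by (rule ennreal_square_le) (use quartic_const_nonneg R riesz_const_nonneg in auto)
      then have "potential 2 ?S ?h y \<le> ennreal (sqrt (sqrt ((riesz_const (11/4) * ?S powr (1/4))\<^sup>2 * (riesz_const (5/2) * ?S powr (1/2) * (quartic_const * R * g2\<^sup>2)))))"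
        by (rule ennreal_square_le) (use quartic_const_nonneg R riesz_const_nonneg in auto)
      then show ?thesis by (intro mult_left_mono) auto
    qed simp
  qed
  also have "\<dots> = (\<integral>\<^sup>+y. (indicator (ball 0 ?S) y * ennreal (norm (g y))) * (indicator (ball 0 ?S) y * ennreal (norm (w y))) \<partial>lborel)
      * ennreal (sqrt (sqrt ((riesz_const (11/4) * ?S powr (1/4))\<^sup>2 * (riesz_const (5/2) * ?S powr (1/2) * (quartic_const * R * g2\<^sup>2)))))"
    by (subst nn_integral_multc[symmetric]) (auto intro!: nn_integral_cong simp: indicator_def)
  also have "\<dots> \<le> ennreal (sqrt (g2 * (deviation_const * a2)))
      * ennreal (sqrt (sqrt ((riesz_const (11/4) * ?S powr (1/4))\<^sup>2 * (riesz_const (5/2) * ?S powr (1/2) * (quartic_const * R * g2\<^sup>2)))))"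
  proof (intro mult_right_mono nn_integral_CS_sqrt)
    show "(\<integral>\<^sup>+y. (indicator (ball 0 ?S) y * ennreal (norm (g y)))\<^sup>2 \<partial>lborel) \<le> ennreal g2"
      using nn_g2_half by (simp add: power_mult_distrib indicator_power2)
    show "(\<integral>\<^sup>+y. (indicator (ball 0 ?S) y * ennreal (norm (w y)))\<^sup>2 \<partial>lborel) \<le> ennreal (deviation_const * a2)"
      using w2_energy by (simp add: power_mult_distrib indicator_power2)
  qed (use g2_nonneg deviation_const_nonneg a2_nonneg in auto)
  also have "\<dots> \<le> ennreal (pressure_const * sqrt (R * a2) * g2)"
  proof -
    have "(?S powr (1/4))\<^sup>2 * ?S powr (1/2) = ?S" using S by (simp add: powr_add[symmetric] power2_eq_square)
    then have "(riesz_const (11/4))\<^sup>2 * (riesz_const (5/2) * quartic_const) * (((?S powr (1/4))\<^sup>2 * ?S powr (1/2)) * R * g2\<^sup>2)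
      \<le> (riesz_const (11/4))\<^sup>2 * (riesz_const (5/2) * quartic_const) * (R * R * g2\<^sup>2)"
      using R quartic_const_nonneg riesz_const_nonneg by (intro mult_left_mono mult_right_mono) auto
    then have "sqrt (sqrt ((riesz_const (11/4) * ?S powr (1/4))\<^sup>2 * (riesz_const (5/2) * ?S powr (1/2) * (quartic_const * R * g2\<^sup>2))))
       \<le> sqrt (sqrt ((riesz_const (11/4))\<^sup>2 * (riesz_const (5/2) * quartic_const) * (R * g2)\<^sup>2))"
      by (intro real_sqrt_le_mono) (simp add: power_mult_distrib power2_eq_square mult_ac)
    also have "\<dots> = sqrt (sqrt ((riesz_const (11/4))\<^sup>2 * (riesz_const (5/2) * quartic_const))) * sqrt (R * g2)"
      using R g2_nonneg by (simp add: real_sqrt_mult)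
    finally have "sqrt (g2 * (deviation_const * a2)) * sqrt (sqrt ((riesz_const (11/4) * ?S powr (1/4))\<^sup>2 * (riesz_const (5/2) * ?S powr (1/2) * (quartic_const * R * g2\<^sup>2))))
       \<le> sqrt (g2 * (deviation_const * a2)) * (sqrt (sqrt ((riesz_const (11/4))\<^sup>2 * (riesz_const (5/2) * quartic_const))) * sqrt (R * g2))"
      using g2_nonneg deviation_const_nonneg a2_nonneg by (intro mult_left_mono) auto
    also have "\<dots> = pressure_const * sqrt (R * a2) * (sqrt g2 * sqrt g2)"
      by (simp add: pressure_const_def real_sqrt_mult mult_ac)
    also have "\<dots> = pressure_const * sqrt (R * a2) * g2" using g2_nonneg by simp
    finally show ?thesis
      using g2_nonneg deviation_const_nonneg a2_nonneg quartic_const_nonneg R riesz_const_nonneg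
      by (subst ennreal_mult[symmetric]) (auto intro!: ennreal_leI)
  qed
  finally show ?thesis .
qed

end

subsection \<open>Estimates on a parabolic cylinder\<close>

lemma nn_integral_spacetime:
  assumes "f \<in> borel_measurable (borel :: ('a::euclidean_space \<times> 'b::euclidean_space) measure)"
  shows "(\<integral>\<^sup>+z. f z \<partial>lborel) = (\<integral>\<^sup>+t. \<integral>\<^sup>+x. f (x, t) \<partial>lborel \<partial>lborel)"
  using lborel_pair.nn_integral_snd[of f] assms by (simp add: lborel_prod)

lemma AE_spacetime:
  fixes Pr :: "'a::euclidean_space \<times> 'b::euclidean_space \<Rightarrow> bool"
  assumes "AE z in lborel. Pr z" shows "AE t in lborel. AE x in lborel. Pr (x, t)"
proof -
  obtain N where N: "N \<in> null_sets lborel" "{z. \<not> Pr z} \<subseteq> N" using assms by (auto simp: eventually_ae_filter)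
  have [measurable]: "N \<in> sets borel" using N(1) by auto
  have "(\<integral>\<^sup>+t. \<integral>\<^sup>+x. indicator N (x, t) \<partial>lborel \<partial>lborel) = 0"
    using nn_integral_spacetime[of "indicator N"] N(1) by auto
  then have "AE t in lborel. (\<integral>\<^sup>+x. indicator N (x, t) \<partial>lborel) = 0"
    by (subst (asm) nn_integral_0_iff_AE) auto
  then show ?thesis
  proof eventually_elim
    case (elim t)
    then have "AE x in lborel. indicator N (x, t) = (0::ennreal)" by (subst (asm) nn_integral_0_iff_AE) auto
    then show ?case by eventually_elim (use N(2) in \<open>auto split: split_indicator_asm\<close>)
  qed
qed

lemma integrable_spacetime:
  fixes f :: "'a::euclidean_space \<times> 'b::euclidean_space \<Rightarrow> 'c::{banach, second_countable_topology}"
  assumes f: "integrable lborel f" shows "AE t in lborel. integrable lborel (\<lambda>x. f (x, t))"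
proof -
  have [measurable]: "f \<in> borel_measurable borel" using f borel_measurable_integrable by force
  have "(\<integral>\<^sup>+t. \<integral>\<^sup>+x. ennreal (norm (f (x, t))) \<partial>lborel \<partial>lborel) < \<infinity>"
    using nn_integral_spacetime[of "\<lambda>z. ennreal (norm (f z))"] f by (auto simp: integrable_iff_bounded)
  then have "AE t in lborel. (\<integral>\<^sup>+x. ennreal (norm (f (x, t))) \<partial>lborel) \<noteq> \<infinity>"
    by (intro nn_integral_PInf_AE) auto
  then show ?thesis by eventually_elim (auto simp: integrable_iff_bounded less_top)
qed

lemma integral_spacetime:
  fixes f :: "'a::euclidean_space \<times> 'b::euclidean_space \<Rightarrow> real"
  assumes f: "integrable lborel f"
  shows "(LINT z|lborel. f z) = (LINT t|lborel. LINT x|lborel. f (x, t))" "integrable lborel (\<lambda>t. LINT x|lborel. f (x, t))"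
  using lborel_pair.integral_snd[of "\<lambda>x t. f (x, t)"] lborel_pair.integrable_snd[of "\<lambda>x t. f (x, t)"] f
  by (simp_all add: lborel_prod)

text \<open>The length in time is independent of the radius, as the energy inequality is used with
  3r and 4r^2. Time is the outer variable so that slice estimates can be inserted.\<close>

definition cyl :: "real \<Rightarrow> real \<Rightarrow> (spacetime \<Rightarrow> ennreal) \<Rightarrow> ennreal" where
  "cyl \<rho> T f = (\<integral>\<^sup>+t. indicator {-T<..<0} t * (\<integral>\<^sup>+x. indicator (ball 0 \<rho>) x * f (x, t) \<partial>lborel) \<partial>lborel)"

lemma cyl_mono:
  assumes "AE t in lborel. t \<in> {-T<..<0} \<longrightarrow> (AE x in lborel. x \<in> ball 0 \<rho> \<longrightarrow> f (x, t) \<le> h (x, t))" "\<rho> \<le> \<rho>'" "T \<le> T'"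
  shows "cyl \<rho> T f \<le> cyl \<rho>' T' h"
  unfolding cyl_def
proof (rule nn_integral_mono_AE)
  show "AE t in lborel. indicator {-T<..<0} t * (\<integral>\<^sup>+x. indicator (ball 0 \<rho>) x * f (x, t) \<partial>lborel)
      \<le> indicator {-T'<..<0} t * (\<integral>\<^sup>+x. indicator (ball 0 \<rho>') x * h (x, t) \<partial>lborel)"
    using assms(1)
  proof eventually_elim
    case (elim t)
    show ?case
    proof (cases "t \<in> {-T<..<0}")
      case True
      then have "(\<integral>\<^sup>+x. indicator (ball 0 \<rho>) x * f (x, t) \<partial>lborel) \<le> (\<integral>\<^sup>+x. indicator (ball 0 \<rho>') x * h (x, t) \<partial>lborel)"
        using elim assms(2) by (intro nn_integral_ball_mono) auto
      then show ?thesis using True assms(3) by (simp add: indicator_def)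
    qed simp
  qed
qed

lemma cyl_mono': "(\<And>z. f z \<le> h z) \<Longrightarrow> \<rho> \<le> \<rho>' \<Longrightarrow> T \<le> T' \<Longrightarrow> cyl \<rho> T f \<le> cyl \<rho>' T' h"
  by (rule cyl_mono) auto

lemma cyl_add:
  assumes [measurable]: "f \<in> borel_measurable borel" "h \<in> borel_measurable borel"
  shows "cyl \<rho> T (\<lambda>z. f z + h z) = cyl \<rho> T f + cyl \<rho> T h"
  unfolding cyl_def by (simp add: distrib_left nn_integral_add)

lemma cyl_cmult:
  assumes [measurable]: "f \<in> borel_measurable borel"
  shows "cyl \<rho> T (\<lambda>z. k * f z) = k * cyl \<rho> T f"
  unfolding cyl_def by (simp add: mult.left_commute[of _ k] nn_integral_cmult)

lemma cyl_const:
  assumes "0 \<le> \<rho>" "0 \<le> T" "0 \<le> k"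
  shows "cyl \<rho> T (\<lambda>z. ennreal k) = ennreal (k * (unit_ball_vol 3 * \<rho>^3) * T)"
proof -
  have "(\<integral>\<^sup>+x. indicator (ball (0::real^3) \<rho>) x * ennreal k \<partial>lborel) = ennreal (k * (unit_ball_vol 3 * \<rho>^3))"
    using assms measure_ball_3[of \<rho> 0]
    by (simp add: mult.commute[of _ "ennreal k"] nn_integral_cmult_indicator ennreal_mult
        emeasure_eq_ennreal_measure emeasure_lborel_ball_finite[unfolded infinity_ennreal_def] less_top)
  then show ?thesis unfolding cyl_def using assms
    by (simp add: mult.commute[of "indicator _ _"] nn_integral_cmult_indicator ennreal_mult)
qed

lemma cyl_time:
  assumes [measurable]: "h \<in> borel_measurable borel"
  and "AE t in lborel. t \<in> {-T<..<0} \<longrightarrow> (\<integral>\<^sup>+x. indicator (ball 0 \<rho>) x * f (x, t) \<partial>lborel) \<le> k * h t"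
  shows "cyl \<rho> T f \<le> k * (\<integral>\<^sup>+t. indicator {-T<..<0} t * h t \<partial>lborel)"
proof -
  have "cyl \<rho> T f \<le> (\<integral>\<^sup>+t. k * (indicator {-T<..<0} t * h t) \<partial>lborel)"
    unfolding cyl_def
    by (rule nn_integral_mono_AE) (use assms(2) in eventually_elim, auto simp: indicator_def)
  also have "\<dots> = k * (\<integral>\<^sup>+t. indicator {-T<..<0} t * h t \<partial>lborel)"
    by (rule nn_integral_cmult) measurable
  finally show ?thesis .
qed

lemma borel_measurable_vecI:
  fixes f :: "'a \<Rightarrow> real^'n"
  assumes "\<And>i. (\<lambda>t. f t $ i) \<in> borel_measurable M" shows "f \<in> borel_measurable M"
  by (subst borel_measurable_euclidean_space) (use assms in \<open>auto simp: Basis_vec_def inner_axis\<close>)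

lemma borel_measurable_vec_nth [measurable]: "(\<lambda>x::'a::euclidean_space^'n. x $ i) \<in> borel_measurable borel"
  by (intro borel_measurable_continuous_onI continuous_intros)

lemma borel_measurable_fst' [measurable]: "(fst :: 'a::euclidean_space \<times> 'b::euclidean_space \<Rightarrow> 'a) \<in> borel_measurable borel"
  and borel_measurable_snd' [measurable]: "(snd :: 'a::euclidean_space \<times> 'b::euclidean_space \<Rightarrow> 'b) \<in> borel_measurable borel"
  by (intro borel_measurable_continuous_onI continuous_intros)+

lemma square_powr_three_halves:
  fixes x :: real
  assumes "0 \<le> x" shows "(x\<^sup>2) powr (3/2) = x ^ 3"
proof (cases "x = 0")
  case False
  then have eq: "x\<^sup>2 = x powr 2" "x ^ 3 = x powr 3" using assms by simp_all
  have "(x powr 2) powr (3/2) = x powr (2 * (3/2))" by (rule powr_powr)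
  then show ?thesis unfolding eq by simp
qed simp

lemma norm_matrix_vector_le: "norm (M *v x) \<le> norm M * norm (x :: real^'n)" for M :: "real^'n^'m"
proof -
  have "(norm (M *v x))\<^sup>2 = (\<Sum>i\<in>UNIV. (M $ i \<bullet> x)\<^sup>2)"
    by (simp add: norm_vec_def L2_set_def sum_nonneg inner_vec_def matrix_vector_mult_def)
  also have "\<dots> \<le> (\<Sum>i\<in>UNIV. (norm (M $ i))\<^sup>2 * (norm x)\<^sup>2)"
    by (intro sum_mono) (metis Cauchy_Schwarz_ineq2 abs_ge_zero power2_abs power_mono power_mult_distrib)
  also have "\<dots> = (norm M)\<^sup>2 * (norm x)\<^sup>2"
    unfolding sum_distrib_right[symmetric] by (simp add: power2_norm_eq_inner inner_vec_def)
  also have "\<dots> = (norm M * norm x)\<^sup>2" by (simp add: power_mult_distrib)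
  finally show ?thesis by (rule power2_le_imp_le) simp
qed

lemma Q_borel [measurable]: "Q r \<in> sets borel"
  unfolding Q_def by (intro borel_open open_Times) auto

lemma integrable_indicator_Q: "integrable lborel (indicator (Q r) :: spacetime \<Rightarrow> real)"
proof -
  have "bounded (Q r)" unfolding Q_def by (intro bounded_Times) auto
  then have "emeasure lborel (Q r) < \<infinity>" by (rule emeasure_bounded_finite)
  then show ?thesis by (intro integrable_real_indicator) auto
qed

lemma le_one_plus_powr:
  fixes y :: real
  assumes "0 \<le> y" shows "y \<le> 1 + y powr (3/2)"
proof (cases "y \<le> 1")
  case False
  then have "y powr 1 \<le> y powr (3/2)" by (intro powr_mono) auto
  then show ?thesis using False by simp
qed (use powr_ge_zero[of y "3/2"] in linarith)

lemma integrable_of_powr_three_halves: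
  fixes f :: "spacetime \<Rightarrow> real"
  assumes [measurable]: "f \<in> borel_measurable borel" and zero: "\<And>z. z \<notin> Q r \<Longrightarrow> f z = 0"
    and i: "integrable lborel (\<lambda>z. \<bar>f z\<bar> powr (3/2))"
  shows "integrable lborel f"
proof (rule Bochner_Integration.integrable_bound)
  show "integrable lborel (\<lambda>z. indicator (Q r) z + \<bar>f z\<bar> powr (3/2))"
    by (intro Bochner_Integration.integrable_add integrable_indicator_Q i)
  show "AE z in lborel. norm (f z) \<le> norm (indicator (Q r) z + \<bar>f z\<bar> powr (3/2))"
  proof (rule AE_I2)
    fix z
    show "norm (f z) \<le> norm (indicator (Q r) z + \<bar>f z\<bar> powr (3/2))"
      using zero[of z] le_one_plus_powr[of "\<bar>f z\<bar>"] by (cases "z \<in> Q r") auto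
  qed
qed simp

text \<open>Everything is Borel on the whole of space-time, and the equations have been transferred
  to almost every time slice. In \<open>DIV\<close> and \<open>PR\<close> the exceptional null set
  may depend on the test function. \<open>PR\<close> is the divergence of the momentum equation, in
  which the time derivative and the Laplacian have dropped out; \<open>EN\<close> keeps only the
  energy at time \<open>t\<close> on the left.\<close>

locale local_solution =
  fixes V :: "spacetime \<Rightarrow> real^3" and G :: "spacetime \<Rightarrow> real^3^3" and Pr :: "spacetime \<Rightarrow> real"
  assumes V_borel [measurable]: "V \<in> borel_measurable borel"
    and G_borel [measurable]: "G \<in> borel_measurable borel"
    and P_borel [measurable]: "Pr \<in> borel_measurable borel"
    and P_zero: "\<And>z. z \<notin> Q 1 \<Longrightarrow> Pr z = 0"
    and V2: "integrable lborel (\<lambda>z. (norm (V z))\<^sup>2)"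
    and G2: "integrable lborel (\<lambda>z. (norm (G z))\<^sup>2)"
    and P32: "integrable lborel (\<lambda>z. \<bar>Pr z\<bar> powr (3/2))"
    and WG: "AE t in lborel. weak_grad (\<lambda>x. V (x, t)) (\<lambda>x. G (x, t))"
    and DIV: "\<And>\<phi>. \<phi> \<in> test_functions (ball 0 1) \<Longrightarrow>
       AE t in lborel. (LINT x|lborel. (\<Sum>j\<in>UNIV. V (x, t) $ j * dderiv (axis j 1) \<phi> x)) = 0"
    and PR: "\<And>\<phi>. \<phi> \<in> test_functions (ball 0 1) \<Longrightarrow>
       AE t in lborel. (LINT x|lborel. (\<Sum>i\<in>UNIV. (G (x, t) *v V (x, t)) $ i * dderiv (axis i 1) \<phi> x))
         = (LINT x|lborel. Pr (x, t) * (\<Sum>i\<in>UNIV. dderiv (axis i 1) (dderiv (axis i 1) \<phi>) x))"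
    and EN: "AE t in lborel. t \<in> {-1<..<0} \<longrightarrow> (\<forall>\<phi>\<in>energy_test_functions.
        (LINT x|lborel. \<phi> (x, t) * (norm (V (x, t)))\<^sup>2)
        \<le> (LINT s|lborel. indicator {-1<..<t} s * (LINT x|lborel.
             (norm (V (x, s)))\<^sup>2 * (laplace_x \<phi> (x, s) + dderiv e_t \<phi> (x, s))
              + (V (x, s) \<bullet> grad_x \<phi> (x, s)) * ((norm (V (x, s)))\<^sup>2 + 2 * Pr (x, s)))))"

lemma (in local_solution) Pr_integrable: "integrable lborel Pr"
  by (rule integrable_of_powr_three_halves[OF P_borel P_zero P32])

text \<open>\<open>a\<close>, \<open>e\<close> and \<open>D\<close> stand for \<open>A\<close>,
  \<open>E\<close> and \<open>D0\<close> at the scale \<open>R\<close>, and \<open>mu\<close> for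
  the mean of the pressure over the ball. \<open>e\<close> is exact, whereas \<open>a\<close> and
  \<open>D\<close> enter as upper bounds.\<close>

locale scaled_solution = local_solution +
  fixes R a e D :: real and mu :: "real \<Rightarrow> real"
  assumes R: "0 < R" "R \<le> 1" and a0: "0 \<le> a" and e0: "0 \<le> e" and D0: "0 \<le> D"
    and a: "AE t in lborel. t \<in> {-(R\<^sup>2)<..<0} \<longrightarrow> (LINT x|lborel. indicator (ball 0 R) x * (norm (V (x, t)))\<^sup>2) \<le> R * a"
    and e: "cyl R (R\<^sup>2) (\<lambda>z. ennreal ((norm (G z))\<^sup>2)) = ennreal (R * e)"
    and mu_borel [measurable]: "mu \<in> borel_measurable borel"
    and D: "cyl R (R\<^sup>2) (\<lambda>z. ennreal (\<bar>Pr z - mu (snd z)\<bar> powr (3/2))) \<le> ennreal (R\<^sup>2 * D)"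
begin

definition g2 :: "real \<Rightarrow> real" where "g2 t = (LINT x|lborel. indicator (ball 0 R) x * (norm (G (x, t)))\<^sup>2)"

lemma slices: "AE t in lborel. t \<in> {-(R\<^sup>2)<..<0} \<longrightarrow> slice (\<lambda>x. V (x, t)) (\<lambda>x. G (x, t)) R (R * a) (g2 t)"
  using WG a by eventually_elim (use R in \<open>auto simp: slice_def g2_def\<close>)

lemma g2_borel [measurable]: "g2 \<in> borel_measurable borel"
  unfolding g2_def[abs_def] by measurable

lemma nn_g2: "(\<integral>\<^sup>+t. indicator {-(R\<^sup>2)<..<0} t * ennreal (g2 t) \<partial>lborel) = ennreal (R * e)"
  unfolding e[symmetric] cyl_def
proof (rule nn_integral_cong_AE)
  show "AE t in lborel. indicator {-(R\<^sup>2)<..<0} t * ennreal (g2 t)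
     = indicator {-(R\<^sup>2)<..<0} t * (\<integral>\<^sup>+x. indicator (ball 0 R) x * ennreal ((norm (G (x, t)))\<^sup>2) \<partial>lborel)"
    using slices
  proof eventually_elim
    case (elim t)
    show ?case
    proof (cases "t \<in> {-(R\<^sup>2)<..<0}")
      case True
      then interpret slice "\<lambda>x. V (x, t)" "\<lambda>x. G (x, t)" R "R * a" "g2 t" using elim by simp
      show ?thesis using nn_g2 by (simp add: ennreal_power)
    qed simp
  qed
qed

definition local_mean :: "real \<Rightarrow> real^3" where "local_mean t = avg (R/2) (\<lambda>x. V (x, t))"
definition W :: "spacetime \<Rightarrow> real^3" where "W z = V z - local_mean (snd z)"

lemma local_mean_borel [measurable]: "local_mean \<in> borel_measurable borel"
  by (rule borel_measurable_vecI) (simp add: local_mean_def avg_def mollify_def)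

lemma W_borel [measurable]: "W \<in> borel_measurable borel"
  unfolding W_def[abs_def] by measurable

lemma fluctuation_square: "cyl (R/2) (R\<^sup>2) (\<lambda>z. ennreal ((norm (W z))\<^sup>2)) \<le> ennreal (oscillation_const * riesz_const (5/4) * R^3 * e)"
proof -
  have "cyl (R/2) (R\<^sup>2) (\<lambda>z. ennreal ((norm (W z))\<^sup>2)) \<le> ennreal (oscillation_const * riesz_const (5/4) * R\<^sup>2) *
      (\<integral>\<^sup>+t. indicator {-(R\<^sup>2)<..<0} t * ennreal (g2 t) \<partial>lborel)"
  proof (rule cyl_time)
    show "AE t in lborel. t \<in> {-(R\<^sup>2)<..<0} \<longrightarrow> (\<integral>\<^sup>+x. indicator (ball 0 (R/2)) x * ennreal ((norm (W (x, t)))\<^sup>2) \<partial>lborel)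
        \<le> ennreal (oscillation_const * riesz_const (5/4) * R\<^sup>2) * ennreal (g2 t)"
      using slices
    proof eventually_elim
      case (elim t)
      show ?case
      proof
        assume "t \<in> {-(R\<^sup>2)<..<0}"
        then interpret slice "\<lambda>x. V (x, t)" "\<lambda>x. G (x, t)" R "R * a" "g2 t" using elim by simp
        show "(\<integral>\<^sup>+x. indicator (ball 0 (R/2)) x * ennreal ((norm (W (x, t)))\<^sup>2) \<partial>lborel)
          \<le> ennreal (oscillation_const * riesz_const (5/4) * R\<^sup>2) * ennreal (g2 t)"
          using w2 g2_nonneg oscillation_const_nonneg riesz_const_nonneg
          by (simp add: W_def w_def c_def local_mean_def ennreal_power ennreal_mult)
      qed
    qed
  qed simp
  also have "\<dots> = ennreal (oscillation_const * riesz_const (5/4) * R^3 * e)"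
    unfolding nn_g2 using oscillation_const_nonneg riesz_const_nonneg e0 R
    by (subst ennreal_mult[symmetric]) (auto simp: power2_eq_square power3_eq_cube mult_ac)
  finally show ?thesis .
qed

lemma fluctuation_cubic: "cyl (R/2) (R\<^sup>2) (\<lambda>z. ennreal (norm (W z) ^ 3)) \<le> ennreal (cubic_const * R\<^sup>2 * sqrt a * e)"
proof -
  have "cyl (R/2) (R\<^sup>2) (\<lambda>z. ennreal (norm (W z) ^ 3)) \<le> ennreal (cubic_const * sqrt (R * a * R)) *
      (\<integral>\<^sup>+t. indicator {-(R\<^sup>2)<..<0} t * ennreal (g2 t) \<partial>lborel)"
  proof (rule cyl_time)
    show "AE t in lborel. t \<in> {-(R\<^sup>2)<..<0} \<longrightarrow> (\<integral>\<^sup>+x. indicator (ball 0 (R/2)) x * ennreal (norm (W (x, t)) ^ 3) \<partial>lborel)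
        \<le> ennreal (cubic_const * sqrt (R * a * R)) * ennreal (g2 t)"
      using slices
    proof eventually_elim
      case (elim t)
      show ?case
      proof
        assume "t \<in> {-(R\<^sup>2)<..<0}"
        then interpret slice "\<lambda>x. V (x, t)" "\<lambda>x. G (x, t)" R "R * a" "g2 t" using elim by simp
        have "ennreal (cubic_const * sqrt (R * a * R)) * ennreal (g2 t) = ennreal (cubic_const * sqrt (R * a * R) * g2 t)"
          using g2_nonneg cubic_const_nonneg a0 R by (intro ennreal_mult[symmetric]) auto
        then show "(\<integral>\<^sup>+x. indicator (ball 0 (R/2)) x * ennreal (norm (W (x, t)) ^ 3) \<partial>lborel)
          \<le> ennreal (cubic_const * sqrt (R * a * R)) * ennreal (g2 t)"
          using w3 by (simp add: W_def w_def c_def local_mean_def ennreal_power)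
      qed
    qed
  qed simp
  also have "\<dots> = ennreal (cubic_const * R\<^sup>2 * sqrt a * e)"
  proof -
    have "sqrt (R * a * R) = R * sqrt a" using R by (simp add: real_sqrt_mult)
    then show ?thesis
      unfolding nn_g2 using cubic_const_nonneg e0 R a0
      by (subst ennreal_mult[symmetric]) (auto simp: power2_eq_square mult_ac)
  qed
  finally show ?thesis .
qed

lemma local_mean_bound: "AE t in lborel. t \<in> {-(R\<^sup>2)<..<0} \<longrightarrow> (norm (local_mean t))\<^sup>2 \<le> 8 * avg_const * a / R\<^sup>2"
  using slices
proof eventually_elim
  case (elim t)
  show ?case
  proof
    assume "t \<in> {-(R\<^sup>2)<..<0}"
    then interpret slice "\<lambda>x. V (x, t)" "\<lambda>x. G (x, t)" R "R * a" "g2 t" using elim by simp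
    show "(norm (local_mean t))\<^sup>2 \<le> 8 * avg_const * a / R\<^sup>2"
      using c_bound R by (simp add: c_def local_mean_def power2_eq_square power3_eq_cube field_simps)
  qed
qed

text \<open>|V|^3 \<le> 4|W|^3 + 4|c|^3, where \<open>c\<close> is the local mean of the slice. It
  is bounded in terms of \<open>a\<close> and constant in space, so its share shrinks with the
  volume of the smaller cylinder; the share of \<open>W\<close> does not shrink but contains only
  the power 1/2 of \<open>a\<close>.\<close>

lemma cubic_cylinder:
  assumes \<rho>: "0 \<le> \<rho>" "\<rho> \<le> R/2" "0 \<le> T" "T \<le> R\<^sup>2"
  shows "cyl \<rho> T (\<lambda>z. ennreal (norm (V z) ^ 3)) \<le> ennreal (4 * cubic_const * R\<^sup>2 * sqrt a * e + mean_const * a powr (3/2) / R^3 * \<rho>^3 * T)"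
proof -
  define b where "b = 4 * (8 * avg_const * a / R\<^sup>2) powr (3/2)"
  have b0: "0 \<le> b" by (simp add: b_def)
  have "cyl \<rho> T (\<lambda>z. ennreal (norm (V z) ^ 3)) \<le> cyl \<rho> T (\<lambda>z. ennreal 4 * ennreal (norm (W z) ^ 3) + ennreal b)"
  proof (rule cyl_mono)
    show "AE t in lborel. t \<in> {-T<..<0} \<longrightarrow> (AE x in lborel. x \<in> ball 0 \<rho> \<longrightarrow>
        ennreal (norm (V (x, t)) ^ 3) \<le> ennreal 4 * ennreal (norm (W (x, t)) ^ 3) + ennreal b)"
      using local_mean_bound
    proof eventually_elim
      case (elim t)
      show ?case
      proof (intro impI AE_I2)
        fix x :: "real^3" assume "t \<in> {-T<..<0}"
        then have c: "(norm (local_mean t))\<^sup>2 \<le> 8 * avg_const * a / R\<^sup>2" using elim \<rho> by auto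
        have "norm (local_mean t) ^ 3 = ((norm (local_mean t))\<^sup>2) powr (3/2)" by (simp add: square_powr_three_halves)
        also have "\<dots> \<le> (8 * avg_const * a / R\<^sup>2) powr (3/2)" using c by (intro powr_mono2) auto
        finally have c3: "4 * norm (local_mean t) ^ 3 \<le> b" by (simp add: b_def)
        have "norm (V (x, t)) \<le> norm (W (x, t)) + norm (local_mean t)"
          using norm_triangle_ineq[of "W (x, t)" "local_mean t"] by (simp add: W_def)
        then have "norm (V (x, t)) ^ 3 \<le> (norm (W (x, t)) + norm (local_mean t)) ^ 3" by (rule power_mono) simp
        also have "\<dots> \<le> 4 * norm (W (x, t)) ^ 3 + 4 * norm (local_mean t) ^ 3"
        proof -
          \<comment> \<open>4p^3 + 4q^3 - (p + q)^3 = 3(p + q)(p - q)^2.\<close>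
          have "0 \<le> (p + q) * (p - q)\<^sup>2" if "0 \<le> p" "0 \<le> q" for p q :: real using that by simp
          from this[of "norm (W (x, t))" "norm (local_mean t)"] show ?thesis
            by (simp add: power2_eq_square power3_eq_cube algebra_simps)
        qed
        finally have "norm (V (x, t)) ^ 3 \<le> 4 * norm (W (x, t)) ^ 3 + b" using c3 by simp
        note le = this
        show "ennreal (norm (V (x, t)) ^ 3) \<le> ennreal 4 * ennreal (norm (W (x, t)) ^ 3) + ennreal b"
        proof -
          have "ennreal (4 * norm (W (x, t)) ^ 3 + b) = ennreal 4 * ennreal (norm (W (x, t)) ^ 3) + ennreal b"
            using b0 ennreal_mult[of 4 "norm (W (x, t)) ^ 3"] ennreal_plus[of "4 * norm (W (x, t)) ^ 3" b] by simp
          with ennreal_leI[OF le] show ?thesis by (simp only:)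
        qed
      qed
    qed
  qed auto
  also have "\<dots> = ennreal 4 * cyl \<rho> T (\<lambda>z. ennreal (norm (W z) ^ 3)) + ennreal (b * (unit_ball_vol 3 * \<rho>^3) * T)"
    using \<rho> b0 by (simp add: cyl_add cyl_cmult cyl_const)
  also have "\<dots> \<le> ennreal 4 * ennreal (cubic_const * R\<^sup>2 * sqrt a * e) + ennreal (b * (unit_ball_vol 3 * \<rho>^3) * T)"
    using \<rho> by (intro add_right_mono mult_left_mono order_trans[OF cyl_mono' fluctuation_cubic]) auto
  also have "\<dots> = ennreal (4 * (cubic_const * R\<^sup>2 * sqrt a * e) + b * (unit_ball_vol 3 * \<rho>^3) * T)"
    using cubic_const_nonneg R a0 e0 b0 \<rho> by (subst ennreal_mult[symmetric], simp, simp, subst ennreal_plus[symmetric]) auto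
  also have "4 * (cubic_const * R\<^sup>2 * sqrt a * e) + b * (unit_ball_vol 3 * \<rho>^3) * T = 4 * cubic_const * R\<^sup>2 * sqrt a * e + mean_const * a powr (3/2) / R^3 * \<rho>^3 * T"
  proof -
    have "(R\<^sup>2) powr (3/2) = R^3" using R by (simp add: square_powr_three_halves)
    then have "b = 4 * ((8 * avg_const) powr (3/2) * a powr (3/2) / R^3)"
      using avg_const_nonneg a0 by (simp add: b_def powr_divide powr_mult)
    then show ?thesis by (simp add: mean_const_def mult_ac)
  qed
  finally show ?thesis .
qed

end

subsection \<open>The pressure\<close>

text \<open>Jensen's inequality by integrating the tangent of y^{3/2} at the mean \<open>m\<close>.
  With p = sqrt y and q = sqrt m the gap between curve and tangent is (p - q)^2 (p + q/2), which is
  nonnegative.\<close>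

lemma jensen_three_halves:
  fixes f :: "real^3 \<Rightarrow> real"
  assumes [measurable]: "f \<in> borel_measurable borel" and f0: "\<And>x. 0 \<le> f x" and r: "0 < r"
    and i2: "integrable lborel (\<lambda>x. indicator (ball 0 r) x * f x powr (3/2))"
  shows "integrable lborel (\<lambda>x. indicator (ball 0 r) x * f x)"
    "(LINT x|lborel. indicator (ball 0 r) x * f x) powr (3/2)
      \<le> sqrt (unit_ball_vol 3 * r^3) * (LINT x|lborel. indicator (ball 0 r) x * f x powr (3/2))"
proof -
  define Vo where "Vo = unit_ball_vol 3 * r^3"
  have Vo: "Vo > 0" using r by (simp add: Vo_def)
  have iB: "integrable lborel (indicator (ball (0::real^3) r) :: _ \<Rightarrow> real)"
    by (rule integrable_real_indicator) (auto simp: emeasure_lborel_ball_finite[unfolded infinity_ennreal_def])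
  show i1: "integrable lborel (\<lambda>x. indicator (ball 0 r) x * f x)"
  proof (rule Bochner_Integration.integrable_bound)
    show "integrable lborel (\<lambda>x. indicator (ball 0 r) x + indicator (ball 0 r) x * f x powr (3/2))"
      by (intro Bochner_Integration.integrable_add iB i2)
    show "AE x in lborel. norm (indicator (ball 0 r) x * f x) \<le> norm (indicator (ball 0 r) x + indicator (ball 0 r) x * f x powr (3/2))"
      using le_one_plus_powr f0 by (intro AE_I2) (auto simp: indicator_def)
  qed simp
  define I where "I = (LINT x|lborel. indicator (ball 0 r) x * f x)"
  have I0: "0 \<le> I" unfolding I_def by (rule Bochner_Integration.integral_nonneg) (simp add: f0)
  define m where "m = I / Vo"
  have m0: "0 \<le> m" using I0 Vo by (simp add: m_def)
  have p32: "y powr (3/2) = y * sqrt y" if "0 \<le> y" for y :: real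
  proof (cases "y = 0")
    case False
    then show ?thesis using that powr_add[of y 1 "1/2"] by (simp add: powr_half_sqrt)
  qed simp
  have tangent: "m powr (3/2) + 3/2 * sqrt m * (y - m) \<le> y powr (3/2)" if "0 \<le> y" for y
  proof -
    have cubic: "(p - q)\<^sup>2 * (p + q / 2) = (p * p) * p - (q * q) * q - 3/2 * q * (p * p - q * q)" for p q :: real
      by (simp add: power2_eq_square field_simps)
    have "0 \<le> (sqrt y - sqrt m)\<^sup>2 * (sqrt y + sqrt m / 2)" using that m0 by simp
    also have "\<dots> = y * sqrt y - m * sqrt m - 3/2 * sqrt m * (y - m)" unfolding cubic using that m0 by simp
    finally show ?thesis using that m0 by (simp add: p32)
  qed
  have "m powr (3/2) * Vo = (LINT x|lborel. (m powr (3/2) - 3/2 * sqrt m * m) * indicator (ball 0 r) x + 3/2 * sqrt m * (indicator (ball 0 r) x * f x))"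
    using iB i1 r Vo by (simp add: measure_ball_3 Vo_def[symmetric] I_def[symmetric] m_def[symmetric]) (simp add: m_def algebra_simps)
  also have "\<dots> \<le> (LINT x|lborel. indicator (ball 0 r) x * f x powr (3/2))"
  proof (rule integral_mono)
    show "integrable lborel (\<lambda>x. (m powr (3/2) - 3/2 * sqrt m * m) * indicator (ball 0 r) x + 3/2 * sqrt m * (indicator (ball 0 r) x * f x))"
      by (intro Bochner_Integration.integrable_add integrable_mult_right iB i1)
    show "(m powr (3/2) - 3/2 * sqrt m * m) * indicator (ball 0 r) x + 3/2 * sqrt m * (indicator (ball 0 r) x * f x)
        \<le> indicator (ball 0 r) x * f x powr (3/2)" for x
    proof (cases "x \<in> ball 0 r")
      case True
      have "3/2 * sqrt m * (f x - m) = 3/2 * sqrt m * f x - 3/2 * sqrt m * m" by (simp only: right_diff_distrib)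
      then show ?thesis using tangent[OF f0[of x]] True by (simp add: diff_divide_distrib mult_ac)
    qed simp
  qed (rule i2)
  finally have le: "m powr (3/2) * Vo \<le> (LINT x|lborel. indicator (ball 0 r) x * f x powr (3/2))" .
  have "I powr (3/2) = sqrt Vo * (m powr (3/2) * Vo)"
  proof -
    have "I = m * Vo" using Vo by (simp add: m_def)
    then show ?thesis using m0 Vo by (simp add: p32 real_sqrt_mult)
  qed
  also have "\<dots> \<le> sqrt Vo * (LINT x|lborel. indicator (ball 0 r) x * f x powr (3/2))"
    using le Vo by (intro mult_left_mono) auto
  finally show "(LINT x|lborel. indicator (ball 0 r) x * f x) powr (3/2)
      \<le> sqrt (unit_ball_vol 3 * r^3) * (LINT x|lborel. indicator (ball 0 r) x * f x powr (3/2))"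
    unfolding I_def Vo_def .
qed

lemma powr_three_halves_add:
  assumes "0 \<le> p" "0 \<le> q" shows "(p + q) powr (3/2) \<le> 3 * p powr (3/2) + 3 * q powr (3/2 :: real)"
proof -
  have two: "(2::real) powr (3/2) \<le> 3"
  proof -
    have "(2::real) powr (3/2) = 2 * sqrt 2" using powr_add[of "2::real" 1 "1/2"] by (simp add: powr_half_sqrt)
    moreover have "sqrt 2 \<le> (3/2::real)" by (rule real_le_lsqrt) (auto simp: power2_eq_square)
    ultimately show ?thesis by simp
  qed
  have "(p + q) powr (3/2) \<le> (2 * max p q) powr (3/2)" using assms by (intro powr_mono2) auto
  also have "\<dots> = 2 powr (3/2) * max p q powr (3/2)" using assms by (simp add: powr_mult)
  also have "\<dots> \<le> 3 * max p q powr (3/2)" using two by (intro mult_right_mono) auto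
  also have "\<dots> \<le> 3 * p powr (3/2) + 3 * q powr (3/2)" by (auto simp: max_def)
  finally show ?thesis .
qed

context local_solution
begin

text \<open>Testing with \<open>newton_test\<close> produces the difference of mollifications. A
  constant \<open>c\<close> may be subtracted from V, because its contribution, after integration by
  parts, pairs V with gradients of derivatives of the test function and vanishes by
  incompressibility. The quantifier over \<open>c\<close> stands inside the almost-everywhere
  statement, so that \<open>c\<close> may depend on time.\<close>

lemma pressure_identity:
  assumes e: "0 < e" "e \<le> s" "cball x s \<subseteq> ball 0 1"
  shows "AE t in lborel. \<forall>c. mollify e (\<lambda>y. Pr (y, t)) x - mollify s (\<lambda>y. Pr (y, t)) x
     = (LINT y|lborel. (G (y, t) *v (V (y, t) - c)) \<bullet> newton_flux e s (y - x))"
proof -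
  have s: "0 < s" using e by simp
  let ?\<phi> = "newton_test e s x"
  have t: "?\<phi> \<in> test_functions (ball 0 1)" by (rule newton_test_test_functions[OF e])
  have t1: "dderiv (axis j 1) ?\<phi> \<in> test_functions (ball 0 1)" for j :: 3 by (rule test_functions_dderiv[OF t])
  have t2: "dderiv (axis i 1) (dderiv (axis j 1) ?\<phi>) \<in> test_functions (ball 0 1)" for i j :: 3 by (rule test_functions_dderiv[OF t1])
  have fl: "dderiv (axis i 1) ?\<phi> y = newton_flux e s (y - x) $ i" for i y
    by (simp add: dderiv_newton_test[OF e(1) s] inner_axis)
  have div: "AE t in lborel. \<forall>j. (LINT y|lborel. (\<Sum>i\<in>UNIV. V (y, t) $ i * dderiv (axis i 1) (dderiv (axis j 1) ?\<phi>) y)) = 0"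
    by (rule eventually_all_finite) (rule DIV[OF t1])
  from WG PR[OF t] div integrable_spacetime[OF Pr_integrable] show ?thesis
  proof eventually_elim
    case (elim t)
    note wgD = weak_gradD[OF elim(1)]
    have [measurable]: "(\<lambda>y. V (y, t)) \<in> borel_measurable borel" "(\<lambda>y. G (y, t)) \<in> borel_measurable borel"
      using wgD(1,2) by auto
    have GVi: "integrable lborel (\<lambda>y. (G (y, t) *v V (y, t)) $ i)" for i
    proof (rule Bochner_Integration.integrable_bound)
      show "integrable lborel (\<lambda>y. (norm (G (y, t)))\<^sup>2 + (norm (V (y, t)))\<^sup>2)"
        by (intro Bochner_Integration.integrable_add wgD)
      show "(\<lambda>y. (G (y, t) *v V (y, t)) $ i) \<in> borel_measurable lborel"
        by (simp add: matrix_vector_mult_def)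
      show "AE y in lborel. norm ((G (y, t) *v V (y, t)) $ i) \<le> norm ((norm (G (y, t)))\<^sup>2 + (norm (V (y, t)))\<^sup>2)"
      proof (rule AE_I2)
        fix y
        have "norm ((G (y, t) *v V (y, t)) $ i) \<le> norm (G (y, t)) * norm (V (y, t))"
          by (rule order_trans[OF Finite_Cartesian_Product.norm_nth_le norm_matrix_vector_le])
        also have "\<dots> \<le> (norm (G (y, t)))\<^sup>2 + (norm (V (y, t)))\<^sup>2"
        proof -
          have "2 * (norm (G (y, t)) * norm (V (y, t))) \<le> (norm (G (y, t)))\<^sup>2 + (norm (V (y, t)))\<^sup>2"
            using zero_le_power2[of "norm (G (y, t)) - norm (V (y, t))"] by (simp add: power2_diff mult.assoc)
          moreover have "0 \<le> norm (G (y, t)) * norm (V (y, t))" by simp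
          ultimately show ?thesis by linarith
        qed
        finally show "norm ((G (y, t) *v V (y, t)) $ i) \<le> norm ((norm (G (y, t)))\<^sup>2 + (norm (V (y, t)))\<^sup>2)" by simp
      qed
    qed
    have GV: "integrable lborel (\<lambda>y. (G (y, t) *v V (y, t)) \<bullet> newton_flux e s (y - x))"
      unfolding inner_vec_def fl[symmetric] inner_real_def
      by (intro Bochner_Integration.integrable_sum integrable_mult_test[OF GVi t1])
    have "mollify e (\<lambda>y. Pr (y, t)) x - mollify s (\<lambda>y. Pr (y, t)) x
       = (LINT y|lborel. Pr (y, t) * (eta e (y - x) - eta s (y - x)))"
      unfolding mollify_def right_diff_distrib using e(1) s
      by (subst Bochner_Integration.integral_diff) (simp_all add: integrable_mult_eta[OF elim(4)])
    also have "\<dots> = (LINT y|lborel. Pr (y, t) * (\<Sum>i\<in>UNIV. dderiv (axis i 1) (dderiv (axis i 1) ?\<phi>) y))"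
      by (simp only: laplace_newton_test[OF e(1) s])
    also have "\<dots> = (LINT y|lborel. (\<Sum>i\<in>UNIV. (G (y, t) *v V (y, t)) $ i * dderiv (axis i 1) ?\<phi> y))"
      by (rule elim(2)[symmetric])
    also have "\<dots> = (LINT y|lborel. (G (y, t) *v V (y, t)) \<bullet> newton_flux e s (y - x))"
      by (simp only: fl inner_vec_def inner_real_def)
    finally have 1: "mollify e (\<lambda>y. Pr (y, t)) x - mollify s (\<lambda>y. Pr (y, t)) x = (LINT y|lborel. (G (y, t) *v V (y, t)) \<bullet> newton_flux e s (y - x))" .
    show ?case
    proof
      fix c :: "real^3"
      have eq: "(G (y, t) *v c) \<bullet> newton_flux e s (y - x) = (\<Sum>j\<in>UNIV. c $ j * (\<Sum>i\<in>UNIV. G (y, t) $ i $ j * dderiv (axis i 1) ?\<phi> y))" for y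
        unfolding inner_vec_def fl[symmetric] matrix_vector_mult_def inner_real_def
        by (simp add: sum_distrib_left sum_distrib_right mult_ac) (rule sum.swap)
      have i1: "integrable lborel (\<lambda>y. c $ j * (\<Sum>i\<in>UNIV. G (y, t) $ i $ j * dderiv (axis i 1) ?\<phi> y))" for j
        by (intro integrable_mult_right Bochner_Integration.integrable_sum integrable_mult_test[OF wgD(6) t1])
      have Gc: "integrable lborel (\<lambda>y. (G (y, t) *v c) \<bullet> newton_flux e s (y - x))"
        unfolding eq by (intro Bochner_Integration.integrable_sum i1)
      have zero: "(LINT y|lborel. (\<Sum>i\<in>UNIV. G (y, t) $ i $ j * dderiv (axis i 1) ?\<phi> y)) = 0" for j
      proof -
        have "(LINT y|lborel. (\<Sum>i\<in>UNIV. G (y, t) $ i $ j * dderiv (axis i 1) ?\<phi> y))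
            = (\<Sum>i\<in>UNIV. LINT y|lborel. G (y, t) $ i $ j * dderiv (axis i 1) ?\<phi> y)"
          by (rule Bochner_Integration.integral_sum) (rule integrable_mult_test[OF wgD(6) t1])
        also have "\<dots> = (\<Sum>i\<in>UNIV. - (LINT y|lborel. V (y, t) $ i * dderiv (axis j 1) (dderiv (axis i 1) ?\<phi>) y))"
          by (simp only: wgD(9)[OF t1] minus_minus)
        also have "\<dots> = - (\<Sum>i\<in>UNIV. (LINT y|lborel. V (y, t) $ i * dderiv (axis i 1) (dderiv (axis j 1) ?\<phi>) y))"
          by (simp only: dderiv_symmetric[OF smooth_newton_test, of "axis j 1"] sum_negf)
        also have "(\<Sum>i\<in>UNIV. (LINT y|lborel. V (y, t) $ i * dderiv (axis i 1) (dderiv (axis j 1) ?\<phi>) y))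
            = (LINT y|lborel. (\<Sum>i\<in>UNIV. V (y, t) $ i * dderiv (axis i 1) (dderiv (axis j 1) ?\<phi>) y))"
          by (rule Bochner_Integration.integral_sum[symmetric]) (rule integrable_mult_test[OF wgD(5) t2])
        also have "\<dots> = 0" using elim(3) by blast
        finally show ?thesis by simp
      qed
      have Gc0: "(LINT y|lborel. (G (y, t) *v c) \<bullet> newton_flux e s (y - x)) = 0"
        unfolding eq by (subst Bochner_Integration.integral_sum[OF i1]) (simp add: zero)
      show "mollify e (\<lambda>y. Pr (y, t)) x - mollify s (\<lambda>y. Pr (y, t)) x
         = (LINT y|lborel. (G (y, t) *v (V (y, t) - c)) \<bullet> newton_flux e s (y - x))"
        unfolding 1 matrix_vector_mult_diff_distrib inner_diff_left
        by (subst Bochner_Integration.integral_diff[OF GV Gc]) (simp add: Gc0)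
    qed
  qed
qed

end

context scaled_solution
begin

text \<open>From a point of the ball of radius R/4 this reaches no further than R/2, where the slice
  estimates for \<open>w\<close> hold.\<close>

definition near_radius :: real where "near_radius = R / 4"

lemma near_radius: "0 < near_radius" "near_radius < 1" using R by (auto simp: near_radius_def)

definition pressure_near :: "spacetime \<Rightarrow> real" where
  "pressure_near z = \<bar>eta_mass * Pr z - mollify near_radius (\<lambda>y. Pr (y, snd z)) (fst z)\<bar>"

lemma pressure_near_borel [measurable]: "pressure_near \<in> borel_measurable borel"
  unfolding pressure_near_def[abs_def] mollify_def by measurable

lemma ball_near_radius: assumes "x \<in> ball 0 (R/4)" shows "cball x near_radius \<subseteq> ball (0::real^3) 1" "ball x near_radius \<subseteq> ball 0 (R/2)"
proof -
  have "norm y < R/2" if "norm (x - y) \<le> R/4" for y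
    using that assms norm_triangle_ineq[of x "y - x"] by (simp add: norm_minus_commute)
  then have *: "cball x near_radius \<subseteq> ball (0::real^3) (R/2)" by (auto simp: near_radius_def dist_norm)
  then show "ball x near_radius \<subseteq> ball 0 (R/2)" using ball_subset_cball by blast
  show "cball x near_radius \<subseteq> ball (0::real^3) 1" by (rule order_trans[OF * subset_ball]) (use R in simp)
qed

text \<open>\<open>pressure_identity\<close> holds for each \<open>x\<close> at almost every time,
  while the slice argument wants almost every time and there almost every \<open>x\<close>. Joint
  measurability allows the exchange by Fubini. The free constant is taken to be the local mean of
  the slice.\<close>

lemma pressure_AE:
  assumes \<epsilon>: "0 < \<epsilon>" "\<epsilon> \<le> near_radius"
  shows "AE t in lborel. AE x in lborel. x \<in> ball 0 (R/4) \<longrightarrow>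
    mollify \<epsilon> (\<lambda>y. Pr (y, t)) x - mollify near_radius (\<lambda>y. Pr (y, t)) x
     = (LINT y|lborel. (G (y, t) *v W (y, t)) \<bullet> newton_flux \<epsilon> near_radius (y - x))"
proof -
  have [measurable]: "(\<lambda>z. (G z *v W z) $ i) \<in> borel_measurable borel" for i
    unfolding matrix_vector_mult_def by simp
  have [measurable]: "(\<lambda>z. G z *v W z) \<in> borel_measurable borel"
    by (rule borel_measurable_vecI) simp
  let ?Pd = "\<lambda>x t. x \<in> ball 0 (R/4) \<longrightarrow>
    mollify \<epsilon> (\<lambda>y. Pr (y, t)) x - mollify near_radius (\<lambda>y. Pr (y, t)) x
     = (LINT y|lborel. (G (y, t) *v W (y, t)) \<bullet> newton_flux \<epsilon> near_radius (y - x))"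
  have "{z \<in> space (lborel \<Otimes>\<^sub>M lborel). ?Pd (fst z) (snd z)} \<in> sets (lborel \<Otimes>\<^sub>M lborel)"
    unfolding mollify_def by measurable
  moreover have "AE x in lborel. AE t in lborel. ?Pd x t"
  proof (rule AE_I2)
    fix x :: "real^3"
    show "AE t in lborel. ?Pd x t"
    proof (cases "x \<in> ball 0 (R/4)")
      case True
      from pressure_identity[OF \<epsilon> ball_near_radius(1)[OF True]] show ?thesis
        by eventually_elim (simp add: W_def)
    qed simp
  qed
  ultimately show ?thesis using lborel_pair.AE_commute[of ?Pd] by blast
qed

lemma pressure_near_cylinder: "cyl (R/4) (R\<^sup>2) (\<lambda>z. ennreal (pressure_near z powr (3/2))) \<le> ennreal (pressure_const * R\<^sup>2 * sqrt a * e)"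
proof -
  \<comment> \<open>Countably many scales, hence one null set of times for all of them.\<close>
  have all: "AE t in lborel. \<forall>n. AE x in lborel. x \<in> ball 0 (R/4) \<longrightarrow>
    mollify (near_radius / (real n + 2)) (\<lambda>y. Pr (y, t)) x - mollify near_radius (\<lambda>y. Pr (y, t)) x
     = (LINT y|lborel. (G (y, t) *v W (y, t)) \<bullet> newton_flux (near_radius / (real n + 2)) near_radius (y - x))"
    unfolding AE_all_countable
  proof
    fix n :: nat
    have "0 < near_radius / (real n + 2)" "near_radius / (real n + 2) \<le> near_radius" using near_radius by (auto simp: field_simps)
    from pressure_AE[OF this] show "AE t in lborel. AE x in lborel. x \<in> ball 0 (R/4) \<longrightarrow>
      mollify (near_radius / (real n + 2)) (\<lambda>y. Pr (y, t)) x - mollify near_radius (\<lambda>y. Pr (y, t)) x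
       = (LINT y|lborel. (G (y, t) *v W (y, t)) \<bullet> newton_flux (near_radius / (real n + 2)) near_radius (y - x))" .
  qed
  have "cyl (R/4) (R\<^sup>2) (\<lambda>z. ennreal (pressure_near z powr (3/2))) \<le> ennreal (pressure_const * sqrt (R * (R * a))) *
      (\<integral>\<^sup>+t. indicator {-(R\<^sup>2)<..<0} t * ennreal (g2 t) \<partial>lborel)"
  proof (rule cyl_time)
    show "AE t in lborel. t \<in> {-(R\<^sup>2)<..<0} \<longrightarrow> (\<integral>\<^sup>+x. indicator (ball 0 (R/4)) x * ennreal (pressure_near (x, t) powr (3/2)) \<partial>lborel)
        \<le> ennreal (pressure_const * sqrt (R * (R * a))) * ennreal (g2 t)"
      using slices all integrable_spacetime[OF Pr_integrable]
    proof eventually_elim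
      case (elim t)
      show ?case
      proof
        assume t: "t \<in> {-(R\<^sup>2)<..<0}"
        then interpret slice "\<lambda>x. V (x, t)" "\<lambda>x. G (x, t)" R "R * a" "g2 t" using elim by simp
        have w: "w y = W (y, t)" for y by (simp add: w_def c_def W_def local_mean_def)
        have "AE x in lborel. x \<in> ball 0 (R/4) \<longrightarrow> (\<forall>n. ennreal \<bar>mollify (near_radius / (real n + 2)) (\<lambda>y. Pr (y, t)) x - mollify near_radius (\<lambda>y. Pr (y, t)) x\<bar> \<le> P x)"
          using elim(2)[unfolded AE_all_countable[symmetric]]
        proof eventually_elim
          case (elim x)
          show ?case
          proof (intro impI allI)
            fix n assume x: "x \<in> ball 0 (R/4)"
            have "ennreal \<bar>mollify (near_radius / (real n + 2)) (\<lambda>y. Pr (y, t)) x - mollify near_radius (\<lambda>y. Pr (y, t)) x\<bar>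
               = ennreal \<bar>LINT y|lborel. (G (y, t) *v W (y, t)) \<bullet> newton_flux (near_radius / (real n + 2)) near_radius (y - x)\<bar>"
              using elim x by simp
            also have "\<dots> \<le> potential 2 (R/2) (\<lambda>y. ennreal (norm (G (y, t)) * norm (W (y, t)))) x"
              by (rule flux_potential_bound[OF _ _ ball_near_radius(2)[OF x] norm_matrix_vector_le])
                (use near_radius in \<open>auto simp: field_simps\<close>)
            also have "\<dots> = P x" by (simp add: P_def w ennreal_mult)
            finally show "ennreal \<bar>mollify (near_radius / (real n + 2)) (\<lambda>y. Pr (y, t)) x - mollify near_radius (\<lambda>y. Pr (y, t)) x\<bar> \<le> P x" .
          qed
        qed
        from mollify_limit_bound[OF elim(3) near_radius(1) this]
        have q: "AE x in lborel. x \<in> ball 0 (R/4) \<longrightarrow> ennreal (pressure_near (x, t)) \<le> P x" by (simp add: pressure_near_def)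
        \<comment> \<open>Cut off to the smaller ball, because \<open>P32\<close> wants a function
          dominated by \<open>P\<close> on the whole ball of radius R/2.\<close>
        define q' where "q' x = indicator (ball 0 (R/4)) x * pressure_near (x, t)" for x
        have "(\<integral>\<^sup>+x. indicator (ball 0 (R/4)) x * ennreal (pressure_near (x, t) powr (3/2)) \<partial>lborel)
           = (\<integral>\<^sup>+x. indicator (ball 0 (R/4)) x * ennreal (q' x powr (3/2)) \<partial>lborel)"
          by (intro nn_integral_cong) (auto simp: q'_def indicator_def)
        also have "\<dots> \<le> ennreal (pressure_const * sqrt (R * (R * a)) * g2 t)"
        proof (rule P32)
          show "0 \<le> q' x" for x by (simp add: q'_def pressure_near_def)
          show "AE x in lborel. x \<in> ball 0 (R/2) \<longrightarrow> ennreal (q' x) \<le> P x"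
            using q by eventually_elim (auto simp: q'_def indicator_def)
        qed (use R in simp)
        also have "\<dots> = ennreal (pressure_const * sqrt (R * (R * a))) * ennreal (g2 t)"
          using g2_nonneg pressure_const_nonneg a0 R by (intro ennreal_mult) auto
        finally show "(\<integral>\<^sup>+x. indicator (ball 0 (R/4)) x * ennreal (pressure_near (x, t) powr (3/2)) \<partial>lborel)
          \<le> ennreal (pressure_const * sqrt (R * (R * a))) * ennreal (g2 t)" .
      qed
    qed
  qed simp
  also have "\<dots> = ennreal (pressure_const * R\<^sup>2 * sqrt a * e)"
  proof -
    have "sqrt (R * (R * a)) = R * sqrt a" using R by (simp add: real_sqrt_mult)
    then show ?thesis
      unfolding nn_g2 using pressure_const_nonneg e0 R a0
      by (subst ennreal_mult[symmetric]) (auto simp: power2_eq_square mult_ac)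
  qed
  finally show ?thesis .
qed

end

definition pressure_near_const :: real where "pressure_near_const = 3 * eta_mass powr (-3/2) * pressure_const"
text \<open>256 = 4^4 is due to the Lipschitz constant of the mollifier at scale R/4, and 3 to
  splitting the power 3/2 of a sum. The root of the volume of the unit ball comes from Jensen's
  inequality, the volume itself from integrating over the small ball.\<close>

definition pressure_far_const :: real where "pressure_far_const = 3 * (256 * eta_bound / eta_mass) powr (3/2) * sqrt (unit_ball_vol 3) * unit_ball_vol 3"

lemma pressure_near_const_nonneg: "0 \<le> pressure_near_const" using pressure_const_nonneg by (simp add: pressure_near_const_def)
lemma pressure_far_const_nonneg: "0 \<le> pressure_far_const" by (simp add: pressure_far_const_def)

text \<open>Subtracting a constant from \<open>f\<close> changes all mollifications at one scale by
  the same amount, so only f - c enters the difference.\<close>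

lemma mollify_const_oscillation:
  assumes f: "integrable lborel f" and s: "0 < s" and i: "integrable lborel (\<lambda>y. indicator (ball 0 R) y * \<bar>f y - c\<bar>)"
    and x: "norm x + s \<le> R"
  shows "\<bar>mollify s f x - mollify s f 0\<bar> \<le> eta_bound * norm x / s^4 * (LINT y|lborel. indicator (ball 0 R) y * \<bar>f y - c\<bar>)"
proof -
  have i1: "integrable lborel (\<lambda>y. f y * eta s (y - z) - c * eta s (y - z))" for z
    by (intro Bochner_Integration.integrable_diff integrable_mult_right integrable_mult_eta f integrable_eta_shift s)
  have m: "mollify s f z = (LINT y|lborel. (f y - c) * eta s (y - z)) + c * eta_mass" for z
    unfolding left_diff_distrib mollify_def
    by (subst Bochner_Integration.integral_diff)
      (simp_all add: integrable_mult_eta[OF f s] integrable_eta_shift[OF s] integral_eta_shift[OF s])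
  have "mollify s f x - mollify s f 0 = (LINT y|lborel. (f y - c) * eta s (y - x) - (f y - c) * eta s (y - 0))"
    unfolding m using i1[of x] i1[of 0] by (subst Bochner_Integration.integral_diff) (simp_all add: left_diff_distrib)
  also have "\<bar>\<dots>\<bar> \<le> (LINT y|lborel. eta_bound * norm x / s^4 * (indicator (ball 0 R) y * \<bar>f y - c\<bar>))"
  proof (rule integral_abs_bound[THEN order_trans], rule integral_mono')
    show "integrable lborel (\<lambda>y. eta_bound * norm x / s^4 * (indicator (ball 0 R) y * \<bar>f y - c\<bar>))"
      by (intro integrable_mult_right i)
    fix y
    show "\<bar>(f y - c) * eta s (y - x) - (f y - c) * eta s (y - 0)\<bar> \<le> eta_bound * norm x / s^4 * (indicator (ball 0 R) y * \<bar>f y - c\<bar>)"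
    proof (cases "y \<in> ball 0 R")
      case True
      have "\<bar>eta s (y - x) - eta s (y - 0)\<bar> \<le> eta_bound * norm x / s^4"
        using eta_lipschitz[OF s, of "y - x" "y - 0"] by simp
      then have "\<bar>f y - c\<bar> * \<bar>eta s (y - x) - eta s (y - 0)\<bar> \<le> \<bar>f y - c\<bar> * (eta_bound * norm x / s^4)"
        by (intro mult_left_mono) auto
      moreover have "\<bar>(f y - c) * eta s (y - x) - (f y - c) * eta s (y - 0)\<bar> = \<bar>f y - c\<bar> * \<bar>eta s (y - x) - eta s (y - 0)\<bar>"
        by (simp only: right_diff_distrib[symmetric] abs_mult)
      ultimately show ?thesis using True by (simp add: mult.commute)
    next
      case False
      then have "s \<le> norm (y - x)" "s \<le> norm y" using x norm_triangle_ineq2[of y x] norm_ge_zero[of x] by (auto simp del: norm_ge_zero)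
      then show ?thesis using False s by (simp add: eta_eq_0)
    qed
    show "0 \<le> eta_bound * norm x / s^4 * (indicator (ball 0 R) y * \<bar>f y - c\<bar>)"
      using eta_bound_pos s by simp
  qed
  finally show ?thesis by simp
qed

context scaled_solution
begin

text \<open>Takes the place of the mean of the pressure on all smaller balls: the normalised
  mollification at the origin, at a scale tied to \<open>R\<close>. Returning to the true mean costs
  a factor 6 in \<open>D0_le\<close>.\<close>

definition pressure_mean :: "real \<Rightarrow> real" where "pressure_mean t = mollify near_radius (\<lambda>y. Pr (y, t)) 0 / eta_mass"

lemma pressure_mean_borel [measurable]: "pressure_mean \<in> borel_measurable borel"
  unfolding pressure_mean_def[abs_def] mollify_def by measurable

definition pressure_slice :: "real \<Rightarrow> real" where "pressure_slice t = (LINT x|lborel. indicator (ball 0 R) x * \<bar>Pr (x, t) - mu t\<bar> powr (3/2))"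

lemma pressure_slice_borel [measurable]: "pressure_slice \<in> borel_measurable borel"
  unfolding pressure_slice_def[abs_def] by measurable

lemma pressure_slice_nonneg: "0 \<le> pressure_slice t" unfolding pressure_slice_def by (rule Bochner_Integration.integral_nonneg) simp

lemma pressure_slice_slices: "AE t in lborel. t \<in> {-(R\<^sup>2)<..<0} \<longrightarrow>
    integrable lborel (\<lambda>x. indicator (ball 0 R) x * \<bar>Pr (x, t) - mu t\<bar> powr (3/2))"
proof -
  let ?f = "\<lambda>t. indicator {-(R\<^sup>2)<..<0} t * (\<integral>\<^sup>+x. indicator (ball 0 R) x * ennreal (\<bar>Pr (x, t) - mu t\<bar> powr (3/2)) \<partial>lborel)"
  have "(\<integral>\<^sup>+t. ?f t \<partial>lborel) \<noteq> \<infinity>"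
    using D unfolding cyl_def snd_conv by (metis ennreal_less_top infinity_ennreal_def leD)
  then have "AE t in lborel. ?f t \<noteq> \<infinity>" by (intro nn_integral_PInf_AE) auto
  then show ?thesis
  proof eventually_elim
    case (elim t)
    show ?case
    proof
      assume "t \<in> {-(R\<^sup>2)<..<0}"
      then have "(\<integral>\<^sup>+x. ennreal (norm (indicator (ball 0 R) x * \<bar>Pr (x, t) - mu t\<bar> powr (3/2))) \<partial>lborel) < \<infinity>"
        using elim by (simp add: less_top ennreal_mult ennreal_indicator)
      then show "integrable lborel (\<lambda>x. indicator (ball 0 R) x * \<bar>Pr (x, t) - mu t\<bar> powr (3/2))"
        by (intro integrableI_bounded) auto
    qed
  qed
qed

lemma pressure_slice_integral: "(\<integral>\<^sup>+t. indicator {-(R\<^sup>2)<..<0} t * ennreal (pressure_slice t) \<partial>lborel) \<le> ennreal (R\<^sup>2 * D)"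
proof -
  have "(\<integral>\<^sup>+t. indicator {-(R\<^sup>2)<..<0} t * ennreal (pressure_slice t) \<partial>lborel) = cyl R (R\<^sup>2) (\<lambda>z. ennreal (\<bar>Pr z - mu (snd z)\<bar> powr (3/2)))"
    unfolding cyl_def snd_conv
  proof (rule nn_integral_cong_AE)
    show "AE t in lborel. indicator {-(R\<^sup>2)<..<0} t * ennreal (pressure_slice t)
      = indicator {-(R\<^sup>2)<..<0} t * (\<integral>\<^sup>+x. indicator (ball 0 R) x * ennreal (\<bar>Pr (x, t) - mu t\<bar> powr (3/2)) \<partial>lborel)"
      using pressure_slice_slices
    proof eventually_elim
      case (elim t)
      show ?case
      proof (cases "t \<in> {-(R\<^sup>2)<..<0}")
        case True
        have "ennreal (pressure_slice t) = (\<integral>\<^sup>+x. ennreal (indicator (ball 0 R) x * \<bar>Pr (x, t) - mu t\<bar> powr (3/2)) \<partial>lborel)"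
          unfolding pressure_slice_def using elim True by (intro nn_integral_eq_integral[symmetric]) auto
        then show ?thesis by (simp add: ennreal_mult ennreal_indicator)
      qed simp
    qed
  qed
  with D show ?thesis by simp
qed

text \<open>The pressure minus \<open>pressure_mean\<close> consists of the near part and an
  oscillation of the mollification at scale R/4. The latter is of order \<theta>, so its power 3/2,
  integrated over the ball of radius \<theta> R, yields 3/2 + 3 = 9/2 powers of \<theta>.\<close>

lemma pressure_deviation:
  assumes \<theta>: "0 \<le> \<theta>" "\<theta> \<le> 1/4" and T: "T \<le> R\<^sup>2"
  shows "cyl (\<theta> * R) T (\<lambda>z. ennreal (\<bar>Pr z - pressure_mean (snd z)\<bar> powr (3/2)))
    \<le> ennreal (pressure_near_const * R\<^sup>2 * sqrt a * e + pressure_far_const * \<theta> powr (9/2) * R\<^sup>2 * D)"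
proof -
  define c1 where "c1 = 3 * eta_mass powr (-3/2)"
  define c2 where "c2 = c1 * ((\<theta> * R) * (eta_bound / near_radius^4)) powr (3/2) * sqrt (unit_ball_vol 3 * R^3)"
  have c: "0 \<le> c1" "0 \<le> c2" using R by (auto simp: c1_def c2_def)
  have pt: "AE t in lborel. t \<in> {-T<..<0} \<longrightarrow> (AE x in lborel. x \<in> ball 0 (\<theta> * R) \<longrightarrow>
      ennreal (\<bar>Pr (x, t) - pressure_mean t\<bar> powr (3/2)) \<le> ennreal c1 * ennreal (pressure_near (x, t) powr (3/2)) + ennreal c2 * ennreal (pressure_slice t))"
    using pressure_slice_slices integrable_spacetime[OF Pr_integrable]
  proof eventually_elim
    case (elim t)
    show ?case
    proof (intro impI AE_I2)
      fix x :: "real^3" assume t: "t \<in> {-T<..<0}" and x: "x \<in> ball 0 (\<theta> * R)"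
      have t': "t \<in> {-(R\<^sup>2)<..<0}" using t T by auto
      have [measurable]: "(\<lambda>y. Pr (y, t)) \<in> borel_measurable borel" by simp
      let ?I = "LINT y|lborel. indicator (ball 0 R) y * \<bar>Pr (y, t) - mu t\<bar>"
      have I: "integrable lborel (\<lambda>y. indicator (ball 0 R) y * \<bar>Pr (y, t) - mu t\<bar>)"
        "?I powr (3/2) \<le> sqrt (unit_ball_vol 3 * R^3) * pressure_slice t"
        using jensen_three_halves[of "\<lambda>y. \<bar>Pr (y, t) - mu t\<bar>" R] elim(1) t' R(1) by (auto simp: pressure_slice_def)
      have I0: "0 \<le> ?I" by (rule Bochner_Integration.integral_nonneg) simp
      have nx: "norm x < \<theta> * R" using x by simp
      have "\<theta> * R \<le> 1/4 * R" using \<theta> R by (intro mult_right_mono) auto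
      then have "norm x + near_radius \<le> R" using nx R unfolding near_radius_def by linarith
      then have "\<bar>mollify near_radius (\<lambda>y. Pr (y, t)) x - mollify near_radius (\<lambda>y. Pr (y, t)) 0\<bar> \<le> eta_bound * norm x / near_radius^4 * ?I"
        by (rule mollify_const_oscillation[OF elim(2) near_radius(1) I(1)])
      also have "\<dots> \<le> ((\<theta> * R) * (eta_bound / near_radius^4)) * ?I"
        using nx I0 eta_bound_pos near_radius by (intro mult_right_mono) (auto simp: divide_right_mono mult.commute)
      finally have osc: "\<bar>mollify near_radius (\<lambda>y. Pr (y, t)) x - mollify near_radius (\<lambda>y. Pr (y, t)) 0\<bar> \<le> ((\<theta> * R) * (eta_bound / near_radius^4)) * ?I" .
      have LI0: "0 \<le> ((\<theta> * R) * (eta_bound / near_radius^4)) * ?I" using I0 \<theta> R eta_bound_pos near_radius by auto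
      have "eta_mass * \<bar>Pr (x, t) - pressure_mean t\<bar> = \<bar>eta_mass * Pr (x, t) - mollify near_radius (\<lambda>y. Pr (y, t)) 0\<bar>"
      proof -
        have "eta_mass * \<bar>Pr (x, t) - pressure_mean t\<bar> = \<bar>eta_mass * (Pr (x, t) - pressure_mean t)\<bar>"
          using eta_mass_pos by (simp add: abs_mult)
        also have "eta_mass * (Pr (x, t) - pressure_mean t) = eta_mass * Pr (x, t) - mollify near_radius (\<lambda>y. Pr (y, t)) 0"
          using eta_mass_pos by (simp add: pressure_mean_def right_diff_distrib)
        finally show ?thesis .
      qed
      also have "\<dots> \<le> pressure_near (x, t) + ((\<theta> * R) * (eta_bound / near_radius^4)) * ?I"
        using osc by (simp add: pressure_near_def)
      finally have "(eta_mass * \<bar>Pr (x, t) - pressure_mean t\<bar>) powr (3/2) \<le> (pressure_near (x, t) + ((\<theta> * R) * (eta_bound / near_radius^4)) * ?I) powr (3/2)"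
        using eta_mass_pos by (intro powr_mono2) auto
      also have "\<dots> \<le> 3 * pressure_near (x, t) powr (3/2) + 3 * (((\<theta> * R) * (eta_bound / near_radius^4)) * ?I) powr (3/2)"
        by (rule powr_three_halves_add) (use LI0 in \<open>auto simp: pressure_near_def\<close>)
      also have "(((\<theta> * R) * (eta_bound / near_radius^4)) * ?I) powr (3/2) = ((\<theta> * R) * (eta_bound / near_radius^4)) powr (3/2) * ?I powr (3/2)"
        by (rule powr_mult)
      also have "3 * pressure_near (x, t) powr (3/2) + 3 * (((\<theta> * R) * (eta_bound / near_radius^4)) powr (3/2) * ?I powr (3/2))
         \<le> 3 * pressure_near (x, t) powr (3/2) + 3 * (((\<theta> * R) * (eta_bound / near_radius^4)) powr (3/2) * (sqrt (unit_ball_vol 3 * R^3) * pressure_slice t))"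
        by (intro add_left_mono mult_left_mono I) auto
      finally have "eta_mass powr (-3/2) * (eta_mass * \<bar>Pr (x, t) - pressure_mean t\<bar>) powr (3/2)
         \<le> eta_mass powr (-3/2) * (3 * pressure_near (x, t) powr (3/2) + 3 * (((\<theta> * R) * (eta_bound / near_radius^4)) powr (3/2) * (sqrt (unit_ball_vol 3 * R^3) * pressure_slice t)))"
        by (rule mult_left_mono) simp
      also have "\<dots> = c1 * pressure_near (x, t) powr (3/2) + c2 * pressure_slice t" by (simp add: c1_def c2_def algebra_simps)
      also have "eta_mass powr (-3/2) * (eta_mass * \<bar>Pr (x, t) - pressure_mean t\<bar>) powr (3/2) = \<bar>Pr (x, t) - pressure_mean t\<bar> powr (3/2)"
      proof -
        have "eta_mass powr (-3/2) * eta_mass powr (3/2) = 1" using eta_mass_pos by (simp add: powr_add[symmetric])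
        then show ?thesis using eta_mass_pos by (simp add: powr_mult mult.assoc[symmetric])
      qed
      finally have le: "\<bar>Pr (x, t) - pressure_mean t\<bar> powr (3/2) \<le> c1 * pressure_near (x, t) powr (3/2) + c2 * pressure_slice t" .
      have "ennreal (c1 * pressure_near (x, t) powr (3/2) + c2 * pressure_slice t) = ennreal c1 * ennreal (pressure_near (x, t) powr (3/2)) + ennreal c2 * ennreal (pressure_slice t)"
        using c pressure_slice_nonneg[of t] ennreal_plus[of "c1 * pressure_near (x, t) powr (3/2)" "c2 * pressure_slice t"]
          ennreal_mult[of c1 "pressure_near (x, t) powr (3/2)"] ennreal_mult[of c2 "pressure_slice t"] by simp
      with ennreal_leI[OF le] show "ennreal (\<bar>Pr (x, t) - pressure_mean t\<bar> powr (3/2)) \<le> ennreal c1 * ennreal (pressure_near (x, t) powr (3/2)) + ennreal c2 * ennreal (pressure_slice t)"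
        by (simp only:)
    qed
  qed
  have \<theta>R: "0 \<le> \<theta> * R" "\<theta> * R \<le> R/4" using \<theta> R mult_right_mono[of \<theta> "1/4" R] by auto
  have "cyl (\<theta> * R) T (\<lambda>z. ennreal (\<bar>Pr z - pressure_mean (snd z)\<bar> powr (3/2)))
     \<le> cyl (\<theta> * R) (R\<^sup>2) (\<lambda>z. ennreal c1 * ennreal (pressure_near z powr (3/2)) + ennreal c2 * ennreal (pressure_slice (snd z)))"
    by (rule cyl_mono) (use pt T in auto)
  also have "\<dots> = ennreal c1 * cyl (\<theta> * R) (R\<^sup>2) (\<lambda>z. ennreal (pressure_near z powr (3/2))) + ennreal c2 * cyl (\<theta> * R) (R\<^sup>2) (\<lambda>z. ennreal (pressure_slice (snd z)))"
    by (simp add: cyl_add cyl_cmult)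
  also have "\<dots> \<le> ennreal c1 * ennreal (pressure_const * R\<^sup>2 * sqrt a * e) + ennreal c2 * (ennreal (unit_ball_vol 3 * (\<theta> * R)^3) * ennreal (R\<^sup>2 * D))"
  proof (intro add_mono mult_left_mono)
    show "cyl (\<theta> * R) (R\<^sup>2) (\<lambda>z. ennreal (pressure_near z powr (3/2))) \<le> ennreal (pressure_const * R\<^sup>2 * sqrt a * e)"
      by (rule order_trans[OF cyl_mono' pressure_near_cylinder]) (use \<theta>R in auto)
    have "cyl (\<theta> * R) (R\<^sup>2) (\<lambda>z. ennreal (pressure_slice (snd z))) \<le> ennreal (unit_ball_vol 3 * (\<theta> * R)^3) *
        (\<integral>\<^sup>+t. indicator {-(R\<^sup>2)<..<0} t * ennreal (pressure_slice t) \<partial>lborel)"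
    proof (rule cyl_time)
      show "AE t in lborel. t \<in> {-(R\<^sup>2)<..<0} \<longrightarrow> (\<integral>\<^sup>+x. indicator (ball (0::real^3) (\<theta> * R)) x * ennreal (pressure_slice (snd (x, t))) \<partial>lborel)
          \<le> ennreal (unit_ball_vol 3 * (\<theta> * R)^3) * ennreal (pressure_slice t)"
        using \<theta>R measure_ball_3[of "\<theta> * R" 0]
        by (intro AE_I2) (simp add: nn_integral_multc emeasure_eq_ennreal_measure emeasure_lborel_ball_finite[unfolded infinity_ennreal_def] less_top)
    qed simp
    also have "\<dots> \<le> ennreal (unit_ball_vol 3 * (\<theta> * R)^3) * ennreal (R\<^sup>2 * D)"
      by (intro mult_left_mono pressure_slice_integral) simp
    finally show "cyl (\<theta> * R) (R\<^sup>2) (\<lambda>z. ennreal (pressure_slice (snd z))) \<le> ennreal (unit_ball_vol 3 * (\<theta> * R)^3) * ennreal (R\<^sup>2 * D)" .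
  qed auto
  also have "\<dots> = ennreal (c1 * (pressure_const * R\<^sup>2 * sqrt a * e) + c2 * ((unit_ball_vol 3 * (\<theta> * R)^3) * (R\<^sup>2 * D)))"
  proof -
    have 0: "0 \<le> pressure_const * R\<^sup>2 * sqrt a * e" "0 \<le> unit_ball_vol 3 * (\<theta> * R)^3" "0 \<le> R\<^sup>2 * D"
      using pressure_const_nonneg a0 e0 D0 R \<theta>R by auto
    show ?thesis
      using c 0 by (simp only: ennreal_plus[OF mult_nonneg_nonneg mult_nonneg_nonneg] ennreal_mult mult_nonneg_nonneg)
  qed
  also have "c1 * (pressure_const * R\<^sup>2 * sqrt a * e) + c2 * ((unit_ball_vol 3 * (\<theta> * R)^3) * (R\<^sup>2 * D)) = pressure_near_const * R\<^sup>2 * sqrt a * e + pressure_far_const * \<theta> powr (9/2) * R\<^sup>2 * D"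
  proof -
    have 1: "(\<theta> * R) * (eta_bound / near_radius^4) = \<theta> * (256 * eta_bound) * (1 / R^3)"
      using R by (simp add: near_radius_def power_divide field_simps power3_eq_cube power4_eq_xxxx)
    have 2: "(1 / R^3) powr (3/2) * sqrt (R^3) = 1 / R^3"
    proof -
      have "(R^3) powr (3/2) = R^3 * sqrt (R^3)"
        using R powr_add[of "R^3" 1 "1/2"] by (simp add: powr_half_sqrt)
      then show ?thesis using R by (simp add: powr_divide)
    qed
    have 3: "eta_mass powr (-3/2) * (256 * eta_bound) powr (3/2) = (256 * eta_bound / eta_mass) powr (3/2)"
      using eta_mass_pos eta_bound_pos by (simp add: powr_divide powr_minus_divide)
    have 4: "\<theta> powr (3/2) * \<theta>^3 = \<theta> powr (9/2)"
    proof (cases "\<theta> = 0")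
      case False
      then have "\<theta>^3 = \<theta> powr 3" using \<theta> by simp
      then show ?thesis by (simp only: powr_add[symmetric]) simp
    qed simp
    have "c2 = 3 * (eta_mass powr (-3/2) * (256 * eta_bound) powr (3/2)) * \<theta> powr (3/2) * ((1 / R^3) powr (3/2) * sqrt (R^3)) * sqrt (unit_ball_vol 3)"
      unfolding c2_def c1_def 1 powr_mult real_sqrt_mult by (simp only: mult_ac)
    then have "c2 = 3 * (256 * eta_bound / eta_mass) powr (3/2) * \<theta> powr (3/2) * (1 / R^3) * sqrt (unit_ball_vol 3)"
      unfolding 2 3 .
    then have "c2 * ((unit_ball_vol 3 * (\<theta> * R)^3) * (R\<^sup>2 * D)) = pressure_far_const * (\<theta> powr (3/2) * \<theta>^3) * (1 / R^3 * R^3) * R\<^sup>2 * D"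
      unfolding pressure_far_const_def power_mult_distrib by (simp only: mult_ac)
    moreover have "1 / R^3 * R^3 = 1" using R by simp
    ultimately have "c2 * ((unit_ball_vol 3 * (\<theta> * R)^3) * (R\<^sup>2 * D)) = pressure_far_const * (\<theta> powr (3/2) * \<theta>^3) * R\<^sup>2 * D"
      by (simp only: mult_1_right)
    then show ?thesis unfolding 4 by (simp add: c1_def pressure_near_const_def mult_ac)
  qed
  finally show ?thesis .
qed

end

subsection \<open>The local energy inequality\<close>

lemma dderiv_tensor:
  fixes f :: "real^3 \<Rightarrow> real" and h :: "real \<Rightarrow> real"
  assumes f: "smooth f" and h: "smooth h"
  shows "dderiv (v, \<tau>) (\<lambda>z. f (fst z) * h (snd z)) z = dderiv v f (fst z) * h (snd z) + f (fst z) * dderiv \<tau> h (snd z)"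
proof -
  have 1: "((\<lambda>z. f (fst z)) has_derivative (\<lambda>k. dderiv (fst k) f (fst z))) (at z)"
    by (rule has_derivative_compose[OF _ smooth_has_derivative[OF f]]) (auto intro!: derivative_eq_intros)
  have 2: "((\<lambda>z. h (snd z)) has_derivative (\<lambda>k. dderiv (snd k) h (snd z))) (at z)"
    by (rule has_derivative_compose[OF _ smooth_has_derivative[OF h]]) (auto intro!: derivative_eq_intros)
  from dderiv_eqI[OF has_derivative_mult[OF 1 2]] show ?thesis by simp
qed

lemma smooth_tensor:
  fixes f :: "real^3 \<Rightarrow> real" and h :: "real \<Rightarrow> real"
  assumes "smooth f" "smooth h" shows "smooth (\<lambda>z::spacetime. f (fst z) * h (snd z))"
  using smooth_mult[OF smooth_compose_affine[OF bounded_linear_fst assms(1), of 0]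
      smooth_compose_affine[OF bounded_linear_snd assms(2), of 0]] by simp

lemma dderiv_zero_direction: "smooth f \<Longrightarrow> dderiv 0 f x = 0"
  using has_derivative_linear[OF smooth_has_derivative, THEN linear_0] .

lemma dderiv_tensor_x:
  assumes "smooth f" "smooth h"
  shows "dderiv (e_x i) (\<lambda>z. f (fst z) * h (snd z)) = (\<lambda>z. dderiv (axis i 1) f (fst z) * h (snd z))"
  using assms by (auto simp: e_x_def dderiv_tensor dderiv_zero_direction)

lemma dderiv_tensor_t:
  assumes "smooth f" "smooth h"
  shows "dderiv e_t (\<lambda>z. f (fst z) * h (snd z)) = (\<lambda>z. f (fst z) * dderiv 1 h (snd z))"
  using assms by (auto simp: e_t_def dderiv_tensor dderiv_zero_direction)

lemma laplace_tensor:
  assumes "smooth f" "smooth h"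
  shows "laplace_x (\<lambda>z. f (fst z) * h (snd z)) z = (\<Sum>i\<in>UNIV. dderiv (axis i 1) (dderiv (axis i 1) f) (fst z)) * h (snd z)"
  using assms by (simp add: laplace_x_def dderiv_tensor_x smooth_dderiv sum_distrib_right)

lemma grad_tensor:
  assumes "smooth f" "smooth h"
  shows "grad_x (\<lambda>z. f (fst z) * h (snd z)) z = h (snd z) *\<^sub>R (\<chi> i. dderiv (axis i 1) f (fst z))"
  using assms by (simp add: grad_x_def dderiv_tensor_x vec_eq_iff mult.commute)

lemma dderiv_scale:
  assumes f: "smooth f" shows "dderiv v (\<lambda>x. f (c *\<^sub>R x)) x = c * dderiv v f (c *\<^sub>R x)"
proof -
  have "((\<lambda>x. f (c *\<^sub>R x)) has_derivative (\<lambda>h. dderiv (c *\<^sub>R h) f (c *\<^sub>R x))) (at x)"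
    by (rule has_derivative_compose[OF _ smooth_has_derivative[OF f]]) (auto intro!: derivative_eq_intros)
  from dderiv_eqI[OF this] show ?thesis
    using linear_cmul[OF has_derivative_linear[OF smooth_has_derivative[OF f]]] by simp
qed

section \<open>Parabolic cut-off functions\<close>

definition unit_cutoff :: "'a::euclidean_space \<Rightarrow> real" where "unit_cutoff x = 1 - chi ((norm x)\<^sup>2 / 4)"

lemma smooth_unit_cutoff: "smooth unit_cutoff"
  using smooth_diff[OF smooth_const[of 1] smooth_radial[OF smooth_chi, of 4 1]] by (simp add: unit_cutoff_def[abs_def])

lemma unit_cutoff_range: "0 \<le> unit_cutoff x" "unit_cutoff x \<le> 1" using chi_nonneg chi_le_1 by (auto simp: unit_cutoff_def)

lemma unit_cutoff_eq_1: "norm x \<le> 1 \<Longrightarrow> unit_cutoff x = 1"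
  using power_mono[of "norm x" 1 2] by (simp add: unit_cutoff_def chi_eq_0)

lemma unit_cutoff_eq_0: "2 \<le> norm x \<Longrightarrow> unit_cutoff x = 0"
  using power_mono[of 2 "norm x" 2] by (simp add: unit_cutoff_def chi_eq_1)

definition unit_cutoff_bound :: real where
  "unit_cutoff_bound = (SOME B. 0 < B \<and> (\<forall>i x. \<bar>dderiv (axis i 1) unit_cutoff (x::real^3)\<bar> \<le> B)
    \<and> (\<forall>i x. \<bar>dderiv (axis i 1) (dderiv (axis i 1) unit_cutoff) (x::real^3)\<bar> \<le> B) \<and> (\<forall>t. \<bar>dderiv 1 unit_cutoff (t::real)\<bar> \<le> B))"

lemma unit_cutoff_bound: "0 < unit_cutoff_bound" "\<bar>dderiv (axis i 1) unit_cutoff (x::real^3)\<bar> \<le> unit_cutoff_bound"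
    "\<bar>dderiv (axis i 1) (dderiv (axis i 1) unit_cutoff) (x::real^3)\<bar> \<le> unit_cutoff_bound" "\<bar>dderiv 1 unit_cutoff (t::real)\<bar> \<le> unit_cutoff_bound"
proof -
  have z: "unit_cutoff x = 0" if "x \<notin> cball 0 2" for x :: "'a::euclidean_space" using that by (intro unit_cutoff_eq_0) auto
  have z1: "dderiv v unit_cutoff x = 0" if "x \<notin> cball 0 2" for x v :: "'a::euclidean_space"
    by (rule dderiv_eq_0_outside[OF z closed_cball that])
  have z2: "dderiv u (dderiv v unit_cutoff) x = 0" if "x \<notin> cball 0 2" for x u v :: "'a::euclidean_space"
    by (rule dderiv_eq_0_outside[OF z1 closed_cball that])
  note b = bounded_of_compact_support[OF smooth_continuous_on compact_cball]
  have "\<exists>B\<ge>0. \<forall>x. \<bar>dderiv (axis i 1) unit_cutoff (x::real^3)\<bar> \<le> B" for i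
    by (rule b[OF _ z1]) (intro smooth_dderiv smooth_unit_cutoff)
  then obtain B1 where B1: "\<And>i. 0 \<le> B1 i" "\<And>i x. \<bar>dderiv (axis i 1) unit_cutoff (x::real^3)\<bar> \<le> B1 i" by metis
  have "\<exists>B\<ge>0. \<forall>x. \<bar>dderiv (axis i 1) (dderiv (axis i 1) unit_cutoff) (x::real^3)\<bar> \<le> B" for i
    by (rule b[OF _ z2]) (intro smooth_dderiv smooth_unit_cutoff)
  then obtain B2 where B2: "\<And>i. 0 \<le> B2 i" "\<And>i x. \<bar>dderiv (axis i 1) (dderiv (axis i 1) unit_cutoff) (x::real^3)\<bar> \<le> B2 i" by metis
  have "\<exists>B\<ge>0. \<forall>t. \<bar>dderiv 1 unit_cutoff (t::real)\<bar> \<le> B"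
    by (rule b[OF _ z1]) (intro smooth_dderiv smooth_unit_cutoff)
  then obtain B3 where B3: "0 \<le> B3" "\<And>t. \<bar>dderiv 1 unit_cutoff (t::real)\<bar> \<le> B3" by metis
  define B where "B = (\<Sum>i\<in>UNIV. B1 i) + (\<Sum>i\<in>UNIV. B2 i) + B3 + 1"
  have s: "0 \<le> (\<Sum>i\<in>UNIV. B1 i)" "0 \<le> (\<Sum>i\<in>UNIV. B2 i)" using B1 B2 by (auto intro: sum_nonneg)
  have m: "B1 i \<le> (\<Sum>i\<in>UNIV. B1 i)" "B2 i \<le> (\<Sum>i\<in>UNIV. B2 i)" for i
    using B1 B2 by (auto intro!: member_le_sum)
  have "0 < B" using s B3 by (simp add: B_def)
  moreover have "\<bar>dderiv (axis i 1) unit_cutoff (x::real^3)\<bar> \<le> B" for i x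
    using B1(2)[of i x] m(1)[of i] s B3(1) unfolding B_def by linarith
  moreover have "\<bar>dderiv (axis i 1) (dderiv (axis i 1) unit_cutoff) (x::real^3)\<bar> \<le> B" for i x
    using B2(2)[of i x] m(2)[of i] s B3(1) unfolding B_def by linarith
  moreover have "\<bar>dderiv 1 unit_cutoff (t::real)\<bar> \<le> B" for t
    using B3(2)[of t] s unfolding B_def by linarith
  ultimately have "\<exists>B. 0 < B \<and> (\<forall>i x. \<bar>dderiv (axis i 1) unit_cutoff (x::real^3)\<bar> \<le> B)
    \<and> (\<forall>i x. \<bar>dderiv (axis i 1) (dderiv (axis i 1) unit_cutoff) (x::real^3)\<bar> \<le> B) \<and> (\<forall>t. \<bar>dderiv 1 unit_cutoff (t::real)\<bar> \<le> B)"
    by blast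
  from someI_ex[OF this] show "0 < unit_cutoff_bound" "\<bar>dderiv (axis i 1) unit_cutoff (x::real^3)\<bar> \<le> unit_cutoff_bound"
    "\<bar>dderiv (axis i 1) (dderiv (axis i 1) unit_cutoff) (x::real^3)\<bar> \<le> unit_cutoff_bound" "\<bar>dderiv 1 unit_cutoff (t::real)\<bar> \<le> unit_cutoff_bound"
    unfolding unit_cutoff_bound_def[symmetric] by blast+
qed

definition cutoff_x :: "real \<Rightarrow> real^3 \<Rightarrow> real" where "cutoff_x r x = unit_cutoff ((1/r) *\<^sub>R x)"
definition cutoff_t :: "real \<Rightarrow> real \<Rightarrow> real" where "cutoff_t r t = unit_cutoff ((1/r\<^sup>2) *\<^sub>R t)"
text \<open>Scaled parabolically from one profile that is used in space and in time. The time factor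
  is even, so it is still 1 at t = 0: a test function of the energy inequality vanishes near the
  bottom and the lateral boundary, but may be nonzero at the top.\<close>

definition cutoff :: "real \<Rightarrow> spacetime \<Rightarrow> real" where "cutoff r z = cutoff_x r (fst z) * cutoff_t r (snd z)"

lemma smooth_cutoff_x: "smooth (cutoff_x r)" and smooth_cutoff_t: "smooth (cutoff_t r)"
  unfolding cutoff_x_def[abs_def] cutoff_t_def[abs_def]
  using smooth_compose_affine[OF bounded_linear_scaleR_right smooth_unit_cutoff, of "1/r" 0]
    smooth_compose_affine[OF bounded_linear_scaleR_right smooth_unit_cutoff, of "1/r\<^sup>2" 0] by (simp_all only: add_0_right)

lemma cutoff_x_eq_0: "0 < r \<Longrightarrow> 2 * r \<le> norm x \<Longrightarrow> cutoff_x r x = 0"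
  unfolding cutoff_x_def by (rule unit_cutoff_eq_0) (simp add: field_simps)

lemma cutoff_t_eq_0: "0 < r \<Longrightarrow> 2 * r\<^sup>2 \<le> \<bar>t\<bar> \<Longrightarrow> cutoff_t r t = 0"
  unfolding cutoff_t_def by (rule unit_cutoff_eq_0) (simp add: field_simps abs_mult)

lemma cutoff_x_eq_1: "0 < r \<Longrightarrow> norm x \<le> r \<Longrightarrow> cutoff_x r x = 1"
  unfolding cutoff_x_def by (rule unit_cutoff_eq_1) (simp add: field_simps)

lemma cutoff_t_eq_1: "0 < r \<Longrightarrow> \<bar>t\<bar> \<le> r\<^sup>2 \<Longrightarrow> cutoff_t r t = 1"
  unfolding cutoff_t_def by (rule unit_cutoff_eq_1) (simp add: field_simps abs_mult)

lemma cutoff_x_test: assumes "0 < r" "2 * r < 1" shows "cutoff_x r \<in> test_functions (ball 0 1)"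
  by (rule smooth_test_functionsI[OF smooth_cutoff_x compact_cball[of 0 "2*r"]]) (use assms cutoff_x_eq_0 in auto)

lemma cutoff_energy_test:
  assumes r: "0 < r" "2 * r < 1" shows "cutoff r \<in> energy_test_functions"
proof -
  let ?K = "cball 0 (2*r) \<times> {-(2*r\<^sup>2)..2*r\<^sup>2} :: spacetime set"
  have K: "compact ?K" by (intro compact_Times) auto
  have z: "cutoff r z = 0" if "z \<notin> ?K" for z
  proof -
    have "2 * r \<le> norm (fst z) \<or> 2 * r\<^sup>2 \<le> \<bar>snd z\<bar>" using that by (cases z) auto
    then show ?thesis using cutoff_x_eq_0[OF r(1)] cutoff_t_eq_0[OF r(1)] by (auto simp: cutoff_def)
  qed
  have sm: "smooth (cutoff r)" unfolding cutoff_def[abs_def] by (rule smooth_tensor[OF smooth_cutoff_x smooth_cutoff_t])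
  have "cutoff r \<in> test_functions UNIV" by (rule smooth_test_functionsI[OF sm K _ z]) auto
  moreover have "0 \<le> cutoff r z" for z by (simp add: cutoff_def cutoff_x_def cutoff_t_def unit_cutoff_range)
  moreover have "open (- ?K)" using K compact_imp_closed by auto
  moreover have "parabolic_boundary \<subseteq> - ?K"
  proof -
    have "r\<^sup>2 < (1/2)\<^sup>2" using r by (intro power_strict_mono) auto
    then have "2 * r\<^sup>2 < 1" by (simp add: power2_eq_square)
    then show ?thesis using r by (auto simp: parabolic_boundary_def)
  qed
  ultimately show ?thesis unfolding energy_test_functions_def using z by blast
qed

definition cutoff_grad :: "real \<Rightarrow> real^3 \<Rightarrow> real^3" where "cutoff_grad r x = (\<chi> i. dderiv (axis i 1) (cutoff_x r) x)"

lemma cutoff_t_range: "0 \<le> cutoff_t r t" "cutoff_t r t \<le> 1" and cutoff_x_range: "0 \<le> cutoff_x r x" "cutoff_x r x \<le> 1"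
  by (auto simp: cutoff_x_def cutoff_t_def unit_cutoff_range)

lemma dderiv_cutoff_x: "dderiv v (cutoff_x r) x = (1/r) * dderiv v unit_cutoff ((1/r) *\<^sub>R x)"
  unfolding cutoff_x_def[abs_def] by (rule dderiv_scale[OF smooth_unit_cutoff])

lemma norm_cutoff_grad: assumes "0 < r" shows "norm (cutoff_grad r x) \<le> 3 * unit_cutoff_bound / r"
proof -
  have "norm (cutoff_grad r x) \<le> (\<Sum>i\<in>UNIV. \<bar>cutoff_grad r x $ i\<bar>)" by (rule norm_le_l1_cart)
  also have "\<dots> \<le> (\<Sum>i\<in>(UNIV::3 set). unit_cutoff_bound / r)"
    using assms unit_cutoff_bound(2) by (intro sum_mono) (simp add: cutoff_grad_def dderiv_cutoff_x abs_mult divide_right_mono)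
  finally show ?thesis by simp
qed

lemma grad_cutoff: "grad_x (cutoff r) (x, t) = cutoff_t r t *\<^sub>R cutoff_grad r x"
  using grad_tensor[OF smooth_cutoff_x[of r] smooth_cutoff_t[of r], of "(x, t)"] by (simp add: cutoff_def[abs_def] cutoff_grad_def)

lemma norm_grad_cutoff: assumes "0 < r" shows "norm (grad_x (cutoff r) (x, t)) \<le> 3 * unit_cutoff_bound / r"
proof -
  have "norm (grad_x (cutoff r) (x, t)) \<le> 1 * norm (cutoff_grad r x)"
    unfolding grad_cutoff norm_scaleR using cutoff_t_range[of r t] by (intro mult_right_mono) auto
  with norm_cutoff_grad[OF assms, of x] show ?thesis by simp
qed

lemma heat_cutoff_bound:
  assumes r: "0 < r" shows "\<bar>laplace_x (cutoff r) (x, t) + dderiv e_t (cutoff r) (x, t)\<bar> \<le> 4 * unit_cutoff_bound / r\<^sup>2"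
proof -
  have "dderiv (axis i 1) (dderiv (axis i 1) (cutoff_x r)) x = (1/r) * ((1/r) * dderiv (axis i 1) (dderiv (axis i 1) unit_cutoff) ((1/r) *\<^sub>R x))" for i
  proof -
    have "dderiv (axis i 1) (cutoff_x r) = (\<lambda>x. (1/r) * dderiv (axis i 1) unit_cutoff ((1/r) *\<^sub>R x))" by (intro ext dderiv_cutoff_x)
    moreover have "smooth (\<lambda>x. (1/r) * dderiv (axis i 1) unit_cutoff x)"
      by (intro smooth_mult smooth_const smooth_dderiv smooth_unit_cutoff)
    moreover have "dderiv (axis i 1) (\<lambda>x. (1/r) * dderiv (axis i 1) unit_cutoff x) y = (1/r) * dderiv (axis i 1) (dderiv (axis i 1) unit_cutoff) y" for y :: "real^3"
      by (rule dderiv_eqI) (intro has_derivative_mult_right smooth_has_derivative smooth_dderiv smooth_unit_cutoff)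
    ultimately show ?thesis using dderiv_scale[of "\<lambda>x. (1/r) * dderiv (axis i 1) unit_cutoff x" "axis i 1" "1/r" x] by simp
  qed
  then have b: "\<bar>dderiv (axis i 1) (dderiv (axis i 1) (cutoff_x r)) x\<bar> \<le> unit_cutoff_bound / r\<^sup>2" for i
    using unit_cutoff_bound(3)[of i "(1/r) *\<^sub>R x"] r by (simp add: abs_mult power2_eq_square divide_right_mono)
  have "\<bar>\<Sum>i\<in>UNIV. dderiv (axis i 1) (dderiv (axis i 1) (cutoff_x r)) x\<bar> \<le> (\<Sum>i\<in>(UNIV::3 set). unit_cutoff_bound / r\<^sup>2)"
    by (intro order_trans[OF sum_abs] sum_mono b)
  then have l: "\<bar>(\<Sum>i\<in>UNIV. dderiv (axis i 1) (dderiv (axis i 1) (cutoff_x r)) x) * cutoff_t r t\<bar> \<le> 3 * (unit_cutoff_bound / r\<^sup>2) * 1"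
    unfolding abs_mult using cutoff_t_range[of r t] by (intro mult_mono) auto
  have "\<bar>dderiv 1 (cutoff_t r) t\<bar> \<le> unit_cutoff_bound / r\<^sup>2"
    unfolding cutoff_t_def[abs_def] dderiv_scale[OF smooth_unit_cutoff] using unit_cutoff_bound(4) r by (simp add: abs_mult divide_right_mono)
  then have "\<bar>cutoff_x r x * dderiv 1 (cutoff_t r) t\<bar> \<le> 1 * (unit_cutoff_bound / r\<^sup>2)"
    unfolding abs_mult using cutoff_x_range[of r x] by (intro mult_mono) auto
  with l show ?thesis
    using laplace_tensor[OF smooth_cutoff_x[of r] smooth_cutoff_t[of r], of "(x, t)"]
      fun_cong[OF dderiv_tensor_t[OF smooth_cutoff_x[of r] smooth_cutoff_t[of r]], of "(x, t)"]
    by (simp add: cutoff_def[abs_def])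
qed

text \<open>The cut-off vanishes off radius 2r and off times of modulus 2r^2. The larger margins
  place the point in the open complement, where all derivatives vanish as well.\<close>

lemma cutoff_deriv_support:
  assumes r: "0 < r" and z: "3 * r \<le> norm x \<or> 4 * r\<^sup>2 \<le> \<bar>t\<bar>"
  shows "laplace_x (cutoff r) (x, t) = 0" "dderiv e_t (cutoff r) (x, t) = 0" "grad_x (cutoff r) (x, t) = 0"
proof -
  let ?K = "cball 0 (2*r) \<times> {-(2*r\<^sup>2)..2*r\<^sup>2} :: spacetime set"
  have K: "closed ?K" by (intro closed_Times) auto
  have 0: "cutoff r z = 0" if "z \<notin> ?K" for z
  proof -
    have "2 * r \<le> norm (fst z) \<or> 2 * r\<^sup>2 \<le> \<bar>snd z\<bar>" using that by (cases z) auto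
    then show ?thesis using cutoff_x_eq_0[OF r] cutoff_t_eq_0[OF r] by (auto simp: cutoff_def)
  qed
  have 1: "dderiv v (cutoff r) z = 0" if "z \<notin> ?K" for v z by (rule dderiv_eq_0_outside[OF 0 K that])
  have 2: "dderiv u (dderiv v (cutoff r)) z = 0" if "z \<notin> ?K" for u v z by (rule dderiv_eq_0_outside[OF 1 K that])
  have "0 < r\<^sup>2" using r by simp
  then have "2 * r < norm x \<or> 2 * r\<^sup>2 < \<bar>t\<bar>" using z r by linarith
  then have "(x, t) \<notin> ?K" by auto
  then show "laplace_x (cutoff r) (x, t) = 0" "dderiv e_t (cutoff r) (x, t) = 0" "grad_x (cutoff r) (x, t) = 0"
    by (auto simp: laplace_x_def grad_x_def 1 2 vec_eq_iff)
qed

text \<open>A divergent integral is 0 by convention and therefore at most \<open>X\<close>.\<close>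

lemma integral_le_of_nn_integral:
  fixes f :: "'a \<Rightarrow> real"
  assumes "(\<integral>\<^sup>+x. ennreal (f x) \<partial>M) \<le> ennreal X" "0 \<le> X" shows "integral\<^sup>L M f \<le> X"
proof (cases "integrable M f")
  case True
  have "integral\<^sup>L M f \<le> enn2real (\<integral>\<^sup>+x. ennreal (f x) \<partial>M)"
    using real_lebesgue_integral_def[OF True] by simp
  also have "\<dots> \<le> X" using assms by (intro enn2real_leI) auto
  finally show ?thesis .
qed (use assms in \<open>simp add: not_integrable_integral_eq\<close>)

text \<open>If \<open>f\<close> is not integrable, neither is the sum, and both sides are 0. In this
  way the integrand of the energy inequality is treated without asking whether it is
  integrable.\<close>

lemma integral_add_null:
  fixes f h :: "'a \<Rightarrow> real"
  assumes h: "integrable M h" "integral\<^sup>L M h = 0" shows "integral\<^sup>L M (\<lambda>x. f x + h x) = integral\<^sup>L M f"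
proof (cases "integrable M f")
  case False
  have "\<not> integrable M (\<lambda>x. f x + h x)"
    using Bochner_Integration.integrable_diff[of M "\<lambda>x. f x + h x" h] h False by auto
  with False show ?thesis by (simp add: not_integrable_integral_eq)
qed (use h in simp)

context scaled_solution
begin

text \<open>A bound for the right-hand side of the local energy inequality with the cut-off at scale \<open>r\<close>.
  Subtracting functions of time from \<open>|v|^2\<close> and \<open>p\<close> does not change it, since \<open>v\<close> is divergence-free.\<close>

definition energy_flux :: "real \<Rightarrow> spacetime \<Rightarrow> real" where
  "energy_flux r z = 4 * unit_cutoff_bound / r\<^sup>2 * (norm (V z))\<^sup>2
    + 3 * unit_cutoff_bound / r * norm (V z) * (\<bar>(norm (V z))\<^sup>2 - (norm (local_mean (snd z)))\<^sup>2\<bar> + 2 * \<bar>Pr z - pressure_mean (snd z)\<bar>)"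

text \<open>The cut-off is a product, so at each time its spatial gradient is a multiple of that of
  the one test function \<open>cutoff_x r\<close>; \<open>DIV\<close> is applied to it, with a
  single null set of times. The right-hand side reduces to the cylinder of radius 3r and length
  4r^2, because the derivatives of the cut-off vanish elsewhere at negative times.\<close>

lemma energy_bound:
  assumes r: "0 < r" "2 * r < 1" "4 * r\<^sup>2 \<le> R\<^sup>2" and X: "0 \<le> X" "cyl (3 * r) (4 * r\<^sup>2) (\<lambda>z. ennreal (energy_flux r z)) \<le> ennreal X"
  shows "AE t in lborel. t \<in> {-(r\<^sup>2)<..<0} \<longrightarrow> (LINT x|lborel. indicator (ball 0 r) x * (norm (V (x, t)))\<^sup>2) \<le> X"
proof -
  have r1: "r\<^sup>2 < 1" using r power_strict_mono[of r 1 2] by auto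
  let ?h = "\<lambda>s. LINT x|lborel. (norm (V (x, s)))\<^sup>2 * (laplace_x (cutoff r) (x, s) + dderiv e_t (cutoff r) (x, s))
              + (V (x, s) \<bullet> grad_x (cutoff r) (x, s)) * ((norm (V (x, s)))\<^sup>2 + 2 * Pr (x, s))"
  have slice: "AE s in lborel. s < 0 \<longrightarrow>
      ennreal (?h s) \<le> indicator {-(4*r\<^sup>2)<..<0} s * (\<integral>\<^sup>+x. indicator (ball 0 (3*r)) x * ennreal (energy_flux r (x, s)) \<partial>lborel)"
    using DIV[OF cutoff_x_test[OF r(1,2)]] WG
  proof eventually_elim
    case (elim s)
    show ?case
    proof
      assume s0: "s < 0"
      show "ennreal (?h s) \<le> indicator {-(4*r\<^sup>2)<..<0} s * (\<integral>\<^sup>+x. indicator (ball 0 (3*r)) x * ennreal (energy_flux r (x, s)) \<partial>lborel)"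
      proof (cases "s \<in> {-(4*r\<^sup>2)<..<0}")
        case False
        then have "4 * r\<^sup>2 \<le> \<bar>s\<bar>" using s0 by auto
        then show ?thesis using cutoff_deriv_support[OF r(1)] by simp
      next
        case True
        note wgD = weak_gradD[OF elim(2)]
        let ?k = "(norm (local_mean s))\<^sup>2 + 2 * pressure_mean s"
        let ?F1 = "\<lambda>x. (norm (V (x, s)))\<^sup>2 * (laplace_x (cutoff r) (x, s) + dderiv e_t (cutoff r) (x, s))
              + (V (x, s) \<bullet> grad_x (cutoff r) (x, s)) * ((norm (V (x, s)))\<^sup>2 - (norm (local_mean s))\<^sup>2 + 2 * (Pr (x, s) - pressure_mean s))"
        let ?F2 = "\<lambda>x. (cutoff_t r s * ?k) * (\<Sum>j\<in>UNIV. V (x, s) $ j * dderiv (axis j 1) (cutoff_x r) x)"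
        have i2: "integrable lborel ?F2"
          by (intro integrable_mult_right Bochner_Integration.integrable_sum
              integrable_mult_test[OF wgD(5) test_functions_dderiv[OF cutoff_x_test[OF r(1,2)]]])
        have z2: "integral\<^sup>L lborel ?F2 = 0" using elim(1) by simp
        have gr: "V (x, s) \<bullet> grad_x (cutoff r) (x, s) = cutoff_t r s * (\<Sum>j\<in>UNIV. V (x, s) $ j * dderiv (axis j 1) (cutoff_x r) x)" for x
          by (simp add: grad_cutoff cutoff_grad_def inner_vec_def sum_distrib_left mult.left_commute)
        have "?h s = (LINT x|lborel. ?F1 x + ?F2 x)"
        proof (intro Bochner_Integration.integral_cong refl)
          fix x
          have "h + c * S * (q + 2 * p) = h + c * S * (q - k + 2 * (p - m)) + c * (k + 2 * m) * S" for h c S q p k m :: real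
            by (simp add: algebra_simps)
          then show "(norm (V (x, s)))\<^sup>2 * (laplace_x (cutoff r) (x, s) + dderiv e_t (cutoff r) (x, s))
              + (V (x, s) \<bullet> grad_x (cutoff r) (x, s)) * ((norm (V (x, s)))\<^sup>2 + 2 * Pr (x, s)) = ?F1 x + ?F2 x"
            unfolding gr .
        qed
        also have "\<dots> = integral\<^sup>L lborel ?F1" by (rule integral_add_null[OF i2 z2])
        finally have "ennreal (?h s) \<le> ennreal \<bar>integral\<^sup>L lborel ?F1\<bar>" by (simp only: ennreal_leI[OF abs_ge_self])
        also have "\<dots> \<le> (\<integral>\<^sup>+x. ennreal \<bar>?F1 x\<bar> \<partial>lborel)" by (rule ennreal_abs_integral_le)
        also have "\<dots> \<le> (\<integral>\<^sup>+x. indicator (ball 0 (3*r)) x * ennreal (energy_flux r (x, s)) \<partial>lborel)"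
        proof (intro nn_integral_mono)
          fix x
          show "ennreal \<bar>?F1 x\<bar> \<le> indicator (ball 0 (3*r)) x * ennreal (energy_flux r (x, s))"
          proof (cases "x \<in> ball 0 (3*r)")
            case False
            then have "3 * r \<le> norm x" by simp
            then show ?thesis using cutoff_deriv_support[OF r(1)] by simp
          next
            case True
            have "\<bar>?F1 x\<bar> \<le> \<bar>(norm (V (x, s)))\<^sup>2 * (laplace_x (cutoff r) (x, s) + dderiv e_t (cutoff r) (x, s))\<bar>
              + \<bar>(V (x, s) \<bullet> grad_x (cutoff r) (x, s)) * ((norm (V (x, s)))\<^sup>2 - (norm (local_mean s))\<^sup>2 + 2 * (Pr (x, s) - pressure_mean s))\<bar>"
              by (rule abs_triangle_ineq)
            also have "\<dots> \<le> (norm (V (x, s)))\<^sup>2 * (4 * unit_cutoff_bound / r\<^sup>2)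
              + (norm (V (x, s)) * (3 * unit_cutoff_bound / r)) * (\<bar>(norm (V (x, s)))\<^sup>2 - (norm (local_mean s))\<^sup>2\<bar> + 2 * \<bar>Pr (x, s) - pressure_mean s\<bar>)"
              unfolding abs_mult
            proof (intro add_mono mult_mono)
              show "\<bar>(norm (V (x, s)))\<^sup>2 - (norm (local_mean s))\<^sup>2 + 2 * (Pr (x, s) - pressure_mean s)\<bar>
                \<le> \<bar>(norm (V (x, s)))\<^sup>2 - (norm (local_mean s))\<^sup>2\<bar> + 2 * \<bar>Pr (x, s) - pressure_mean s\<bar>"
                using abs_mult[of 2 "Pr (x, s) - pressure_mean s"]
                  abs_triangle_ineq[of "(norm (V (x, s)))\<^sup>2 - (norm (local_mean s))\<^sup>2" "2 * (Pr (x, s) - pressure_mean s)"] by linarith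
              show "\<bar>V (x, s) \<bullet> grad_x (cutoff r) (x, s)\<bar> \<le> norm (V (x, s)) * (3 * unit_cutoff_bound / r)"
                by (rule order_trans[OF Cauchy_Schwarz_ineq2]) (intro mult_left_mono norm_grad_cutoff r, simp)
            qed (use heat_cutoff_bound[OF r(1)] unit_cutoff_bound(1) r in auto)
            also have "\<dots> = energy_flux r (x, s)" by (simp add: energy_flux_def mult_ac)
            finally show ?thesis using True by (simp add: ennreal_leI)
          qed
        qed
        finally show ?thesis using True by simp
      qed
    qed
  qed
  have V2': "AE t in lborel. integrable lborel (\<lambda>x. (norm (V (x, t)))\<^sup>2)" by (rule integrable_spacetime[OF V2])
  show ?thesis using EN V2'
  proof eventually_elim
    case (elim t)
    show ?case
    proof
      assume t: "t \<in> {-(r\<^sup>2)<..<0}"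
      have [measurable]: "(\<lambda>x. cutoff r (x, t)) \<in> borel_measurable borel"
        using smooth_borel[OF smooth_cutoff_x] by (simp add: cutoff_def)
      have "(LINT x|lborel. indicator (ball 0 r) x * (norm (V (x, t)))\<^sup>2) \<le> (LINT x|lborel. cutoff r (x, t) * (norm (V (x, t)))\<^sup>2)"
      proof (rule integral_mono)
        show "integrable lborel (\<lambda>x. indicator (ball 0 r) x * (norm (V (x, t)))\<^sup>2)"
          using integrable_mult_indicator[of "ball 0 r" lborel "\<lambda>x. (norm (V (x, t)))\<^sup>2"] elim(2) by auto
        show "integrable lborel (\<lambda>x. cutoff r (x, t) * (norm (V (x, t)))\<^sup>2)"
        proof -
          have "\<bar>cutoff r (x, t)\<bar> \<le> 1" for x
            using cutoff_x_range[of r x] cutoff_t_range[of r t] by (simp add: cutoff_def abs_mult mult_le_one)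
          from integrable_mult_bounded[OF elim(2) _ this] show ?thesis by (simp add: mult.commute)
        qed
        show "indicator (ball 0 r) x * (norm (V (x, t)))\<^sup>2 \<le> cutoff r (x, t) * (norm (V (x, t)))\<^sup>2" for x
          using cutoff_x_eq_1[OF r(1), of x] cutoff_t_eq_1[OF r(1), of t] t cutoff_x_range[of r x] cutoff_t_range[of r t]
          by (cases "x \<in> ball 0 r") (auto simp: cutoff_def)
      qed
      also have "\<dots> \<le> (LINT s|lborel. indicator {-1<..<t} s * ?h s)"
      proof -
        have "t \<in> {-1<..<0}" using t r1 by auto
        then show ?thesis using elim(1) cutoff_energy_test[OF r(1,2)] by blast
      qed
      also have "\<dots> \<le> X"
      proof (rule integral_le_of_nn_integral[OF _ X(1)])
        have "(\<integral>\<^sup>+s. ennreal (indicator {-1<..<t} s * ?h s) \<partial>lborel) \<le> cyl (3 * r) (4 * r\<^sup>2) (\<lambda>z. ennreal (energy_flux r z))"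
          unfolding cyl_def
        proof (rule nn_integral_mono_AE)
          show "AE s in lborel. ennreal (indicator {-1<..<t} s * ?h s)
            \<le> indicator {-(4*r\<^sup>2)<..<0} s * (\<integral>\<^sup>+x. indicator (ball 0 (3*r)) x * ennreal (energy_flux r (x, s)) \<partial>lborel)"
            using slice
          proof eventually_elim
            case (elim s)
            then show ?case using t by (cases "s \<in> {-1<..<t}") auto
          qed
        qed
        with X(2) show "(\<integral>\<^sup>+s. ennreal (indicator {-1<..<t} s * ?h s) \<partial>lborel) \<le> ennreal X" by simp
      qed
      finally show "(LINT x|lborel. indicator (ball 0 r) x * (norm (V (x, t)))\<^sup>2) \<le> X" .
    qed
  qed
qed

end

subsection \<open>Estimates at a smaller scale\<close>

text \<open>According to the size of \<open>q\<close> relative to l p^2, one of the two terms alone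
  dominates the product.\<close>

lemma young_three_halves:
  fixes p q l :: real
  assumes "0 \<le> p" "0 \<le> q" "0 < l" shows "p * q \<le> l * p ^ 3 + 1 / sqrt l * q powr (3/2)"
proof (cases "q \<le> l * p\<^sup>2")
  case True
  then have "p * q \<le> p * (l * p\<^sup>2)" using assms by (intro mult_left_mono) auto
  then have "p * q \<le> l * p ^ 3" by (simp add: power2_eq_square power3_eq_cube mult_ac)
  moreover have "0 \<le> 1 / sqrt l * q powr (3/2)" using assms by simp
  ultimately show ?thesis by linarith
next
  case False
  have q: "q powr (3/2) = q * sqrt q"
  proof (cases "q = 0")
    case False
    then show ?thesis using assms powr_add[of q 1 "1/2"] by (simp add: powr_half_sqrt)
  qed simp
  have "p\<^sup>2 \<le> q / l" using False assms by (simp add: field_simps)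
  then have "p \<le> sqrt (q / l)" by (rule real_le_rsqrt)
  then have "p * q \<le> sqrt (q / l) * q" using assms by (intro mult_right_mono) auto
  also have "\<dots> = 1 / sqrt l * q powr (3/2)" unfolding q by (simp add: real_sqrt_divide)
  finally show ?thesis using assms by (smt (verit) mult_nonneg_nonneg zero_le_power)
qed

text \<open>Every term on the right contains a factor \<open>w\<close>. A term c^3 would have degree
  3/2 in \<open>a\<close>, too high in a bound for \<open>A\<close> that is to be raised to the
  power 3/2. The mixed term w^2 c is absorbed by means of w (w - c)^2 \<ge> 0.\<close>

lemma cubic_difference_bound:
  fixes v w c :: real
  assumes "0 \<le> v" "0 \<le> w" "0 \<le> c" "\<bar>v - c\<bar> \<le> w"
  shows "v * \<bar>v\<^sup>2 - c\<^sup>2\<bar> \<le> 4 * w ^ 3 + 4 * (w * c\<^sup>2)"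
proof -
  have "\<bar>v\<^sup>2 - c\<^sup>2\<bar> = \<bar>v - c\<bar> * (v + c)"
    using assms by (simp add: power2_eq_square square_diff_square_factored abs_mult mult.commute)
  also have "\<dots> \<le> w * (w + 2 * c)" using assms by (intro mult_mono) auto
  finally have "v * \<bar>v\<^sup>2 - c\<^sup>2\<bar> \<le> (w + c) * (w * (w + 2 * c))" using assms by (intro mult_mono) auto
  also have "\<dots> = w ^ 3 + 3 * (w\<^sup>2 * c) + 2 * (w * c\<^sup>2)" by (simp add: power2_eq_square power3_eq_cube algebra_simps)
  also have "\<dots> \<le> 4 * w ^ 3 + 4 * (w * c\<^sup>2)"
  proof -
    have "0 \<le> w * (w - c)\<^sup>2" using assms by simp
    also have "\<dots> = w ^ 3 - 2 * (w\<^sup>2 * c) + w * c\<^sup>2" by (simp add: power2_eq_square power3_eq_cube algebra_simps)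
    finally have "2 * (w\<^sup>2 * c) \<le> w ^ 3 + w * c\<^sup>2" by simp
    moreover have "0 \<le> w ^ 3" "0 \<le> w * c\<^sup>2" using assms by auto
    ultimately show ?thesis by linarith
  qed
  finally show ?thesis .
qed

lemma le_add_square_over: assumes "0 < \<tau>" shows "w \<le> \<tau> + w\<^sup>2 / (\<tau>::real)"
proof -
  have "0 \<le> (w - \<tau> / 2)\<^sup>2 / \<tau>" using assms by simp
  also have "\<dots> = w\<^sup>2 / \<tau> - w + \<tau> / 4" using assms by (simp add: power2_eq_square field_simps)
  finally show ?thesis using assms by simp
qed

text \<open>The coefficients of the identities \<open>e1\<close> to \<open>e7\<close> in
  \<open>energy_step\<close>, the last two sharing one summand. The factors 6912 and 10368 are 8 and
  12 times 8 * 27 * 4: 8 from the bound for the local mean, 27 and 4 from the volume of the cylinder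
  of radius 3r and length 4r^2.\<close>

definition energy_const :: real where
  "energy_const = 8 * unit_cutoff_bound * (oscillation_const * riesz_const (5/4)) + 96 * unit_cutoff_bound * avg_const * (oscillation_const * riesz_const (5/4))
     + 6912 * unit_cutoff_bound * avg_const * unit_ball_vol 3 + 10368 * unit_cutoff_bound * avg_const * unit_ball_vol 3
     + 12 * unit_cutoff_bound * cubic_const + 6 * unit_cutoff_bound"

context scaled_solution
begin

text \<open>Two parameters stay free. \<open>\<tau>\<close> splits w c^2 and will depend on \<theta>
  and R only; \<open>l\<close> splits the product of velocity and pressure, and its choice will
  depend on the size of the solution.\<close>

lemma energy_flux_pointwise:
  assumes r: "0 < r" and l: "0 < l" and \<tau>: "0 < \<tau>" and c: "(norm (local_mean t))\<^sup>2 \<le> cc"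
  shows "energy_flux r (x, t) \<le> (8 * unit_cutoff_bound / r\<^sup>2 + 12 * unit_cutoff_bound / r * cc / \<tau>) * (norm (W (x, t)))\<^sup>2
     + (8 * unit_cutoff_bound / r\<^sup>2 * cc + 12 * unit_cutoff_bound / r * cc * \<tau>)
     + 12 * unit_cutoff_bound / r * norm (W (x, t)) ^ 3
     + 6 * unit_cutoff_bound / r * l * norm (V (x, t)) ^ 3
     + 6 * unit_cutoff_bound / r / sqrt l * \<bar>Pr (x, t) - pressure_mean t\<bar> powr (3/2)"
proof -
  define v w c where "v = norm (V (x, t))" "w = norm (W (x, t))" "c = norm (local_mean t)"
  note defs = this
  have nn: "0 \<le> v" "0 \<le> w" "0 \<le> c" by (auto simp: defs)
  have vc: "\<bar>v - c\<bar> \<le> w" unfolding defs W_def using norm_triangle_ineq3[of "V (x, t)" "local_mean t"] by simp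
  have c2: "c\<^sup>2 \<le> cc" using c by (simp add: defs)
  have cc: "0 \<le> cc" using c2 zero_le_power2[of c] by linarith
  have "v\<^sup>2 \<le> (w + c)\<^sup>2" using vc nn by (intro power_mono) auto
  also have "\<dots> \<le> 2 * w\<^sup>2 + 2 * c\<^sup>2" using zero_le_power2[of "w - c"] by (simp add: power2_sum power2_diff)
  finally have 1: "v\<^sup>2 \<le> 2 * w\<^sup>2 + 2 * cc" using c2 by linarith
  have "w * c\<^sup>2 \<le> (\<tau> + w\<^sup>2 / \<tau>) * cc"
    using le_add_square_over[OF \<tau>, of w] c2 nn by (intro mult_mono) auto
  then have 2: "v * \<bar>v\<^sup>2 - c\<^sup>2\<bar> \<le> 4 * w ^ 3 + 4 * ((\<tau> + w\<^sup>2 / \<tau>) * cc)"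
    using cubic_difference_bound[OF nn vc] by linarith
  have 3: "v * \<bar>Pr (x, t) - pressure_mean t\<bar> \<le> l * v ^ 3 + 1 / sqrt l * \<bar>Pr (x, t) - pressure_mean t\<bar> powr (3/2)"
    by (rule young_three_halves) (use nn l in auto)
  have "energy_flux r (x, t) = 4 * unit_cutoff_bound / r\<^sup>2 * v\<^sup>2 + 3 * unit_cutoff_bound / r * (v * \<bar>v\<^sup>2 - c\<^sup>2\<bar>) + 6 * unit_cutoff_bound / r * (v * \<bar>Pr (x, t) - pressure_mean t\<bar>)"
    by (simp add: energy_flux_def defs algebra_simps)
  also have "\<dots> \<le> 4 * unit_cutoff_bound / r\<^sup>2 * (2 * w\<^sup>2 + 2 * cc) + 3 * unit_cutoff_bound / r * (4 * w ^ 3 + 4 * ((\<tau> + w\<^sup>2 / \<tau>) * cc))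
     + 6 * unit_cutoff_bound / r * (l * v ^ 3 + 1 / sqrt l * \<bar>Pr (x, t) - pressure_mean t\<bar> powr (3/2))"
    using r unit_cutoff_bound(1) by (intro add_mono mult_left_mono 1 2 3) auto
  also have "\<dots> = (8 * unit_cutoff_bound / r\<^sup>2 + 12 * unit_cutoff_bound / r * cc / \<tau>) * w\<^sup>2
     + (8 * unit_cutoff_bound / r\<^sup>2 * cc + 12 * unit_cutoff_bound / r * cc * \<tau>)
     + 12 * unit_cutoff_bound / r * w ^ 3
     + 6 * unit_cutoff_bound / r * l * v ^ 3
     + 6 * unit_cutoff_bound / r / sqrt l * \<bar>Pr (x, t) - pressure_mean t\<bar> powr (3/2)"
    by (simp add: algebra_simps)
  finally show ?thesis by (simp add: defs)
qed

lemma cyl_linear5: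
  assumes [measurable]: "f1 \<in> borel_measurable borel" "f2 \<in> borel_measurable borel" "f3 \<in> borel_measurable borel" "f4 \<in> borel_measurable borel"
    and nn: "\<And>z. 0 \<le> f1 z" "\<And>z. 0 \<le> f2 z" "\<And>z. 0 \<le> f3 z" "\<And>z. 0 \<le> f4 z"
    and cs: "0 \<le> c0" "0 \<le> c1" "0 \<le> c2" "0 \<le> c3" "0 \<le> c4" and \<rho>: "0 \<le> \<rho>" "0 \<le> T"
    and b: "cyl \<rho> T (\<lambda>z. ennreal (f1 z)) \<le> ennreal b1" "cyl \<rho> T (\<lambda>z. ennreal (f2 z)) \<le> ennreal b2"
      "cyl \<rho> T (\<lambda>z. ennreal (f3 z)) \<le> ennreal b3" "cyl \<rho> T (\<lambda>z. ennreal (f4 z)) \<le> ennreal b4"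
    and bn: "0 \<le> b1" "0 \<le> b2" "0 \<le> b3" "0 \<le> b4"
  shows "cyl \<rho> T (\<lambda>z. ennreal (c1 * f1 z + c0 + c2 * f2 z + c3 * f3 z + c4 * f4 z))
    \<le> ennreal (c1 * b1 + c0 * (unit_ball_vol 3 * \<rho>^3) * T + c2 * b2 + c3 * b3 + c4 * b4)"
proof -
  have "cyl \<rho> T (\<lambda>z. ennreal (c1 * f1 z + c0 + c2 * f2 z + c3 * f3 z + c4 * f4 z))
    = cyl \<rho> T (\<lambda>z. ennreal c1 * ennreal (f1 z) + ennreal c0 + ennreal c2 * ennreal (f2 z) + ennreal c3 * ennreal (f3 z) + ennreal c4 * ennreal (f4 z))"
    using nn cs by (simp add: ennreal_plus ennreal_mult)
  also have "\<dots> = ennreal c1 * cyl \<rho> T (\<lambda>z. ennreal (f1 z)) + ennreal (c0 * (unit_ball_vol 3 * \<rho>^3) * T) + ennreal c2 * cyl \<rho> T (\<lambda>z. ennreal (f2 z))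
      + ennreal c3 * cyl \<rho> T (\<lambda>z. ennreal (f3 z)) + ennreal c4 * cyl \<rho> T (\<lambda>z. ennreal (f4 z))"
    using cs \<rho> by (simp add: cyl_add cyl_cmult cyl_const)
  also have "\<dots> \<le> ennreal c1 * ennreal b1 + ennreal (c0 * (unit_ball_vol 3 * \<rho>^3) * T) + ennreal c2 * ennreal b2
      + ennreal c3 * ennreal b3 + ennreal c4 * ennreal b4"
    by (intro add_mono mult_left_mono b order_refl) auto
  also have "\<dots> = ennreal (c1 * b1 + c0 * (unit_ball_vol 3 * \<rho>^3) * T + c2 * b2 + c3 * b3 + c4 * b4)"
  proof -
    have "0 \<le> c0 * (unit_ball_vol 3 * \<rho>^3) * T" using cs \<rho> by simp
    then show ?thesis using cs bn by (simp add: ennreal_plus ennreal_mult)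
  qed
  finally show ?thesis .
qed

text \<open>Scale-invariant majorants for the cubic integral and, in \<open>pressure_bound\<close>,
  for the pressure oscillation, good for radius 3 \<theta> R and length 4 (\<theta> R)^2 too. This
  explains 108 = 27 * 4 and 243 = 3^5, the latter a bound for 3^{9/2}.\<close>

definition cubic_bound :: "real \<Rightarrow> real" where "cubic_bound \<theta> = 4 * cubic_const * sqrt a * e / \<theta>\<^sup>2 + 108 * mean_const * \<theta>^3 * a powr (3/2)"
definition pressure_bound :: "real \<Rightarrow> real" where "pressure_bound \<theta> = pressure_near_const * sqrt a * e / \<theta>\<^sup>2 + 243 * pressure_far_const * \<theta> powr (5/2) * D"

lemma cubic_bound_nonneg: "0 \<le> cubic_bound \<theta>" if "0 \<le> \<theta>" using that cubic_const_nonneg mean_const_nonneg a0 e0 by (simp add: cubic_bound_def)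
lemma pressure_bound_nonneg: "0 \<le> pressure_bound \<theta>" using pressure_near_const_nonneg pressure_far_const_nonneg a0 e0 D0 by (simp add: pressure_bound_def)

text \<open>The value m = 1 is for the functional itself, m = 3 for the energy flux. With \<theta>
  \<le> 1/6 the radius 3 \<theta> R is at most R/2, the range of the slice estimates; in
  \<open>pressure_step\<close> the condition \<theta> \<le> 1/12 keeps it within R/4.\<close>

lemma cubic_step:
  assumes \<theta>: "0 < \<theta>" "\<theta> \<le> 1/6" and m: "m = 1 \<or> m = 3" "n \<le> 4 * (\<theta> * R)\<^sup>2" "0 \<le> n"
  shows "cyl (m * (\<theta> * R)) n (\<lambda>z. ennreal (norm (V z) ^ 3)) \<le> ennreal ((\<theta> * R)\<^sup>2 * cubic_bound \<theta>)"
proof -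
  have \<theta>2: "(2 * \<theta>)\<^sup>2 \<le> 1\<^sup>2" using \<theta> by (intro power_mono) auto
  have "4 * (\<theta> * R)\<^sup>2 = (2 * \<theta>)\<^sup>2 * R\<^sup>2" by (simp add: power_mult_distrib)
  also have "\<dots> \<le> R\<^sup>2" using mult_right_mono[OF \<theta>2, of "R\<^sup>2"] by simp
  finally have T: "4 * (\<theta> * R)\<^sup>2 \<le> R\<^sup>2" .
  have \<rho>: "3 * (\<theta> * R) \<le> R/2" using mult_right_mono[OF \<theta>(2), of R] R by simp
  have "cyl (m * (\<theta> * R)) n (\<lambda>z. ennreal (norm (V z) ^ 3)) \<le> cyl (3 * (\<theta> * R)) (4 * (\<theta> * R)\<^sup>2) (\<lambda>z. ennreal (norm (V z) ^ 3))"
    by (rule cyl_mono') (use m \<theta> R in auto)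
  also have "\<dots> \<le> ennreal (4 * cubic_const * R\<^sup>2 * sqrt a * e + mean_const * a powr (3/2) / R^3 * (3 * (\<theta> * R))^3 * (4 * (\<theta> * R)\<^sup>2))"
    by (rule cubic_cylinder) (use \<theta> R \<rho> T in auto)
  also have "4 * cubic_const * R\<^sup>2 * sqrt a * e + mean_const * a powr (3/2) / R^3 * (3 * (\<theta> * R))^3 * (4 * (\<theta> * R)\<^sup>2) = (\<theta> * R)\<^sup>2 * cubic_bound \<theta>"
    using \<theta> R by (simp add: cubic_bound_def field_simps)
  finally show ?thesis .
qed

lemma pressure_step:
  assumes \<theta>: "0 < \<theta>" "\<theta> \<le> 1/12" and m: "m = 1 \<or> m = 3" "n \<le> 4 * (\<theta> * R)\<^sup>2"
  shows "cyl (m * (\<theta> * R)) n (\<lambda>z. ennreal (\<bar>Pr z - pressure_mean (snd z)\<bar> powr (3/2))) \<le> ennreal ((\<theta> * R)\<^sup>2 * pressure_bound \<theta>)"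
proof -
  have \<theta>2: "(2 * \<theta>)\<^sup>2 \<le> 1\<^sup>2" using \<theta> by (intro power_mono) auto
  have "4 * (\<theta> * R)\<^sup>2 = (2 * \<theta>)\<^sup>2 * R\<^sup>2" by (simp add: power_mult_distrib)
  also have "\<dots> \<le> R\<^sup>2" using mult_right_mono[OF \<theta>2, of "R\<^sup>2"] by simp
  finally have T: "4 * (\<theta> * R)\<^sup>2 \<le> R\<^sup>2" .
  have "cyl (m * (\<theta> * R)) n (\<lambda>z. ennreal (\<bar>Pr z - pressure_mean (snd z)\<bar> powr (3/2)))
     \<le> cyl ((3 * \<theta>) * R) (4 * (\<theta> * R)\<^sup>2) (\<lambda>z. ennreal (\<bar>Pr z - pressure_mean (snd z)\<bar> powr (3/2)))"
    by (rule cyl_mono') (use m \<theta> R in auto)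
  also have "\<dots> \<le> ennreal (pressure_near_const * R\<^sup>2 * sqrt a * e + pressure_far_const * (3 * \<theta>) powr (9/2) * R\<^sup>2 * D)"
    by (rule pressure_deviation) (use \<theta> T in auto)
  also have "\<dots> \<le> ennreal ((\<theta> * R)\<^sup>2 * pressure_bound \<theta>)"
  proof (rule ennreal_leI)
    have "(3 * \<theta>) powr (9/2) = 3 powr (9/2) * \<theta> powr (9/2)" by (rule powr_mult)
    also have "\<dots> \<le> 3 powr 5 * \<theta> powr (9/2)" by (intro mult_right_mono powr_mono) auto
    also have "\<dots> = 243 * (\<theta>\<^sup>2 * \<theta> powr (5/2))" using \<theta> powr_add[of \<theta> 2 "5/2"] by simp
    finally have "pressure_far_const * (3 * \<theta>) powr (9/2) * R\<^sup>2 * D \<le> pressure_far_const * (243 * (\<theta>\<^sup>2 * \<theta> powr (5/2))) * R\<^sup>2 * D"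
      using pressure_far_const_nonneg D0 by (intro mult_right_mono mult_left_mono) auto
    moreover have "(\<theta> * R)\<^sup>2 * pressure_bound \<theta> = pressure_near_const * R\<^sup>2 * sqrt a * e + pressure_far_const * (243 * (\<theta>\<^sup>2 * \<theta> powr (5/2))) * R\<^sup>2 * D"
      using \<theta> by (simp add: pressure_bound_def power_mult_distrib field_simps)
    ultimately show "pressure_near_const * R\<^sup>2 * sqrt a * e + pressure_far_const * (3 * \<theta>) powr (9/2) * R\<^sup>2 * D \<le> (\<theta> * R)\<^sup>2 * pressure_bound \<theta>" by linarith
  qed
  finally show ?thesis .
qed

text \<open>The pointwise bound for the flux is integrated term by term, and the results are sorted
  by their dependence on \<theta>, \<open>a\<close> and \<open>e\<close>. After division by \<theta>
  R the radius R has disappeared from every term, which reflects the scale invariance of the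
  functionals.\<close>

lemma energy_step:
  assumes \<theta>: "0 < \<theta>" "\<theta> \<le> 1/12" and l: "0 < l"
  shows "AE t in lborel. t \<in> {-((\<theta> * R)\<^sup>2)<..<0} \<longrightarrow> (LINT x|lborel. indicator (ball 0 (\<theta> * R)) x * (norm (V (x, t)))\<^sup>2)
    \<le> (\<theta> * R) * (energy_const * (e / \<theta>^3 + \<theta>\<^sup>2 * a + sqrt a * e / \<theta>\<^sup>2 + sqrt \<theta> * a * (1 + e) + l * cubic_bound \<theta> + pressure_bound \<theta> / sqrt l))"
proof -
  \<comment> \<open>In terms of sqrt \<theta> all powers in the identities \<open>e1\<close> to
    \<open>e5\<close> are integral.\<close>
  define \<sigma> where "\<sigma> = sqrt \<theta>"
  have \<sigma>: "0 < \<sigma>" "\<theta> = \<sigma>\<^sup>2" using \<theta> by (auto simp: \<sigma>_def)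
  define r where "r = \<theta> * R"
  have r: "0 < r" using \<theta> R by (simp add: r_def)
  \<comment> \<open>Chosen so that both halves of the split of w c^2 have the same order in
    \<theta>: they become \<open>r * \<sigma> * a * e\<close> and \<open>r * \<sigma> * a\<close> up
    to constants.\<close>
  define \<tau> where "\<tau> = 1 / (R * \<sigma>^5)"
  have \<tau>: "0 < \<tau>" using R \<sigma> by (simp add: \<tau>_def)
  define cc where "cc = 8 * avg_const * a / R\<^sup>2"
  have cc: "0 \<le> cc" using avg_const_nonneg a0 by (simp add: cc_def)
  have \<theta>2: "(2 * \<theta>)\<^sup>2 \<le> 1\<^sup>2" using \<theta> by (intro power_mono) auto
  have "4 * r\<^sup>2 = (2 * \<theta>)\<^sup>2 * R\<^sup>2" by (simp add: r_def power_mult_distrib)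
  also have "\<dots> \<le> R\<^sup>2" using mult_right_mono[OF \<theta>2, of "R\<^sup>2"] by simp
  finally have T: "4 * r\<^sup>2 \<le> R\<^sup>2" .
  have r12: "r \<le> R / 12" using mult_right_mono[OF \<theta>(2), of R] R by (simp add: r_def)
  let ?B = unit_cutoff_bound
  let ?w2 = "oscillation_const * riesz_const (5/4) * R^3 * e"
  let ?w3 = "cubic_const * R\<^sup>2 * sqrt a * e"
  let ?X = "(8 * ?B / r\<^sup>2 + 12 * ?B / r * cc / \<tau>) * ?w2 + (8 * ?B / r\<^sup>2 * cc + 12 * ?B / r * cc * \<tau>) * (unit_ball_vol 3 * (3 * r)^3) * (4 * r\<^sup>2)
     + 12 * ?B / r * ?w3 + 6 * ?B / r * l * (r\<^sup>2 * cubic_bound \<theta>) + 6 * ?B / r / sqrt l * (r\<^sup>2 * pressure_bound \<theta>)"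
  have B: "0 < ?B" by (rule unit_cutoff_bound(1))
  have w2n: "0 \<le> ?w2" using oscillation_const_nonneg riesz_const_nonneg R e0 by simp
  have w3n: "0 \<le> ?w3" using cubic_const_nonneg R a0 e0 by simp
  have "cyl (3 * r) (4 * r\<^sup>2) (\<lambda>z. ennreal (energy_flux r z)) \<le> cyl (3 * r) (4 * r\<^sup>2) (\<lambda>z. ennreal ((8 * ?B / r\<^sup>2 + 12 * ?B / r * cc / \<tau>) * (norm (W z))\<^sup>2
     + (8 * ?B / r\<^sup>2 * cc + 12 * ?B / r * cc * \<tau>)
     + 12 * ?B / r * norm (W z) ^ 3
     + 6 * ?B / r * l * norm (V z) ^ 3
     + 6 * ?B / r / sqrt l * \<bar>Pr z - pressure_mean (snd z)\<bar> powr (3/2)))"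
  proof (rule cyl_mono)
    show "AE t in lborel. t \<in> {-(4 * r\<^sup>2)<..<0} \<longrightarrow> (AE x in lborel. x \<in> ball 0 (3 * r) \<longrightarrow> ennreal (energy_flux r (x, t))
      \<le> ennreal ((8 * ?B / r\<^sup>2 + 12 * ?B / r * cc / \<tau>) * (norm (W (x, t)))\<^sup>2
     + (8 * ?B / r\<^sup>2 * cc + 12 * ?B / r * cc * \<tau>)
     + 12 * ?B / r * norm (W (x, t)) ^ 3
     + 6 * ?B / r * l * norm (V (x, t)) ^ 3
     + 6 * ?B / r / sqrt l * \<bar>Pr (x, t) - pressure_mean (snd (x, t))\<bar> powr (3/2)))"
      using local_mean_bound
    proof eventually_elim
      case (elim t)
      show ?case
      proof (intro impI AE_I2 ennreal_leI)
        fix x :: "real^3" assume "t \<in> {-(4 * r\<^sup>2)<..<0}"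
        then have "(norm (local_mean t))\<^sup>2 \<le> cc" using elim T by (auto simp: cc_def)
        from energy_flux_pointwise[OF r l \<tau> this, of x]
        show "energy_flux r (x, t) \<le> (8 * ?B / r\<^sup>2 + 12 * ?B / r * cc / \<tau>) * (norm (W (x, t)))\<^sup>2
         + (8 * ?B / r\<^sup>2 * cc + 12 * ?B / r * cc * \<tau>)
         + 12 * ?B / r * norm (W (x, t)) ^ 3
         + 6 * ?B / r * l * norm (V (x, t)) ^ 3
         + 6 * ?B / r / sqrt l * \<bar>Pr (x, t) - pressure_mean (snd (x, t))\<bar> powr (3/2)" by simp
      qed
    qed
  qed auto
  also have "\<dots> \<le> ennreal ?X"
  proof (rule cyl_linear5)
    show "cyl (3 * r) (4 * r\<^sup>2) (\<lambda>z. ennreal ((norm (W z))\<^sup>2)) \<le> ennreal ?w2"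
      by (rule order_trans[OF cyl_mono' fluctuation_square]) (use r12 R T in auto)
    show "cyl (3 * r) (4 * r\<^sup>2) (\<lambda>z. ennreal (norm (W z) ^ 3)) \<le> ennreal ?w3"
      by (rule order_trans[OF cyl_mono' fluctuation_cubic]) (use r12 R T in auto)
    show "cyl (3 * r) (4 * r\<^sup>2) (\<lambda>z. ennreal (norm (V z) ^ 3)) \<le> ennreal (r\<^sup>2 * cubic_bound \<theta>)"
      unfolding r_def by (rule cubic_step) (use \<theta> in auto)
    show "cyl (3 * r) (4 * r\<^sup>2) (\<lambda>z. ennreal (\<bar>Pr z - pressure_mean (snd z)\<bar> powr (3/2))) \<le> ennreal (r\<^sup>2 * pressure_bound \<theta>)"
      unfolding r_def by (rule pressure_step) (use \<theta> in auto)
  qed (use B r cc \<tau> l w2n w3n cubic_bound_nonneg pressure_bound_nonneg \<theta> in auto)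
  finally have X: "cyl (3 * r) (4 * r\<^sup>2) (\<lambda>z. ennreal (energy_flux r z)) \<le> ennreal ?X" .
  have X0: "0 \<le> ?X"
    using B r cc \<tau> l w2n w3n cubic_bound_nonneg[of \<theta>] pressure_bound_nonneg[of \<theta>] \<theta> oscillation_const_nonneg riesz_const_nonneg cubic_const_nonneg R a0 e0
    by (intro add_nonneg_nonneg mult_nonneg_nonneg) auto
  have "?X \<le> r * (energy_const * (e / \<theta>^3 + \<theta>\<^sup>2 * a + sqrt a * e / \<theta>\<^sup>2 + \<sigma> * a * (1 + e) + l * cubic_bound \<theta> + pressure_bound \<theta> / sqrt l))"
  proof -
    let ?t1 = "e / \<theta>^3" and ?t2 = "\<theta>\<^sup>2 * a" and ?t3 = "sqrt a * e / \<theta>\<^sup>2" and ?t4 = "\<sigma> * a * (1 + e)" and ?t5 = "l * cubic_bound \<theta>" and ?t6 = "pressure_bound \<theta> / sqrt l"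
    define q where "q = oscillation_const * riesz_const (5/4)"
    have q: "0 \<le> q" using oscillation_const_nonneg riesz_const_nonneg by (simp add: q_def)
    have e1: "8 * ?B / r\<^sup>2 * ?w2 = r * (8 * ?B * q * ?t1)"
      using R \<sigma> unfolding r_def q_def[symmetric] by (simp add: field_simps eval_nat_numeral)
    have e2: "12 * ?B / r * cc / \<tau> * ?w2 = r * (96 * ?B * avg_const * q * (\<sigma> * a * e))"
      using R \<sigma> unfolding r_def q_def[symmetric] cc_def \<tau>_def by (simp add: field_simps eval_nat_numeral)
    have e3: "8 * ?B / r\<^sup>2 * cc * (unit_ball_vol 3 * (3 * r)^3) * (4 * r\<^sup>2) = r * (6912 * ?B * avg_const * unit_ball_vol 3 * ?t2)"
      using R \<sigma> unfolding r_def cc_def by (simp add: field_simps eval_nat_numeral)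
    have e4: "12 * ?B / r * cc * \<tau> * (unit_ball_vol 3 * (3 * r)^3) * (4 * r\<^sup>2) = r * (10368 * ?B * avg_const * unit_ball_vol 3 * (\<sigma> * a))"
      using R \<sigma> unfolding r_def cc_def \<tau>_def by (simp add: field_simps eval_nat_numeral)
    have e5: "12 * ?B / r * ?w3 = r * (12 * ?B * cubic_const * ?t3)"
      using R \<sigma> unfolding r_def by (simp add: field_simps eval_nat_numeral)
    have e6: "6 * ?B / r * l * (r\<^sup>2 * cubic_bound \<theta>) = r * (6 * ?B * ?t5)"
      using r by (simp add: power2_eq_square)
    have e7: "6 * ?B / r / sqrt l * (r\<^sup>2 * pressure_bound \<theta>) = r * (6 * ?B * ?t6)"
      using r by (simp add: power2_eq_square)
    have Xeq: "?X = r * (8 * ?B * q * ?t1 + 96 * ?B * avg_const * q * (\<sigma> * a * e) + 6912 * ?B * avg_const * unit_ball_vol 3 * ?t2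
       + 10368 * ?B * avg_const * unit_ball_vol 3 * (\<sigma> * a) + 12 * ?B * cubic_const * ?t3 + 6 * ?B * ?t5 + 6 * ?B * ?t6)"
      unfolding distrib_right e1 e2 e3 e4 e5 e6 e7 by (simp only: distrib_left add_ac)
    have ts: "0 \<le> ?t1" "0 \<le> ?t2" "0 \<le> ?t3" "0 \<le> ?t4" "0 \<le> ?t5" "0 \<le> ?t6" "\<sigma> * a * e \<le> ?t4" "\<sigma> * a \<le> ?t4"
      using e0 a0 \<theta> \<sigma>(1) l cubic_bound_nonneg[of \<theta>] pressure_bound_nonneg[of \<theta>] by (auto simp: distrib_left)
    have cs: "0 \<le> 8 * ?B * q" "0 \<le> 96 * ?B * avg_const * q" "0 \<le> 6912 * ?B * avg_const * unit_ball_vol 3"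
      "0 \<le> 10368 * ?B * avg_const * unit_ball_vol 3" "0 \<le> 12 * ?B * cubic_const" "0 \<le> 6 * ?B"
      using B q avg_const_nonneg cubic_const_nonneg by auto
    have energy_const: "8 * ?B * q + 96 * ?B * avg_const * q + 6912 * ?B * avg_const * unit_ball_vol 3
      + 10368 * ?B * avg_const * unit_ball_vol 3 + 12 * ?B * cubic_const + 6 * ?B = energy_const" by (simp add: energy_const_def q_def)
    have gen: "c1 * t1 + c2 * s1 + c3 * t2 + c4 * s2 + c5 * t3 + c6 * t5 + c6 * t6 \<le> (c1 + c2 + c3 + c4 + c5 + c6) * (t1 + t2 + t3 + t4 + t5 + t6)"
      if "0 \<le> c1" "0 \<le> c2" "0 \<le> c3" "0 \<le> c4" "0 \<le> c5" "0 \<le> c6" "0 \<le> t1" "0 \<le> t2" "0 \<le> t3" "0 \<le> t4" "0 \<le> t5" "0 \<le> t6" "s1 \<le> t4" "s2 \<le> t4"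
      for c1 c2 c3 c4 c5 c6 t1 t2 t3 t4 t5 t6 s1 s2 :: real
    proof -
      let ?S = "t1 + t2 + t3 + t4 + t5 + t6"
      have "c1 * t1 \<le> c1 * ?S" "c2 * s1 \<le> c2 * ?S" "c3 * t2 \<le> c3 * ?S" "c4 * s2 \<le> c4 * ?S" "c5 * t3 \<le> c5 * ?S" "c6 * (t5 + t6) \<le> c6 * ?S"
        using that by (auto intro!: mult_left_mono)
      then show ?thesis by (simp only: distrib_right distrib_left)
    qed
    show ?thesis
      unfolding Xeq energy_const[symmetric] using r by (intro mult_left_mono gen cs ts) auto
  qed
  then have le: "?X \<le> (\<theta> * R) * (energy_const * (e / \<theta>^3 + \<theta>\<^sup>2 * a + sqrt a * e / \<theta>\<^sup>2 + sqrt \<theta> * a * (1 + e) + l * cubic_bound \<theta> + pressure_bound \<theta> / sqrt l))"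
    by (simp only: r_def \<sigma>_def)
  have "2 * r < 1" using r12 R by simp
  from energy_bound[OF r this T X0 X] show ?thesis
    by eventually_elim (use le in \<open>auto simp: r_def\<close>)
qed

end

subsection \<open>Borel representatives of suitable weak solutions\<close>

lemma AE_lebesgue_on_iff_lborel:
  assumes "S \<in> sets borel"
  shows "(AE x in lebesgue_on S. Pd x) \<longleftrightarrow> (AE x in lborel. x \<in> S \<longrightarrow> Pd x)"
  using assms by (subst AE_restrict_space_iff) (auto simp: AE_completion_iff)

lemma ex_borel_representative:
  fixes f :: "'a::euclidean_space \<Rightarrow> 'b::euclidean_space"
  assumes f: "f \<in> borel_measurable (lebesgue_on S)" and S[measurable]: "S \<in> sets borel"
  shows "\<exists>F\<in>borel_measurable borel. (\<forall>z. z \<notin> S \<longrightarrow> F z = 0) \<and> (AE z in lborel. z \<in> S \<longrightarrow> F z = f z)"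
proof -
  have m: "(\<lambda>z. indicator S z *\<^sub>R f z) \<in> borel_measurable lebesgue"
    using f S by (subst (asm) borel_measurable_restrict_space_iff) auto
  have "\<forall>b. \<exists>g\<in>borel_measurable lborel. AE z in lborel. (indicator S z *\<^sub>R f z) \<bullet> b = g z"
  proof
    fix b :: 'b
    have "(\<lambda>z. (indicator S z *\<^sub>R f z) \<bullet> b) \<in> borel_measurable lebesgue"
      by (intro borel_measurable_inner m borel_measurable_const)
    from completion_ex_borel_measurable_real[OF this]
    show "\<exists>g\<in>borel_measurable lborel. AE z in lborel. (indicator S z *\<^sub>R f z) \<bullet> b = g z" by blast
  qed
  then obtain g where g: "\<And>b. g b \<in> borel_measurable lborel" "\<And>b. AE z in lborel. (indicator S z *\<^sub>R f z) \<bullet> b = g b z"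
    by metis
  have [measurable]: "g b \<in> borel_measurable borel" for b using g(1) by simp
  define F where "F z = indicator S z *\<^sub>R (\<Sum>b\<in>Basis. g b z *\<^sub>R b)" for z
  have "F \<in> borel_measurable borel" unfolding F_def[abs_def] by measurable
  moreover have "\<forall>z. z \<notin> S \<longrightarrow> F z = 0" by (simp add: F_def)
  moreover have "AE z in lborel. \<forall>b\<in>Basis. (indicator S z *\<^sub>R f z) \<bullet> b = g b z"
    by (rule AE_finite_allI[OF finite_Basis g(2)])
  then have "AE z in lborel. z \<in> S \<longrightarrow> F z = f z"
  proof eventually_elim
    case (elim z)
    show ?case
    proof
      assume "z \<in> S"
      then have "F z = (\<Sum>b\<in>Basis. (f z \<bullet> b) *\<^sub>R b)" using elim by (simp add: F_def)
      then show "F z = f z" by (simp add: euclidean_representation)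
    qed
  qed
  ultimately show ?thesis by blast
qed

text \<open>Lebesgue measure is complete, so agreement almost everywhere with a Borel function
  settles measurability, integrability and the integral at once.\<close>

lemma lebesgue_on_cong:
  fixes f F :: "'a::euclidean_space \<Rightarrow> real"
  assumes S[measurable]: "S \<in> sets borel" and F[measurable]: "F \<in> borel_measurable borel"
    and eq: "AE z in lborel. z \<in> S \<longrightarrow> F z = f z"
  shows "f \<in> borel_measurable (lebesgue_on S)"
    "(LINT z|lebesgue_on S. f z) = (LINT z|lborel. indicator S z * F z)"
    "integrable (lebesgue_on S) f \<longleftrightarrow> integrable lborel (\<lambda>z. indicator S z * F z)"
proof -
  have Fm: "(\<lambda>z. indicator S z * F z) \<in> borel_measurable lborel" by simp
  then have FL: "(\<lambda>z. indicator S z * F z) \<in> borel_measurable lebesgue" by (rule measurable_completion)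
  have ae: "AE z in lebesgue. indicator S z * F z = indicator S z *\<^sub>R f z"
    unfolding AE_completion_iff using eq by eventually_elim (auto simp: indicator_def)
  have fL: "(\<lambda>z. indicator S z *\<^sub>R f z) \<in> borel_measurable lebesgue"
    by (rule borel_measurable_AE[OF FL ae])
  then show "f \<in> borel_measurable (lebesgue_on S)"
    by (subst borel_measurable_restrict_space_iff) auto
  have "(LINT z|lebesgue_on S. f z) = (LINT z|lebesgue. indicator S z *\<^sub>R f z)"
    by (rule integral_restrict_space) simp
  also have "\<dots> = (LINT z|lebesgue. indicator S z * F z)"
    by (rule integral_cong_AE[OF fL FL]) (use ae in \<open>eventually_elim, simp only:\<close>)
  also have "\<dots> = (LINT z|lborel. indicator S z * F z)" by (rule integral_completion[OF Fm])
  finally show "(LINT z|lebesgue_on S. f z) = (LINT z|lborel. indicator S z * F z)" .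
  have "integrable (lebesgue_on S) f \<longleftrightarrow> integrable lebesgue (\<lambda>z. indicator S z *\<^sub>R f z)"
    by (rule integrable_restrict_space) simp
  also have "\<dots> \<longleftrightarrow> integrable lebesgue (\<lambda>z. indicator S z * F z)"
    by (rule integrable_cong_AE[OF fL FL]) (use ae in \<open>eventually_elim, simp only:\<close>)
  also have "\<dots> \<longleftrightarrow> integrable lborel (\<lambda>z. indicator S z * F z)" by (rule integrable_completion[OF Fm])
  finally show "integrable (lebesgue_on S) f \<longleftrightarrow> integrable lborel (\<lambda>z. indicator S z * F z)" .
qed

locale representative =
  fixes v :: "spacetime \<Rightarrow> real^3" and p :: "spacetime \<Rightarrow> real"
    and V :: "spacetime \<Rightarrow> real^3" and G :: "spacetime \<Rightarrow> real^3^3" and Pr :: "spacetime \<Rightarrow> real"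
  assumes sws: "suitable_weak_solution v p"
    and V_borel [measurable]: "V \<in> borel_measurable borel"
    and G_borel [measurable]: "G \<in> borel_measurable borel"
    and P_borel [measurable]: "Pr \<in> borel_measurable borel"
    and zero: "\<And>z. z \<notin> Q 1 \<Longrightarrow> V z = 0" "\<And>z. z \<notin> Q 1 \<Longrightarrow> G z = 0" "\<And>z. z \<notin> Q 1 \<Longrightarrow> Pr z = 0"
    and eq: "AE z in lborel. z \<in> Q 1 \<longrightarrow> V z = v z \<and> G z = grad v z \<and> Pr z = p z"

lemma W12_0_gradient_grad: "v \<in> W12_0 \<Longrightarrow> W12_0_gradient v (grad v)"
  unfolding W12_0_def grad_def using someI_ex[of "W12_0_gradient v"] by blast

lemma ex_representative:
  assumes "suitable_weak_solution v p" shows "\<exists>V G Pr. representative v p V G Pr"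
proof -
  have gr: "W12_0_gradient v (grad v)"
    using assms by (intro W12_0_gradient_grad) (simp add: suitable_weak_solution_def)
  have v: "v \<in> borel_measurable (lebesgue_on (Q 1))" and g: "grad v \<in> borel_measurable (lebesgue_on (Q 1))"
    using gr by (auto simp: W12_0_gradient_def L_space_def)
  have p: "p \<in> borel_measurable (lebesgue_on (Q 1))" using assms by (auto simp: suitable_weak_solution_def L_space_def)
  obtain V where V: "V \<in> borel_measurable borel" "\<And>z. z \<notin> Q 1 \<Longrightarrow> V z = 0" "AE z in lborel. z \<in> Q 1 \<longrightarrow> V z = v z"
    using ex_borel_representative[OF v Q_borel] by blast
  obtain G where G: "G \<in> borel_measurable borel" "\<And>z. z \<notin> Q 1 \<Longrightarrow> G z = 0" "AE z in lborel. z \<in> Q 1 \<longrightarrow> G z = grad v z"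
    using ex_borel_representative[OF g Q_borel] by blast
  obtain Pr where P: "Pr \<in> borel_measurable borel" "\<And>z. z \<notin> Q 1 \<Longrightarrow> Pr z = 0" "AE z in lborel. z \<in> Q 1 \<longrightarrow> Pr z = p z"
    using ex_borel_representative[OF p Q_borel] by blast
  have "AE z in lborel. z \<in> Q 1 \<longrightarrow> V z = v z \<and> G z = grad v z \<and> Pr z = p z"
    using V(3) G(3) P(3) by eventually_elim blast
  then have "representative v p V G Pr" using assms V G P by (intro representative.intro) auto
  then show ?thesis by blast
qed

context representative
begin

lemma eq_slices: "AE t in lborel. t \<in> {-1<..<0} \<longrightarrow> (AE x in lborel. x \<in> ball 0 1 \<longrightarrow>
    V (x, t) = v (x, t) \<and> G (x, t) = grad v (x, t) \<and> Pr (x, t) = p (x, t))"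
  using AE_spacetime[OF eq] by eventually_elim (auto simp: Q_def elim!: eventually_mono)

lemma grad_gradient: "W12_0_gradient v (grad v)"
  using sws by (intro W12_0_gradient_grad) (simp add: suitable_weak_solution_def)

lemma indicator_zero: "(indicator (Q 1) z * f z :: real) = f z" if "z \<notin> Q 1 \<Longrightarrow> f z = 0"
  using that by (auto simp: indicator_def)

lemma Q_integral:
  fixes F f :: "spacetime \<Rightarrow> real"
  assumes "F \<in> borel_measurable borel" "\<And>z. z \<notin> Q 1 \<Longrightarrow> F z = 0"
    and "\<And>z. z \<in> Q 1 \<Longrightarrow> V z = v z \<Longrightarrow> G z = grad v z \<Longrightarrow> Pr z = p z \<Longrightarrow> F z = f z"
  shows "(LINT z|lebesgue_on (Q 1). f z) = (LINT z|lborel. F z)" "integrable (lebesgue_on (Q 1)) f \<longleftrightarrow> integrable lborel F"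
proof -
  have ae: "AE z in lborel. z \<in> Q 1 \<longrightarrow> F z = f z" using eq by eventually_elim (use assms(3) in blast)
  have i: "(\<lambda>z. indicator (Q 1) z * F z) = F" by (rule ext) (rule indicator_zero, rule assms(2))
  show "(LINT z|lebesgue_on (Q 1). f z) = (LINT z|lborel. F z)" "integrable (lebesgue_on (Q 1)) f \<longleftrightarrow> integrable lborel F"
    using lebesgue_on_cong[OF Q_borel assms(1) ae] by (simp_all only: i)
qed

lemma V2: "integrable lborel (\<lambda>z. (norm (V z))\<^sup>2)"
  using grad_gradient Q_integral(2)[of "\<lambda>z. (norm (V z))\<^sup>2" "\<lambda>z. norm (v z) powr 2"] zero
  by (auto simp: W12_0_gradient_def L_space_def)

lemma G2: "integrable lborel (\<lambda>z. (norm (G z))\<^sup>2)"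
  using grad_gradient Q_integral(2)[of "\<lambda>z. (norm (G z))\<^sup>2" "\<lambda>z. norm (grad v z) powr 2"] zero
  by (auto simp: W12_0_gradient_def L_space_def)

lemma P32: "integrable lborel (\<lambda>z. \<bar>Pr z\<bar> powr (3/2))"
  using sws Q_integral(2)[of "\<lambda>z. \<bar>Pr z\<bar> powr (3/2)" "\<lambda>z. norm (p z) powr (3/2)"] zero
  by (auto simp: suitable_weak_solution_def L_space_def)

lemma slice_zero: "(x, t) \<notin> Q 1 \<longleftrightarrow> x \<notin> ball 0 1 \<or> t \<notin> {-1<..<0}" by (auto simp: Q_def)

lemma ball_integral:
  fixes F f :: "real^3 \<Rightarrow> real"
  assumes "F \<in> borel_measurable borel" "\<And>x. x \<notin> ball 0 1 \<Longrightarrow> F x = 0" "AE x in lborel. x \<in> ball 0 1 \<longrightarrow> F x = f x"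
  shows "(LINT x|lebesgue_on (ball 0 1). f x) = (LINT x|lborel. F x)"
proof -
  have "(\<lambda>x. indicator (ball 0 1) x * F x) = F" using assms(2) by (auto simp: indicator_def fun_eq_iff)
  with lebesgue_on_cong(2)[OF sets_borel_ball assms(1,3)] show ?thesis by simp
qed

lemma WG: "AE t in lborel. weak_grad (\<lambda>x. V (x, t)) (\<lambda>x. G (x, t))"
proof -
  have "AE t in lborel. t \<in> {-1<..<0} \<longrightarrow> W12_gradient (ball 0 1) (\<lambda>x. v (x, t)) (\<lambda>x. grad v (x, t))"
    using grad_gradient unfolding W12_0_gradient_def by (subst (asm) AE_lebesgue_on_iff_lborel) auto
  with eq_slices integrable_spacetime[OF V2] integrable_spacetime[OF G2] show ?thesis
  proof eventually_elim
    case (elim t)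
    have z: "V (x, t) = 0" "G (x, t) = 0" if "x \<notin> ball 0 1" for x using that zero slice_zero by blast+
    have "(LINT x|lborel. V (x, t) $ i * dderiv (axis j 1) \<phi> x) = - (LINT x|lborel. G (x, t) $ i $ j * \<phi> x)"
      if \<phi>: "\<phi> \<in> test_functions (ball 0 1)" for i j \<phi>
    proof (cases "t \<in> {-1<..<0}")
      case True
      have [measurable]: "\<phi> \<in> borel_measurable borel" "dderiv (axis j 1) \<phi> \<in> borel_measurable borel"
        using \<phi> by (auto intro: test_functions_borel test_functions_dderiv)
      have W: "W12_gradient (ball 0 1) (\<lambda>x. v (x, t)) (\<lambda>x. grad v (x, t))" using elim True by blast
      have ae: "AE x in lborel. x \<in> ball 0 1 \<longrightarrow> V (x, t) = v (x, t) \<and> G (x, t) = grad v (x, t) \<and> Pr (x, t) = p (x, t)"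
        using elim True by blast
      have "(LINT x|lebesgue_on (ball 0 1). v (x, t) $ i * dderiv (axis j 1) \<phi> x) = (LINT x|lborel. V (x, t) $ i * dderiv (axis j 1) \<phi> x)"
        by (rule ball_integral) (simp, simp add: z, use ae in eventually_elim, simp)
      moreover have "(LINT x|lebesgue_on (ball 0 1). grad v (x, t) $ i $ j * \<phi> x) = (LINT x|lborel. G (x, t) $ i $ j * \<phi> x)"
        by (rule ball_integral) (simp, simp add: z, use ae in eventually_elim, simp)
      moreover have "- (LINT x|lebesgue_on (ball 0 1). v (x, t) $ i * dderiv (axis j 1) \<phi> x) = (LINT x|lebesgue_on (ball 0 1). grad v (x, t) $ i $ j * \<phi> x)"
        using W \<phi> by (simp add: W12_gradient_def distr_deriv_def regular_def)
      ultimately show ?thesis by simp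
    next
      case False
      then have "V (x, t) = 0" "G (x, t) = 0" for x using zero slice_zero by blast+
      then show ?thesis by simp
    qed
    then show ?case unfolding weak_grad_def using elim z by auto
  qed
qed

lemma V_integrable: "integrable lborel (\<lambda>z. V z $ i)"
  and GV_integrable: "integrable lborel (\<lambda>z. (G z *v V z) $ i)"
proof -
  show "integrable lborel (\<lambda>z. V z $ i)"
  proof (rule Bochner_Integration.integrable_bound)
    show "integrable lborel (\<lambda>z. indicator (Q 1) z + (norm (V z))\<^sup>2)" by (intro Bochner_Integration.integrable_add integrable_indicator_Q V2)
    show "AE z in lborel. norm (V z $ i) \<le> norm (indicator (Q 1) z + (norm (V z))\<^sup>2)"
    proof (rule AE_I2)
      fix z
      have "norm (V z) \<le> 1 + (norm (V z))\<^sup>2" using zero_le_power2[of "norm (V z) - 1/2"] by (simp add: power2_diff power_divide)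
      then show "norm (V z $ i) \<le> norm (indicator (Q 1) z + (norm (V z))\<^sup>2)"
        using zero(1)[of z] component_le_norm_cart[of "V z" i] by (cases "z \<in> Q 1") auto
    qed
  qed simp
  show "integrable lborel (\<lambda>z. (G z *v V z) $ i)"
  proof (rule Bochner_Integration.integrable_bound)
    show "integrable lborel (\<lambda>z. (norm (G z))\<^sup>2 + (norm (V z))\<^sup>2)" by (intro Bochner_Integration.integrable_add G2 V2)
    show "(\<lambda>z. (G z *v V z) $ i) \<in> borel_measurable lborel" by (simp add: matrix_vector_mult_def)
    show "AE z in lborel. norm ((G z *v V z) $ i) \<le> norm ((norm (G z))\<^sup>2 + (norm (V z))\<^sup>2)"
    proof (rule AE_I2)
      fix z
      have "norm ((G z *v V z) $ i) \<le> norm (G z) * norm (V z)"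
        by (rule order_trans[OF Finite_Cartesian_Product.norm_nth_le norm_matrix_vector_le])
      moreover have "2 * (norm (G z) * norm (V z)) \<le> (norm (G z))\<^sup>2 + (norm (V z))\<^sup>2"
        using zero_le_power2[of "norm (G z) - norm (V z)"] by (simp add: power2_diff mult.assoc)
      moreover have "0 \<le> norm (G z) * norm (V z)" by simp
      ultimately have "norm ((G z *v V z) $ i) \<le> (norm (G z))\<^sup>2 + (norm (V z))\<^sup>2" by linarith
      then show "norm ((G z *v V z) $ i) \<le> norm ((norm (G z))\<^sup>2 + (norm (V z))\<^sup>2)" by simp
    qed
  qed
qed

lemma P_integrable: "integrable lborel Pr"
  by (rule integrable_of_powr_three_halves[OF P_borel zero(3) P32])

section \<open>Product test functions and the equations on time slices\<close>

lemma tensor_test: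
  assumes "\<phi> \<in> test_functions (ball 0 1)" "\<zeta> \<in> test_functions {-1<..<0}"
  shows "(\<lambda>z. \<phi> (fst z) * \<zeta> (snd z)) \<in> test_functions (Q 1)"
proof (rule smooth_test_functionsI[OF smooth_tensor])
  let ?K = "closure {x. \<phi> x \<noteq> 0} \<times> closure {t. \<zeta> t \<noteq> 0}"
  show "smooth \<phi>" "smooth \<zeta>" using assms test_functions_smooth by blast+
  show "compact ?K" using assms by (intro compact_Times) (auto simp: test_functions_def)
  show "?K \<subseteq> Q 1" using assms by (auto simp: test_functions_def Q_def)
  show "\<phi> (fst z) * \<zeta> (snd z) = 0" if "z \<notin> ?K" for z
  proof -
    have "fst z \<notin> {x. \<phi> x \<noteq> 0} \<or> snd z \<notin> {t. \<zeta> t \<noteq> 0}"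
      using that closure_subset[of "{x. \<phi> x \<noteq> 0}"] closure_subset[of "{t. \<zeta> t \<noteq> 0}"] by (cases z) auto
    then show ?thesis by auto
  qed
qed

lemma tensor_integral:
  fixes f :: "spacetime \<Rightarrow> real"
  assumes f: "integrable lborel f" and \<phi>: "\<phi> \<in> test_functions (ball 0 1)" and \<zeta>: "\<zeta> \<in> test_functions {-1<..<0}"
  shows "integrable lborel (\<lambda>z. f z * (\<phi> (fst z) * \<zeta> (snd z)))"
    "(LINT z|lborel. f z * (\<phi> (fst z) * \<zeta> (snd z))) = (LINT t|lborel. (LINT x|lborel. f (x, t) * \<phi> x) * \<zeta> t)"
proof -
  show i: "integrable lborel (\<lambda>z. f z * (\<phi> (fst z) * \<zeta> (snd z)))"
    by (rule integrable_mult_test[OF f tensor_test[OF \<phi> \<zeta>]])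
  show "(LINT z|lborel. f z * (\<phi> (fst z) * \<zeta> (snd z))) = (LINT t|lborel. (LINT x|lborel. f (x, t) * \<phi> x) * \<zeta> t)"
    unfolding integral_spacetime(1)[OF i] by (simp add: mult.assoc[symmetric])
qed

lemma slice_integrable:
  fixes f :: "spacetime \<Rightarrow> real"
  assumes f: "integrable lborel f" and \<phi>: "\<phi> \<in> test_functions (ball 0 1)"
  shows "integrable lborel (\<lambda>t. LINT x|lborel. f (x, t) * \<phi> x)" "AE t in lborel. integrable lborel (\<lambda>x. f (x, t) * \<phi> x)"
proof -
  obtain B where B: "\<And>x. \<bar>\<phi> x\<bar> \<le> B" using test_functions_bounded[OF \<phi>] by blast
  have [measurable]: "\<phi> \<in> borel_measurable borel" by (rule test_functions_borel[OF \<phi>])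
  have "integrable lborel (\<lambda>z. f z * \<phi> (fst z))"
    by (rule integrable_mult_bounded[OF f, of _ B]) (use B in auto)
  from integral_spacetime(2)[OF this] show "integrable lborel (\<lambda>t. LINT x|lborel. f (x, t) * \<phi> x)" by simp
  show "AE t in lborel. integrable lborel (\<lambda>x. f (x, t) * \<phi> x)"
    using integrable_spacetime[OF f] by eventually_elim (rule integrable_mult_test[OF _ \<phi>])
qed

definition moment :: "(spacetime \<Rightarrow> real) \<Rightarrow> (real^3 \<Rightarrow> real) \<Rightarrow> real \<Rightarrow> real" where
  "moment f \<phi> t = (LINT x|lborel. f (x, t) * \<phi> x)"

lemma moment_zero: "(\<And>z. z \<notin> Q 1 \<Longrightarrow> f z = 0) \<Longrightarrow> t \<notin> {-1<..<0} \<Longrightarrow> moment f \<phi> t = 0"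
  unfolding moment_def using slice_zero[of _ t] by simp

lemma regular_tensor:
  assumes "\<phi> \<in> test_functions (ball 0 1)" "\<zeta> \<in> test_functions {-1<..<0}"
    and F: "integrable lborel F" "F \<in> borel_measurable borel" "\<And>z. z \<notin> Q 1 \<Longrightarrow> F z = 0"
    and "\<And>z. V z = v z \<Longrightarrow> G z = grad v z \<Longrightarrow> Pr z = p z \<Longrightarrow> F z = f z"
  shows "regular (Q 1) f (\<lambda>z. \<phi> (fst z) * \<zeta> (snd z)) = (LINT t|lborel. moment F \<phi> t * \<zeta> t)"
    "integrable lborel (\<lambda>t. moment F \<phi> t * \<zeta> t)"
proof -
  have m: "(\<lambda>z. \<phi> (fst z) * \<zeta> (snd z)) \<in> borel_measurable borel"
    by (rule test_functions_borel[OF tensor_test[OF assms(1,2)]])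
  have "regular (Q 1) f (\<lambda>z. \<phi> (fst z) * \<zeta> (snd z)) = (LINT z|lborel. F z * (\<phi> (fst z) * \<zeta> (snd z)))"
    unfolding regular_def by (rule Q_integral(1)) (use assms m in auto)
  then show "regular (Q 1) f (\<lambda>z. \<phi> (fst z) * \<zeta> (snd z)) = (LINT t|lborel. moment F \<phi> t * \<zeta> t)"
    unfolding moment_def tensor_integral(2)[OF F(1) assms(1,2)] .
  have "(LINT x|lborel. F (x, t) * (\<phi> x * \<zeta> t)) = moment F \<phi> t * \<zeta> t" for t
    unfolding moment_def by (simp add: mult.assoc[symmetric])
  with integral_spacetime(2)[OF tensor_integral(1)[OF F(1) assms(1,2)]]
  show "integrable lborel (\<lambda>t. moment F \<phi> t * \<zeta> t)" by simp
qed

lemma AE_zero_moment: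
  fixes F :: "real \<Rightarrow> real"
  assumes "integrable lborel F" "\<And>\<zeta>. \<zeta> \<in> test_functions {-1<..<0} \<Longrightarrow> (LINT t|lborel. F t * \<zeta> t) = 0"
    and "\<And>t. t \<notin> {-1<..<0} \<Longrightarrow> F t = 0"
  shows "AE t in lborel. F t = 0"
proof -
  have "AE t in lborel. -1 < t \<and> t < 0 \<longrightarrow> F t = 0" using assms(1,2) by (rule AE_zero_of_test_functions)
  then show ?thesis by eventually_elim (use assms(3) in force)
qed

lemma V_zero_nth: "z \<notin> Q 1 \<Longrightarrow> V z $ i = 0" "z \<notin> Q 1 \<Longrightarrow> (G z *v V z) $ i = 0"
  using zero by auto

lemma GV_borel: "(\<lambda>z. (G z *v V z) $ i) \<in> borel_measurable borel"
  by (simp add: matrix_vector_mult_def)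

text \<open>Test functions \<phi>(x) \<zeta>(t) turn the distributional equation into one for a
  function of time, to which the fundamental lemma of the calculus of variations applies.\<close>

lemma divergence_moment:
  assumes \<phi>: "\<phi> \<in> test_functions (ball 0 1)"
  shows "AE t in lborel. (\<Sum>j\<in>UNIV. moment (\<lambda>z. V z $ j) (dderiv (axis j 1) \<phi>) t) = 0"
proof (rule AE_zero_moment)
  note td = test_functions_dderiv[OF \<phi>]
  show "integrable lborel (\<lambda>t. \<Sum>j\<in>UNIV. moment (\<lambda>z. V z $ j) (dderiv (axis j 1) \<phi>) t)"
    unfolding moment_def by (intro Bochner_Integration.integrable_sum slice_integrable(1) V_integrable td)
  fix \<zeta> assume \<zeta>: "\<zeta> \<in> test_functions {-1<..<0::real}"
  have r: "regular (Q 1) (\<lambda>z. v z $ j) (\<lambda>z. dderiv (axis j 1) \<phi> (fst z) * \<zeta> (snd z))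
      = (LINT t|lborel. moment (\<lambda>z. V z $ j) (dderiv (axis j 1) \<phi>) t * \<zeta> t)"
    and i: "integrable lborel (\<lambda>t. moment (\<lambda>z. V z $ j) (dderiv (axis j 1) \<phi>) t * \<zeta> t)" for j
    by (rule regular_tensor[OF td \<zeta> V_integrable]; use V_zero_nth in simp)+
  have "(\<Sum>j\<in>UNIV. distr_deriv (e_x j) (regular (Q 1) (\<lambda>z. v z $ j)) (\<lambda>z. \<phi> (fst z) * \<zeta> (snd z))) = 0"
    using sws tensor_test[OF \<phi> \<zeta>] by (auto simp: suitable_weak_solution_def navier_stokes_def)
  then have "(\<Sum>j\<in>UNIV. LINT t|lborel. moment (\<lambda>z. V z $ j) (dderiv (axis j 1) \<phi>) t * \<zeta> t) = 0"
    using \<phi> \<zeta> by (simp add: distr_deriv_def dderiv_tensor_x test_functions_smooth r sum_negf)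
  then show "(LINT t|lborel. (\<Sum>j\<in>UNIV. moment (\<lambda>z. V z $ j) (dderiv (axis j 1) \<phi>) t) * \<zeta> t) = 0"
    unfolding sum_distrib_right by (subst Bochner_Integration.integral_sum) (rule i)
qed (simp add: moment_zero V_zero_nth)

lemma divergence_free:
  assumes \<phi>: "\<phi> \<in> test_functions (ball 0 1)"
  shows "AE t in lborel. (LINT x|lborel. (\<Sum>j\<in>UNIV. V (x, t) $ j * dderiv (axis j 1) \<phi> x)) = 0"
proof -
  have "AE t in lborel. \<forall>j. integrable lborel (\<lambda>x. V (x, t) $ j * dderiv (axis j 1) \<phi> x)"
    unfolding AE_all_countable by (intro allI slice_integrable(2)[OF V_integrable] test_functions_dderiv \<phi>)
  with divergence_moment[OF \<phi>] show ?thesis by eventually_elim (simp add: moment_def)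
qed

text \<open>The i-th momentum equation is tested with the i-th derivative of \<phi> times
  \<zeta>(t), and the three equations are added. Time derivative and Laplacian disappear in the sum,
  because the velocity is divergence-free; the convective term and the pressure remain.\<close>

lemma pressure_equation:
  assumes \<phi>: "\<phi> \<in> test_functions (ball 0 1)"
  shows "AE t in lborel. (LINT x|lborel. (\<Sum>i\<in>UNIV. (G (x, t) *v V (x, t)) $ i * dderiv (axis i 1) \<phi> x))
         = (LINT x|lborel. Pr (x, t) * (\<Sum>i\<in>UNIV. dderiv (axis i 1) (dderiv (axis i 1) \<phi>) x))"
proof -
  let ?d = "\<lambda>i. dderiv (axis i 1 :: real^3)"
  have td: "?d i \<phi> \<in> test_functions (ball 0 1)" "?d i (?d j \<phi>) \<in> test_functions (ball 0 1)"
    "?d i (?d j (?d k \<phi>)) \<in> test_functions (ball 0 1)" for i j k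
    by (intro test_functions_dderiv \<phi>)+
  have s: "smooth \<phi>" using \<phi> by (rule test_functions_smooth)
  have sym: "?d j (?d j (?d i \<phi>)) = ?d i (?d j (?d j \<phi>))" for i j
  proof -
    have 1: "?d j (?d i \<phi>) = ?d i (?d j \<phi>)" by (rule ext) (rule dderiv_symmetric[OF s])
    show ?thesis unfolding 1 by (rule ext) (rule dderiv_symmetric[OF smooth_dderiv[OF s]])
  qed
  let ?M = "\<lambda>t. (\<Sum>i\<in>UNIV. moment (\<lambda>z. (G z *v V z) $ i) (?d i \<phi>) t - moment Pr (?d i (?d i \<phi>)) t)"
  have "AE t in lborel. ?M t = 0"
  proof (rule AE_zero_moment)
    show "integrable lborel ?M"
      unfolding moment_def
      by (intro Bochner_Integration.integrable_sum Bochner_Integration.integrable_diff slice_integrable(1) GV_integrable P_integrable td)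
    fix \<zeta> assume \<zeta>: "\<zeta> \<in> test_functions {-1<..<0::real}"
    have z': "dderiv 1 \<zeta> \<in> test_functions {-1<..<0}" by (rule test_functions_dderiv[OF \<zeta>])
    have rV: "regular (Q 1) (\<lambda>z. v z $ i) (\<lambda>z. \<psi> (fst z) * \<xi> (snd z)) = (LINT t|lborel. moment (\<lambda>z. V z $ i) \<psi> t * \<xi> t)"
      and iV: "integrable lborel (\<lambda>t. moment (\<lambda>z. V z $ i) \<psi> t * \<xi> t)"
      if "\<psi> \<in> test_functions (ball 0 1)" "\<xi> \<in> test_functions {-1<..<0}" for i \<psi> \<xi>
      by (rule regular_tensor[OF that V_integrable]; use V_zero_nth in simp)+
    have rG: "regular (Q 1) (\<lambda>z. (grad v z *v v z) $ i) (\<lambda>z. \<psi> (fst z) * \<zeta> (snd z)) = (LINT t|lborel. moment (\<lambda>z. (G z *v V z) $ i) \<psi> t * \<zeta> t)"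
      and iG: "integrable lborel (\<lambda>t. moment (\<lambda>z. (G z *v V z) $ i) \<psi> t * \<zeta> t)"
      if "\<psi> \<in> test_functions (ball 0 1)" for i \<psi>
      by (rule regular_tensor[OF that \<zeta> GV_integrable GV_borel]; use V_zero_nth in simp)+
    have rP: "regular (Q 1) p (\<lambda>z. \<psi> (fst z) * \<zeta> (snd z)) = (LINT t|lborel. moment Pr \<psi> t * \<zeta> t)"
      and iP: "integrable lborel (\<lambda>t. moment Pr \<psi> t * \<zeta> t)"
      if "\<psi> \<in> test_functions (ball 0 1)" for \<psi>
      by (rule regular_tensor[OF that \<zeta> P_integrable]; use zero in simp)+
    have sd: "smooth (?d i \<phi>)" "smooth (?d i (?d j \<phi>))" "smooth \<zeta>" for i j
      using s \<zeta> by (auto intro: smooth_dderiv test_functions_smooth)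
    have NS: "distr_deriv e_t (regular (Q 1) (\<lambda>z. v z $ i)) \<Phi> + regular (Q 1) (\<lambda>z. (grad v z *v v z) $ i) \<Phi>
        - (\<Sum>j\<in>UNIV. distr_deriv (e_x j) (distr_deriv (e_x j) (regular (Q 1) (\<lambda>z. v z $ i))) \<Phi>)
        = - distr_deriv (e_x i) (regular (Q 1) p) \<Phi>" if "\<Phi> \<in> test_functions (Q 1)" for i \<Phi>
      using sws that by (auto simp: suitable_weak_solution_def navier_stokes_def)
    have N: "- (LINT t|lborel. moment (\<lambda>z. V z $ i) (?d i \<phi>) t * dderiv 1 \<zeta> t)
        + (LINT t|lborel. moment (\<lambda>z. (G z *v V z) $ i) (?d i \<phi>) t * \<zeta> t)
        - (\<Sum>j\<in>UNIV. LINT t|lborel. moment (\<lambda>z. V z $ i) (?d i (?d j (?d j \<phi>))) t * \<zeta> t)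
        = (LINT t|lborel. moment Pr (?d i (?d i \<phi>)) t * \<zeta> t)" for i
    proof -
      have 1: "(\<Sum>j\<in>UNIV. LINT t|lborel. moment (\<lambda>z. V z $ i) (?d i (?d j (?d j \<phi>))) t * \<zeta> t)
          = (\<Sum>j\<in>UNIV. LINT t|lborel. moment (\<lambda>z. V z $ i) (?d j (?d j (?d i \<phi>))) t * \<zeta> t)"
        by (rule sum.cong[OF refl]) (simp only: sym[of _ i, symmetric])
      show ?thesis unfolding 1
      using NS[OF tensor_test[OF td(1) \<zeta>], of i i]
      by (simp only: distr_deriv_def minus_minus dderiv_tensor_x[OF sd(1,3)] dderiv_tensor_x[OF sd(2,3)]
          dderiv_tensor_t[OF sd(1,3)] rV[OF td(1) z'] rV[OF td(3) \<zeta>] rG[OF td(1)] rP[OF td(2)])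
    qed
    \<comment> \<open>Used twice: with \<phi> and the derivative of \<zeta> for the time derivative,
      and with second derivatives of \<phi> and \<zeta> itself for the Laplacian.\<close>
    have V1: "(\<Sum>i\<in>UNIV. LINT t|lborel. moment (\<lambda>z. V z $ i) (?d i \<psi>) t * \<xi> t) = 0"
      if \<psi>: "\<psi> \<in> test_functions (ball 0 1)" and \<xi>: "\<xi> \<in> test_functions {-1<..<0}" for \<psi> \<xi>
    proof -
      have "(\<Sum>i\<in>UNIV. LINT t|lborel. moment (\<lambda>z. V z $ i) (?d i \<psi>) t * \<xi> t)
          = (LINT t|lborel. (\<Sum>i\<in>UNIV. moment (\<lambda>z. V z $ i) (?d i \<psi>) t * \<xi> t))"
        by (rule Bochner_Integration.integral_sum[symmetric]) (rule iV[OF test_functions_dderiv[OF \<psi>] \<xi>])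
      also have "\<dots> = 0"
        by (rule integral_eq_zero_AE) (use divergence_moment[OF \<psi>] in \<open>eventually_elim, simp add: sum_distrib_right[symmetric]\<close>)
      finally show ?thesis .
    qed
    have "(\<Sum>i\<in>UNIV. \<Sum>j\<in>UNIV. LINT t|lborel. moment (\<lambda>z. V z $ i) (?d i (?d j (?d j \<phi>))) t * \<zeta> t) = 0"
      by (subst sum.swap) (simp add: V1[OF td(2) \<zeta>])
    then have sumN: "(\<Sum>i\<in>UNIV. LINT t|lborel. moment (\<lambda>z. (G z *v V z) $ i) (?d i \<phi>) t * \<zeta> t)
        = (\<Sum>i\<in>UNIV. LINT t|lborel. moment Pr (?d i (?d i \<phi>)) t * \<zeta> t)"
      using V1[OF \<phi> z'] by (simp add: N[symmetric] sum.distrib sum_subtractf sum_negf)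
    have "(LINT t|lborel. ?M t * \<zeta> t) = (\<Sum>i\<in>UNIV. LINT t|lborel. moment (\<lambda>z. (G z *v V z) $ i) (?d i \<phi>) t * \<zeta> t - moment Pr (?d i (?d i \<phi>)) t * \<zeta> t)"
      unfolding sum_distrib_right left_diff_distrib
      by (rule Bochner_Integration.integral_sum) (intro Bochner_Integration.integrable_diff iG iP td)
    also have "\<dots> = 0"
      using sumN by (simp add: iG iP td sum_subtractf)
    finally show "(LINT t|lborel. ?M t * \<zeta> t) = 0" .
  qed (simp add: moment_zero V_zero_nth zero)
  moreover have "AE t in lborel. \<forall>i. integrable lborel (\<lambda>x. (G (x, t) *v V (x, t)) $ i * ?d i \<phi> x)"
    unfolding AE_all_countable by (intro allI slice_integrable(2)[OF GV_integrable] td)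
  moreover have "AE t in lborel. \<forall>i. integrable lborel (\<lambda>x. Pr (x, t) * ?d i (?d i \<phi>) x)"
    unfolding AE_all_countable by (intro allI slice_integrable(2)[OF P_integrable] td)
  ultimately show ?thesis
    by eventually_elim (simp add: moment_def sum_distrib_left sum_subtractf)
qed

lemma energy_inequality:
  "AE t in lborel. t \<in> {-1<..<0} \<longrightarrow> (\<forall>\<phi>\<in>energy_test_functions.
        (LINT x|lborel. \<phi> (x, t) * (norm (V (x, t)))\<^sup>2)
        \<le> (LINT s|lborel. indicator {-1<..<t} s * (LINT x|lborel.
             (norm (V (x, s)))\<^sup>2 * (laplace_x \<phi> (x, s) + dderiv e_t \<phi> (x, s))
              + (V (x, s) \<bullet> grad_x \<phi> (x, s)) * ((norm (V (x, s)))\<^sup>2 + 2 * Pr (x, s)))))"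
proof -
  define L where "L \<phi> t \<longleftrightarrow> (LINT x|lebesgue_on (ball 0 1). \<phi> (x, t) * (norm (v (x, t)))^2)
        + 2 * (LINT s|lebesgue_on {-1<..<t}. LINT x|lebesgue_on (ball 0 1).
                 \<phi> (x, s) * (norm (grad v (x, s)))^2)
        \<le> (LINT s|lebesgue_on {-1<..<t}. LINT x|lebesgue_on (ball 0 1).
              (norm (v (x, s)))^2 * (laplace_x \<phi> (x, s) + dderiv e_t \<phi> (x, s))
              + (v (x, s) \<bullet> grad_x \<phi> (x, s)) * ((norm (v (x, s)))^2 + 2 * p (x, s)))" for \<phi> t
  have "AE t in lborel. t \<in> {-1<..<0} \<longrightarrow> (\<forall>\<phi>\<in>energy_test_functions. L \<phi> t)"
    using sws unfolding suitable_weak_solution_def local_energy_inequality_def L_def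
    by (subst (asm) AE_lebesgue_on_iff_lborel) auto
  with eq_slices show ?thesis
  proof eventually_elim
    case (elim t)
    show ?case
    proof (intro impI ballI)
      fix \<phi> assume t: "t \<in> {-1<..<0}" and \<phi>: "\<phi> \<in> energy_test_functions"
      have L: "L \<phi> t" using elim t \<phi> by blast
      have tf: "\<phi> \<in> test_functions UNIV" and \<phi>0: "\<And>z. 0 \<le> \<phi> z" using \<phi> by (auto simp: energy_test_functions_def)
      have [measurable]: "\<phi> \<in> borel_measurable borel" "dderiv u \<phi> \<in> borel_measurable borel" "dderiv w (dderiv u \<phi>) \<in> borel_measurable borel" for u w
        using tf test_functions_dderiv test_functions_borel by blast+
      have [measurable]: "laplace_x \<phi> \<in> borel_measurable borel" "grad_x \<phi> \<in> borel_measurable borel"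
        unfolding laplace_x_def[abs_def] grad_x_def[abs_def] by (auto intro!: borel_measurable_vecI)
      let ?h = "\<lambda>x s. (norm (v (x, s)))^2 * (laplace_x \<phi> (x, s) + dderiv e_t \<phi> (x, s))
              + (v (x, s) \<bullet> grad_x \<phi> (x, s)) * ((norm (v (x, s)))^2 + 2 * p (x, s))"
      let ?H = "\<lambda>x s. (norm (V (x, s)))^2 * (laplace_x \<phi> (x, s) + dderiv e_t \<phi> (x, s))
              + (V (x, s) \<bullet> grad_x \<phi> (x, s)) * ((norm (V (x, s)))^2 + 2 * Pr (x, s))"
      have z: "V (x, s) = 0" if "x \<notin> ball 0 1" for x s using that zero(1) slice_zero by blast
      have at: "AE x in lborel. x \<in> ball 0 1 \<longrightarrow> V (x, t) = v (x, t) \<and> G (x, t) = grad v (x, t) \<and> Pr (x, t) = p (x, t)"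
        using elim t by blast
      have l1: "(LINT x|lebesgue_on (ball 0 1). \<phi> (x, t) * (norm (v (x, t)))^2) = (LINT x|lborel. \<phi> (x, t) * (norm (V (x, t)))\<^sup>2)"
        by (rule ball_integral) (simp, simp add: z, use at in eventually_elim, simp)
      have slice: "AE s in lborel. s \<in> {-1<..<t} \<longrightarrow> (LINT x|lborel. ?H x s) = (LINT x|lebesgue_on (ball 0 1). ?h x s)"
        using eq_slices
      proof eventually_elim
        case (elim s)
        show ?case
        proof
          assume "s \<in> {-1<..<t}"
          then have ae: "AE x in lborel. x \<in> ball 0 1 \<longrightarrow> V (x, s) = v (x, s) \<and> G (x, s) = grad v (x, s) \<and> Pr (x, s) = p (x, s)"
            using elim t by auto
          have "(LINT x|lebesgue_on (ball 0 1). ?h x s) = (LINT x|lborel. ?H x s)"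
            by (rule ball_integral) (measurable, simp add: z, use ae in eventually_elim, simp)
          then show "(LINT x|lborel. ?H x s) = (LINT x|lebesgue_on (ball 0 1). ?h x s)" by simp
        qed
      qed
      have Hm: "(\<lambda>s. LINT x|lborel. ?H x s) \<in> borel_measurable borel" by measurable
      have l2: "(LINT s|lebesgue_on {-1<..<t}. LINT x|lebesgue_on (ball 0 1). ?h x s)
          = (LINT s|lborel. indicator {-1<..<t} s * (LINT x|lborel. ?H x s))"
        by (rule lebesgue_on_cong(2)[OF _ Hm slice]) simp
      \<comment> \<open>The dissipation is nonnegative, also by convention if an integral diverges,
        and is dropped from the left-hand side.\<close>
      have "0 \<le> (LINT s|lebesgue_on {-1<..<t}. LINT x|lebesgue_on (ball 0 1). \<phi> (x, s) * (norm (grad v (x, s)))^2)"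
        by (intro Bochner_Integration.integral_nonneg mult_nonneg_nonneg \<phi>0) auto
      with L show "(LINT x|lborel. \<phi> (x, t) * (norm (V (x, t)))\<^sup>2) \<le> (LINT s|lborel. indicator {-1<..<t} s * (LINT x|lborel. ?H x s))"
        unfolding L_def l1 l2 by linarith
    qed
  qed
qed

lemma local_solution: "local_solution V G Pr"
  by (intro local_solution.intro V_borel G_borel P_borel zero V2 G2 P32 WG divergence_free pressure_equation energy_inequality)

end

subsection \<open>The scale-invariant functionals\<close>

lemma AE_snd_spacetime:
  assumes "AE t in lborel. Pd t" shows "AE z in (lborel :: spacetime measure). Pd (snd z)"
proof -
  obtain N where N: "N \<in> null_sets lborel" "{t. \<not> Pd t} \<subseteq> N" using assms by (auto simp: eventually_ae_filter)
  have [measurable]: "N \<in> sets borel" using N by auto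
  have "(\<integral>\<^sup>+z. indicator N (snd z) \<partial>(lborel :: spacetime measure)) = (\<integral>\<^sup>+t. \<integral>\<^sup>+x. indicator N t \<partial>(lborel :: (real^3) measure) \<partial>lborel)"
    by (subst nn_integral_spacetime) auto
  also have "\<dots> = 0"
    using AE_not_in[OF N(1)] by (subst nn_integral_0_iff_AE) (auto elim!: eventually_mono)
  finally have "AE z in (lborel :: spacetime measure). indicator N (snd z) = (0::ennreal)"
    by (subst (asm) nn_integral_0_iff_AE) auto
  then show ?thesis by eventually_elim (use N(2) in \<open>auto simp: indicator_def split: if_splits\<close>)
qed

lemma cyl_Q:
  assumes F[measurable]: "F \<in> borel_measurable borel"
  shows "cyl r (r\<^sup>2) F = (\<integral>\<^sup>+z. indicator (Q r) z * F z \<partial>lborel)"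
proof -
  have "(\<integral>\<^sup>+z. indicator (Q r) z * F z \<partial>lborel) = (\<integral>\<^sup>+t. \<integral>\<^sup>+x. indicator (Q r) (x, t) * F (x, t) \<partial>lborel \<partial>lborel)"
    by (rule nn_integral_spacetime) measurable
  also have "\<dots> = cyl r (r\<^sup>2) F"
    unfolding cyl_def
    by (intro nn_integral_cong) (simp add: Q_def indicator_times nn_integral_cmult[symmetric] mult_ac)
  finally show ?thesis by simp
qed

lemma cyl_Q_real:
  assumes F[measurable]: "F \<in> borel_measurable borel" and F0: "\<And>z. 0 \<le> F z"
  shows "cyl r (r\<^sup>2) (\<lambda>z. ennreal (F z)) = (\<integral>\<^sup>+z. ennreal (indicator (Q r) z * F z) \<partial>lborel)"
  by (subst cyl_Q) (auto intro!: nn_integral_cong simp: indicator_def)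

lemma time_mono:
  fixes t :: real
  assumes "0 < r" "r \<le> s" "-(r\<^sup>2) < t" shows "-(s\<^sup>2) < t"
proof -
  have "r\<^sup>2 \<le> s\<^sup>2" using assms by (intro power_mono) auto
  then show ?thesis using assms by linarith
qed

lemma Q_mono: assumes "0 < r" "r \<le> s" shows "Q r \<subseteq> Q s"
  using assms time_mono[OF assms] by (auto simp: Q_def)

text \<open>The mean is the best constant up to a factor: |f - m| \<le> |f - c| + |m - c|, and
  Jensen's inequality controls |m - c| by the deviation of \<open>f\<close> from \<open>c\<close>.
  Each part contributes 3 to the factor 6.\<close>

lemma mean_deviation:
  fixes f :: "real^3 \<Rightarrow> real"
  assumes f[measurable]: "f \<in> borel_measurable borel" and r: "0 < r" and i: "integrable lborel f"
    and m: "m = 1 / (unit_ball_vol 3 * r^3) * (LINT x|lborel. indicator (ball 0 r) x * f x)"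
  shows "(\<integral>\<^sup>+x. indicator (ball 0 r) x * ennreal (\<bar>f x - m\<bar> powr (3/2)) \<partial>lborel)
     \<le> 6 * (\<integral>\<^sup>+x. indicator (ball 0 r) x * ennreal (\<bar>f x - c\<bar> powr (3/2)) \<partial>lborel)"
proof (cases "(\<integral>\<^sup>+x. indicator (ball 0 r) x * ennreal (\<bar>f x - c\<bar> powr (3/2)) \<partial>lborel) = \<infinity>")
  case False
  define Vo where "Vo = unit_ball_vol 3 * r^3"
  have Vo: "0 < Vo" using r by (simp add: Vo_def)
  have mb: "measure lborel (ball (0::real^3) r) = Vo" using r by (simp add: measure_ball_3 Vo_def)
  have eb: "emeasure lborel (ball (0::real^3) r) = ennreal Vo"
    using emeasure_lborel_ball_finite[of "0::real^3" r] by (simp add: emeasure_eq_ennreal_measure mb less_top)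
  have ib: "integrable lborel (indicator (ball 0 r) :: real^3 \<Rightarrow> real)"
    by (intro integrable_real_indicator) (use eb in auto)
  define I where "I = (LINT x|lborel. indicator (ball 0 r) x * \<bar>f x - c\<bar> powr (3/2))"
  have n: "(\<integral>\<^sup>+x. indicator (ball 0 r) x * ennreal (\<bar>f x - c\<bar> powr (3/2)) \<partial>lborel)
      = (\<integral>\<^sup>+x. ennreal (indicator (ball 0 r) x * \<bar>f x - c\<bar> powr (3/2)) \<partial>lborel)"
    by (intro nn_integral_cong) (simp add: indicator_def)
  have i2: "integrable lborel (\<lambda>x. indicator (ball 0 r) x * \<bar>f x - c\<bar> powr (3/2))"
    by (rule integrableI_nonneg) (use False n in \<open>auto simp: less_top\<close>)
  have nI: "(\<integral>\<^sup>+x. indicator (ball 0 r) x * ennreal (\<bar>f x - c\<bar> powr (3/2)) \<partial>lborel) = ennreal I"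
    unfolding n I_def by (rule nn_integral_eq_integral[OF i2]) simp
  have I0: "0 \<le> I" unfolding I_def by (rule Bochner_Integration.integral_nonneg) simp
  note J = jensen_three_halves[of "\<lambda>x. \<bar>f x - c\<bar>", OF _ _ r i2]
  let ?j = "LINT x|lborel. indicator (ball 0 r) x * \<bar>f x - c\<bar>"
  have if': "integrable lborel (\<lambda>x. indicator (ball 0 r) x * f x)"
    using integrable_mult_indicator[OF _ i, of "ball 0 r"] by simp
  have "Vo * (m - c) = (LINT x|lborel. indicator (ball 0 r) x * f x) - c * Vo"
    using Vo by (simp add: m Vo_def[symmetric] field_simps)
  also have "\<dots> = (LINT x|lborel. indicator (ball 0 r) x * f x - c * indicator (ball 0 r) x)"
    using if' ib by (simp add: mb)
  also have "\<dots> = (LINT x|lborel. indicator (ball 0 r) x * (f x - c))" by (simp add: algebra_simps)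
  finally have "\<bar>Vo * (m - c)\<bar> = \<bar>LINT x|lborel. indicator (ball 0 r) x * (f x - c)\<bar>" by (rule arg_cong)
  then have "Vo * \<bar>m - c\<bar> = \<bar>LINT x|lborel. indicator (ball 0 r) x * (f x - c)\<bar>" using Vo by (simp add: abs_mult)
  also have "\<dots> \<le> (LINT x|lborel. \<bar>indicator (ball 0 r) x * (f x - c)\<bar>)" by (rule integral_abs_bound)
  finally have "Vo * \<bar>m - c\<bar> \<le> ?j" by (simp add: abs_mult)
  then have "(Vo * \<bar>m - c\<bar>) powr (3/2) \<le> ?j powr (3/2)" using Vo by (intro powr_mono2) auto
  also have "\<dots> \<le> sqrt Vo * I" unfolding I_def Vo_def by (rule J(2)) auto
  finally have "Vo powr (3/2) * \<bar>m - c\<bar> powr (3/2) \<le> sqrt Vo * I" using Vo by (simp add: powr_mult)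
  moreover have "Vo powr (3/2) = sqrt Vo * Vo" using powr_add[of Vo "1/2" 1] Vo by (simp add: powr_half_sqrt)
  ultimately have "sqrt Vo * (Vo * \<bar>m - c\<bar> powr (3/2)) \<le> sqrt Vo * I" by (simp add: mult.assoc)
  then have mc: "Vo * \<bar>m - c\<bar> powr (3/2) \<le> I" using Vo by simp
  have "(\<integral>\<^sup>+x. indicator (ball 0 r) x * ennreal (\<bar>f x - m\<bar> powr (3/2)) \<partial>lborel)
     \<le> (\<integral>\<^sup>+x. 3 * (indicator (ball 0 r) x * ennreal (\<bar>f x - c\<bar> powr (3/2))) + ennreal (3 * \<bar>m - c\<bar> powr (3/2)) * indicator (ball 0 r) x \<partial>lborel)"
  proof (rule nn_integral_mono)
    fix x
    have "\<bar>f x - m\<bar> powr (3/2) \<le> (\<bar>f x - c\<bar> + \<bar>m - c\<bar>) powr (3/2)" by (intro powr_mono2) auto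
    also have "\<dots> \<le> 3 * \<bar>f x - c\<bar> powr (3/2) + 3 * \<bar>m - c\<bar> powr (3/2)" by (rule powr_three_halves_add) auto
    finally have "ennreal (\<bar>f x - m\<bar> powr (3/2)) \<le> ennreal (3 * \<bar>f x - c\<bar> powr (3/2) + 3 * \<bar>m - c\<bar> powr (3/2))" by (rule ennreal_leI)
    also have "\<dots> = 3 * ennreal (\<bar>f x - c\<bar> powr (3/2)) + ennreal (3 * \<bar>m - c\<bar> powr (3/2))"
      by (simp add: ennreal_mult)
    finally show "indicator (ball 0 r) x * ennreal (\<bar>f x - m\<bar> powr (3/2))
      \<le> 3 * (indicator (ball 0 r) x * ennreal (\<bar>f x - c\<bar> powr (3/2))) + ennreal (3 * \<bar>m - c\<bar> powr (3/2)) * indicator (ball 0 r) x"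
      by (auto simp: indicator_def)
  qed
  also have "\<dots> = 3 * ennreal I + ennreal (3 * \<bar>m - c\<bar> powr (3/2)) * ennreal Vo"
    by (subst nn_integral_add) (auto simp: nn_integral_cmult nI nn_integral_cmult_indicator eb)
  also have "\<dots> = ennreal (3 * I + 3 * (Vo * \<bar>m - c\<bar> powr (3/2)))"
    using I0 Vo by (simp add: ennreal_plus ennreal_mult mult_ac)
  also have "\<dots> \<le> ennreal (6 * I)" using mc by (intro ennreal_leI) simp
  also have "\<dots> = 6 * ennreal I" using I0 by (simp add: ennreal_mult)
  finally show ?thesis unfolding nI .
qed (simp add: ennreal_mult_top)

section \<open>The functionals expressed by the Borel representatives\<close>

context representative
begin

lemma Q_r_integral:
  fixes F f :: "spacetime \<Rightarrow> real"
  assumes r: "0 < r" "r \<le> 1" and F: "F \<in> borel_measurable borel"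
    and ae: "AE z in lborel. z \<in> Q r \<longrightarrow> V z = v z \<and> G z = grad v z \<and> Pr z = p z \<longrightarrow> F z = f z"
  shows "(LINT z|lebesgue_on (Q r). f z) = (LINT z|lborel. indicator (Q r) z * F z)"
proof (rule lebesgue_on_cong(2)[OF Q_borel F])
  show "AE z in lborel. z \<in> Q r \<longrightarrow> F z = f z"
    using eq ae by eventually_elim (use Q_mono[OF r] in blast)
qed

lemma E_cyl:
  assumes r: "0 < r" "r \<le> 1"
  shows "cyl r (r\<^sup>2) (\<lambda>z. ennreal ((norm (G z))\<^sup>2)) = ennreal (r * E v r)" "0 \<le> E v r"
proof -
  have i: "integrable lborel (\<lambda>z. indicator (Q r) z * (norm (G z))\<^sup>2)"
    using integrable_mult_indicator[OF _ G2, of "Q r"] by simp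
  have "(LINT z|lebesgue_on (Q r). (norm (grad v z))\<^sup>2) = (LINT z|lborel. indicator (Q r) z * (norm (G z))\<^sup>2)"
    by (rule Q_r_integral[OF r]) auto
  then have E: "r * E v r = (LINT z|lborel. indicator (Q r) z * (norm (G z))\<^sup>2)"
    using r by (simp add: E_def)
  show "cyl r (r\<^sup>2) (\<lambda>z. ennreal ((norm (G z))\<^sup>2)) = ennreal (r * E v r)"
    unfolding E using cyl_Q_real[of "\<lambda>z. (norm (G z))\<^sup>2" r] nn_integral_eq_integral[OF i] by simp
  have "0 \<le> r * E v r" unfolding E by (rule Bochner_Integration.integral_nonneg) simp
  then show "0 \<le> E v r" using r by (simp add: zero_le_mult_iff)
qed

lemma C_le:
  assumes r: "0 < r" "r \<le> 1" and X: "0 \<le> X" "cyl r (r\<^sup>2) (\<lambda>z. ennreal (norm (V z) ^ 3)) \<le> ennreal (r\<^sup>2 * X)"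
  shows "C v r \<le> X"
proof -
  have "(LINT z|lebesgue_on (Q r). (norm (v z))^3) = (LINT z|lborel. indicator (Q r) z * norm (V z) ^ 3)"
    by (rule Q_r_integral[OF r]) auto
  also have "\<dots> \<le> r\<^sup>2 * X"
    by (rule integral_le_of_nn_integral) (use X cyl_Q_real[of "\<lambda>z. norm (V z) ^ 3" r] in auto)
  finally show ?thesis using r by (simp add: C_def field_simps)
qed

definition ball_energy :: "real \<Rightarrow> real \<Rightarrow> real" where
  "ball_energy r t = (LINT x|lborel. indicator (ball 0 r) x * (norm (V (x, t)))\<^sup>2)"

lemma ball_energy_borel [measurable]: "ball_energy r \<in> borel_measurable borel"
  unfolding ball_energy_def[abs_def] by measurable

lemma ball_energy_eq:
  assumes r: "0 < r" "r \<le> 1"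
  shows "AE t in lborel. t \<in> {-(r\<^sup>2)<..<0} \<longrightarrow> ball_energy r t = (LINT x|lebesgue_on (ball 0 r). (norm (v (x, t)))^2)"
  using eq_slices
proof eventually_elim
  case (elim t)
  show ?case
  proof
    assume t: "t \<in> {-(r\<^sup>2)<..<0}"
    have "r\<^sup>2 \<le> 1" using r by (simp add: power_le_one)
    then have "t \<in> {-1<..<0}" using t by auto
    then have ae: "AE x in lborel. x \<in> ball 0 1 \<longrightarrow> V (x, t) = v (x, t) \<and> G (x, t) = grad v (x, t) \<and> Pr (x, t) = p (x, t)"
      using elim by blast
    have "(LINT x|lebesgue_on (ball 0 r). (norm (v (x, t)))^2) = (LINT x|lborel. indicator (ball 0 r) x * (norm (V (x, t)))^2)"
      by (rule lebesgue_on_cong(2)) (simp, measurable, use ae in eventually_elim, use r in auto)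
    then show "ball_energy r t = (LINT x|lebesgue_on (ball 0 r). (norm (v (x, t)))^2)" by (simp add: ball_energy_def)
  qed
qed

lemma ball_energy_mono:
  assumes "r \<le> s" shows "AE t in lborel. ball_energy r t \<le> ball_energy s t"
  using integrable_spacetime[OF V2]
proof eventually_elim
  case (elim t)
  have i: "integrable lborel (\<lambda>x. indicator (ball 0 q) x * (norm (V (x, t)))\<^sup>2)" for q
    using integrable_mult_indicator[OF _ elim, of "ball 0 q"] by simp
  show ?case unfolding ball_energy_def
    by (rule integral_mono[OF i i]) (use assms in \<open>auto simp: indicator_def\<close>)
qed

text \<open>\<open>real_of_ereal\<close> is faithful here because the essential supremum is finite:
  it is at least 0, since the time interval is not a null set, and at most M/r by the bound in
  \<open>L2_inf\<close>. The second and third parts say in terms of \<open>V\<close> that it is an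
  upper bound and the least one.\<close>

lemma A_esssup:
  assumes r: "0 < r" "r \<le> 1"
  shows "0 \<le> A v r"
    "AE t in lborel. t \<in> {-(r\<^sup>2)<..<0} \<longrightarrow> ball_energy r t \<le> r * A v r"
    "\<And>X. AE t in lborel. t \<in> {-(r\<^sup>2)<..<0} \<longrightarrow> ball_energy r t \<le> r * X \<Longrightarrow> A v r \<le> X"
proof -
  let ?I = "{-(r\<^sup>2)<..<0::real}"
  define f where "f t = ereal (1 / r * (LINT x|lebesgue_on (ball 0 r). (norm (v (x, t)))^2))" for t
  have "(\<lambda>t. LINT x|lebesgue_on (ball 0 r). (norm (v (x, t)))^2) \<in> borel_measurable (lebesgue_on ?I)"
    by (rule lebesgue_on_cong(1)[OF _ ball_energy_borel ball_energy_eq[OF r]]) simp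
  then have fm: "f \<in> borel_measurable (lebesgue_on ?I)" unfolding f_def by measurable
  have fe: "AE t in lborel. t \<in> ?I \<longrightarrow> f t = ereal (ball_energy r t / r)"
    using ball_energy_eq[OF r] by eventually_elim (simp add: f_def)
  have up: "esssup (lebesgue_on ?I) f \<le> ereal X" if "AE t in lborel. t \<in> ?I \<longrightarrow> ball_energy r t \<le> r * X" for X
  proof (rule esssup_I[OF fm])
    show "AE t in lebesgue_on ?I. f t \<le> ereal X"
      using fe that by (subst AE_lebesgue_on_iff_lborel, simp, eventually_elim) (use r in \<open>auto simp: field_simps\<close>)
  qed
  have "emeasure (lebesgue_on ?I) (space (lebesgue_on ?I)) \<noteq> 0"
    using r by (subst emeasure_restrict_space) (auto simp: space_restrict_space)
  then have "esssup (lebesgue_on ?I) (\<lambda>t. 0::ereal) = 0" by (rule esssup_const)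
  moreover have "esssup (lebesgue_on ?I) (\<lambda>t. 0::ereal) \<le> esssup (lebesgue_on ?I) f"
    using r by (intro esssup_mono) (auto simp: f_def intro!: Bochner_Integration.integral_nonneg)
  ultimately have lo: "0 \<le> esssup (lebesgue_on ?I) f" by simp
  obtain M where "AE t in lebesgue_on {-1<..<0}. (LINT x|lebesgue_on (ball 0 1). (norm (v (x, t)))^2) \<le> M"
    using sws unfolding suitable_weak_solution_def L2_inf_def by (auto elim!: eventually_mono)
  then have "AE t in lborel. t \<in> {-1<..<0} \<longrightarrow> (LINT x|lebesgue_on (ball 0 1). (norm (v (x, t)))^2) \<le> M"
    by (subst (asm) AE_lebesgue_on_iff_lborel) auto
  moreover have "AE t in lborel. t \<in> {-1<..<0} \<longrightarrow> ball_energy 1 t = (LINT x|lebesgue_on (ball 0 1). (norm (v (x, t)))^2)"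
    using ball_energy_eq[of 1] by simp
  moreover have tm: "t \<in> {-1<..<0}" if "t \<in> ?I" for t using time_mono[OF r] that by simp
  ultimately have "AE t in lborel. t \<in> ?I \<longrightarrow> ball_energy r t \<le> r * (M / r)"
    using ball_energy_mono[OF r(2)] by eventually_elim (use r tm in force)
  from up[OF this] lo have fin: "\<bar>esssup (lebesgue_on ?I) f\<bar> \<noteq> \<infinity>" by auto
  have A: "A v r = real_of_ereal (esssup (lebesgue_on ?I) f)" unfolding A_def f_def ..
  then have Ae: "ereal (A v r) = esssup (lebesgue_on ?I) f" using fin by (simp add: ereal_real)
  show "0 \<le> A v r" using lo Ae by (metis ereal_less_eq(5))
  have "AE t in lborel. t \<in> ?I \<longrightarrow> f t \<le> ereal (A v r)"
    using esssup_AE[of f "lebesgue_on ?I"] unfolding Ae by (subst (asm) AE_lebesgue_on_iff_lborel) auto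
  with fe show "AE t in lborel. t \<in> ?I \<longrightarrow> ball_energy r t \<le> r * A v r"
    by eventually_elim (use r in \<open>auto simp: field_simps\<close>)
  show "A v r \<le> X" if "AE t in lborel. t \<in> ?I \<longrightarrow> ball_energy r t \<le> r * X" for X
    using up[OF that] unfolding Ae[symmetric] by simp
qed

definition ball_mean :: "real \<Rightarrow> real \<Rightarrow> real" where
  "ball_mean r t = 1 / (unit_ball_vol 3 * r^3) * (LINT x|lborel. indicator (ball 0 r) x * Pr (x, t))"

lemma ball_mean_borel [measurable]: "ball_mean r \<in> borel_measurable borel"
  unfolding ball_mean_def[abs_def] by measurable

lemma ball_mean_eq:
  assumes r: "0 < r" "r \<le> 1"
  shows "AE t in lborel. t \<in> {-1<..<0} \<longrightarrow> ball_mean r t = mean p r t"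
  using eq_slices
proof eventually_elim
  case (elim t)
  show ?case
  proof
    assume "t \<in> {-1<..<0}"
    then have ae: "AE x in lborel. x \<in> ball 0 1 \<longrightarrow> V (x, t) = v (x, t) \<and> G (x, t) = grad v (x, t) \<and> Pr (x, t) = p (x, t)"
      using elim by blast
    have "(LINT x|lebesgue_on (ball 0 r). p (x, t)) = (LINT x|lborel. indicator (ball 0 r) x * Pr (x, t))"
      by (rule lebesgue_on_cong(2)) (simp, measurable, use ae in eventually_elim, use r in auto)
    moreover have "measure lebesgue (ball (0::real^3) r) = unit_ball_vol 3 * r^3"
      using r measure_ball_3[of r "0::real^3"] by simp
    ultimately show "ball_mean r t = mean p r t" by (simp add: ball_mean_def mean_def)
  qed
qed

lemma pressure_mean_deviation:
  assumes r: "0 < r" and m[measurable]: "m \<in> borel_measurable borel"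
  shows "cyl r (r\<^sup>2) (\<lambda>z. ennreal (\<bar>Pr z - ball_mean r (snd z)\<bar> powr (3/2)))
    \<le> 6 * cyl r (r\<^sup>2) (\<lambda>z. ennreal (\<bar>Pr z - m (snd z)\<bar> powr (3/2)))"
proof -
  have "cyl r (r\<^sup>2) (\<lambda>z. ennreal (\<bar>Pr z - ball_mean r (snd z)\<bar> powr (3/2)))
    \<le> (\<integral>\<^sup>+t. 6 * (indicator {-(r\<^sup>2)<..<0} t * (\<integral>\<^sup>+x. indicator (ball 0 r) x * ennreal (\<bar>Pr (x, t) - m t\<bar> powr (3/2)) \<partial>lborel)) \<partial>lborel)"
    unfolding cyl_def
  proof (rule nn_integral_mono_AE)
    show "AE t in lborel. indicator {-(r\<^sup>2)<..<0} t * (\<integral>\<^sup>+x. indicator (ball 0 r) x * ennreal (\<bar>Pr (x, t) - ball_mean r (snd (x, t))\<bar> powr (3/2)) \<partial>lborel)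
      \<le> 6 * (indicator {-(r\<^sup>2)<..<0} t * (\<integral>\<^sup>+x. indicator (ball 0 r) x * ennreal (\<bar>Pr (x, t) - m t\<bar> powr (3/2)) \<partial>lborel))"
      using integrable_spacetime[OF P_integrable]
    proof eventually_elim
      case (elim t)
      from mean_deviation[OF _ r elim ball_mean_def[of r t], where c = "m t"] show ?case
        by (cases "t \<in> {-(r\<^sup>2)<..<0}") (auto simp del: indicator_simps simp: indicator_simps(1,2)[of t])
    qed
  qed
  then show ?thesis by (simp add: nn_integral_cmult cyl_def)
qed

text \<open>The finiteness behind it comes from comparing the mean with the constant 0, for which
  the integral is bounded by that of |p|^{3/2}.\<close>

lemma D0_cyl:
  assumes r: "0 < r" "r \<le> 1"
  shows "cyl r (r\<^sup>2) (\<lambda>z. ennreal (\<bar>Pr z - ball_mean r (snd z)\<bar> powr (3/2))) = ennreal (r\<^sup>2 * D0 p r)" "0 \<le> D0 p r"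
proof -
  let ?F = "\<lambda>z. \<bar>Pr z - ball_mean r (snd z)\<bar> powr (3/2)"
  have "cyl r (r\<^sup>2) (\<lambda>z. ennreal (?F z)) \<le> 6 * cyl r (r\<^sup>2) (\<lambda>z. ennreal (\<bar>Pr z - 0\<bar> powr (3/2)))"
    by (rule pressure_mean_deviation[OF r(1), of "\<lambda>_. 0"]) simp
  also have "\<dots> \<le> 6 * (\<integral>\<^sup>+z. ennreal (\<bar>Pr z\<bar> powr (3/2)) \<partial>lborel)"
    by (intro mult_left_mono, subst cyl_Q_real) (auto intro!: nn_integral_mono ennreal_leI simp: indicator_def)
  also have "\<dots> < \<infinity>"
    using P32 by (simp add: integrable_iff_bounded ennreal_mult_less_top)
  finally have fin: "(\<integral>\<^sup>+z. ennreal (indicator (Q r) z * ?F z) \<partial>lborel) < \<infinity>"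
    by (subst (asm) cyl_Q_real) auto
  have i: "integrable lborel (\<lambda>z. indicator (Q r) z * ?F z)"
    by (rule integrableI_nonneg) (use fin in auto)
  have "Q r \<subseteq> Q 1" by (rule Q_mono[OF r])
  then have ae: "AE z in lborel. z \<in> Q r \<longrightarrow> V z = v z \<and> G z = grad v z \<and> Pr z = p z \<longrightarrow> ?F z = \<bar>p z - mean p r (snd z)\<bar> powr (3/2)"
    using AE_snd_spacetime[OF ball_mean_eq[OF r]]
    by eventually_elim (use time_mono[OF r] in \<open>auto simp: Q_def\<close>)
  have "(LINT z|lebesgue_on (Q r). \<bar>p z - mean p r (snd z)\<bar> powr (3/2)) = (LINT z|lborel. indicator (Q r) z * ?F z)"
    by (rule Q_r_integral[OF r _ ae]) measurable
  then have D: "r\<^sup>2 * D0 p r = (LINT z|lborel. indicator (Q r) z * ?F z)"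
    using r by (simp add: D0_def)
  show "cyl r (r\<^sup>2) (\<lambda>z. ennreal (?F z)) = ennreal (r\<^sup>2 * D0 p r)"
    unfolding D using cyl_Q_real[of ?F r] nn_integral_eq_integral[OF i] by simp
  have "0 \<le> r\<^sup>2 * D0 p r" unfolding D by (rule Bochner_Integration.integral_nonneg) simp
  then show "0 \<le> D0 p r" using r by (simp add: zero_le_mult_iff)
qed

lemma D0_le:
  assumes r: "0 < r" "r \<le> 1" and m: "m \<in> borel_measurable borel" and X: "0 \<le> X"
    and b: "cyl r (r\<^sup>2) (\<lambda>z. ennreal (\<bar>Pr z - m (snd z)\<bar> powr (3/2))) \<le> ennreal (r\<^sup>2 * X)"
  shows "D0 p r \<le> 6 * X"
proof -
  have "ennreal (r\<^sup>2 * D0 p r) \<le> 6 * ennreal (r\<^sup>2 * X)"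
    using pressure_mean_deviation[OF r(1) m] mult_left_mono[OF b, of 6] unfolding D0_cyl(1)[OF r] by simp
  also have "\<dots> = ennreal (r\<^sup>2 * (6 * X))" using X by (simp add: ennreal_mult mult_ac)
  finally have "r\<^sup>2 * D0 p r \<le> r\<^sup>2 * (6 * X)" using X by (subst (asm) ennreal_le_iff) auto
  then show ?thesis using r by simp
qed

lemma scaled_solution:
  assumes r: "0 < r" "r \<le> 1" shows "scaled_solution V G Pr r (A v r) (E v r) (D0 p r) (ball_mean r)"
  using local_solution A_esssup[OF r] E_cyl[OF r] D0_cyl[OF r] r
  by (intro scaled_solution.intro scaled_solution_axioms.intro) (auto simp: ball_energy_def)

lemma A_mono:
  assumes r: "0 < r" "r \<le> R" "R \<le> 1" shows "A v r \<le> R / r * A v R"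
proof (rule A_esssup(3))
  have "AE t in lborel. t \<in> {-(R\<^sup>2)<..<0} \<longrightarrow> ball_energy R t \<le> R * A v R" using r by (intro A_esssup) auto
  then show "AE t in lborel. t \<in> {-(r\<^sup>2)<..<0} \<longrightarrow> ball_energy r t \<le> r * (R / r * A v R)"
    using ball_energy_mono[OF r(2)] by (elim AE_mp, elim AE_mp) (use r time_mono[OF r(1,2)] in \<open>auto intro!: AE_I2\<close>)
qed (use r in auto)

text \<open>Besides the ratio of the scales, the change of the mean costs the factor 6.\<close>

lemma D0_mono:
  assumes r: "0 < r" "r \<le> R" "R \<le> 1" shows "D0 p r \<le> 6 * ((R / r)\<^sup>2 * D0 p R)"
proof (rule D0_le)
  have "r\<^sup>2 \<le> R\<^sup>2" using r by (intro power_mono) auto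
  then have "cyl r (r\<^sup>2) (\<lambda>z. ennreal (\<bar>Pr z - ball_mean R (snd z)\<bar> powr (3/2)))
      \<le> cyl R (R\<^sup>2) (\<lambda>z. ennreal (\<bar>Pr z - ball_mean R (snd z)\<bar> powr (3/2)))"
    by (intro cyl_mono' r) auto
  also have "\<dots> = ennreal (r\<^sup>2 * ((R / r)\<^sup>2 * D0 p R))"
    using r D0_cyl[of R] by (simp add: power_divide)
  finally show "cyl r (r\<^sup>2) (\<lambda>z. ennreal (\<bar>Pr z - ball_mean R (snd z)\<bar> powr (3/2))) \<le> ennreal (r\<^sup>2 * ((R / r)\<^sup>2 * D0 p R))" .
qed (use r D0_cyl[of R] in auto)

text \<open>\<open>C\<close> is estimated already for \<theta> \<le> 1/6, as the pressure does not
  enter. With \<theta> = 1/6 this bounds \<open>C\<close> at r by \<open>A\<close> and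
  \<open>E\<close> at 6r in the end.\<close>

lemma scale_step:
  assumes R: "0 < R" "R \<le> 1" and \<theta>: "0 < \<theta>"
  defines "a \<equiv> A v R" and "e \<equiv> E v R" and "D \<equiv> D0 p R"
  defines "cubic_bound \<equiv> 4 * cubic_const * sqrt a * e / \<theta>\<^sup>2 + 108 * mean_const * \<theta>^3 * a powr (3/2)"
    and "pressure_bound \<equiv> pressure_near_const * sqrt a * e / \<theta>\<^sup>2 + 243 * pressure_far_const * \<theta> powr (5/2) * D"
  shows "\<theta> \<le> 1/6 \<Longrightarrow> C v (\<theta> * R) \<le> cubic_bound" "\<theta> \<le> 1/12 \<Longrightarrow> D0 p (\<theta> * R) \<le> 6 * pressure_bound"
    "\<theta> \<le> 1/12 \<Longrightarrow> 0 < l \<Longrightarrow> A v (\<theta> * R) \<le> energy_const * (e / \<theta>^3 + \<theta>\<^sup>2 * a + sqrt a * e / \<theta>\<^sup>2 + sqrt \<theta> * a * (1 + e) + l * cubic_bound + pressure_bound / sqrt l)"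
proof -
  interpret c: scaled_solution V G Pr R a e D "ball_mean R" unfolding a_def e_def D_def by (rule scaled_solution[OF R])
  have cubic_bound: "cubic_bound = c.cubic_bound \<theta>" and pressure_bound: "pressure_bound = c.pressure_bound \<theta>" by (simp_all add: cubic_bound_def pressure_bound_def c.cubic_bound_def c.pressure_bound_def)
  have s: "0 < \<theta> * R" "(\<theta> * R)\<^sup>2 \<le> 4 * (\<theta> * R)\<^sup>2" using R \<theta> by auto
  have le: "\<theta> * R \<le> 1" if "\<theta> \<le> 1" using mult_mono[OF that R(2)] R by simp
  show "C v (\<theta> * R) \<le> cubic_bound" if "\<theta> \<le> 1/6"
    unfolding cubic_bound by (rule C_le) (use c.cubic_step[OF \<theta> that, of 1 "(\<theta> * R)\<^sup>2"] c.cubic_bound_nonneg[of \<theta>] \<theta> s le that in auto)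
  show "D0 p (\<theta> * R) \<le> 6 * pressure_bound" if "\<theta> \<le> 1/12"
    unfolding pressure_bound by (rule D0_le[OF _ _ c.pressure_mean_borel]) (use c.pressure_step[OF \<theta> that, of 1 "(\<theta> * R)\<^sup>2"] c.pressure_bound_nonneg[of \<theta>] \<theta> s le that in auto)
  show "A v (\<theta> * R) \<le> energy_const * (e / \<theta>^3 + \<theta>\<^sup>2 * a + sqrt a * e / \<theta>\<^sup>2 + sqrt \<theta> * a * (1 + e) + l * cubic_bound + pressure_bound / sqrt l)" if "\<theta> \<le> 1/12" "0 < l"
    unfolding cubic_bound pressure_bound by (rule A_esssup(3)) (use c.energy_step[OF \<theta> that] s le that in \<open>auto simp: ball_energy_def\<close>)
qed

text \<open>Serves the radii between 1/6 and 1/4, for which 6r exceeds 1, by comparing with the unit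
  scale directly.\<close>

lemma C_unit:
  assumes r: "0 < r" "r \<le> 1/2"
  shows "C v r \<le> (4 * cubic_const * sqrt (A v 1) * E v 1 + mean_const * A v 1 powr (3/2)) / r\<^sup>2"
proof (rule C_le)
  interpret c: scaled_solution V G Pr 1 "A v 1" "E v 1" "D0 p 1" "ball_mean 1" by (rule scaled_solution) auto
  let ?X = "4 * cubic_const * sqrt (A v 1) * E v 1 + mean_const * A v 1 powr (3/2)"
  show "0 \<le> ?X / r\<^sup>2" using cubic_const_nonneg mean_const_nonneg c.e0 c.a0 by simp
  have "r^3 * r\<^sup>2 \<le> 1 * 1" using r by (intro mult_mono power_le_one) auto
  then have "mean_const * A v 1 powr (3/2) * (r^3 * r\<^sup>2) \<le> mean_const * A v 1 powr (3/2) * 1"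
    using mean_const_nonneg by (intro mult_left_mono) auto
  then have "ennreal (4 * cubic_const * 1\<^sup>2 * sqrt (A v 1) * E v 1 + mean_const * A v 1 powr (3/2) / 1^3 * r^3 * r\<^sup>2) \<le> ennreal ?X"
    by (intro ennreal_leI) (simp add: mult.assoc)
  with c.cubic_cylinder[of r "r\<^sup>2"] show "cyl r (r\<^sup>2) (\<lambda>z. ennreal (norm (V z) ^ 3)) \<le> ennreal (r\<^sup>2 * (?X / r\<^sup>2))"
    using r by (auto simp: power_le_one)
qed (use r in auto)

end

subsection \<open>Decay and iteration\<close>

text \<open>\<open>b\<close> is the point from which on \<eta> a^{3/2} dominates c a^s; below it the
  left-hand side is at most c b^s.\<close>

lemma powr_sublinear:
  fixes c s \<eta> :: real
  assumes c: "0 \<le> c" and s: "0 < s" "s < 3/2" and \<eta>: "0 < \<eta>"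
  shows "\<exists>K\<ge>0. \<forall>a\<ge>0. c * a powr s \<le> \<eta> * a powr (3/2) + K"
proof -
  define b where "b = (c / \<eta>) powr (1 / (3/2 - s))"
  have "c * a powr s \<le> \<eta> * a powr (3/2) + c * b powr s" if a: "0 \<le> a" for a
  proof (cases "a \<le> b")
    case True
    then have "c * a powr s \<le> c * b powr s" using c s a by (intro mult_left_mono powr_mono2) auto
    moreover have "0 \<le> \<eta> * a powr (3/2)" using \<eta> by simp
    ultimately show ?thesis by linarith
  next
    case False
    have b0: "0 \<le> b" by (simp add: b_def)
    have "b powr (3/2 - s) \<le> a powr (3/2 - s)" using False b0 s by (intro powr_mono2) auto
    then have "c / \<eta> \<le> a powr (3/2 - s)" using c \<eta> s by (simp add: b_def powr_powr)
    then have "c \<le> \<eta> * a powr (3/2 - s)" using \<eta> by (simp add: field_simps)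
    then have "c * a powr s \<le> \<eta> * a powr (3/2 - s) * a powr s" by (intro mult_right_mono) auto
    also have "\<dots> = \<eta> * a powr (3/2)" by (simp add: mult.assoc powr_add[symmetric])
    finally show ?thesis using c by (smt (verit) mult_nonneg_nonneg powr_ge_zero)
  qed
  moreover have "0 \<le> c * b powr s" using c by simp
  ultimately show ?thesis by blast
qed

text \<open>81 = 3^4: the two-term inequality is applied once for each of the four
  additions.\<close>

lemma powr_three_halves_sum:
  fixes x1 x2 x3 x4 x5 :: real
  assumes "0 \<le> x1" "0 \<le> x2" "0 \<le> x3" "0 \<le> x4" "0 \<le> x5"
  shows "(x1 + (x2 + (x3 + (x4 + x5)))) powr (3/2)
    \<le> 81 * (x1 powr (3/2) + x2 powr (3/2) + x3 powr (3/2) + x4 powr (3/2) + x5 powr (3/2))"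
proof -
  have "(x1 + (x2 + (x3 + (x4 + x5)))) powr (3/2) \<le> 3 * x1 powr (3/2) + 3 * (x2 + (x3 + (x4 + x5))) powr (3/2)"
    "(x2 + (x3 + (x4 + x5))) powr (3/2) \<le> 3 * x2 powr (3/2) + 3 * (x3 + (x4 + x5)) powr (3/2)"
    "(x3 + (x4 + x5)) powr (3/2) \<le> 3 * x3 powr (3/2) + 3 * (x4 + x5) powr (3/2)"
    "(x4 + x5) powr (3/2) \<le> 3 * x4 powr (3/2) + 3 * x5 powr (3/2)"
    using assms by (intro powr_three_halves_add; simp)+
  moreover have "s1 \<le> 81 * (y1 + y2 + y3 + y4 + y5)"
    if "s1 \<le> 3 * y1 + 3 * s2" "s2 \<le> 3 * y2 + 3 * s3" "s3 \<le> 3 * y3 + 3 * s4" "s4 \<le> 3 * y4 + 3 * y5"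
      "0 \<le> y1" "0 \<le> y2" "0 \<le> y3" "0 \<le> y4" "0 \<le> y5" for s1 s2 s3 s4 y1 y2 y3 y4 y5 :: real
  proof -
    have "3 * s2 \<le> 9 * y2 + 9 * s3" "9 * s3 \<le> 27 * y3 + 27 * s4" "27 * s4 \<le> 81 * y4 + 81 * y5" using that(2-4) by simp_all
    then have "s1 \<le> 3 * y1 + (9 * y2 + (27 * y3 + (81 * y4 + 81 * y5)))" using that(1) by linarith
    moreover have "3 * y1 \<le> 81 * y1" "9 * y2 \<le> 81 * y2" "27 * y3 \<le> 81 * y3" using that(5-7) by simp_all
    ultimately show ?thesis unfolding distrib_left by linarith
  qed
  ultimately show ?thesis using powr_ge_zero by blast
qed

text \<open>Chooses the parameter of Young's inequality left open in \<open>energy_step\<close>.\<close>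

lemma balanced_split:
  fixes x d :: real
  assumes "0 \<le> x" "0 \<le> d"
  shows "\<exists>l>0. (l * x + d / sqrt l) powr (3/2) \<le> 3 * (x + d\<^sup>2 + 1)"
proof -
  define Z where "Z = x + d\<^sup>2 + 1"
  have Z: "0 < Z" "x \<le> Z" "d\<^sup>2 \<le> Z"
    unfolding Z_def using assms zero_le_power2[of d] by linarith+
  \<comment> \<open>The exponent -1/3 balances the two terms: l Z and Z^{1/2} / sqrt l both become
    Z^{2/3}.\<close>
  define l where "l = Z powr (-1/3)"
  have l: "0 < l" using Z by (simp add: l_def)
  have "l * x \<le> Z powr (-1/3) * Z powr 1" using Z assms by (auto simp: l_def intro!: mult_left_mono)
  also have "\<dots> = Z powr (2/3)" unfolding powr_add[symmetric] by simp
  finally have 1: "l * x \<le> Z powr (2/3)" .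
  have "sqrt l = Z powr (-1/6)" using Z by (simp add: l_def powr_half_sqrt[symmetric] powr_powr)
  moreover have "d \<le> Z powr (1/2)" using Z assms real_le_rsqrt by (simp add: powr_half_sqrt)
  ultimately have "d / sqrt l \<le> Z powr (1/2) / Z powr (-1/6)" by (simp add: divide_right_mono)
  also have "\<dots> = Z powr (2/3)" unfolding powr_diff[symmetric] by simp
  finally have "l * x + d / sqrt l \<le> 2 * Z powr (2/3)" using 1 by simp
  then have "(l * x + d / sqrt l) powr (3/2) \<le> (2 * Z powr (2/3)) powr (3/2)" using assms l by (intro powr_mono2) auto
  also have "\<dots> = 2 powr (3/2) * Z" using Z by (simp add: powr_mult powr_powr)
  also have "\<dots> \<le> 3 * Z"
  proof -
    have "(2::real) powr (3/2) = 2 * sqrt 2" using powr_add[of "2::real" 1 "1/2"] by (simp add: powr_half_sqrt)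
    moreover have "sqrt 2 \<le> 3/2" by (rule real_le_lsqrt) (auto simp: power2_eq_square)
    ultimately show ?thesis using Z by (intro mult_right_mono) auto
  qed
  finally show ?thesis using l unfolding Z_def by blast
qed

text \<open>243 = 81 * 3, from the sum of five terms and from \<open>balanced_split\<close>; 36 is
  the square of the factor 6 lost in returning to the mean of the pressure.\<close>

definition step_const :: real where "step_const = 243 * energy_const powr (3/2) + 36"

lemma step_const_pos: "0 < step_const"
  unfolding step_const_def by (rule add_nonneg_pos) auto

text \<open>The coefficient of the terms of full degree, apart from the power of \<theta>. The
  number 118098 is 2 * 243^2, from squaring the two-term pressure bound.\<close>

definition growth :: "real \<Rightarrow> real" where
  "growth b = step_const * (1 + b powr (3/2) + 108 * mean_const + 118098 * pressure_far_const\<^sup>2)"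

text \<open>Among the terms of full degree, a^{3/2} and D^2, the worst power of \<theta> is 3/4,
  from (sqrt \<theta> a)^{3/2}; the others carry \<theta>^3 or \<theta>^5. All further terms have
  degree at most 1 in \<open>a\<close>. The bound for \<open>a'\<close> is given for every l > 0,
  since the right \<open>l\<close> depends on \<open>a\<close> and \<open>D\<close>.\<close>

lemma step_inequality:
  fixes a e D b \<theta> :: real
  assumes a: "0 \<le> a" and e: "0 \<le> e" "e + 1 \<le> b" and D: "0 \<le> D" and \<theta>: "0 < \<theta>" "\<theta> \<le> 1"
  defines "cubic_bound \<equiv> 4 * cubic_const * sqrt a * e / \<theta>\<^sup>2 + 108 * mean_const * \<theta>^3 * a powr (3/2)"
    and "pressure_bound \<equiv> pressure_near_const * sqrt a * e / \<theta>\<^sup>2 + 243 * pressure_far_const * \<theta> powr (5/2) * D"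
  assumes D': "0 \<le> D'" "D' \<le> 6 * pressure_bound" and a': "0 \<le> a'"
    "\<And>l. 0 < l \<Longrightarrow> a' \<le> energy_const * (e / \<theta>^3 + \<theta>\<^sup>2 * a + sqrt a * e / \<theta>\<^sup>2 + sqrt \<theta> * a * (1 + e) + l * cubic_bound + pressure_bound / sqrt l)"
  shows "a' powr (3/2) + D'\<^sup>2 \<le> growth b * \<theta> powr (3/4) * (a powr (3/2) + D\<^sup>2)
    + (step_const * (1 + (b / \<theta>^3) powr (3/2)) + step_const * (b / \<theta>\<^sup>2) powr (3/2) * a powr (3/4)
       + step_const * (4 * cubic_const * b / \<theta>\<^sup>2) * a powr (1/2) + step_const * (2 * (pressure_near_const * b / \<theta>\<^sup>2)\<^sup>2) * a powr 1)"
proof -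
  define w where "w = a powr (3/2)"
  have w: "0 \<le> w" by (simp add: w_def)
  have eb: "0 \<le> b" "e \<le> b" using e by auto
  define t where "t = \<theta> powr (3/4)"
  have t: "\<theta> powr s \<le> t" if "3/4 \<le> s" for s unfolding t_def using \<theta> that by (intro powr_mono_both') auto
  have tp: "\<theta>^n \<le> t" if "1 \<le> n" for n using t[of "real n"] \<theta> that by (simp add: powr_realpow)
  have t0: "0 \<le> t" by (simp add: t_def)
  have xx0: "0 \<le> cubic_bound" and dd0: "0 \<le> pressure_bound"
    using a e D \<theta> cubic_const_nonneg mean_const_nonneg pressure_near_const_nonneg pressure_far_const_nonneg by (auto simp: cubic_bound_def pressure_bound_def)
  obtain l where l: "0 < l" "(l * cubic_bound + pressure_bound / sqrt l) powr (3/2) \<le> 3 * (cubic_bound + pressure_bound\<^sup>2 + 1)"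
    using balanced_split[OF xx0 dd0] by blast
  let ?x1 = "e / \<theta>^3" and ?x2 = "\<theta>\<^sup>2 * a" and ?x3 = "sqrt a * e / \<theta>\<^sup>2" and ?x4 = "sqrt \<theta> * a * (1 + e)" and ?x5 = "l * cubic_bound + pressure_bound / sqrt l"
  have x: "0 \<le> ?x1" "0 \<le> ?x2" "0 \<le> ?x3" "0 \<le> ?x4" "0 \<le> ?x5" using a e \<theta> l xx0 dd0 by auto
  have a12: "sqrt a powr (3/2) = a powr (3/4)" using a by (simp add: powr_half_sqrt[symmetric] powr_powr)
  have "a' \<le> energy_const * (?x1 + (?x2 + (?x3 + (?x4 + ?x5))))" using a'(2)[OF l(1)] by (simp only: add.assoc)
  then have "a' powr (3/2) \<le> (energy_const * (?x1 + (?x2 + (?x3 + (?x4 + ?x5))))) powr (3/2)" using a' by (intro powr_mono2) auto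
  also have "\<dots> = energy_const powr (3/2) * (?x1 + (?x2 + (?x3 + (?x4 + ?x5)))) powr (3/2)" by (rule powr_mult)
  also have "\<dots> \<le> energy_const powr (3/2) * (81 * (?x1 powr (3/2) + ?x2 powr (3/2) + ?x3 powr (3/2) + ?x4 powr (3/2) + ?x5 powr (3/2)))"
    by (intro mult_left_mono powr_three_halves_sum x) auto
  finally have split: "a' powr (3/2) \<le> energy_const powr (3/2) * (81 * (?x1 powr (3/2) + ?x2 powr (3/2) + ?x3 powr (3/2) + ?x4 powr (3/2) + ?x5 powr (3/2)))" .
  have sum: "?x1 powr (3/2) + ?x2 powr (3/2) + ?x3 powr (3/2) + ?x4 powr (3/2) + ?x5 powr (3/2)
      \<le> (b / \<theta>^3) powr (3/2) + t * w + (b / \<theta>\<^sup>2) powr (3/2) * a powr (3/4) + t * b powr (3/2) * w + 3 * (cubic_bound + pressure_bound\<^sup>2 + 1)"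
  proof (intro add_mono l(2))
    show "?x1 powr (3/2) \<le> (b / \<theta>^3) powr (3/2)" using eb e \<theta> by (intro powr_mono2 divide_right_mono) auto
    have "?x2 powr (3/2) = (\<theta>\<^sup>2) powr (3/2) * w" using a by (simp add: powr_mult w_def)
    also have "(\<theta>\<^sup>2) powr (3/2) = \<theta> ^ 3"
    proof -
      have "\<theta>\<^sup>2 = \<theta> powr 2" "\<theta> ^ 3 = \<theta> powr 3" using \<theta> by simp_all
      then show ?thesis by (simp only: powr_powr) simp
    qed
    also have "\<dots> * w \<le> t * w" using w by (intro mult_right_mono tp) auto
    finally show "?x2 powr (3/2) \<le> t * w" .
    have "?x3 powr (3/2) = (e / \<theta>\<^sup>2) powr (3/2) * a powr (3/4)"
      using a e powr_mult[of "sqrt a" "e / \<theta>\<^sup>2" "3/2"] by (simp add: a12 mult.commute)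
    also have "\<dots> \<le> (b / \<theta>\<^sup>2) powr (3/2) * a powr (3/4)" using eb e \<theta> by (intro mult_right_mono powr_mono2 divide_right_mono) auto
    finally show "?x3 powr (3/2) \<le> (b / \<theta>\<^sup>2) powr (3/2) * a powr (3/4)" .
    have "sqrt \<theta> powr (3/2) = t" using \<theta> by (simp add: t_def powr_half_sqrt[symmetric] powr_powr)
    then have "?x4 powr (3/2) = t * (1 + e) powr (3/2) * w" by (simp only: powr_mult w_def mult_ac)
    also have "\<dots> \<le> t * b powr (3/2) * w" using e w t0 by (intro mult_right_mono mult_left_mono powr_mono2) auto
    finally show "?x4 powr (3/2) \<le> t * b powr (3/2) * w" .
  qed
  have A: "a' powr (3/2) \<le> energy_const powr (3/2) * (81 * ((b / \<theta>^3) powr (3/2) + t * w + (b / \<theta>\<^sup>2) powr (3/2) * a powr (3/4) + t * b powr (3/2) * w + 3 * (cubic_bound + pressure_bound\<^sup>2 + 1)))"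
    by (rule order_trans[OF split]) (intro mult_left_mono sum; simp)
  have "D'\<^sup>2 \<le> (6 * pressure_bound)\<^sup>2" using D' by (intro power_mono)
  then have B: "D'\<^sup>2 \<le> 36 * pressure_bound\<^sup>2" by (simp add: power_mult_distrib)
  define K where "K = energy_const powr (3/2)"
  have K: "0 \<le> K" by (simp add: K_def)
  have gen: "K * (81 * (q1 + q2 + q3 + q4 + 3 * (cubic_bound + d2 + 1))) + 36 * d2 \<le> step_const * (q1 + q2 + q3 + q4 + cubic_bound + d2 + 1)"
    if "0 \<le> q1" "0 \<le> q2" "0 \<le> q3" "0 \<le> q4" "0 \<le> d2" for q1 q2 q3 q4 d2
  proof -
    have "0 \<le> K * q1" "0 \<le> K * q2" "0 \<le> K * q3" "0 \<le> K * q4" using that K by auto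
    then show ?thesis using that xx0 by (simp add: step_const_def K_def[symmetric] algebra_simps)
  qed
  have "a' powr (3/2) + D'\<^sup>2 \<le> step_const * ((b / \<theta>^3) powr (3/2) + t * w + (b / \<theta>\<^sup>2) powr (3/2) * a powr (3/4) + t * b powr (3/2) * w + cubic_bound + pressure_bound\<^sup>2 + 1)"
    using add_mono[OF A B] gen[of "(b / \<theta>^3) powr (3/2)" "t * w" "(b / \<theta>\<^sup>2) powr (3/2) * a powr (3/4)" "t * b powr (3/2) * w" "pressure_bound\<^sup>2"] w t0
    unfolding K_def by simp
  also have "\<dots> \<le> step_const * ((b / \<theta>^3) powr (3/2) + t * w + (b / \<theta>\<^sup>2) powr (3/2) * a powr (3/4) + t * b powr (3/2) * w
      + (4 * cubic_const * b / \<theta>\<^sup>2 * a powr (1/2) + 108 * mean_const * (t * w)) + (2 * (pressure_near_const * b / \<theta>\<^sup>2)\<^sup>2 * a powr 1 + 118098 * pressure_far_const\<^sup>2 * (t * D\<^sup>2)) + 1)"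
  proof (rule mult_left_mono[OF _ less_imp_le[OF step_const_pos]], intro add_mono order_refl)
    have "4 * cubic_const * sqrt a * e / \<theta>\<^sup>2 \<le> 4 * cubic_const * sqrt a * b / \<theta>\<^sup>2"
      using eb a cubic_const_nonneg by (intro divide_right_mono mult_left_mono) auto
    moreover have "108 * mean_const * (\<theta>^3 * w) \<le> 108 * mean_const * (t * w)" using mean_const_nonneg w by (intro mult_left_mono mult_right_mono tp) auto
    ultimately show "cubic_bound \<le> 4 * cubic_const * b / \<theta>\<^sup>2 * a powr (1/2) + 108 * mean_const * (t * w)"
      using a by (simp add: cubic_bound_def w_def powr_half_sqrt mult_ac)
    have sq: "(p + q)\<^sup>2 \<le> 2 * p\<^sup>2 + 2 * q\<^sup>2" for p q :: real
      using zero_le_power2[of "p - q"] by (simp add: power2_sum power2_diff)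
    have "pressure_bound\<^sup>2 \<le> 2 * (pressure_near_const * sqrt a * e / \<theta>\<^sup>2)\<^sup>2 + 2 * (243 * pressure_far_const * \<theta> powr (5/2) * D)\<^sup>2" unfolding pressure_bound_def by (rule sq)
    moreover have "(pressure_near_const * sqrt a * e / \<theta>\<^sup>2)\<^sup>2 \<le> (pressure_near_const * b / \<theta>\<^sup>2)\<^sup>2 * a powr 1"
    proof -
      have "(pressure_near_const * sqrt a * e / \<theta>\<^sup>2)\<^sup>2 = (pressure_near_const * e / \<theta>\<^sup>2)\<^sup>2 * a" using a by (simp add: power_mult_distrib power_divide)
      also have "\<dots> \<le> (pressure_near_const * b / \<theta>\<^sup>2)\<^sup>2 * a"
        using a e eb pressure_near_const_nonneg by (intro mult_right_mono power_mono divide_right_mono mult_left_mono) auto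
      finally show ?thesis using a by simp
    qed
    moreover have "(243 * pressure_far_const * \<theta> powr (5/2) * D)\<^sup>2 \<le> 59049 * pressure_far_const\<^sup>2 * (t * D\<^sup>2)"
    proof -
      have "(\<theta> powr (5/2))\<^sup>2 = \<theta> powr 5" by (simp add: power2_eq_square powr_add[symmetric])
      also have "\<dots> \<le> t" by (rule t) simp
      finally have "59049 * pressure_far_const\<^sup>2 * ((\<theta> powr (5/2))\<^sup>2 * D\<^sup>2) \<le> 59049 * pressure_far_const\<^sup>2 * (t * D\<^sup>2)"
        by (intro mult_left_mono mult_right_mono) auto
      then show ?thesis by (simp add: power_mult_distrib mult.assoc)
    qed
    ultimately show "pressure_bound\<^sup>2 \<le> 2 * (pressure_near_const * b / \<theta>\<^sup>2)\<^sup>2 * a powr 1 + 118098 * pressure_far_const\<^sup>2 * (t * D\<^sup>2)" by simp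
  qed
  also have "\<dots> \<le> step_const * ((1 + b powr (3/2) + 108 * mean_const + 118098 * pressure_far_const\<^sup>2) * (t * (w + D\<^sup>2))
      + (1 + (b / \<theta>^3) powr (3/2) + (b / \<theta>\<^sup>2) powr (3/2) * a powr (3/4) + 4 * cubic_const * b / \<theta>\<^sup>2 * a powr (1/2) + 2 * (pressure_near_const * b / \<theta>\<^sup>2)\<^sup>2 * a powr 1))"
  proof (rule mult_left_mono[OF _ less_imp_le[OF step_const_pos]])
    have gen2: "q1 + tw + q3 + t * b' * w + (q5 + c5 * tw) + (q6 + c7 * tD) + 1 \<le> (1 + b' + c5 + c7) * (tw + tD) + (1 + q1 + q3 + q5 + q6)"
      if "tw = t * w" "0 \<le> tw" "0 \<le> tD" "0 \<le> b'" "0 \<le> c5" "0 \<le> c7" for q1 tw q3 b' q5 c5 q6 c7 tD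
    proof -
      have "0 \<le> b' * tD" "0 \<le> c5 * tD" "0 \<le> c7 * tw" using that by auto
      then show ?thesis using that(3) by (simp add: that(1) algebra_simps)
    qed
    show "(b / \<theta>^3) powr (3/2) + t * w + (b / \<theta>\<^sup>2) powr (3/2) * a powr (3/4) + t * b powr (3/2) * w
      + (4 * cubic_const * b / \<theta>\<^sup>2 * a powr (1/2) + 108 * mean_const * (t * w)) + (2 * (pressure_near_const * b / \<theta>\<^sup>2)\<^sup>2 * a powr 1 + 118098 * pressure_far_const\<^sup>2 * (t * D\<^sup>2)) + 1
      \<le> (1 + b powr (3/2) + 108 * mean_const + 118098 * pressure_far_const\<^sup>2) * (t * (w + D\<^sup>2))
      + (1 + (b / \<theta>^3) powr (3/2) + (b / \<theta>\<^sup>2) powr (3/2) * a powr (3/4) + 4 * cubic_const * b / \<theta>\<^sup>2 * a powr (1/2) + 2 * (pressure_near_const * b / \<theta>\<^sup>2)\<^sup>2 * a powr 1)"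
      unfolding distrib_left[of t w] by (rule gen2) (use t0 w mean_const_nonneg in auto)
  qed
  finally have fin: "a' powr (3/2) + D'\<^sup>2 \<le> \<dots>" .
  have "step_const * (g * (t * (w + D\<^sup>2)) + (1 + q1 + q2 * q3 + q4 * q5 + 2 * q6 * q7))
     = step_const * g * t * (w + D\<^sup>2) + (step_const * (1 + q1) + step_const * q2 * q3 + step_const * q4 * q5 + step_const * (2 * q6) * q7)"
    for g q1 q2 q3 q4 q5 q6 q7 by (simp add: algebra_simps)
  with fin show ?thesis unfolding growth_def w_def t_def by (simp only:)
qed

lemma growth_pos: assumes "0 \<le> b" shows "0 < growth b"
  unfolding growth_def using mean_const_nonneg
  by (intro mult_pos_pos step_const_pos add_pos_nonneg add_nonneg_nonneg) auto

lemma contraction: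
  fixes b :: real
  assumes b: "0 \<le> b"
  shows "\<exists>\<theta> K. 0 < \<theta> \<and> \<theta> \<le> 1/12 \<and> 0 \<le> K \<and> (\<forall>a\<ge>0. \<forall>q\<ge>0.
    growth b * \<theta> powr (3/4) * (a powr (3/2) + q) + (step_const * (1 + (b / \<theta>^3) powr (3/2)) + step_const * (b / \<theta>\<^sup>2) powr (3/2) * a powr (3/4)
       + step_const * (4 * cubic_const * b / \<theta>\<^sup>2) * a powr (1/2) + step_const * (2 * (pressure_near_const * b / \<theta>\<^sup>2)\<^sup>2) * a powr 1)
    \<le> sqrt \<theta> * (a powr (3/2) + q) + K)"
proof -
  define H where "H = growth b"
  have H: "0 < H" using growth_pos[OF b] by (simp add: H_def)
  \<comment> \<open>Makes H \<theta>^{1/4} \<le> 1/2, so that H \<theta>^{3/4} is at most half of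
    sqrt \<theta>. The other half is left for the three terms of lower degree, one sixth of sqrt
    \<theta> each.\<close>
  define \<theta> where "\<theta> = min (1/12) ((1 / (2 * H))^4)"
  have \<theta>: "0 < \<theta>" "\<theta> \<le> 1/12" "\<theta> \<le> (1 / (2 * H))^4" using H by (auto simp: \<theta>_def)
  have "\<theta> powr (1/4) \<le> ((1 / (2 * H))^4) powr (1/4)" using \<theta> by (intro powr_mono2) auto
  also have "\<dots> = ((1 / (2 * H)) powr 4) powr (1/4)" using H by (subst powr_realpow[symmetric]) auto
  also have "\<dots> = 1 / (2 * H)" unfolding powr_powr using H by simp
  finally have "H * \<theta> powr (1/4) \<le> 1/2" using H by (simp add: field_simps)
  then have "H * \<theta> powr (1/4) * \<theta> powr (1/2) \<le> 1/2 * \<theta> powr (1/2)" by (intro mult_right_mono) auto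
  then have "H * (\<theta> powr (1/4) * \<theta> powr (1/2)) \<le> 1/2 * \<theta> powr (1/2)" by (simp only: mult.assoc)
  then have "H * \<theta> powr (1/4 + 1/2) \<le> 1/2 * \<theta> powr (1/2)" unfolding powr_add .
  then have half: "H * \<theta> powr (3/4) \<le> sqrt \<theta> / 2" using \<theta> by (simp add: powr_half_sqrt)
  have \<eta>: "0 < sqrt \<theta> / 6" using \<theta> by simp
  have sc: "0 \<le> step_const" using step_const_pos by simp
  obtain K1 where K1: "0 \<le> K1" "\<And>a. 0 \<le> a \<Longrightarrow> step_const * (b / \<theta>\<^sup>2) powr (3/2) * a powr (3/4) \<le> sqrt \<theta> / 6 * a powr (3/2) + K1"
    using powr_sublinear[OF _ _ _ \<eta>, of "step_const * (b / \<theta>\<^sup>2) powr (3/2)" "3/4"] sc by auto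
  obtain K2 where K2: "0 \<le> K2" "\<And>a. 0 \<le> a \<Longrightarrow> step_const * (4 * cubic_const * b / \<theta>\<^sup>2) * a powr (1/2) \<le> sqrt \<theta> / 6 * a powr (3/2) + K2"
    using powr_sublinear[OF _ _ _ \<eta>, of "step_const * (4 * cubic_const * b / \<theta>\<^sup>2)" "1/2"] sc b cubic_const_nonneg by auto
  obtain K3 where K3: "0 \<le> K3" "\<And>a. 0 \<le> a \<Longrightarrow> step_const * (2 * (pressure_near_const * b / \<theta>\<^sup>2)\<^sup>2) * a powr 1 \<le> sqrt \<theta> / 6 * a powr (3/2) + K3"
    using powr_sublinear[OF _ _ _ \<eta>, of "step_const * (2 * (pressure_near_const * b / \<theta>\<^sup>2)\<^sup>2)" 1] sc by auto
  define K0 where "K0 = step_const * (1 + (b / \<theta>^3) powr (3/2))"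
  have K0: "0 \<le> K0" unfolding K0_def by (intro mult_nonneg_nonneg sc add_nonneg_nonneg) auto
  show ?thesis
  proof (rule exI[of _ \<theta>], rule exI[of _ "K0 + K1 + K2 + K3"], intro conjI allI impI)
    fix a q :: real assume a: "0 \<le> a" and q: "0 \<le> q"
    define w where "w = a powr (3/2)"
    have w: "0 \<le> w" by (simp add: w_def)
    have "H * \<theta> powr (3/4) * (w + q) \<le> sqrt \<theta> / 2 * (w + q)" using half w q by (intro mult_right_mono) auto
    also have "\<dots> \<le> sqrt \<theta> / 2 * w + sqrt \<theta> * q" using q \<theta> by (simp add: distrib_left mult_right_mono)
    finally have 1: "H * \<theta> powr (3/4) * (w + q) \<le> sqrt \<theta> / 2 * w + sqrt \<theta> * q" .
    have 2: "x0 + (K0 + x1 + x2 + x3) \<le> s * (w + q) + (K0 + K1 + K2 + K3)"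
      if "x0 \<le> s / 2 * w + s * q" "x1 \<le> s / 6 * w + K1" "x2 \<le> s / 6 * w + K2" "x3 \<le> s / 6 * w + K3" for x0 x1 x2 x3 s
    proof -
      have "s / 2 * w + s / 6 * w + s / 6 * w + s / 6 * w = s * w" by simp
      then show ?thesis using that by (simp only: distrib_left)
    qed
    show "growth b * \<theta> powr (3/4) * (a powr (3/2) + q) + (step_const * (1 + (b / \<theta>^3) powr (3/2)) + step_const * (b / \<theta>\<^sup>2) powr (3/2) * a powr (3/4)
       + step_const * (4 * cubic_const * b / \<theta>\<^sup>2) * a powr (1/2) + step_const * (2 * (pressure_near_const * b / \<theta>\<^sup>2)\<^sup>2) * a powr 1)
      \<le> sqrt \<theta> * (a powr (3/2) + q) + (K0 + K1 + K2 + K3)"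
      unfolding H_def[symmetric] w_def[symmetric] K0_def[symmetric]
      by (rule 2[OF 1 K1(2)[OF a, folded w_def] K2(2)[OF a, folded w_def] K3(2)[OF a, folded w_def]])
  qed (use \<theta> K0 K1 K2 K3 in auto)
qed

lemma sqrt_le_three_halves: "0 \<le> a \<Longrightarrow> sqrt a \<le> 1 + a powr (3/2)"
proof (cases "a \<le> 1")
  case False
  then have "a powr (1/2) \<le> a powr (3/2)" by (intro powr_mono) auto
  then show ?thesis using False by (simp add: powr_half_sqrt)
qed (use powr_ge_zero[of a "3/2"] in \<open>simp add: add_increasing2\<close>)

theorem lemma1p6:
  fixes E0 :: real
  assumes "E0 \<ge> 0"
  shows "\<exists>d>0. \<forall>v p.
     suitable_weak_solution v p \<longrightarrow> (SUP r\<in>{0<..1}. ereal (E v r)) = ereal E0 \<longrightarrow>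
     (\<forall>r. 0 < r \<and> r \<le> 1/4 \<longrightarrow>
        A v r powr (3/2) + C v r + (D0 p r)^2
        \<le> d * (r powr (1/2) * (A v 1 powr (3/2) + (D0 p 1)^2) + 1))"
proof -
  define b where "b = E0 + 1"
  have b: "1 \<le> b" using assms by (simp add: b_def)
  obtain \<theta> K where \<theta>: "0 < \<theta>" "\<theta> \<le> 1/12" and K: "0 \<le> K" and contr: "\<And>a q. 0 \<le> a \<Longrightarrow> 0 \<le> q \<Longrightarrow>
    growth b * \<theta> powr (3/4) * (a powr (3/2) + q) + (step_const * (1 + (b / \<theta>^3) powr (3/2)) + step_const * (b / \<theta>\<^sup>2) powr (3/2) * a powr (3/4)
       + step_const * (4 * cubic_const * b / \<theta>\<^sup>2) * a powr (1/2) + step_const * (2 * (pressure_near_const * b / \<theta>\<^sup>2)\<^sup>2) * a powr 1)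
    \<le> sqrt \<theta> * (a powr (3/2) + q) + K"
    using contraction[of b] b by auto
  \<comment> \<open>For R between \<theta> and 1 the direct comparison with scale 1 gives the factor
    36/\<theta>^4; the additional 1/\<theta> makes room for sqrt R, which is at least \<theta>
    there.\<close>
  define N where "N = 36 / \<theta>^5"
  have "\<theta>^5 \<le> 1" using \<theta> by (intro power_le_one) auto
  then have N: "1 \<le> N" using \<theta> by (simp add: N_def field_simps)
  \<comment> \<open>36 is the square of the ratio of the scales 6r and r, and it also bounds 1/r^2
    for r > 1/6.\<close>
  define M where "M = 36 * (4 * cubic_const * b + mean_const)"
  have M: "0 \<le> M" using cubic_const_nonneg mean_const_nonneg b by (simp add: M_def)
  define d where "d = (N + 3 * M * N) + (2 * K + M * (1 + 2 * K))"
  have s2: "sqrt \<theta> \<le> 1/2" by (rule real_le_lsqrt) (use \<theta> in \<open>auto simp: power2_eq_square\<close>)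
  have "A v r powr (3/2) + C v r + (D0 p r)^2 \<le> d * (r powr (1/2) * (A v 1 powr (3/2) + (D0 p 1)^2) + 1)"
    if sws: "suitable_weak_solution v p" and sup: "(SUP r\<in>{0<..1}. ereal (E v r)) = ereal E0" and r: "0 < r" "r \<le> 1/4"
    for v p r
  proof -
    obtain V G Pr where "representative v p V G Pr" using ex_representative[OF sws] by blast
    then interpret representative v p V G Pr .
    have Eb: "0 \<le> E v R" "E v R + 1 \<le> b" "E v R \<le> b" if R: "0 < R" "R \<le> 1" for R
    proof -
      have "ereal (E v R) \<le> ereal E0" unfolding sup[symmetric] using R by (intro SUP_upper) auto
      then show "E v R + 1 \<le> b" "E v R \<le> b" by (auto simp: b_def)
      show "0 \<le> E v R" by (rule E_cyl[OF R])
    qed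
    define Y where "Y R = A v R powr (3/2) + (D0 p R)\<^sup>2" for R
    have Y0: "0 \<le> Y R" for R by (simp add: Y_def)
    have step: "Y (\<theta> * R) \<le> sqrt \<theta> * Y R + K" if R: "0 < R" "R \<le> 1" for R
    proof -
      have "\<theta> * R \<le> 1" using mult_mono[of \<theta> 1 R 1] R \<theta> by simp
      then have s: "0 < \<theta> * R" "\<theta> * R \<le> 1" using R \<theta> by auto
      note sc = scale_step[OF R \<theta>(1)]
      have "\<theta> \<le> 1" using \<theta> by simp
      from step_inequality[OF A_esssup(1)[OF R] Eb(1,2)[OF R] D0_cyl(2)[OF R] \<theta>(1) this D0_cyl(2)[OF s] sc(2)[OF \<theta>(2)] A_esssup(1)[OF s] sc(3)[OF \<theta>(2)]]
        contr[OF A_esssup(1)[OF R] zero_le_power2[of "D0 p R"]]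
      show ?thesis unfolding Y_def by linarith
    qed
    have base: "Y R \<le> N * sqrt R * Y 1" if R: "\<theta> \<le> R" "R \<le> 1" for R
    proof -
      have R0: "0 < R" using R \<theta> by simp
      have inv: "1 / R \<le> 1 / \<theta>" "1 \<le> 1 / \<theta>" using R \<theta> R0 by (auto simp: field_simps)
      have "A v R \<le> 1 / R * A v 1" using A_mono[OF R0 R(2)] by simp
      also have "\<dots> \<le> 1 / \<theta> * A v 1" using inv A_esssup(1)[of 1] by (intro mult_right_mono) auto
      finally have "A v R powr (3/2) \<le> (1 / \<theta> * A v 1) powr (3/2)" using A_esssup(1)[OF R0 R(2)] by (intro powr_mono2) auto
      also have "\<dots> = (1 / \<theta>) powr (3/2) * A v 1 powr (3/2)" by (rule powr_mult)
      also have "\<dots> \<le> (36 / \<theta>^4) * A v 1 powr (3/2)"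
      proof (rule mult_right_mono)
        have "(1 / \<theta>) powr (3/2) \<le> (1 / \<theta>) powr 4" using inv by (intro powr_mono) auto
        also have "\<dots> = 1 / \<theta>^4" using \<theta> by (subst powr_numeral) (auto simp: power_divide)
        also have "\<dots> \<le> 36 / \<theta>^4" using \<theta> by (intro divide_right_mono) auto
        finally show "(1 / \<theta>) powr (3/2) \<le> 36 / \<theta>^4" .
      qed simp
      finally have 1: "A v R powr (3/2) \<le> (36 / \<theta>^4) * A v 1 powr (3/2)" .
      have "D0 p R \<le> 6 * ((1 / R)\<^sup>2 * D0 p 1)" by (rule D0_mono) (use R R0 in auto)
      also have "\<dots> \<le> 6 * ((1 / \<theta>)\<^sup>2 * D0 p 1)"
        using inv R0 D0_cyl(2)[of 1] by (intro mult_left_mono mult_right_mono power_mono) auto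
      finally have "(D0 p R)\<^sup>2 \<le> (6 * ((1 / \<theta>)\<^sup>2 * D0 p 1))\<^sup>2" using D0_cyl(2)[OF R0 R(2)] by (intro power_mono)
      also have "\<dots> = (36 / \<theta>^4) * (D0 p 1)\<^sup>2" by (simp add: power_mult_distrib power_divide)
      finally have "Y R \<le> (36 / \<theta>^4) * Y 1" using 1 by (simp add: Y_def distrib_left)
      also have "36 / \<theta>^4 = N * \<theta>" using \<theta> by (simp add: N_def eval_nat_numeral)
      also have "N * \<theta> * Y 1 \<le> N * sqrt R * Y 1"
      proof (intro mult_right_mono mult_left_mono Y0)
        have "R * R \<le> 1 * R" using R R0 by (intro mult_right_mono) auto
        then have "R \<le> sqrt R" by (intro real_le_rsqrt) (simp add: power2_eq_square)
        then show "\<theta> \<le> sqrt R" using R by simp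
      qed (use N in auto)
      finally show ?thesis .
    qed
    \<comment> \<open>The bound reproduces itself: sqrt \<theta> sqrt(R/\<theta>) = sqrt R, and sqrt
      \<theta> \<le> 1/2 turns 2K into at most K, to which the new K is added. The induction covers
      all R at or above \<theta>^n, so scales between the powers of \<theta> are treated along with
      them.\<close>
    have iter: "Y R \<le> N * sqrt R * Y 1 + 2 * K" if "\<theta>^n \<le> R" "R \<le> 1" for n R
      using that
    proof (induction n arbitrary: R)
      case 0
      then have "R = 1" by simp
      then show ?case using base[of R] \<theta> K by simp
    next
      case (Suc n)
      show ?case
      proof (cases "\<theta> \<le> R")
        case True
        then show ?thesis using base[OF True Suc.prems(2)] K by simp
      next
        case False
        have R0: "0 < R" using Suc.prems(1) zero_less_power[OF \<theta>(1), of "Suc n"] by linarith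
        have q: "\<theta>^n \<le> R / \<theta>" "R / \<theta> \<le> 1" using Suc.prems(1) False \<theta> by (auto simp: field_simps)
        have "Y R \<le> sqrt \<theta> * Y (R / \<theta>) + K" using step[of "R / \<theta>"] q R0 \<theta> by simp
        also have "\<dots> \<le> sqrt \<theta> * (N * sqrt (R / \<theta>) * Y 1 + 2 * K) + K"
          using Suc.IH[OF q] \<theta> by (intro add_right_mono mult_left_mono) auto
        also have "\<dots> = N * sqrt R * Y 1 + sqrt \<theta> * (2 * K) + K" using \<theta> by (simp add: real_sqrt_divide distrib_left)
        also have "\<dots> \<le> N * sqrt R * Y 1 + 1/2 * (2 * K) + K" using s2 K by (intro add_right_mono add_left_mono mult_right_mono) auto
        finally show ?thesis by simp
      qed
    qed
    have main: "Y R \<le> N * sqrt R * Y 1 + 2 * K" if "0 < R" "R \<le> 1" for R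
    proof -
      obtain n where "\<theta>^n < R" using real_arch_pow_inv[OF \<open>0 < R\<close>, of \<theta>] \<theta> by auto
      then show ?thesis using iter[of n R] that by simp
    qed
    have cub: "36 * (4 * cubic_const * sqrt a * e + mean_const * a powr (3/2)) \<le> M * (1 + a powr (3/2))" if "0 \<le> a" "0 \<le> e" "e \<le> b" for a e
    proof -
      have "4 * cubic_const * sqrt a * e \<le> 4 * cubic_const * (1 + a powr (3/2)) * b"
        using that cubic_const_nonneg sqrt_le_three_halves[OF that(1)] by (intro mult_mono) auto
      moreover have "mean_const * a powr (3/2) \<le> mean_const * (1 + a powr (3/2))" using mean_const_nonneg by (intro mult_left_mono) auto
      ultimately show ?thesis by (simp add: M_def algebra_simps)
    qed
    have Cb: "C v r \<le> M * (1 + (3 * N * sqrt r * Y 1 + 2 * K))"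
    proof (cases "r \<le> 1/6")
      case True
      have R: "0 < 6 * r" "6 * r \<le> 1" using r True by auto
      have "C v (1/6 * (6 * r)) \<le> 4 * cubic_const * sqrt (A v (6 * r)) * E v (6 * r) / (1/6)\<^sup>2 + 108 * mean_const * (1/6)^3 * A v (6 * r) powr (3/2)"
        by (rule scale_step(1)[OF R]) auto
      also have "\<dots> \<le> 36 * (4 * cubic_const * sqrt (A v (6 * r)) * E v (6 * r) + mean_const * A v (6 * r) powr (3/2))"
        using mean_const_nonneg mult_nonneg_nonneg[of mean_const "A v (6 * r) powr (3/2)"] by (simp add: power2_eq_square power3_eq_cube)
      also have "\<dots> \<le> M * (1 + A v (6 * r) powr (3/2))" by (rule cub[OF A_esssup(1)[OF R] Eb(1,3)[OF R]])
      also have "\<dots> \<le> M * (1 + (3 * N * sqrt r * Y 1 + 2 * K))"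
      proof (intro mult_left_mono add_left_mono M)
        have "A v (6 * r) powr (3/2) \<le> Y (6 * r)" by (simp add: Y_def)
        also have "\<dots> \<le> N * sqrt (6 * r) * Y 1 + 2 * K" by (rule main[OF R])
        also have "sqrt (6 * r) = sqrt 6 * sqrt r" by (rule real_sqrt_mult)
        also have "N * (sqrt 6 * sqrt r) * Y 1 \<le> N * (3 * sqrt r) * Y 1"
        proof (intro mult_right_mono mult_left_mono)
          show "sqrt 6 \<le> 3" by (rule real_le_lsqrt) auto
        qed (use N r Y0[of 1] in auto)
        finally show "A v (6 * r) powr (3/2) \<le> 3 * N * sqrt r * Y 1 + 2 * K" by (simp add: mult_ac)
      qed
      finally show ?thesis by simp
    next
      case False
      have r2: "1/36 \<le> r\<^sup>2" using power_mono[of "1/6" r 2] False by (simp add: power2_eq_square)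
      have "C v r \<le> (4 * cubic_const * sqrt (A v 1) * E v 1 + mean_const * A v 1 powr (3/2)) / r\<^sup>2" by (rule C_unit) (use r in auto)
      also have "\<dots> \<le> (4 * cubic_const * sqrt (A v 1) * E v 1 + mean_const * A v 1 powr (3/2)) / (1/36)"
        using r2 cubic_const_nonneg mean_const_nonneg A_esssup(1)[of 1] Eb(1)[of 1] by (intro divide_left_mono) auto
      also have "\<dots> = 36 * (4 * cubic_const * sqrt (A v 1) * E v 1 + mean_const * A v 1 powr (3/2))" by simp
      also have "\<dots> \<le> M * (1 + A v 1 powr (3/2))" by (rule cub) (use A_esssup(1)[of 1] Eb[of 1] in auto)
      also have "\<dots> \<le> M * (1 + (3 * N * sqrt r * Y 1 + 2 * K))"
      proof (intro mult_left_mono add_left_mono M)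
        \<comment> \<open>For these r the factor sqrt r is bounded below, so the term with sqrt r
          can carry the whole of Y(1).\<close>
        have "1/3 \<le> sqrt r" using False by (intro real_le_rsqrt) (simp add: power2_eq_square)
        then have "1 * Y 1 \<le> (3 * N * sqrt r) * Y 1"
          using mult_mono[of 1 N "1/3" "sqrt r"] N Y0[of 1] by (intro mult_right_mono) auto
        moreover have "A v 1 powr (3/2) \<le> Y 1" by (simp add: Y_def)
        ultimately show "A v 1 powr (3/2) \<le> 3 * N * sqrt r * Y 1 + 2 * K" using K by linarith
      qed
      finally show ?thesis .
    qed
    have s: "0 \<le> sqrt r * Y 1" using r Y0[of 1] by simp
    have "A v r powr (3/2) + C v r + (D0 p r)^2 = Y r + C v r" by (simp add: Y_def)
    also have "\<dots> \<le> (N * sqrt r * Y 1 + 2 * K) + M * (1 + (3 * N * sqrt r * Y 1 + 2 * K))"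
      using main[of r] Cb r by (intro add_mono) auto
    also have "\<dots> = (N + 3 * M * N) * (sqrt r * Y 1) + (2 * K + M * (1 + 2 * K))" by (simp add: algebra_simps)
    also have "\<dots> \<le> d * (sqrt r * Y 1) + d * 1"
      using s N M K by (intro add_mono mult_right_mono) (auto simp: d_def)
    also have "\<dots> = d * (r powr (1/2) * (A v 1 powr (3/2) + (D0 p 1)^2) + 1)"
      using r by (simp add: Y_def powr_half_sqrt distrib_left)
    finally show ?thesis .
  qed
  moreover have "0 < d" using N M K by (auto simp: d_def intro!: add_pos_nonneg)
  ultimately show ?thesis by blast
qed

end
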